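(* Let $\lambda,\mu\in\mathbb C$, $m\in\mathbb N$ and $0\le k\le n$. Set $E^{(m)}_{\lambda,\mu}=E_{\lambda+m-1,\mu+m-1}\circ\cdots\circ E_{\lambda+1,\mu+1}\circ E_{\lambda,\mu}$ and $B^{(m)}_{k;\lambda,\mu}=\widetilde\Psi^{(k)}\circ E^{(m)}_{\lambda,\mu}$. (i) The operator $B^{(m)}_{k;\lambda,\mu}\colon C^\infty(\mathbb R^n\times\mathbb R^n,\mathbb S\otimes\mathbb S')\to C^\infty(\mathbb R^n,\Lambda^*_k(\mathbb R^n)\otimes\mathbb C)$ is a constant coefficient bi-differential operator, homogeneous of degree $2m$; that is, it has the form $F\mapsto\sum_{|\alpha|+|\beta|=2m}c_{\alpha\beta}\,\big(\partial_x^\alpha\partial_y^\beta F\big)(x,y)\big|_{y=x}$ with constant linear maps $c_{\alpha\beta}\colon\mathbb S\otimes\mathbb S'\to\Lambda_k^*(\mathbb R^n)\otimes\mathbb C$. (ii) For every $g\in\mathbf G$, $$B^{(m)}_{k;\lambda,\mu}\circ\big(\pi_\lambda(g)\otimes\pi'_\mu(g)\big)=\pi_{k;\lambda+\mu+2m}(g)\circ B^{(m)}_{k;\lambda,\mu}$$ (when applied to smooth compactly supported $F$ such that the diagonal action of $g$ is defined on $\mathrm{supp}\,F$).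
   Context: Let $n\ge 1$, $e_1,\dots,e_n$ the standard basis of Euclidean $\mathbb R^n$, and $C\ell(\mathbb R^n)$ the real unital algebra generated by $\mathbb R^n$ with $xy+yx=-2\langle x,y\rangle$. Let $\mathbb S$ be a finite-dimensional complex vector space with a unital algebra homomorphism $\rho\colon C\ell(\mathbb R^n)\otimes\mathbb C\to\mathrm{End}(\mathbb S)$ (a Clifford module). On the dual $\mathbb S'$ (pairing $(s,t')$), $\rho'(x)t'=-t'\circ\rho(x)$ for $x\in\mathbb R^n$, extended to an algebra homomorphism. $\mathbf D=\sum_j\rho(e_j)\partial_j$, $\mathbf D'=\sum_j\rho'(e_j)\partial_j$, $\Delta=\sum_j\partial_j^2$; subscripts $x,y$ indicate the variable. In $P\otimes P'$, $P$ acts in $x$ and on $\mathbb S$, $P'$ in $y$ and on $\mathbb S'$; coefficients depending on $x,y$ act by multiplication after the derivatives. The source operator is $$\begin{aligned}E_{\lambda,\mu}={}&|x-y|^2\Delta_x\otimes\Delta_y+2(2\lambda-n+1)\sum_{j}(x_j-y_j)\tfrac{\partial}{\partial x_j}\otimes\Delta_y+2(2\mu-n+1)\sum_{j}(y_j-x_j)\Delta_x\otimes\tfrac{\partial}{\partial y_j}\\&-2\rho(x-y)\mathbf D_x\otimes\Delta_y-2\Delta_x\otimes\rho'(y-x)\mathbf D'_y+(2\mu-n+1)(2\mu+1)\Delta_x\otimes\mathrm{id}+(2\lambda-n+1)(2\lambda+1)\,\mathrm{id}\otimes\Delta_y\\&-2(2\lambda-n+1)(2\mu-n+1)\sum_{j}\tfrac{\partial}{\partial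 x_j}\otimes\tfrac{\partial}{\partial y_j}+2(2\lambda-n+1)\sum_{j}\tfrac{\partial}{\partial x_j}\otimes\rho'(e_j)\mathbf D'_y\\&+2(2\mu-n+1)\sum_{j}\rho(e_j)\mathbf D_x\otimes\tfrac{\partial}{\partial y_j}-2\sum_{j}\rho(e_j)\mathbf D_x\otimes\rho'(e_j)\mathbf D'_y\end{aligned}$$ (sums over $1\le j\le n$), acting on $C^\infty(\mathbb R^n\times\mathbb R^n,\mathbb S\otimes\mathbb S')$; $E^{(0)}_{\lambda,\mu}=\mathrm{id}$. $\Lambda^*_k(\mathbb R^n)$ is the space of alternating $k$-forms, i.e. the dual of $\Lambda^k(\mathbb R^n)$. $\Psi^{(k)}\colon\mathbb S\otimes\mathbb S'\to\Lambda^*_k(\mathbb R^n)\otimes\mathbb C$ is given by $\Psi^{(k)}(s\otimes t')(e_{i_1}\wedge\cdots\wedge e_{i_k})=(\rho(e_{i_1})\cdots\rho(e_{i_k})s,t')$ for $i_1<\dots<i_k$ (and $\Psi^{(0)}(s\otimes t')=(s,t')$), and $(\widetilde\Psi^{(k)}F)(x)=\Psi^{(k)}(F(x,x))$. On $\mathbb R^{1,n+1}$ with basis $e_0,\dots,e_{n+1}$ let $\mathbf Q(\mathbf x,\mathbf y)=x_0y_0-x_1y_1-\dots-x_{n+1}y_{n+1}$, $\mathbf Q(\mathbf x)=\mathbf Q(\mathbf x,\mathbf x)$, with Clifford algebra generated by $\mathbb R^{1,n+1}$ and $\mathbf x\mathbf y+\mathbf y\mathbf x=2\mathbf Q(\mathbf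 x,\mathbf y)$; it contains $C\ell(\mathbb R^n)$, $\mathbb R^n=\mathrm{span}(e_1,\dots,e_n)$. $\mathbf G=\mathrm{Spin}_0(1,n+1)$ is the group of products $\mathbf v_1\cdots\mathbf v_{2r}$ with $\mathbf v_j\in\mathbb R^{1,n+1}$, $\mathbf Q(\mathbf v_j)=\pm1$, the number of $j$ with $\mathbf Q(\mathbf v_j)=-1$ being even. $\mathbf M=\mathrm{Spin}(n)$ is the group of products of an even number of unit vectors of $\mathbb R^n$, $A=\{a_t=\cosh t+\sinh t\,e_0e_{n+1}\}$, $N=\{1+\tfrac12 y(e_0-e_{n+1}):y\in\mathbb R^n\}$, $\overline N=\{\overline n_x=1+\tfrac12x(e_0+e_{n+1}):x\in\mathbb R^n\}$. The map $(\overline n,m,a,n)\mapsto\overline nman$ from $\overline N\times\mathbf M\times A\times N$ to $\mathbf G$ is injective with dense open image. The action of $g$ is defined at $x$ if $g\overline n_x$ lies in this image; then $g\overline n_x=\overline n_{g(x)}m(g,x)a(g,x)n$. $\chi_\lambda(a_t)=e^{2t\lambda}$. Define $$\big((\pi_\lambda(g)\otimes\pi'_\mu(g))F\big)(x,y)=\chi_\lambda(a(g^{-1},x))^{-1}\chi_\mu(a(g^{-1},y))^{-1}\big(\rho(m(g^{-1},x))^{-1}\otimes\rho'(m(g^{-1},y))^{-1}\big)F(g^{-1}(x),g^{-1}(y)),$$ $$(\pi_{k;\nu}(g)\varphi)(x)=\chi_\nu(a(g^{-1},x))^{-1}\tau^*_k(m(g^{-1},x))^{-1}\varphi(g^{-1}(x)),$$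 where $\tau_k^*$ is the natural representation of $\mathrm{Spin}(n)$ on $\Lambda_k^*(\mathbb R^n)\otimes\mathbb C$: $(\tau^*_k(m)\omega)(v_1,\dots,v_k)=\omega(m^{-1}v_1m,\dots,m^{-1}v_km)$. These are applied to smooth compactly supported functions on whose support $g$ is defined (for two variables: $g$ defined at $x$ and at $y$ for all $(x,y)$ in the support), and are extended by $0$ at points where $g^{-1}$ is not defined. *)

theory Defs
  imports "HOL-Analysis.Analysis"
begin

section \<open>Clifford algebras\<close>

class quadratic_space = real_vector +
  fixes qprod :: "'a \<Rightarrow> 'a \<Rightarrow> real"
  assumes qprod_commute: "qprod x y = qprod y x"
    and qprod_add_left: "qprod (x + y) z = qprod x z + qprod y z"
    and qprod_scaleR_left: "qprod (r *\<^sub>R x) z = r * qprod x z"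

text \<open>
  The real unital algebra generated by a quadratic space with the relations
  \<open>x y + y x = 2 qprod x y\<close>, as the term algebra modulo the least congruence that
  contains the axioms of a unital \<open>\<real>\<close>-algebra, linearity of \<open>Vec\<close> and these relations.
\<close>

datatype 'v cl_term =
    Vec 'v
  | Scal real
  | Add "'v cl_term" "'v cl_term"
  | Mul "'v cl_term" "'v cl_term"

inductive cl_rel :: "'v::quadratic_space cl_term \<Rightarrow> 'v cl_term \<Rightarrow> bool" where
  cl_refl: "cl_rel a a"
| cl_sym: "cl_rel a b \<Longrightarrow> cl_rel b a"
| cl_trans: "cl_rel a b \<Longrightarrow> cl_rel b c \<Longrightarrow> cl_rel a c"
| cl_add_cong: "cl_rel a a' \<Longrightarrow> cl_rel b b' \<Longrightarrow> cl_rel (Add a b) (Add a' b')"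
| cl_mul_cong: "cl_rel a a' \<Longrightarrow> cl_rel b b' \<Longrightarrow> cl_rel (Mul a b) (Mul a' b')"
| cl_add_assoc: "cl_rel (Add (Add a b) c) (Add a (Add b c))"
| cl_add_commute: "cl_rel (Add a b) (Add b a)"
| cl_add_0: "cl_rel (Add (Scal 0) a) a"
| cl_add_minus: "cl_rel (Add (Mul (Scal (-1)) a) a) (Scal 0)"
| cl_mul_assoc: "cl_rel (Mul (Mul a b) c) (Mul a (Mul b c))"
| cl_mul_1: "cl_rel (Mul (Scal 1) a) a"
| cl_distrib_right: "cl_rel (Mul (Add a b) c) (Add (Mul a c) (Mul b c))"
| cl_distrib_left: "cl_rel (Mul a (Add b c)) (Add (Mul a b) (Mul a c))"
| cl_scal_add: "cl_rel (Scal (r + s)) (Add (Scal r) (Scal s))"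
| cl_scal_mul: "cl_rel (Scal (r * s)) (Mul (Scal r) (Scal s))"
| cl_scal_central: "cl_rel (Mul (Scal r) a) (Mul a (Scal r))"
| cl_vec_add: "cl_rel (Vec (x + y)) (Add (Vec x) (Vec y))"
| cl_vec_scaleR: "cl_rel (Vec (r *\<^sub>R x)) (Mul (Scal r) (Vec x))"
| cl_clifford: "cl_rel (Add (Mul (Vec x) (Vec y)) (Mul (Vec y) (Vec x))) (Scal (2 * qprod x y))"

quotient_type (overloaded) 'v clifford = "'v::quadratic_space cl_term" / cl_rel
  by (intro equivpI reflpI sympI transpI) (auto intro: cl_rel.intros)

text \<open>
  The classes are \<open>real_algebra\<close> and \<open>monoid_mult\<close> rather than \<open>real_algebra_1\<close>, because
  the latter also contains \<open>0 \<noteq> 1\<close>.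
\<close>

instantiation clifford :: (quadratic_space) "{real_algebra, monoid_mult}"
begin

lift_definition zero_clifford :: "'a clifford" is "Scal 0" .
lift_definition one_clifford :: "'a clifford" is "Scal 1" .
lift_definition plus_clifford :: "'a clifford \<Rightarrow> 'a clifford \<Rightarrow> 'a clifford" is Add
  by (rule cl_add_cong)
lift_definition times_clifford :: "'a clifford \<Rightarrow> 'a clifford \<Rightarrow> 'a clifford" is Mul
  by (rule cl_mul_cong)
lift_definition uminus_clifford :: "'a clifford \<Rightarrow> 'a clifford" is "Mul (Scal (-1))"
  by (intro cl_mul_cong cl_refl)
lift_definition scaleR_clifford :: "real \<Rightarrow> 'a clifford \<Rightarrow> 'a clifford" is "\<lambda>r. Mul (Scal r)"
  by (intro cl_mul_cong cl_refl)
definition minus_clifford :: "'a clifford \<Rightarrow> 'a clifford \<Rightarrow> 'a clifford"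
  where "minus_clifford a b = a + (- b)"

instance
proof
  fix a b c :: "'a clifford" and r s :: real
  show "a + b + c = a + (b + c)" by transfer (rule cl_add_assoc)
  show "a + b = b + a" by transfer (rule cl_add_commute)
  show "0 + a = a" by transfer (rule cl_add_0)
  show "- a + a = 0" by transfer (rule cl_add_minus)
  show "a - b = a + - b" by (rule minus_clifford_def)
  show "a * b * c = a * (b * c)" by transfer (rule cl_mul_assoc)
  show "1 * a = a" by transfer (rule cl_mul_1)
  show "a * 1 = a" by transfer (blast intro: cl_trans cl_sym cl_scal_central cl_mul_1)
  show "(a + b) * c = a * c + b * c" by transfer (rule cl_distrib_right)
  show "a * (b + c) = a * b + a * c" by transfer (rule cl_distrib_left)
  show "r *\<^sub>R (a + b) = r *\<^sub>R a + r *\<^sub>R b" by transfer (rule cl_distrib_left)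
  show "(r + s) *\<^sub>R a = r *\<^sub>R a + s *\<^sub>R a"
    by transfer (blast intro: cl_trans cl_mul_cong cl_refl cl_scal_add cl_distrib_right)
  show "r *\<^sub>R s *\<^sub>R a = (r * s) *\<^sub>R a"
    by transfer (blast intro: cl_trans cl_sym cl_mul_cong cl_refl cl_scal_mul cl_mul_assoc)
  show "1 *\<^sub>R a = a" by transfer (rule cl_mul_1)
  show "r *\<^sub>R a * b = r *\<^sub>R (a * b)" by transfer (rule cl_mul_assoc)
  show "a * r *\<^sub>R b = r *\<^sub>R (a * b)"
  proof transfer
    fix r :: real and a b :: "'a cl_term"
    have "cl_rel (Mul a (Mul (Scal r) b)) (Mul (Mul a (Scal r)) b)"
      by (rule cl_sym, rule cl_mul_assoc)
    moreover have "cl_rel (Mul (Mul a (Scal r)) b) (Mul (Mul (Scal r) a) b)"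
      by (intro cl_mul_cong cl_refl cl_sym[OF cl_scal_central])
    ultimately show "cl_rel (Mul a (Mul (Scal r) b)) (Mul (Scal r) (Mul a b))"
      by (meson cl_trans cl_mul_assoc)
  qed
qed

end

lift_definition cvec :: "'v::quadratic_space \<Rightarrow> 'v clifford" is Vec .

lemma cvec_add: "cvec (x + y) = cvec x + cvec y"
  by transfer (rule cl_vec_add)

lemma cvec_scaleR: "cvec (r *\<^sub>R x) = r *\<^sub>R cvec x"
  by transfer (rule cl_vec_scaleR)

lemma cl_scal_eq: "cl_rel (Scal s) (Mul (Scal s) (Scal 1))"
  using cl_scal_mul[of s 1] by simp

lemma cvec_clifford: "cvec x * cvec y + cvec y * cvec x = (2 * qprod x y) *\<^sub>R 1"
  by transfer (rule cl_trans[OF cl_clifford cl_scal_eq])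

definition clinv :: "'v::quadratic_space clifford \<Rightarrow> 'v clifford" where
  "clinv a = (THE b. a * b = 1 \<and> b * a = 1)"

text \<open>
  On \<open>\<real>\<^sup>n\<close> the form is \<open>-\<langle>x,y\<rangle>\<close>, so \<open>(real^'n) clifford\<close> has the relations
  \<open>x y + y x = -2 \<langle>x,y\<rangle>\<close>.
\<close>

instantiation vec :: (real_inner, finite) quadratic_space
begin

definition qprod_vec :: "'a ^ 'b \<Rightarrow> 'a ^ 'b \<Rightarrow> real" where "qprod_vec x y = - (x \<bullet> y)"

instance
proof
  fix x y z :: "'a ^ 'b" and r :: real
  show "qprod x y = qprod y x" by (simp add: qprod_vec_def inner_commute)
  show "qprod (x + y) z = qprod x z + qprod y z" by (simp add: qprod_vec_def inner_add_left)
  show "qprod (r *\<^sub>R x) z = r * qprod x z" by (simp add: qprod_vec_def)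
qed

end

text \<open>\<open>Lor a x b\<close> is the vector \<open>a e\<^sub>0 + x + b e\<^sub>n\<^sub>+\<^sub>1\<close> of \<open>\<real>\<^sup>1\<^sup>,\<^sup>n\<^sup>+\<^sup>1\<close>.\<close>

datatype 'n lorentz = Lor (lor_first: real) (lor_mid: "real^'n") (lor_last: real)

instantiation lorentz :: (finite) quadratic_space
begin

definition "0 = Lor 0 0 0"
definition "u + v = Lor (lor_first u + lor_first v) (lor_mid u + lor_mid v) (lor_last u + lor_last v)"
definition "u - v = Lor (lor_first u - lor_first v) (lor_mid u - lor_mid v) (lor_last u - lor_last v)"
definition "- u = Lor (- lor_first u) (- lor_mid u) (- lor_last u)"
definition "r *\<^sub>R u = Lor (r * lor_first u) (r *\<^sub>R lor_mid u) (r * lor_last u)"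
definition "qprod u v = lor_first u * lor_first v - lor_mid u \<bullet> lor_mid v - lor_last u * lor_last v"

instance
  by standard
    (auto simp: zero_lorentz_def plus_lorentz_def minus_lorentz_def uminus_lorentz_def
      scaleR_lorentz_def qprod_lorentz_def lorentz.expand algebra_simps inner_commute inner_add_left
      inner_add_right)

end

primrec incl_term :: "(real^'n) cl_term \<Rightarrow> 'n::finite lorentz cl_term" where
  "incl_term (Vec x) = Vec (Lor 0 x 0)"
| "incl_term (Scal r) = Scal r"
| "incl_term (Add a b) = Add (incl_term a) (incl_term b)"
| "incl_term (Mul a b) = Mul (incl_term a) (incl_term b)"

lemma incl_term_cong: "cl_rel a b \<Longrightarrow> cl_rel (incl_term a) (incl_term b)"
proof (induction rule: cl_rel.induct)
  case (cl_vec_add x y)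
  show ?case
    using cl_rel.cl_vec_add[of "Lor 0 x 0" "Lor 0 y 0"] by (simp add: plus_lorentz_def)
next
  case (cl_vec_scaleR r x)
  show ?case
    using cl_rel.cl_vec_scaleR[of r "Lor 0 x 0"] by (simp add: scaleR_lorentz_def)
next
  case (cl_clifford x y)
  show ?case
    using cl_rel.cl_clifford[of "Lor 0 x 0" "Lor 0 y 0"]
    by (simp add: qprod_lorentz_def qprod_vec_def)
qed (auto intro: cl_rel.intros)

text \<open>The inclusion of the Clifford algebra of \<open>\<real>\<^sup>n\<close> in that of \<open>\<real>\<^sup>1\<^sup>,\<^sup>n\<^sup>+\<^sup>1\<close>.\<close>

lift_definition cl_incl :: "(real^'n::finite) clifford \<Rightarrow> 'n lorentz clifford" is incl_term
  by (rule incl_term_cong)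

lemma cl_incl_simps:
  "cl_incl (cvec x) = cvec (Lor 0 x 0)" "cl_incl 1 = 1"
  "cl_incl (a + b) = cl_incl a + cl_incl b" "cl_incl (a * b) = cl_incl a * cl_incl b"
  "cl_incl (r *\<^sub>R a) = r *\<^sub>R cl_incl a"
  by (transfer, simp, rule cl_refl)+


section \<open>Clifford modules\<close>

text \<open>\<open>Cpx a b\<close> is the element \<open>a \<otimes> 1 + b \<otimes> \<i>\<close> of \<open>A \<otimes> \<complex>\<close>.\<close>

datatype 'a complexification = Cpx (cpx_re: 'a) (cpx_im: 'a)

instantiation complexification :: ("{real_algebra, monoid_mult}") "{plus, times, one}"
begin

definition "1 = Cpx 1 0"
definition "u + v = Cpx (cpx_re u + cpx_re v) (cpx_im u + cpx_im v)"
definition "u * v = Cpx (cpx_re u * cpx_re v - cpx_im u * cpx_im v)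
  (cpx_re u * cpx_im v + cpx_im u * cpx_re v)"

instance ..

end

definition cpx_scale :: "complex \<Rightarrow> 'a::real_algebra complexification \<Rightarrow> 'a complexification" where
  "cpx_scale z u = Cpx (Re z *\<^sub>R cpx_re u - Im z *\<^sub>R cpx_im u) (Re z *\<^sub>R cpx_im u + Im z *\<^sub>R cpx_re u)"

abbreviation cl_cpx :: "'v::quadratic_space clifford \<Rightarrow> 'v clifford complexification" where
  "cl_cpx a \<equiv> Cpx a 0"

abbreviation cl_vec :: "real^'n \<Rightarrow> (real^'n) clifford complexification" where
  "cl_vec x \<equiv> cl_cpx (cvec x)"

abbreviation stdb :: "'n \<Rightarrow> real^'n" where "stdb j \<equiv> axis j 1"

abbreviation cl_e :: "'n \<Rightarrow> (real^'n) clifford complexification" where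
  "cl_e j \<equiv> cl_vec (stdb j)"

text \<open>
  \<open>\<S>\<close> is \<open>complex^'s\<close> and \<open>End \<S>\<close> is the algebra of complex matrices. The dual \<open>\<S>'\<close> is
  \<open>complex^'s\<close> in dual coordinates, i.e. with the bilinear (not sesquilinear) \<open>pairing\<close>.
\<close>

type_synonym ('n, 's) cl_hom = "(real^'n) clifford complexification \<Rightarrow> complex^'s^'s"

definition clifford_module :: "('n::finite, 's::finite) cl_hom \<Rightarrow> bool" where
  "clifford_module \<rho> \<longleftrightarrow>
     (\<forall>a b. \<rho> (a + b) = \<rho> a + \<rho> b) \<and>
     (\<forall>z a. \<rho> (cpx_scale z a) = (\<chi> i j. z * \<rho> a $ i $ j)) \<and>
     (\<forall>a b. \<rho> (a * b) = \<rho> a ** \<rho> b) \<and>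
     \<rho> 1 = mat 1"

definition pairing :: "complex^'s \<Rightarrow> complex^'s \<Rightarrow> complex" where
  "pairing s t = (\<Sum>i\<in>UNIV. s $ i * t $ i)"

definition dual_module :: "('n::finite, 's::finite) cl_hom \<Rightarrow> ('n, 's) cl_hom \<Rightarrow> bool" where
  "dual_module \<rho> \<rho>' \<longleftrightarrow> clifford_module \<rho>' \<and>
     (\<forall>x s t. pairing s (\<rho>' (cl_vec x) *v t) = - pairing (\<rho> (cl_vec x) *v s) t)"

text \<open>\<open>\<S> \<otimes> \<S>'\<close> is \<open>complex^('s \<times> 's)\<close>, with \<open>kron A B\<close> the operator \<open>A \<otimes> B\<close>.\<close>

definition tensor :: "complex^'s \<Rightarrow> complex^'s \<Rightarrow> complex^('s \<times> 's)" where
  "tensor s t = (\<chi> p. s $ fst p * t $ snd p)"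

definition kron :: "complex^'s^'s \<Rightarrow> complex^'s^'s \<Rightarrow> complex^('s \<times> 's)^('s \<times> 's)" where
  "kron A B = (\<chi> p q. A $ fst p $ fst q * B $ snd p $ snd q)"

lemma kron_tensor:
  fixes A B :: "complex^'s::finite^'s"
  shows "kron A B *v tensor s t = tensor (A *v s) (B *v t)"
proof -
  have "(kron A B *v tensor s t) $ p = tensor (A *v s) (B *v t) $ p" for p
  proof -
    have "(kron A B *v tensor s t) $ p =
        (\<Sum>q\<in>UNIV \<times> UNIV. (A $ fst p $ fst q * s $ fst q) * (B $ snd p $ snd q * t $ snd q))"
      by (simp add: kron_def tensor_def matrix_vector_mult_def mult_ac)
    also have "\<dots> = (\<Sum>a\<in>UNIV. \<Sum>b\<in>UNIV. (A $ fst p $ a * s $ a) * (B $ snd p $ b * t $ b))"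
      by (simp add: sum.cartesian_product split_beta)
    also have "\<dots> = tensor (A *v s) (B *v t) $ p"
      by (simp only: tensor_def matrix_vector_mult_def sum_product vec_lambda_beta)
    finally show ?thesis .
  qed
  then show ?thesis by (metis vec_eq_iff)
qed


section \<open>Smooth functions and partial derivatives\<close>

primrec cont_diff :: "nat \<Rightarrow> ('a::real_normed_vector \<Rightarrow> 'b::real_normed_vector) \<Rightarrow> bool" where
  "cont_diff 0 f \<longleftrightarrow> continuous_on UNIV f"
| "cont_diff (Suc r) f \<longleftrightarrow> (\<forall>p. f differentiable (at p)) \<and>
     (\<forall>v. cont_diff r (\<lambda>p. frechet_derivative f (at p) v))"

definition smooth :: "('a::real_normed_vector \<Rightarrow> 'b::real_normed_vector) \<Rightarrow> bool" where
  "smooth f \<longleftrightarrow> (\<forall>r. cont_diff r f)"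

definition supp :: "('a::topological_space \<Rightarrow> 'b::zero) \<Rightarrow> 'a set" where
  "supp f = closure {p. f p \<noteq> 0}"

type_synonym ('n, 's) field2 = "(real^'n) \<times> (real^'n) \<Rightarrow> complex^('s \<times> 's)"

definition dx :: "'n \<Rightarrow> ('n::finite, 's::finite) field2 \<Rightarrow> ('n, 's) field2" where
  "dx j F = (\<lambda>p. frechet_derivative F (at p) (stdb j, 0))"

definition dy :: "'n \<Rightarrow> ('n::finite, 's::finite) field2 \<Rightarrow> ('n, 's) field2" where
  "dy j F = (\<lambda>p. frechet_derivative F (at p) (0, stdb j))"

definition dx_multi ::
  "('n \<Rightarrow> nat) \<Rightarrow> ('n::{finite,linorder}, 's::finite) field2 \<Rightarrow> ('n, 's) field2" where
  "dx_multi \<alpha> = fold (\<lambda>j. dx j ^^ \<alpha> j) (sorted_list_of_set UNIV)"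

definition dy_multi ::
  "('n \<Rightarrow> nat) \<Rightarrow> ('n::{finite,linorder}, 's::finite) field2 \<Rightarrow> ('n, 's) field2" where
  "dy_multi \<beta> = fold (\<lambda>j. dy j ^^ \<beta> j) (sorted_list_of_set UNIV)"

definition lap_x :: "('n::finite, 's::finite) field2 \<Rightarrow> ('n, 's) field2" where
  "lap_x F = (\<lambda>p. \<Sum>j\<in>UNIV. dx j (dx j F) p)"

definition lap_y :: "('n::finite, 's::finite) field2 \<Rightarrow> ('n, 's) field2" where
  "lap_y F = (\<lambda>p. \<Sum>j\<in>UNIV. dy j (dy j F) p)"

definition dirac_x ::
  "('n::finite, 's::finite) cl_hom \<Rightarrow> ('n, 's) field2 \<Rightarrow> ('n, 's) field2" where
  "dirac_x \<rho> F = (\<lambda>p. \<Sum>j\<in>UNIV. kron (\<rho> (cl_e j)) (mat 1) *v dx j F p)"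

definition dirac_y ::
  "('n::finite, 's::finite) cl_hom \<Rightarrow> ('n, 's) field2 \<Rightarrow> ('n, 's) field2" where
  "dirac_y \<rho>' F = (\<lambda>p. \<Sum>j\<in>UNIV. kron (mat 1) (\<rho>' (cl_e j)) *v dy j F p)"


section \<open>The source operator\<close>

definition source_op ::
  "('n::finite, 's::finite) cl_hom \<Rightarrow> ('n, 's) cl_hom \<Rightarrow> complex \<Rightarrow> complex
    \<Rightarrow> ('n, 's) field2 \<Rightarrow> ('n, 's) field2" where
  "source_op \<rho> \<rho>' l \<mu> F = (\<lambda>(x, y).
     let n = of_nat CARD('n);
         a = 2 * l - n + 1;
         b = 2 * \<mu> - n + 1
     in (norm (x - y))\<^sup>2 *\<^sub>R lap_x (lap_y F) (x, y)
      + (2 * a) *s (\<Sum>j\<in>UNIV. (x $ j - y $ j) *\<^sub>R dx j (lap_y F) (x, y))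
      + (2 * b) *s (\<Sum>j\<in>UNIV. (y $ j - x $ j) *\<^sub>R lap_x (dy j F) (x, y))
      - 2 *s (kron (\<rho> (cl_vec (x - y))) (mat 1) *v dirac_x \<rho> (lap_y F) (x, y))
      - 2 *s (kron (mat 1) (\<rho>' (cl_vec (y - x))) *v lap_x (dirac_y \<rho>' F) (x, y))
      + (b * (2 * \<mu> + 1)) *s lap_x F (x, y)
      + (a * (2 * l + 1)) *s lap_y F (x, y)
      - (2 * a * b) *s (\<Sum>j\<in>UNIV. dx j (dy j F) (x, y))
      + (2 * a) *s (\<Sum>j\<in>UNIV. kron (mat 1) (\<rho>' (cl_e j)) *v dx j (dirac_y \<rho>' F) (x, y))
      + (2 * b) *s (\<Sum>j\<in>UNIV. kron (\<rho> (cl_e j)) (mat 1) *v dirac_x \<rho> (dy j F) (x, y))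
      - 2 *s (\<Sum>j\<in>UNIV. kron (\<rho> (cl_e j)) (\<rho>' (cl_e j)) *v dirac_x \<rho> (dirac_y \<rho>' F) (x, y)))"

primrec source_op_iter ::
  "('n::finite, 's::finite) cl_hom \<Rightarrow> ('n, 's) cl_hom \<Rightarrow> complex \<Rightarrow> complex \<Rightarrow> nat
    \<Rightarrow> ('n, 's) field2 \<Rightarrow> ('n, 's) field2" where
  "source_op_iter \<rho> \<rho>' l \<mu> 0 = id"
| "source_op_iter \<rho> \<rho>' l \<mu> (Suc m) =
     source_op \<rho> \<rho>' (l + of_nat m) (\<mu> + of_nat m) \<circ> source_op_iter \<rho> \<rho>' l \<mu> m"


section \<open>Alternating forms\<close>

text \<open>
  An element of \<open>\<Lambda>\<^sup>*\<^sub>k(\<real>\<^sup>n) \<otimes> \<complex>\<close> is a complex valued alternating \<open>\<real>\<close>-multilinear function of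
  the vectors in a list of length \<open>k\<close>. It is set to 0 on lists of any other length, so that
  equality of functions is equality of forms.
\<close>

type_synonym 'n form = "(real^'n) list \<Rightarrow> complex"
type_synonym 'n form_field = "real^'n \<Rightarrow> 'n form"

definition alt_form :: "nat \<Rightarrow> 'n::finite form \<Rightarrow> bool" where
  "alt_form k \<omega> \<longleftrightarrow>
     (\<forall>vs. length vs \<noteq> k \<longrightarrow> \<omega> vs = 0) \<and>
     (\<forall>vs i u v. length vs = k \<and> i < k \<longrightarrow> \<omega> (vs[i := u + v]) = \<omega> (vs[i := u]) + \<omega> (vs[i := v])) \<and>
     (\<forall>vs i r v. length vs = k \<and> i < k \<longrightarrow> \<omega> (vs[i := r *\<^sub>R v]) = of_real r * \<omega> (vs[i := v])) \<and>
     (\<forall>vs i j. length vs = k \<and> i < j \<and> j < k \<and> vs ! i = vs ! j \<longrightarrow> \<omega> vs = 0)"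

definition smooth_form_field :: "nat \<Rightarrow> 'n::finite form_field \<Rightarrow> bool" where
  "smooth_form_field k \<phi> \<longleftrightarrow> (\<forall>x. alt_form k (\<phi> x)) \<and> (\<forall>vs. smooth (\<lambda>x. \<phi> x vs))"

definition psi_basis ::
  "('n::finite, 's::finite) cl_hom \<Rightarrow> 'n list \<Rightarrow> complex^('s \<times> 's) \<Rightarrow> complex" where
  "psi_basis \<rho> is T = (\<Sum>a\<in>UNIV. \<Sum>b\<in>UNIV.
     T $ (a, b) * pairing (foldr (\<lambda>i A. \<rho> (cl_e i) ** A) is (mat 1) *v axis a 1) (axis b 1))"

lemma psi_basis_tensor:
  "psi_basis \<rho> is (tensor s t) = pairing (foldr (\<lambda>i A. \<rho> (cl_e i) ** A) is (mat 1) *v s) t"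
proof -
  define M where "M = foldr (\<lambda>i A. \<rho> (cl_e i) ** A) is (mat 1)"
  have entry: "pairing (M *v axis a 1) (axis b 1) = M $ b $ a" for a b
    by (simp add: pairing_def matrix_vector_mult_def axis_def if_distrib cong: if_cong)
  have "psi_basis \<rho> is (tensor s t) = (\<Sum>a\<in>UNIV. \<Sum>b\<in>UNIV. M $ b $ a * s $ a * t $ b)"
    by (simp only: psi_basis_def M_def[symmetric] entry) (simp add: tensor_def mult_ac)
  also have "\<dots> = (\<Sum>b\<in>UNIV. \<Sum>a\<in>UNIV. M $ b $ a * s $ a * t $ b)"
    by (rule sum.swap)
  also have "\<dots> = pairing (M *v s) t"
    by (simp only: pairing_def matrix_vector_mult_def vec_lambda_beta sum_distrib_right)
  finally show ?thesis by (simp only: M_def)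
qed

text \<open>\<open>\<Psi>\<^sup>(\<^sup>k\<^sup>)\<close>: the form with prescribed values on \<open>e\<^sub>i\<^sub>1 \<and> \<dots> \<and> e\<^sub>i\<^sub>k\<close> for \<open>i\<^sub>1 < \<dots> < i\<^sub>k\<close>.\<close>

definition psi ::
  "('n::{finite,linorder}, 's::finite) cl_hom \<Rightarrow> nat \<Rightarrow> complex^('s \<times> 's) \<Rightarrow> 'n form" where
  "psi \<rho> k T = (THE \<omega>. alt_form k \<omega> \<and>
     (\<forall>is. length is = k \<and> sorted_wrt (<) is \<longrightarrow> \<omega> (map stdb is) = psi_basis \<rho> is T))"

definition psi_diag ::
  "('n::{finite,linorder}, 's::finite) cl_hom \<Rightarrow> nat \<Rightarrow> ('n, 's) field2 \<Rightarrow> 'n form_field" where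
  "psi_diag \<rho> k F = (\<lambda>x. psi \<rho> k (F (x, x)))"

definition sym_break_op ::
  "('n::{finite,linorder}, 's::finite) cl_hom \<Rightarrow> ('n, 's) cl_hom \<Rightarrow> nat \<Rightarrow> complex \<Rightarrow> complex \<Rightarrow> nat
    \<Rightarrow> ('n, 's) field2 \<Rightarrow> 'n form_field" where
  "sym_break_op \<rho> \<rho>' k l \<mu> m = psi_diag \<rho> k \<circ> source_op_iter \<rho> \<rho>' l \<mu> m"

definition form_valued_linear :: "nat \<Rightarrow> (complex^('s::finite \<times> 's) \<Rightarrow> 'n::finite form) \<Rightarrow> bool" where
  "form_valued_linear k c \<longleftrightarrow> (\<forall>T. alt_form k (c T)) \<and>
     (\<forall>T U vs. c (T + U) vs = c T vs + c U vs) \<and>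
     (\<forall>z T vs. c (z *s T) vs = z * c T vs)"

definition const_coeff_bidiff_op ::
  "nat \<Rightarrow> nat \<Rightarrow> (('n::{finite,linorder}, 's::finite) field2 \<Rightarrow> 'n form_field) \<Rightarrow> bool" where
  "const_coeff_bidiff_op k d B \<longleftrightarrow>
     (\<exists>c. (\<forall>\<alpha> \<beta>. form_valued_linear k (c \<alpha> \<beta>)) \<and>
       (\<forall>F. smooth F \<longrightarrow> (\<forall>x vs. B F x vs =
         (\<Sum>(\<alpha>, \<beta>)\<in>{(\<alpha>, \<beta>). sum \<alpha> UNIV + sum \<beta> UNIV = d}.
            c \<alpha> \<beta> (dx_multi \<alpha> (dy_multi \<beta> F) (x, x)) vs))))"


section \<open>The conformal group and its representations\<close>

definition spin_lorentz :: "'n::finite lorentz clifford set" where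
  "spin_lorentz = {prod_list (map cvec vs) | vs.
     even (length vs) \<and> (\<forall>v\<in>set vs. qprod v v = 1 \<or> qprod v v = -1) \<and>
     even (length (filter (\<lambda>v. qprod v v = -1) vs))}"

definition spin_compact :: "(real^'n::finite) clifford set" where
  "spin_compact = {prod_list (map cvec vs) | vs. even (length vs) \<and> (\<forall>v\<in>set vs. norm v = 1)}"

abbreviation lor_e0 :: "'n::finite lorentz clifford" where "lor_e0 \<equiv> cvec (Lor 1 0 0)"

abbreviation lor_en1 :: "'n::finite lorentz clifford" where "lor_en1 \<equiv> cvec (Lor 0 0 1)"

definition a_elt :: "real \<Rightarrow> 'n::finite lorentz clifford" where
  "a_elt t = cosh t *\<^sub>R 1 + sinh t *\<^sub>R (lor_e0 * lor_en1)"

definition n_elt :: "real^'n \<Rightarrow> 'n::finite lorentz clifford" where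
  "n_elt y = 1 + (1/2) *\<^sub>R (cl_incl (cvec y) * (lor_e0 - lor_en1))"

definition nbar_elt :: "real^'n \<Rightarrow> 'n::finite lorentz clifford" where
  "nbar_elt x = 1 + (1/2) *\<^sub>R (cl_incl (cvec x) * (lor_e0 + lor_en1))"

definition is_decomp ::
  "'n::finite lorentz clifford \<Rightarrow> real^'n \<Rightarrow> real^'n \<Rightarrow> (real^'n) clifford \<Rightarrow> real \<Rightarrow> bool" where
  "is_decomp g x x' m t \<longleftrightarrow> m \<in> spin_compact \<and>
     (\<exists>z. g * nbar_elt x = nbar_elt x' * cl_incl m * a_elt t * n_elt z)"

definition act_defined :: "'n::finite lorentz clifford \<Rightarrow> real^'n \<Rightarrow> bool" where
  "act_defined g x \<longleftrightarrow> (\<exists>x' m t. is_decomp g x x' m t)"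

definition act :: "'n::finite lorentz clifford \<Rightarrow> real^'n \<Rightarrow> real^'n" where
  "act g x = (THE x'. \<exists>m t. is_decomp g x x' m t)"

definition m_part :: "'n::finite lorentz clifford \<Rightarrow> real^'n \<Rightarrow> (real^'n) clifford" where
  "m_part g x = (THE m. \<exists>x' t. is_decomp g x x' m t)"

text \<open>The real number \<open>t\<close> with \<open>a(g,x) = a\<^sub>t\<close>; accordingly \<open>chi\<close> takes \<open>t\<close> instead of \<open>a\<^sub>t\<close>.\<close>

definition a_part :: "'n::finite lorentz clifford \<Rightarrow> real^'n \<Rightarrow> real" where
  "a_part g x = (THE t. \<exists>x' m. is_decomp g x x' m t)"

definition chi :: "complex \<Rightarrow> real \<Rightarrow> complex" where
  "chi l t = exp (2 * of_real t * l)"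

definition pi_tensor ::
  "('n::finite, 's::finite) cl_hom \<Rightarrow> ('n, 's) cl_hom \<Rightarrow> complex \<Rightarrow> complex
    \<Rightarrow> 'n lorentz clifford \<Rightarrow> ('n, 's) field2 \<Rightarrow> ('n, 's) field2" where
  "pi_tensor \<rho> \<rho>' l \<mu> g F = (\<lambda>(x, y).
     let h = clinv g in
     if act_defined h x \<and> act_defined h y
     then (inverse (chi l (a_part h x)) * inverse (chi \<mu> (a_part h y))) *s
            (kron (matrix_inv (\<rho> (cl_cpx (m_part h x)))) (matrix_inv (\<rho>' (cl_cpx (m_part h y))))
              *v F (act h x, act h y))
     else 0)"

definition spin_conj :: "(real^'n::finite) clifford \<Rightarrow> real^'n \<Rightarrow> real^'n" where
  "spin_conj m v = (THE w. cvec w = clinv m * cvec v * m)"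

definition tau :: "(real^'n::finite) clifford \<Rightarrow> 'n form \<Rightarrow> 'n form" where
  "tau m \<omega> = (\<lambda>vs. \<omega> (map (spin_conj m) vs))"

text \<open>
  For \<open>m \<in> spin_compact\<close> the map \<open>tau m\<close> is a bijection of all functions on lists which
  preserves \<open>k\<close>-forms in both directions, hence \<open>inv (tau m)\<close> restricts to the inverse on \<open>k\<close>-forms.
\<close>

definition pi_form ::
  "complex \<Rightarrow> 'n::finite lorentz clifford \<Rightarrow> 'n form_field \<Rightarrow> 'n form_field" where
  "pi_form \<nu> g \<phi> = (\<lambda>x vs.
     let h = clinv g in
     if act_defined h x
     then inverse (chi \<nu> (a_part h x)) * inv (tau (m_part h x)) (\<phi> (act h x)) vs
     else 0)"

end

theory Submission
  imports Defs
begin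

text \<open>
  The source operator is \<open>E = K \<otimes> \<Delta> + \<Delta> \<otimes> K - 2 \<Sum>\<^sub>j P\<^sub>j \<otimes> P\<^sub>j\<close>, an invariant pairing of two copies of
  the vector of operators \<open>(\<Delta>, P\<^sub>j, K)\<close>, where
  \<open>P\<^sub>j = x\<^sub>j \<Delta> + (2 \<lambda> - n + 1) \<partial>\<^sub>j - \<rho>(e\<^sub>j) D\<close> and
  \<open>K = |x|\<^sup>2 \<Delta> + 2 (2 \<lambda> - n + 1) \<Sum>\<^sub>j x\<^sub>j \<partial>\<^sub>j - 2 \<rho>(x) D + (2 \<lambda> - n + 1) (2 \<lambda> + 1)\<close>.
  The Clifford-twisted inversion exchanges \<open>\<Delta>\<close> and \<open>K\<close> and fixes the \<open>P\<^sub>j\<close>, linear similarities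
  rescale \<open>\<Delta>\<close> and \<open>K\<close> and mix the \<open>P\<^sub>j\<close> orthogonally, and \<open>E\<close> is translation invariant. So all of
  them intertwine \<open>E\<close>, with \<open>\<lambda>\<close> and \<open>\<mu>\<close> raised by one on the other side.

  The left action of \<open>g \<in> Spin\<^sub>0(1, n + 1)\<close> on a left ideal whose generator is fixed by \<open>N\<close> shows
  that \<open>g\<close> acts on \<open>\<real>\<^sup>n\<close> by a similarity, possibly after an inversion, and exhibits \<open>m(g, x)\<close> and
  \<open>a(g, x)\<close> as the normalisation and the norm of a product of vectors. Finally, \<open>\<Psi>\<^sup>(\<^sup>k\<^sup>)\<close> is the
  antisymmetrisation of \<open>(\<rho>(v\<^sub>1) \<cdots> \<rho>(v\<^sub>k) s, t')\<close>, which is equivariant under \<open>Spin(n)\<close>.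
\<close>

section \<open>Smooth maps\<close>

text \<open>The inverse of \<open>g\<close> may send one point to infinity, so
  \<open>pi_tensor\<close> is given by a smooth formula only off that point. Calculus is therefore
  done on open sets and the covariance is checked point by point; near the bad point both sides
  vanish, because the image point runs to infinity while \<open>F\<close> has bounded support. The
  Clifford algebra is a quotient of terms, without a basis. What is needed about its size is that 1
  is not 0, and this comes from the module, since the identity matrix is not 0. As vectors square to
  scalars, this makes \<open>cvec\<close> injective, and the decomposition can then be read off from
  the action on the left ideal. Products of vectors are kept unnormalised, as z = e^t m. Replacing
  the inverse of m by the reversal of z costs e^-t, and with chi^-1 = e^(-2tl) the multiplier
  becomes e^(-t(2l+1)). This is the origin of the exponent -(2l+1) in the twisted inversion. At l =
  (n-1)/2 it is -n, the weight of the Kelvin transform of the Dirac operator; the constant 2l - n +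
  1 in the operators measures the distance to this case.\<close>

primrec cont_diff_on :: "'a set \<Rightarrow> nat \<Rightarrow> ('a::real_normed_vector \<Rightarrow> 'b::real_normed_vector) \<Rightarrow> bool" where
  "cont_diff_on W 0 f \<longleftrightarrow> continuous_on W f"
| "cont_diff_on W (Suc r) f \<longleftrightarrow> (\<forall>p\<in>W. f differentiable (at p)) \<and>
     (\<forall>v. cont_diff_on W r (\<lambda>p. frechet_derivative f (at p) v))"

text \<open>Derivatives are taken at p and not within \<open>W\<close>, so the notion depends on
  germs only and is meant for open \<open>W\<close>. The inversion and the powers of |x| are smooth
  in this sense away from 0.\<close>

definition smooth_on :: "'a set \<Rightarrow> ('a::real_normed_vector \<Rightarrow> 'b::real_normed_vector) \<Rightarrow> bool" where
  "smooth_on W f \<longleftrightarrow> (\<forall>r. cont_diff_on W r f)"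

lemma cont_diff_on_UNIV: "cont_diff_on UNIV r f = cont_diff r f"
  by (induction r arbitrary: f) auto

lemma smooth_on_UNIV: "smooth_on UNIV f = smooth f"
  by (simp add: smooth_on_def smooth_def cont_diff_on_UNIV)

lemma has_derivative_cong_open:
  assumes "open W" "p \<in> W" and "\<And>q. q \<in> W \<Longrightarrow> f q = g q"
  shows "(f has_derivative D) (at p) \<longleftrightarrow> (g has_derivative D) (at p)"
proof
  show "(f has_derivative D) (at p) \<Longrightarrow> (g has_derivative D) (at p)"
    by (erule has_derivative_transform_within_open[OF _ assms(1,2)]) (simp add: assms(3))
  show "(g has_derivative D) (at p) \<Longrightarrow> (f has_derivative D) (at p)"
    by (erule has_derivative_transform_within_open[OF _ assms(1,2)]) (simp add: assms(3))
qed

lemma frechet_derivative_cong_open: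
  assumes "open W" "p \<in> W" and "\<And>q. q \<in> W \<Longrightarrow> f q = g q"
  shows "frechet_derivative f (at p) = frechet_derivative g (at p)"
  unfolding frechet_derivative_def by (simp add: has_derivative_cong_open[OF assms])

lemma cont_diff_on_cong:
  assumes "open W" and "\<And>p. p \<in> W \<Longrightarrow> f p = g p"
  shows "cont_diff_on W r f = cont_diff_on W r g"
  using assms
proof (induction r arbitrary: f g)
  case 0
  then show ?case by (auto intro: continuous_on_cong)
next
  case (Suc r)
  have "f differentiable (at p) \<longleftrightarrow> g differentiable (at p)" if "p \<in> W" for p
    unfolding differentiable_def by (simp add: has_derivative_cong_open[OF Suc.prems(1) that Suc.prems(2)])
  moreover have "frechet_derivative f (at p) = frechet_derivative g (at p)" if "p \<in> W" for p
    by (rule frechet_derivative_cong_open[OF Suc.prems(1) that Suc.prems(2)])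
  then have "cont_diff_on W r (\<lambda>p. frechet_derivative f (at p) v) =
      cont_diff_on W r (\<lambda>p. frechet_derivative g (at p) v)" for v
    by (intro Suc.IH[OF Suc.prems(1)]) auto
  ultimately show ?case by simp
qed

lemma cont_diff_on_Suc_iff:
  assumes "open W" and "\<And>p. p \<in> W \<Longrightarrow> (f has_derivative f' p) (at p)"
  shows "cont_diff_on W (Suc r) f \<longleftrightarrow> (\<forall>v. cont_diff_on W r (\<lambda>p. f' p v))"
proof -
  have "frechet_derivative f (at p) = f' p" if "p \<in> W" for p
    using assms(2)[OF that] frechet_derivative_at by metis
  then have "cont_diff_on W r (\<lambda>p. frechet_derivative f (at p) v) = cont_diff_on W r (\<lambda>p. f' p v)" for v
    by (intro cont_diff_on_cong[OF assms(1)]) auto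
  then show ?thesis using assms(2) by (auto simp: differentiable_def)
qed

lemma cont_diff_on_has_derivative:
  "cont_diff_on W (Suc r) f \<Longrightarrow> p \<in> W \<Longrightarrow> (f has_derivative frechet_derivative f (at p)) (at p)"
  by (simp add: frechet_derivative_works)

lemma cont_diff_on_imp_continuous_on: "cont_diff_on W r f \<Longrightarrow> continuous_on W f"
  by (cases r) (auto intro!: differentiable_imp_continuous_on
      simp: differentiable_on_def differentiable_at_withinI)

lemma cont_diff_on_Suc_D: "cont_diff_on W (Suc r) f \<Longrightarrow> cont_diff_on W r f"
proof (induction r arbitrary: f)
  case 0
  then show ?case using cont_diff_on_imp_continuous_on[of W "Suc 0" f] by simp
next
  case (Suc r)
  show ?case using Suc.prems Suc.IH by (metis cont_diff_on.simps(2))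
qed

lemma cont_diff_on_const [simp]: "cont_diff_on W r (\<lambda>_. c)"
  by (induction r arbitrary: c) (auto simp: frechet_derivative_const)

lemma cont_diff_on_bounded_linear:
  assumes "bounded_linear L" "open W" "cont_diff_on W r f"
  shows "cont_diff_on W r (\<lambda>p. L (f p))"
  using assms(3)
proof (induction r arbitrary: f)
  case 0
  then show ?case using assms(1) by (auto intro: bounded_linear.continuous_on)
next
  case (Suc r)
  have "((\<lambda>p. L (f p)) has_derivative (\<lambda>v. L (frechet_derivative f (at p) v))) (at p)" if "p \<in> W" for p
    using bounded_linear.has_derivative[OF assms(1) cont_diff_on_has_derivative[OF Suc.prems that]] .
  then show ?case
    using Suc by (subst cont_diff_on_Suc_iff[OF assms(2)]) auto
qed

lemma cont_diff_on_linear: "bounded_linear L \<Longrightarrow> open W \<Longrightarrow> cont_diff_on W r L"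
proof (cases r)
  case (Suc k)
  assume L: "bounded_linear L" "open W"
  show ?thesis unfolding Suc
    by (subst cont_diff_on_Suc_iff[where f'="\<lambda>_. L"])
      (auto intro: L bounded_linear_imp_has_derivative)
qed (simp add: linear_continuous_on)

lemma cont_diff_on_add:
  assumes "open W" "cont_diff_on W r f" "cont_diff_on W r g"
  shows "cont_diff_on W r (\<lambda>p. f p + g p)"
  using assms(2,3)
proof (induction r arbitrary: f g)
  case 0
  then show ?case by (auto intro: continuous_intros)
next
  case (Suc r)
  have "((\<lambda>p. f p + g p) has_derivative
      (\<lambda>v. frechet_derivative f (at p) v + frechet_derivative g (at p) v)) (at p)" if "p \<in> W" for p
    by (intro has_derivative_add cont_diff_on_has_derivative[OF Suc.prems(1) that]
        cont_diff_on_has_derivative[OF Suc.prems(2) that])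
  then show ?case
    using Suc by (subst cont_diff_on_Suc_iff[OF assms(1)]) auto
qed

lemma cont_diff_on_sum:
  assumes "open W" "\<And>i. i \<in> I \<Longrightarrow> cont_diff_on W r (f i)"
  shows "cont_diff_on W r (\<lambda>p. \<Sum>i\<in>I. f i p)"
  using assms(2) by (induction I rule: infinite_finite_induct) (auto intro: cont_diff_on_add[OF assms(1)])

lemma cont_diff_on_bilinear:
  assumes "bounded_bilinear B" "open W" "cont_diff_on W r f" "cont_diff_on W r g"
  shows "cont_diff_on W r (\<lambda>p. B (f p) (g p))"
  using assms(3,4)
proof (induction r arbitrary: f g)
  case 0
  then show ?case using assms(1) by (auto intro: bounded_bilinear.continuous_on)
next
  case (Suc r)
  have d: "((\<lambda>p. B (f p) (g p)) has_derivative (\<lambda>v. B (f p) (frechet_derivative g (at p) v)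
      + B (frechet_derivative f (at p) v) (g p))) (at p)" if "p \<in> W" for p
    by (intro bounded_bilinear.FDERIV[OF assms(1)] cont_diff_on_has_derivative[OF Suc.prems(1) that]
        cont_diff_on_has_derivative[OF Suc.prems(2) that])
  have "cont_diff_on W r f" "cont_diff_on W r g"
    using Suc.prems cont_diff_on_Suc_D by blast+
  moreover have "cont_diff_on W r (\<lambda>p. frechet_derivative f (at p) v)"
    "cont_diff_on W r (\<lambda>p. frechet_derivative g (at p) v)" for v
    using Suc.prems by auto
  ultimately show ?case
    by (subst cont_diff_on_Suc_iff[OF assms(2) d]) (auto intro!: cont_diff_on_add[OF assms(2)] Suc.IH)
qed

text \<open>The chain rule yields a derivative of \<open>f\<close> at the moving point
  \<open>H p\<close> in a moving direction. Expanding that direction in a basis leaves scalar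
  functions times fixed directional derivatives of \<open>f\<close> composed with \<open>H\<close>,
  to which the induction hypothesis applies.\<close>

lemma cont_diff_on_compose:
  fixes H :: "'a::real_normed_vector \<Rightarrow> 'b::euclidean_space"
  assumes "open W" "open U" "H ` W \<subseteq> U" "cont_diff_on U r f" "cont_diff_on W r H"
  shows "cont_diff_on W r (\<lambda>p. f (H p))"
  using assms(4,5)
proof (induction r arbitrary: f)
  case 0
  then show ?case using assms(3) by (auto intro: continuous_on_compose2)
next
  case (Suc r)
  have d: "((\<lambda>p. f (H p)) has_derivative (\<lambda>v. frechet_derivative f (at (H p))
      (frechet_derivative H (at p) v))) (at p)" if "p \<in> W" for p
  proof -
    have "H p \<in> U" using assms(3) that by auto
    then show ?thesis
      by (rule has_derivative_compose[OF cont_diff_on_has_derivative[OF Suc.prems(2) that]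
            cont_diff_on_has_derivative[OF Suc.prems(1)]])
  qed
  have e: "frechet_derivative f (at (H p)) w = (\<Sum>b\<in>Basis. (w \<bullet> b) *\<^sub>R frechet_derivative f (at (H p)) b)"
    if "p \<in> W" for p w
  proof -
    have "linear (frechet_derivative f (at (H p)))"
      using Suc.prems(1) assms(3) that by (intro linear_frechet_derivative) auto
    then have "frechet_derivative f (at (H p)) (\<Sum>b\<in>Basis. (w \<bullet> b) *\<^sub>R b)
      = (\<Sum>b\<in>Basis. (w \<bullet> b) *\<^sub>R frechet_derivative f (at (H p)) b)"
      by (simp add: linear_sum linear_scale)
    then show ?thesis by (simp add: euclidean_representation)
  qed
  have dH: "cont_diff_on W r H" "cont_diff_on W r (\<lambda>p. frechet_derivative H (at p) v)" for v
    using Suc.prems(2) cont_diff_on_Suc_D by auto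
  have "cont_diff_on W r (\<lambda>p. (frechet_derivative H (at p) v \<bullet> b) *\<^sub>R frechet_derivative f (at (H p)) b)"
    for v b
  proof (rule cont_diff_on_bilinear[OF bounded_bilinear_scaleR assms(1)])
    show "cont_diff_on W r (\<lambda>p. frechet_derivative H (at p) v \<bullet> b)"
      by (rule cont_diff_on_bounded_linear[OF bounded_linear_inner_left assms(1) dH(2)])
    show "cont_diff_on W r (\<lambda>p. frechet_derivative f (at (H p)) b)"
      using Suc.prems(1) dH(1) by (intro Suc.IH) auto
  qed
  then have "cont_diff_on W r (\<lambda>p. \<Sum>b\<in>Basis. (frechet_derivative H (at p) v \<bullet> b)
      *\<^sub>R frechet_derivative f (at (H p)) b)" for v
    by (rule cont_diff_on_sum[OF assms(1)])
  then have "cont_diff_on W r (\<lambda>p. frechet_derivative f (at (H p)) (frechet_derivative H (at p) v))" for v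
    by (rule subst[OF cont_diff_on_cong[OF assms(1)], rotated]) (rule e[symmetric])
  then show ?case by (subst cont_diff_on_Suc_iff[OF assms(1) d]) auto
qed

lemma smooth_on_const: "smooth_on W (\<lambda>_. c)"
  by (simp add: smooth_on_def)

lemma smooth_on_cong: "open W \<Longrightarrow> (\<And>p. p \<in> W \<Longrightarrow> f p = g p) \<Longrightarrow> smooth_on W f = smooth_on W g"
  unfolding smooth_on_def using cont_diff_on_cong by blast

lemma smooth_on_bounded_linear:
  "bounded_linear L \<Longrightarrow> open W \<Longrightarrow> smooth_on W f \<Longrightarrow> smooth_on W (\<lambda>p. L (f p))"
  by (simp add: smooth_on_def cont_diff_on_bounded_linear)

lemma smooth_on_linear: "bounded_linear L \<Longrightarrow> open W \<Longrightarrow> smooth_on W L"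
  by (simp add: smooth_on_def cont_diff_on_linear)

lemma smooth_on_add: "open W \<Longrightarrow> smooth_on W f \<Longrightarrow> smooth_on W g \<Longrightarrow> smooth_on W (\<lambda>p. f p + g p)"
  by (simp add: smooth_on_def cont_diff_on_add)

lemma smooth_on_sum:
  "open W \<Longrightarrow> (\<And>i. i \<in> I \<Longrightarrow> smooth_on W (f i)) \<Longrightarrow> smooth_on W (\<lambda>p. \<Sum>i\<in>I. f i p)"
  by (simp add: smooth_on_def cont_diff_on_sum)

lemma smooth_on_bilinear:
  "bounded_bilinear B \<Longrightarrow> open W \<Longrightarrow> smooth_on W f \<Longrightarrow> smooth_on W g \<Longrightarrow> smooth_on W (\<lambda>p. B (f p) (g p))"
  by (simp add: smooth_on_def cont_diff_on_bilinear)

lemma smooth_on_compose: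
  fixes H :: "'a::real_normed_vector \<Rightarrow> 'b::euclidean_space"
  shows "open W \<Longrightarrow> open U \<Longrightarrow> H ` W \<subseteq> U \<Longrightarrow> smooth_on U f \<Longrightarrow> smooth_on W H \<Longrightarrow> smooth_on W (\<lambda>p. f (H p))"
  by (simp add: smooth_on_def cont_diff_on_compose)

lemma smooth_on_deriv: "smooth_on W f \<Longrightarrow> smooth_on W (\<lambda>p. frechet_derivative f (at p) v)"
  unfolding smooth_on_def by (metis cont_diff_on.simps(2))

lemma smooth_on_differentiable: "smooth_on W f \<Longrightarrow> p \<in> W \<Longrightarrow> f differentiable (at p)"
  unfolding smooth_on_def by (metis cont_diff_on.simps(2))

lemma smooth_on_continuous_on: "smooth_on W f \<Longrightarrow> continuous_on W f"
  unfolding smooth_on_def by (metis cont_diff_on.simps(1))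

lemma smooth_on_has_derivative:
  "smooth_on W f \<Longrightarrow> p \<in> W \<Longrightarrow> (f has_derivative frechet_derivative f (at p)) (at p)"
  using smooth_on_differentiable frechet_derivative_works by blast

text \<open>By the mean value theorem, the second difference is a value of either mixed derivative.\<close>

lemma second_difference:
  fixes f :: "'a::real_normed_vector \<Rightarrow> real"
  assumes sm: "smooth_on W f" and h: "h > 0"
    and sq: "\<And>s t. \<bar>s\<bar> \<le> h \<Longrightarrow> \<bar>t\<bar> \<le> h \<Longrightarrow> p + s *\<^sub>R u + t *\<^sub>R v \<in> W"
  obtains s t where "0 < s" "s < h" "0 < t" "t < h"
    "f (p + h *\<^sub>R u + h *\<^sub>R v) - f (p + h *\<^sub>R u) - f (p + h *\<^sub>R v) + f p
      = h * h * frechet_derivative (\<lambda>q. frechet_derivative f (at q) u) (at (p + s *\<^sub>R u + t *\<^sub>R v)) v"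
proof -
  define g where "g = (\<lambda>q. frechet_derivative f (at q) u)"
  have smg: "smooth_on W g" unfolding g_def by (rule smooth_on_deriv[OF sm])
  have lin: "((\<lambda>x. F (q + x *\<^sub>R w)) has_derivative
      (\<lambda>y. frechet_derivative F (at (q + x *\<^sub>R w)) (y *\<^sub>R w))) (at x)"
    if "smooth_on W F" "q + x *\<^sub>R w \<in> W" for F :: "'a \<Rightarrow> real" and q w x
    by (rule has_derivative_compose[where f="\<lambda>x. q + x *\<^sub>R w", OF _ smooth_on_has_derivative[OF that]])
      (auto intro!: derivative_eq_intros)
  have dir: "((\<lambda>x. F (q + x *\<^sub>R w)) has_real_derivative frechet_derivative F (at (q + x *\<^sub>R w)) w) (at x)"
    if "smooth_on W F" "q + x *\<^sub>R w \<in> W" for F :: "'a \<Rightarrow> real" and q w x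
  proof -
    have "linear (frechet_derivative F (at (q + x *\<^sub>R w)))"
      using smooth_on_differentiable[OF that] linear_frechet_derivative by blast
    then have "(\<lambda>y. frechet_derivative F (at (q + x *\<^sub>R w)) (y *\<^sub>R w)) =
        (*) (frechet_derivative F (at (q + x *\<^sub>R w)) w)"
      by (auto simp: linear_scale mult.commute)
    then show ?thesis using lin[OF that] by (simp add: has_field_derivative_def)
  qed
  \<comment> \<open>The second difference is the increment of this function between 0 and h. One
    mean value along u leaves a difference of two values of the u-derivative, a second one along v
    resolves it.\<close>
  define \<phi> where "\<phi> = (\<lambda>x. f (p + h *\<^sub>R v + x *\<^sub>R u) - f (p + x *\<^sub>R u))"
  have "\<exists>s>0. s < h \<and> \<phi> h - \<phi> 0 = (h - 0) * (g (p + h *\<^sub>R v + s *\<^sub>R u) - g (p + s *\<^sub>R u))"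
  proof (rule MVT2[OF h])
    fix x assume "0 \<le> x" "x \<le> h"
    then have "p + h *\<^sub>R v + x *\<^sub>R u \<in> W" "p + x *\<^sub>R u \<in> W"
      using sq[of x h] sq[of x 0] h by (simp_all add: algebra_simps)
    then show "(\<phi> has_real_derivative g (p + h *\<^sub>R v + x *\<^sub>R u) - g (p + x *\<^sub>R u)) (at x)"
      unfolding \<phi>_def g_def by (intro DERIV_diff dir sm)
  qed
  then obtain s where s: "0 < s" "s < h"
    "\<phi> h - \<phi> 0 = h * (g (p + h *\<^sub>R v + s *\<^sub>R u) - g (p + s *\<^sub>R u))" by auto
  have "\<exists>t>0. t < h \<and> g (p + s *\<^sub>R u + h *\<^sub>R v) - g (p + s *\<^sub>R u + 0 *\<^sub>R v)
      = (h - 0) * frechet_derivative g (at (p + s *\<^sub>R u + t *\<^sub>R v)) v"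
  proof (rule MVT2[OF h])
    fix x assume "0 \<le> x" "x \<le> h"
    then have "p + s *\<^sub>R u + x *\<^sub>R v \<in> W"
      using sq[of s x] s by simp
    then show "((\<lambda>x. g (p + s *\<^sub>R u + x *\<^sub>R v)) has_real_derivative
        frechet_derivative g (at (p + s *\<^sub>R u + x *\<^sub>R v)) v) (at x)"
      by (intro dir smg)
  qed
  then obtain t where t: "0 < t" "t < h" "g (p + s *\<^sub>R u + h *\<^sub>R v) - g (p + s *\<^sub>R u)
      = h * frechet_derivative g (at (p + s *\<^sub>R u + t *\<^sub>R v)) v" by auto
  have "f (p + h *\<^sub>R u + h *\<^sub>R v) - f (p + h *\<^sub>R u) - f (p + h *\<^sub>R v) + f p = \<phi> h - \<phi> 0"
    by (simp add: \<phi>_def algebra_simps)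
  also have "\<dots> = h * h * frechet_derivative g (at (p + s *\<^sub>R u + t *\<^sub>R v)) v"
    using s(3) t(3) by (simp add: algebra_simps)
  finally show ?thesis using that s t by (simp add: g_def)
qed

text \<open>The second difference is symmetric in u and v. So at each scale \<open>h n\<close> some
  value of one mixed derivative near p equals some value of the other, and continuity gives equality
  at p as the scale tends to 0.\<close>

lemma schwarz_real:
  fixes f :: "'a::real_normed_vector \<Rightarrow> real"
  assumes sm: "smooth_on W f" and W: "open W" "p \<in> W"
  shows "frechet_derivative (\<lambda>q. frechet_derivative f (at q) u) (at p) v =
    frechet_derivative (\<lambda>q. frechet_derivative f (at q) v) (at p) u"
proof -
  define G where "G = (\<lambda>u v q. frechet_derivative (\<lambda>q. frechet_derivative f (at q) u) (at q) v)"
  have cont: "isCont (G u v) p" for u v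
    using smooth_on_continuous_on[OF smooth_on_deriv[OF smooth_on_deriv[OF sm]]] W
    unfolding G_def by (auto simp: continuous_on_eq_continuous_at)
  have lim: "(\<lambda>n. G u v (p + s n *\<^sub>R u' + t n *\<^sub>R v')) \<longlonglongrightarrow> G u v p"
    if "s \<longlonglongrightarrow> 0" "t \<longlonglongrightarrow> 0" for s t :: "nat \<Rightarrow> real" and u v u' v'
  proof (rule isCont_tendsto_compose[OF cont])
    have "(\<lambda>n. p + s n *\<^sub>R u' + t n *\<^sub>R v') \<longlonglongrightarrow> p + 0 *\<^sub>R u' + 0 *\<^sub>R v'"
      by (intro tendsto_intros that)
    then show "(\<lambda>n. p + s n *\<^sub>R u' + t n *\<^sub>R v') \<longlonglongrightarrow> p" by simp
  qed
  obtain e where e: "e > 0" "ball p e \<subseteq> W" using W open_contains_ball by blast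
  define K where "K = norm u + norm v + 1"
  have K: "K > 0" by (simp add: K_def add_nonneg_pos)
  \<comment> \<open>Chosen so that |s|, |t| at most \<open>h n\<close> give a displacement s u + t v
    of length less than \<open>h n * K = e / (n + 2)\<close>, inside the ball.\<close>
  define h where "h = (\<lambda>n. e / K / real (n + 2))"
  have hpos: "h n > 0" for n using e K by (simp add: h_def)
  have hlim: "h \<longlonglongrightarrow> 0"
    unfolding h_def by (rule LIMSEQ_ignore_initial_segment[where f="\<lambda>n. e / K / real n"])
      (rule lim_const_over_n)
  have in_W: "p + s *\<^sub>R u + t *\<^sub>R v \<in> W" if "\<bar>s\<bar> \<le> h n" "\<bar>t\<bar> \<le> h n" for s t n
  proof -
    have "norm (s *\<^sub>R u + t *\<^sub>R v) \<le> \<bar>s\<bar> * norm u + \<bar>t\<bar> * norm v"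
      using norm_triangle_ineq[of "s *\<^sub>R u" "t *\<^sub>R v"] by simp
    also have "\<dots> \<le> h n * norm u + h n * norm v"
      by (intro add_mono mult_right_mono that) auto
    also have "\<dots> < h n * K" using hpos[of n] by (simp add: K_def algebra_simps)
    also have "h n * K = e / real (n + 2)" using K by (simp add: h_def)
    also have "\<dots> \<le> e" using e(1) by (simp add: field_simps)
    finally have "p + (s *\<^sub>R u + t *\<^sub>R v) \<in> ball p e"
      unfolding mem_ball dist_norm by (subst norm_minus_commute) simp
    then show ?thesis using e(2) by (auto simp: add.assoc)
  qed
  have in_W': "p + s *\<^sub>R v + t *\<^sub>R u \<in> W" if "\<bar>s\<bar> \<le> h n" "\<bar>t\<bar> \<le> h n" for s t n
    using in_W[OF that(2,1)] by (simp add: add_ac)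
  have GI: "frechet_derivative (\<lambda>q. frechet_derivative f (at q) u) (at q) v = G u v q" for u v q
    by (simp add: G_def)
  have "\<exists>s t s' t'. 0 < s \<and> s < h n \<and> 0 < t \<and> t < h n \<and> 0 < s' \<and> s' < h n \<and> 0 < t' \<and> t' < h n \<and>
    G u v (p + s *\<^sub>R u + t *\<^sub>R v) = G v u (p + s' *\<^sub>R u + t' *\<^sub>R v)" for n
  proof -
    obtain s t where st: "0 < s" "s < h n" "0 < t" "t < h n"
      "f (p + h n *\<^sub>R u + h n *\<^sub>R v) - f (p + h n *\<^sub>R u) - f (p + h n *\<^sub>R v) + f p
        = h n * h n * G u v (p + s *\<^sub>R u + t *\<^sub>R v)"
      by (rule second_difference[OF sm hpos[of n] in_W[of _ n], unfolded GI])
    obtain t' s' where ts: "0 < t'" "t' < h n" "0 < s'" "s' < h n"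
      "f (p + h n *\<^sub>R v + h n *\<^sub>R u) - f (p + h n *\<^sub>R v) - f (p + h n *\<^sub>R u) + f p
        = h n * h n * G v u (p + t' *\<^sub>R v + s' *\<^sub>R u)"
      by (rule second_difference[OF sm hpos[of n] in_W'[of _ n], unfolded GI])
    have c: "p + h n *\<^sub>R v + h n *\<^sub>R u = p + h n *\<^sub>R u + h n *\<^sub>R v"
      "p + t' *\<^sub>R v + s' *\<^sub>R u = p + s' *\<^sub>R u + t' *\<^sub>R v"
      by (simp_all add: add_ac)
    have "h n * h n * G u v (p + s *\<^sub>R u + t *\<^sub>R v) = h n * h n * G v u (p + s' *\<^sub>R u + t' *\<^sub>R v)"
      using st(5) ts(5) unfolding c by linarith
    then have "G u v (p + s *\<^sub>R u + t *\<^sub>R v) = G v u (p + s' *\<^sub>R u + t' *\<^sub>R v)"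
      using hpos[of n] by simp
    then show ?thesis using st(1-4) ts(1-4) by blast
  qed
  then obtain s t s' t' where st: "\<And>n. 0 < s n \<and> s n < h n \<and> 0 < t n \<and> t n < h n \<and> 0 < s' n \<and>
      s' n < h n \<and> 0 < t' n \<and> t' n < h n \<and>
      G u v (p + s n *\<^sub>R u + t n *\<^sub>R v) = G v u (p + s' n *\<^sub>R u + t' n *\<^sub>R v)"
    by metis
  have z: "x \<longlonglongrightarrow> 0" if "\<And>n. 0 < x n \<and> x n < h n" for x
    by (rule tendsto_sandwich[OF _ _ tendsto_const hlim]) (use that in \<open>auto intro!: always_eventually less_imp_le\<close>)
  have "(\<lambda>n. G u v (p + s n *\<^sub>R u + t n *\<^sub>R v)) \<longlonglongrightarrow> G u v p"
    by (intro lim z) (use st in auto)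
  moreover have "(\<lambda>n. G v u (p + s' n *\<^sub>R u + t' n *\<^sub>R v)) \<longlonglongrightarrow> G v u p"
    by (intro lim z) (use st in auto)
  moreover have "(\<lambda>n. G v u (p + s' n *\<^sub>R u + t' n *\<^sub>R v)) = (\<lambda>n. G u v (p + s n *\<^sub>R u + t n *\<^sub>R v))"
    using st by auto
  ultimately have "G u v p = G v u p" using LIMSEQ_unique by simp
  then show ?thesis by (simp add: G_def)
qed

lemma frechet_derivative_bounded_linear:
  assumes "bounded_linear L" "f differentiable (at p)"
  shows "frechet_derivative (\<lambda>q. L (f q)) (at p) v = L (frechet_derivative f (at p) v)"
  using bounded_linear.has_derivative[OF assms(1)] assms(2)
  by (metis frechet_derivative_at frechet_derivative_works)

lemma schwarz:
  fixes f :: "'a::real_normed_vector \<Rightarrow> 'b::euclidean_space"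
  assumes sm: "smooth_on W f" and W: "open W" "p \<in> W"
  shows "frechet_derivative (\<lambda>q. frechet_derivative f (at q) u) (at p) v =
    frechet_derivative (\<lambda>q. frechet_derivative f (at q) v) (at p) u"
proof (rule euclidean_eqI)
  fix b :: 'b
  assume "b \<in> Basis"
  define L where "L = (\<lambda>x::'b. x \<bullet> b)"
  have L: "bounded_linear L" unfolding L_def by (rule bounded_linear_inner_left)
  have "frechet_derivative (\<lambda>q. frechet_derivative (\<lambda>q. L (f q)) (at q) u) (at p) v =
      L (frechet_derivative (\<lambda>q. frechet_derivative f (at q) u) (at p) v)" for u v
  proof -
    have "frechet_derivative (\<lambda>q. frechet_derivative (\<lambda>q. L (f q)) (at q) u) (at p) v
      = frechet_derivative (\<lambda>q. L (frechet_derivative f (at q) u)) (at p) v"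
      by (rule arg_cong[where f="\<lambda>D. D v", OF frechet_derivative_cong_open[OF W]])
        (rule frechet_derivative_bounded_linear[OF L smooth_on_differentiable[OF sm]])
    also have "\<dots> = L (frechet_derivative (\<lambda>q. frechet_derivative f (at q) u) (at p) v)"
      by (rule frechet_derivative_bounded_linear[OF L smooth_on_differentiable[OF smooth_on_deriv[OF sm] W(2)]])
    finally show ?thesis .
  qed
  then show "frechet_derivative (\<lambda>q. frechet_derivative f (at q) u) (at p) v \<bullet> b =
    frechet_derivative (\<lambda>q. frechet_derivative f (at q) v) (at p) u \<bullet> b"
    using schwarz_real[OF smooth_on_bounded_linear[OF L W(1) sm] W, of u v] by (simp add: L_def)
qed

section \<open>Dirac operators\<close>

lemmas vcomp = vec_eq_iff vector_scaleR_component scaleR_conv_of_real[where 'a=complex]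

lemma scaleR_eq_smult: "r *\<^sub>R (v :: complex^'t) = complex_of_real r *s v"
  by (simp add: vcomp)

lemma bounded_bilinear_smult: "bounded_bilinear ((*s) :: complex \<Rightarrow> complex^'t::finite \<Rightarrow> complex^'t)"
proof
  fix a a' :: complex and b b' :: "complex^'t" and r :: real
  show "(a + a') *s b = a *s b + a' *s b" "a *s (b + b') = a *s b + a *s b'"
    by (simp_all add: vec_eq_iff algebra_simps)
  show "r *\<^sub>R a *s b = r *\<^sub>R (a *s b)" "a *s r *\<^sub>R b = r *\<^sub>R (a *s b)"
    by (simp_all add: vec_eq_iff)
  have "norm (a *s b) \<le> norm a * norm b * 1" for a and b :: "complex^'t"
  proof -
    have "norm (a *s b) = norm a * norm b"
      by (simp add: norm_vec_def L2_set_def norm_mult power_mult_distrib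
          sum_distrib_left[symmetric] real_sqrt_mult)
    then show ?thesis by simp
  qed
  then show "\<exists>K. \<forall>a b. norm (a *s (b :: complex^'t)) \<le> norm a * norm b * K" by blast
qed

section \<open>Complex linear maps and derivatives in one variable\<close>

definition clin :: "(complex^'t \<Rightarrow> complex^'u) \<Rightarrow> bool" where
  "clin M \<longleftrightarrow> (\<forall>u v. M (u + v) = M u + M v) \<and> (\<forall>z u. M (z *s u) = z *s M u)"

lemma clin_add: "clin M \<Longrightarrow> M (u + v) = M u + M v"
  and clin_smult: "clin M \<Longrightarrow> M (z *s u) = z *s M u"
  by (simp_all add: clin_def)

lemma clin_scaleR: "clin M \<Longrightarrow> M (r *\<^sub>R u) = r *\<^sub>R M u"
  by (simp add: scaleR_eq_smult clin_smult)

lemma clin_linear: "clin M \<Longrightarrow> linear M"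
  by (intro linearI) (simp_all add: clin_add clin_scaleR)

lemma clin_bounded_linear: "clin M \<Longrightarrow> bounded_linear (M :: complex^'t::finite \<Rightarrow> complex^'u::finite)"
  by (simp add: clin_linear linear_conv_bounded_linear[symmetric])

lemma clin_diff: "clin M \<Longrightarrow> M (u - v) = M u - M v"
  using linear_diff[OF clin_linear] .

lemma clin_minus: "clin M \<Longrightarrow> M (- v) = - M v"
  using linear_neg[OF clin_linear] .

lemma clin_zero: "clin M \<Longrightarrow> M 0 = 0"
  using linear_0[OF clin_linear] .

lemma clin_sum: "clin M \<Longrightarrow> M (\<Sum>i\<in>I. f i) = (\<Sum>i\<in>I. M (f i))"
  using linear_sum[OF clin_linear] .

lemmas clin_simps = clin_add clin_smult clin_scaleR clin_diff clin_minus clin_zero clin_sum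

lemma clin_matrix: "clin ((*v) (A :: complex^'t^'u))"
  by (auto simp: clin_def matrix_vector_right_distrib vec_eq_iff matrix_vector_mult_def
      sum_distrib_left sum.distrib[symmetric] algebra_simps)

lemma clin_comp: "clin L \<Longrightarrow> clin M \<Longrightarrow> clin (\<lambda>u. L (M u))"
  by (simp add: clin_def)

lemma clin_smult_const: "clin (\<lambda>u. z *s u)"
  by (simp add: clin_def vec_eq_iff algebra_simps)

definition pd :: "'n \<Rightarrow> (real^'n::finite \<Rightarrow> complex^'t::finite) \<Rightarrow> real^'n \<Rightarrow> complex^'t" where
  "pd j f x = frechet_derivative f (at x) (axis j 1)"

definition lapl :: "(real^'n::finite \<Rightarrow> complex^'t::finite) \<Rightarrow> real^'n \<Rightarrow> complex^'t" where
  "lapl f x = (\<Sum>j\<in>UNIV. pd j (pd j f) x)"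

definition euler :: "(real^'n::finite \<Rightarrow> complex^'t::finite) \<Rightarrow> real^'n \<Rightarrow> complex^'t" where
  "euler f x = (\<Sum>j\<in>UNIV. x $ j *\<^sub>R pd j f x)"

lemma pd_eq: "(f has_derivative f') (at x) \<Longrightarrow> pd j f x = f' (axis j 1)"
  using frechet_derivative_at unfolding pd_def by metis

lemma axis_expansion: "x = (\<Sum>j\<in>UNIV. x $ j *\<^sub>R axis j 1)" for x :: "real^'n::finite"
  by (simp add: vec_eq_iff axis_def if_distrib cong: if_cong)

lemma inner_sum_components: "x \<bullet> y = (\<Sum>j\<in>UNIV. x $ j * y $ j)" for x y :: "real^'n::finite"
  by (simp add: inner_vec_def)

lemma linear_expansion:
  fixes L :: "real^'n::finite \<Rightarrow> 'b::real_vector"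
  assumes "linear L"
  shows "L v = (\<Sum>j\<in>UNIV. v $ j *\<^sub>R L (axis j 1))"
proof -
  have "L v = L (\<Sum>j\<in>UNIV. v $ j *\<^sub>R axis j 1)" by (simp only: axis_expansion[symmetric])
  then show ?thesis by (simp add: linear_sum[OF assms] linear_scale[OF assms])
qed

lemma derivative_expansion:
  "(f has_derivative f') (at x) \<Longrightarrow> f' v = (\<Sum>j\<in>UNIV. v $ j *\<^sub>R pd j f x)"
  using linear_expansion[of f' v] pd_eq[of f f' x] has_derivative_linear[of f f'] by simp

lemma euler_eq: "(f has_derivative f') (at x) \<Longrightarrow> euler f x = f' x"
  by (simp add: euler_def derivative_expansion[of f f' x])

lemma pd_add: "f differentiable (at x) \<Longrightarrow> g differentiable (at x) \<Longrightarrow> pd j (\<lambda>x. f x + g x) x = pd j f x + pd j g x"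
  unfolding pd_def by (subst frechet_derivative_at[OF has_derivative_add, symmetric])
    (auto simp: frechet_derivative_works)

lemma pd_sum:
  assumes "\<And>i. i \<in> I \<Longrightarrow> f i differentiable (at x)"
  shows "pd j (\<lambda>x. \<Sum>i\<in>I. f i x) x = (\<Sum>i\<in>I. pd j (f i) x)"
proof -
  have "((\<lambda>x. \<Sum>i\<in>I. f i x) has_derivative (\<lambda>v. \<Sum>i\<in>I. frechet_derivative (f i) (at x) v)) (at x)"
    using assms by (intro has_derivative_sum) (auto simp: frechet_derivative_works)
  from pd_eq[OF this] show ?thesis by (simp add: pd_def)
qed

lemma pd_clin:
  assumes "clin M" "f differentiable (at x)"
  shows "pd j (\<lambda>x. M (f x)) x = M (pd j f x)"
  using pd_eq[OF bounded_linear.has_derivative[OF clin_bounded_linear[OF assms(1)]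
      frechet_derivative_works[THEN iffD1, OF assms(2)]]]
  by (simp add: pd_def)

lemma pd_smult: "f differentiable (at x) \<Longrightarrow> pd j (\<lambda>x. z *s f x) x = z *s pd j f x"
  by (rule pd_clin[OF clin_smult_const])

lemma differentiable_smult: "f differentiable (at x) \<Longrightarrow> (\<lambda>x. z *s (f x :: complex^'t::finite)) differentiable (at x)"
  using bounded_linear.has_derivative[OF clin_bounded_linear[OF clin_smult_const[of z]]]
  unfolding differentiable_def by blast

lemma differentiable_clin: "clin M \<Longrightarrow> f differentiable (at x) \<Longrightarrow> (\<lambda>x. M (f x :: complex^'t::finite) :: complex^'u::finite) differentiable (at x)"
  using bounded_linear.has_derivative[OF clin_bounded_linear] unfolding differentiable_def by blast

text \<open>Only the anticommutation relations are kept, so that the same results serve the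
  operators of the first factor and those of the second factor, both acting on the whole tensor
  product.\<close>

locale clifford_ops =
  fixes g :: "'n::finite \<Rightarrow> complex^'t::finite \<Rightarrow> complex^'t"
  assumes clin_g: "clin (g j)"
    and g_anticomm: "g i (g j u) + g j (g i u) = (if i = j then - 2 else 0) *s u"
begin

definition G :: "real^'n \<Rightarrow> complex^'t \<Rightarrow> complex^'t" where
  "G v u = (\<Sum>j\<in>UNIV. v $ j *\<^sub>R g j u)"

lemma clin_G: "clin (G v)"
  by (simp add: clin_def G_def clin_simps[OF clin_g] scaleR_add_right sum.distrib
      vec_eq_iff sum_distrib_left mult_ac)

lemmas G_simps = clin_simps[OF clin_G]
lemmas g_simps = clin_simps[OF clin_g]

lemma G_scale: "G (r *\<^sub>R v) u = r *\<^sub>R G v u"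
  by (simp add: G_def scaleR_sum_right)

lemma G_add: "G (v + w) u = G v u + G w u"
  by (simp add: G_def scaleR_add_left sum.distrib)

lemma G_axis: "G (axis j 1) u = g j u"
proof -
  have "(axis j (1::real) $ i) *\<^sub>R g i u = (if i = j then g j u else 0)" for i
    by (simp add: axis_def)
  then show ?thesis by (simp add: G_def)
qed

lemma linear_G: "linear (\<lambda>v. G v u)"
  by (intro linearI) (simp_all add: G_add G_scale)

lemma g_G: "g j (G v u) = - G v (g j u) - (2 * v $ j) *\<^sub>R u"
proof -
  have "g j (G v u) + G v (g j u) = (\<Sum>i\<in>UNIV. v $ i *\<^sub>R (g j (g i u) + g i (g j u)))"
    by (simp add: G_def g_simps scaleR_add_right sum.distrib)
  also have "\<dots> = (\<Sum>i\<in>UNIV. if i = j then (- 2 * v $ j) *\<^sub>R u else 0)"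
    by (intro sum.cong refl) (auto simp: g_anticomm scaleR_eq_smult vec_eq_iff)
  also have "\<dots> = - ((2 * v $ j) *\<^sub>R u)" by simp
  finally have *: "g j (G v u) + G v (g j u) = - ((2 * v $ j) *\<^sub>R u)" .
  have "g j (G v u) = (g j (G v u) + G v (g j u)) - G v (g j u)" by simp
  then show ?thesis unfolding * by simp
qed

lemma G_G: "G w (G v u) = - G v (G w u) - (2 * (v \<bullet> w)) *\<^sub>R u"
proof -
  have "G w (G v u) = (\<Sum>j\<in>UNIV. w $ j *\<^sub>R g j (G v u))" by (simp add: G_def)
  also have "\<dots> = (\<Sum>j\<in>UNIV. - (w $ j *\<^sub>R G v (g j u)) - (2 * (w $ j * v $ j)) *\<^sub>R u)"
    by (simp add: g_G algebra_simps)
  also have "\<dots> = - G v (\<Sum>j\<in>UNIV. w $ j *\<^sub>R g j u) - (\<Sum>j\<in>UNIV. 2 * (w $ j * v $ j)) *\<^sub>R u"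
    by (simp add: sum_subtractf sum_negf G_simps scaleR_sum_left)
  also have "\<dots> = - G v (G w u) - (2 * (v \<bullet> w)) *\<^sub>R u"
    by (simp add: G_def[of w] inner_sum_components sum_distrib_left mult_ac)
  finally show ?thesis .
qed

lemma G_square: "G v (G v u) = - (v \<bullet> v) *\<^sub>R u"
proof -
  have half: "a = - b" if "a = - a - 2 * b" for a b :: complex
    using that by (auto simp: complex_eq_iff)
  have "G v (G v u) $ i = - ((v \<bullet> v) *\<^sub>R u) $ i" for i
    by (rule half, subst (1) G_G) (simp add: vcomp)
  then show ?thesis by (simp add: vec_eq_iff)
qed

lemma g_square: "g j (g j u) = - u"
  using G_square[of "axis j 1" u] by (simp add: G_axis inner_axis_axis)

definition dirac :: "(real^'n \<Rightarrow> complex^'t) \<Rightarrow> real^'n \<Rightarrow> complex^'t" where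
  "dirac f x = (\<Sum>j\<in>UNIV. g j (pd j f x))"

text \<open>Clifford multiplication by x is linear in x, so the product rule adds the term
  \<open>g j (f x)\<close>. In the Dirac operator these terms sum to -n f because \<open>g j\<close>
  squares to -1, and moving \<open>g j\<close> past \<open>G x\<close> produces the Euler
  derivative.\<close>

lemma dirac_G:
  assumes "f differentiable (at x)"
  shows "(\<lambda>x. G x (f x)) differentiable (at x)"
    and pd_G: "pd j (\<lambda>x. G x (f x)) x = g j (f x) + G x (pd j f x)"
    and "dirac (\<lambda>x. G x (f x)) x = - of_nat CARD('n) *s f x - G x (dirac f x) - 2 *\<^sub>R euler f x"
    and "euler (\<lambda>x. G x (f x)) x = G x (f x) + G x (euler f x)"
proof -
  have bl: "bounded_bilinear G"
  proof -
    have "bilinear G" unfolding bilinear_def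
      using linear_G clin_linear[OF clin_G] by auto
    then show ?thesis by (rule bilinear_conv_bounded_bilinear[THEN iffD1])
  qed
  obtain f' where f': "(f has_derivative f') (at x)" using assms by (auto simp: differentiable_def)
  have d: "((\<lambda>x. G x (f x)) has_derivative (\<lambda>v. G x (f' v) + G v (f x))) (at x)"
    by (intro bounded_bilinear.FDERIV[OF bl] has_derivative_ident f')
  then show "(\<lambda>x. G x (f x)) differentiable (at x)" by (auto simp: differentiable_def)
  show p: "pd j (\<lambda>x. G x (f x)) x = g j (f x) + G x (pd j f x)" for j
    using pd_eq[OF d, of j] pd_eq[OF f', of j] by (simp add: G_axis)
  have "dirac (\<lambda>x. G x (f x)) x = (\<Sum>j\<in>UNIV. - f x - G x (g j (pd j f x)) - 2 *\<^sub>R (x $ j *\<^sub>R pd j f x))"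
    unfolding dirac_def p by (simp add: g_simps g_square g_G algebra_simps)
  also have "\<dots> = - of_nat CARD('n) *s f x - G x (dirac f x) - 2 *\<^sub>R euler f x"
    by (simp add: sum_subtractf sum_negf dirac_def euler_def G_simps scaleR_sum_right vcomp of_nat_index)
  finally show "dirac (\<lambda>x. G x (f x)) x = - of_nat CARD('n) *s f x - G x (dirac f x) - 2 *\<^sub>R euler f x" .
  show "euler (\<lambda>x. G x (f x)) x = G x (f x) + G x (euler f x)"
    unfolding euler_eq[OF d] euler_eq[OF f'] by simp
qed

end

section \<open>Intertwining with the inversion\<close>

lemma pd_cong_open:
  assumes "open W" "x \<in> W" "\<And>q. q \<in> W \<Longrightarrow> f q = h q"
  shows "pd j f x = pd j h x"
  unfolding pd_def by (simp add: frechet_derivative_cong_open[OF assms])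

lemma smooth_on_pd: "smooth_on W f \<Longrightarrow> smooth_on W (pd j f)"
  unfolding pd_def[abs_def] by (rule smooth_on_deriv)

lemma smooth_on_clin:
  "clin M \<Longrightarrow> open W \<Longrightarrow> smooth_on W f \<Longrightarrow> smooth_on W (\<lambda>x. M (f x :: complex^'t::finite) :: complex^'u::finite)"
  by (rule smooth_on_bounded_linear[OF clin_bounded_linear])

lemma pd_commute: "open W \<Longrightarrow> x \<in> W \<Longrightarrow> smooth_on W f \<Longrightarrow> pd i (pd j f) x = pd j (pd i f) x"
  unfolding pd_def[abs_def] by (rule schwarz)

text \<open>The power |x|^w with complex exponent, through the logarithm of the squared norm so that
  no root has to be differentiated.\<close>

definition cpow :: "complex \<Rightarrow> real^'n::finite \<Rightarrow> complex" where
  "cpow w x = exp (w * of_real (ln (x \<bullet> x) / 2))"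

definition vinv :: "real^'n::finite \<Rightarrow> real^'n" where
  "vinv x = (1 / (x \<bullet> x)) *\<^sub>R x"

lemma cpow_minus2: "x \<noteq> 0 \<Longrightarrow> cpow (w - 2) x = of_real (1 / (x \<bullet> x)) * cpow w x"
proof -
  assume "x \<noteq> 0"
  then have "complex_of_real (1 / (x \<bullet> x)) = of_real (exp (- ln (x \<bullet> x)))"
    by (simp add: exp_minus inverse_eq_divide)
  then have "exp (- of_real (ln (x \<bullet> x))) = complex_of_real (1 / (x \<bullet> x))"
    by (simp only: exp_of_real[symmetric] of_real_minus)
  moreover have "(w - 2) * of_real (ln (x \<bullet> x) / 2) = w * of_real (ln (x \<bullet> x) / 2) + - of_real (ln (x \<bullet> x))"
    by (simp add: field_simps)
  ultimately show ?thesis by (simp only: cpow_def exp_add mult.commute)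
qed

lemma has_derivative_cpow:
  assumes "x \<noteq> 0"
  shows "(cpow w has_derivative (\<lambda>v. (w * of_real ((x \<bullet> v) / (x \<bullet> x))) * cpow w x)) (at x)"
proof -
  have "((\<lambda>x. ln (x \<bullet> x) / 2) has_derivative (\<lambda>v. (x \<bullet> v) / (x \<bullet> x))) (at x)"
    using assms by (auto intro!: derivative_eq_intros simp: inner_commute field_simps)
  then have "((\<lambda>x. w * of_real (ln (x \<bullet> x) / 2)) has_derivative (\<lambda>v. w * of_real ((x \<bullet> v) / (x \<bullet> x)))) (at x)"
    by (intro has_derivative_mult_right has_derivative_of_real)
  moreover have "(exp has_derivative (*) (exp (w * of_real (ln (x \<bullet> x) / 2))))
      (at (w * of_real (ln (x \<bullet> x) / 2)))"
    using DERIV_exp by (auto simp: has_field_derivative_def)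
  ultimately show ?thesis
    unfolding cpow_def[abs_def] by (auto dest: has_derivative_compose simp: mult_ac)
qed

lemma has_derivative_vinv:
  assumes "x \<noteq> 0"
  shows "(vinv has_derivative (\<lambda>v. (1 / (x \<bullet> x)) *\<^sub>R v - (2 * (x \<bullet> v) / (x \<bullet> x)\<^sup>2) *\<^sub>R x)) (at x)"
  unfolding vinv_def[abs_def] using assms
  by (auto intro!: derivative_eq_intros simp: inner_commute power2_eq_square field_simps scaleR_left_distrib)

lemma open_nonzero: "open (- {0 :: 'a::{t1_space,zero}})" by auto

text \<open>The derivative of |x|^w along v is w (x . v) |x|^(w-2), again a power times a linear
  function, so the induction runs over all exponents at once.\<close>

lemma smooth_on_cpow: "smooth_on (- {0}) (cpow w :: real^'n::finite \<Rightarrow> complex)"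
proof -
  have "cont_diff_on (- {0}) r (cpow w :: real^'n \<Rightarrow> complex)" for r
  proof (induction r arbitrary: w)
    case 0
    show ?case
      by (auto intro!: continuous_at_imp_continuous_on has_derivative_continuous[OF has_derivative_cpow])
  next
    case (Suc r)
    have "cont_diff_on (- {0}) r (\<lambda>x::real^'n. (w * of_real (x \<bullet> v)) * cpow (w - 2) x)" for v
      by (intro cont_diff_on_bilinear[OF bounded_bilinear_mult open_nonzero] Suc.IH
          cont_diff_on_linear[OF _ open_nonzero]
          bounded_linear_compose[OF bounded_linear_mult_right]
          bounded_linear_compose[OF bounded_linear_of_real] bounded_linear_inner_left)
    moreover have "(w * of_real (x \<bullet> v)) * cpow (w - 2) x
        = (w * of_real ((x \<bullet> v) / (x \<bullet> x))) * cpow w x" if "x \<in> - {0}" for x v :: "real^'n"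
      using that by (simp add: cpow_minus2)
    ultimately have "cont_diff_on (- {0}) r (\<lambda>x::real^'n. (w * of_real ((x \<bullet> v) / (x \<bullet> x))) * cpow w x)" for v
      by (rule iffD1[OF cont_diff_on_cong[OF open_nonzero], rotated])
    then show ?case
      by (subst cont_diff_on_Suc_iff[OF open_nonzero has_derivative_cpow]) auto
  qed
  then show ?thesis by (simp add: smooth_on_def)
qed

lemma smooth_on_vinv: "smooth_on (- {0}) (vinv :: real^'n::finite \<Rightarrow> real^'n)"
proof -
  have "smooth_on (- {0}) (\<lambda>x::real^'n. Re (cpow (0 - 2) x) *\<^sub>R x)"
    by (intro smooth_on_bilinear[OF bounded_bilinear_scaleR open_nonzero]
        smooth_on_bounded_linear[OF bounded_linear_Re open_nonzero] smooth_on_cpow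
        smooth_on_linear[OF bounded_linear_ident open_nonzero])
  moreover have "Re (cpow (0 - 2) x) *\<^sub>R x = vinv x" if "x \<in> - {0}" for x :: "real^'n"
    using that cpow_minus2[of x 0] by (simp add: vinv_def cpow_def)
  ultimately show ?thesis
    using smooth_on_cong[OF open_nonzero] by (metis (no_types, lifting))
qed

context clifford_ops
begin

lemma bounded_bilinear_G: "bounded_bilinear G"
proof -
  have "bilinear G" unfolding bilinear_def
    using linear_G clin_linear[OF clin_G] by auto
  then show ?thesis by (rule bilinear_conv_bounded_bilinear[THEN iffD1])
qed

lemma smooth_on_dirac: "open W \<Longrightarrow> smooth_on W f \<Longrightarrow> smooth_on W (dirac f)"
  unfolding dirac_def[abs_def] by (intro smooth_on_sum smooth_on_clin[OF clin_g] smooth_on_pd)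

lemma dirac_cong_open:
  assumes "open W" "x \<in> W" "\<And>q. q \<in> W \<Longrightarrow> f q = h q"
  shows "dirac f x = dirac h x"
  by (simp add: dirac_def pd_cong_open[OF assms])

lemma pd_dirac:
  assumes "open W" "x \<in> W" "smooth_on W f"
  shows "pd i (dirac f) x = (\<Sum>j\<in>UNIV. g j (pd i (pd j f) x))"
proof -
  have d: "pd j f differentiable (at x)" for j
    using smooth_on_differentiable[OF smooth_on_pd[OF assms(3)] assms(2)] .
  show ?thesis unfolding dirac_def[abs_def]
    by (subst pd_sum) (simp_all add: pd_clin[OF clin_g d] differentiable_clin[OF clin_g d])
qed

text \<open>As second derivatives are symmetric, twice the double sum can be written with
  \<open>g i\<close> and \<open>g j\<close> in both orders, and the anticommutator leaves only the
  diagonal.\<close>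

lemma dirac_dirac:
  assumes "open W" "x \<in> W" "smooth_on W f"
  shows "dirac (dirac f) x = - lapl f x"
proof -
  define A where "A i j = pd i (pd j f) x" for i j
  have sym: "A i j = A j i" for i j unfolding A_def by (rule pd_commute[OF assms])
  have 1: "dirac (dirac f) x = (\<Sum>i\<in>UNIV. \<Sum>j\<in>UNIV. g i (g j (A i j)))"
    by (simp add: dirac_def[of "dirac f"] pd_dirac[OF assms] g_simps A_def)
  also have "\<dots> = (\<Sum>j\<in>UNIV. \<Sum>i\<in>UNIV. g i (g j (A i j)))" by (rule sum.swap)
  finally have 2: "dirac (dirac f) x = (\<Sum>i\<in>UNIV. \<Sum>j\<in>UNIV. g j (g i (A i j)))"
    by (simp add: sym)
  have "dirac (dirac f) x + dirac (dirac f) x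
      = (\<Sum>i\<in>UNIV. \<Sum>j\<in>UNIV. g i (g j (A i j)) + g j (g i (A i j)))"
    by (subst (1) 1, subst 2) (simp add: sum.distrib)
  also have "\<dots> = (\<Sum>i\<in>UNIV. \<Sum>j\<in>UNIV. if i = j then - 2 *s A i i else 0)"
    by (intro sum.cong refl) (simp add: g_anticomm)
  also have "\<dots> = (\<Sum>i\<in>UNIV. - 2 *s A i i)" by simp
  also have "\<dots> = - lapl f x + - lapl f x"
    by (simp add: lapl_def A_def vec_eq_iff sum_distrib_left sum_negf)
  finally have "2 *\<^sub>R dirac (dirac f) x = 2 *\<^sub>R (- lapl f x)" by (simp only: scaleR_2)
  then show ?thesis by (simp only: scaleR_cancel_left) simp
qed

lemma dirac_lincomb:
  assumes "f differentiable (at x)" "h differentiable (at x)"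
  shows "dirac (\<lambda>x. c *s f x - h x) x = c *s dirac f x - dirac h x"
    and "euler (\<lambda>x. c *s f x - h x) x = c *s euler f x - euler h x"
proof -
  have fun_eq: "(\<lambda>x. c *s f x - h x) = (\<lambda>x. c *s f x + (- 1) *s h x)"
    by (simp add: fun_eq_iff vec_eq_iff)
  have *: "pd j (\<lambda>x. c *s f x - h x) x = c *s pd j f x - pd j h x" for j
    unfolding fun_eq pd_add[OF differentiable_smult[OF assms(1)] differentiable_smult[OF assms(2)]]
      pd_smult[OF assms(1)] pd_smult[OF assms(2)] by (simp add: vec_eq_iff)
  show "dirac (\<lambda>x. c *s f x - h x) x = c *s dirac f x - dirac h x"
    by (simp add: dirac_def * g_simps sum_subtractf vec_eq_iff sum_distrib_left)
  show "euler (\<lambda>x. c *s f x - h x) x = c *s euler f x - euler h x"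
    by (simp add: euler_def * sum_subtractf vcomp sum_distrib_left algebra_simps)
qed

text \<open>\<open>S\<close> is a weighted Kelvin transform and \<open>T\<close> its Clifford twist.
  For w = -(2l+1) the factor in \<open>T\<close> is |x|^(-2l) times the unit vector x/|x|, which is
  how the inversion acts on sections of weight l.\<close>

definition S :: "complex \<Rightarrow> (real^'n \<Rightarrow> complex^'t) \<Rightarrow> real^'n \<Rightarrow> complex^'t" where
  "S w f x = cpow w x *s f (vinv x)"

definition T :: "complex \<Rightarrow> (real^'n \<Rightarrow> complex^'t) \<Rightarrow> real^'n \<Rightarrow> complex^'t" where
  "T w f x = G x (S w f x)"

text \<open>The derivative of the inversion at x is |x|^-2 times the reflection along x. The
  reflected component of v contributes a multiple of the derivative in the direction
  \<open>vinv x\<close>, which is the Euler derivative at the image point.\<close>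

lemma S_has_derivative:
  assumes "x \<noteq> 0" and "(f has_derivative f') (at (vinv x))"
  shows "(S w f has_derivative (\<lambda>v. cpow w x *s ((w * of_real ((x \<bullet> v) / (x \<bullet> x))) *s f (vinv x)
    + (1 / (x \<bullet> x)) *\<^sub>R f' v - (2 * (x \<bullet> v) / (x \<bullet> x)) *\<^sub>R f' (vinv x)))) (at x)"
proof -
  have "(S w f has_derivative (\<lambda>v. cpow w x *s f' ((1 / (x \<bullet> x)) *\<^sub>R v - (2 * (x \<bullet> v) / (x \<bullet> x)\<^sup>2) *\<^sub>R x)
      + ((w * of_real ((x \<bullet> v) / (x \<bullet> x))) * cpow w x) *s f (vinv x))) (at x)"
    unfolding S_def[abs_def]
    by (intro bounded_bilinear.FDERIV[OF bounded_bilinear_smult] has_derivative_cpow assms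
        has_derivative_compose[OF has_derivative_vinv])
  moreover have "f' ((1 / (x \<bullet> x)) *\<^sub>R v - (2 * (x \<bullet> v) / (x \<bullet> x)\<^sup>2) *\<^sub>R x) =
      (1 / (x \<bullet> x)) *\<^sub>R f' v - (2 * (x \<bullet> v) / (x \<bullet> x)) *\<^sub>R f' (vinv x)" for v
    using has_derivative_linear[OF assms(2)]
    by (simp add: linear_diff linear_scale vinv_def power2_eq_square)
  ultimately have "(S w f has_derivative (\<lambda>v. cpow w x *s ((1 / (x \<bullet> x)) *\<^sub>R f' v
      - (2 * (x \<bullet> v) / (x \<bullet> x)) *\<^sub>R f' (vinv x))
      + ((w * of_real ((x \<bullet> v) / (x \<bullet> x))) * cpow w x) *s f (vinv x))) (at x)" by simp
  then show ?thesis
    by (rule has_derivative_eq_rhs) (simp add: fun_eq_iff vcomp algebra_simps)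
qed

lemma vinv_component: "x \<noteq> 0 \<Longrightarrow> x $ j / (x \<bullet> x) = vinv x $ j"
  by (simp add: vinv_def)

lemma pd_S:
  assumes "x \<noteq> 0" and "f differentiable (at (vinv x))"
  shows "S w f differentiable (at x)"
    and "pd j (S w f) x = cpow w x *s ((w * of_real (vinv x $ j)) *s f (vinv x)
      + (1 / (x \<bullet> x)) *\<^sub>R pd j f (vinv x) - (2 * vinv x $ j) *\<^sub>R euler f (vinv x))"
proof -
  obtain f' where f': "(f has_derivative f') (at (vinv x))"
    using assms(2) by (auto simp: differentiable_def)
  note d = S_has_derivative[OF assms(1) f', of w]
  show "S w f differentiable (at x)" using d by (auto simp: differentiable_def)
  show "pd j (S w f) x = cpow w x *s ((w * of_real (vinv x $ j)) *s f (vinv x)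
      + (1 / (x \<bullet> x)) *\<^sub>R pd j f (vinv x) - (2 * vinv x $ j) *\<^sub>R euler f (vinv x))"
    unfolding pd_eq[OF d] pd_eq[OF f'] euler_eq[OF f']
    by (simp only: inner_axis inner_real_def mult_1_right times_divide_eq_right[symmetric]
        vinv_component[OF assms(1)])
qed

lemma smooth_on_S: "smooth f \<Longrightarrow> smooth_on (- {0}) (S w f)"
  unfolding S_def[abs_def]
  by (intro smooth_on_bilinear[OF bounded_bilinear_smult open_nonzero] smooth_on_cpow
      smooth_on_compose[OF open_nonzero open_UNIV _ _ smooth_on_vinv]) (auto simp: smooth_on_UNIV)

lemma smooth_on_T: "smooth f \<Longrightarrow> smooth_on (- {0}) (T w f)"
  unfolding T_def[abs_def]
  by (intro smooth_on_bilinear[OF bounded_bilinear_G open_nonzero] smooth_on_S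
      smooth_on_linear[OF bounded_linear_ident open_nonzero])

lemma dirac_S:
  assumes "x \<noteq> 0" and "f differentiable (at (vinv x))"
  shows "dirac (S w f) x = cpow w x *s (G (vinv x) (w *s f (vinv x) - 2 *\<^sub>R euler f (vinv x))
      + (1 / (x \<bullet> x)) *\<^sub>R dirac f (vinv x))"
  by (simp add: dirac_def pd_S[OF assms] g_simps G_def vcomp sum.distrib sum_subtractf
      sum_distrib_left algebra_simps)

lemma euler_S:
  assumes "x \<noteq> 0" and "f differentiable (at (vinv x))"
  shows "euler (S w f) x = cpow w x *s (w *s f (vinv x) - euler f (vinv x))"
proof -
  obtain f' where f': "(f has_derivative f') (at (vinv x))"
    using assms(2) by (auto simp: differentiable_def)
  note d = S_has_derivative[OF assms(1) f', of w]
  have "f' x = (x \<bullet> x) *\<^sub>R f' (vinv x)"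
    using assms(1) linear_scale[OF has_derivative_linear[OF f'], of "x \<bullet> x" "vinv x"] by (simp add: vinv_def)
  moreover obtain r where r: "x \<bullet> x = r" "r \<noteq> 0" using assms(1) by simp
  ultimately show ?thesis
    unfolding euler_eq[OF d] euler_eq[OF f'] by (simp only: r(1)) (simp add: r(2) vcomp algebra_simps)
qed

lemma G_vinv: "x \<noteq> 0 \<Longrightarrow> G x u = (x \<bullet> x) *\<^sub>R G (vinv x) u"
  by (simp add: vinv_def G_scale)

lemma vinv_inner: "x \<noteq> 0 \<Longrightarrow> vinv x \<bullet> vinv x = 1 / (x \<bullet> x)"
  by (simp add: vinv_def)

text \<open>The factor |x|^2 in \<open>G x = |x|^2 G (vinv x)\<close> absorbs the loss of 2 in the
  exponent. The right sides of the intertwining relations thus become expressions at the single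
  point \<open>vinv x\<close>.\<close>

lemma T_minus2:
  assumes "x \<noteq> 0"
  shows "T (w - 2) h x = cpow w x *s G (vinv x) (h (vinv x))"
proof -
  obtain r where r: "x \<bullet> x = r" "r \<noteq> 0" using assms by simp
  show ?thesis
    using r by (simp add: T_def S_def cpow_minus2[OF assms] G_simps G_vinv[OF assms] vcomp)
qed

text \<open>The Euler derivatives coming from \<open>dirac_S\<close> and \<open>euler_S\<close>
  cancel because x times \<open>vinv x\<close> is -1 in the Clifford algebra. What remains has the
  constant -(n + w), which is 2l - n + 1 for w = -(2l+1).\<close>

lemma dirac_T:
  assumes "x \<noteq> 0" and "f differentiable (at (vinv x))"
  shows "dirac (T w f) x = S w (\<lambda>y. (- (of_nat CARD('n) + w)) *s f y - G y (dirac f y)) x"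
proof -
  obtain r where r: "x \<bullet> x = r" "r \<noteq> 0" using assms(1) by simp
  show ?thesis
  unfolding T_def[abs_def] dirac_G(3)[OF pd_S(1)[OF assms]] dirac_S[OF assms] euler_S[OF assms]
  unfolding S_def G_vinv[OF assms(1)] G_simps G_square vinv_inner[OF assms(1)]
  using r by (simp add: vcomp algebra_simps)
qed

definition P_op :: "complex \<Rightarrow> 'n \<Rightarrow> (real^'n \<Rightarrow> complex^'t) \<Rightarrow> real^'n \<Rightarrow> complex^'t" where
  "P_op l j f x = x $ j *\<^sub>R lapl f x + (2 * l - of_nat CARD('n) + 1) *s pd j f x - g j (dirac f x)"

definition K_op :: "complex \<Rightarrow> (real^'n \<Rightarrow> complex^'t) \<Rightarrow> real^'n \<Rightarrow> complex^'t" where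
  "K_op l f x = (x \<bullet> x) *\<^sub>R lapl f x + (2 * (2 * l - of_nat CARD('n) + 1)) *s euler f x
     - 2 *s G x (dirac f x) + ((2 * l - of_nat CARD('n) + 1) * (2 * l + 1)) *s f x"

lemma smooth_differentiable: "smooth f \<Longrightarrow> f differentiable (at x)"
  using smooth_on_differentiable[of UNIV f x] by (simp add: smooth_on_UNIV)

lemma smooth_dirac: "smooth f \<Longrightarrow> smooth (dirac f)"
  using smooth_on_dirac[of UNIV f] by (simp add: smooth_on_UNIV)

lemma dirac_dirac_UNIV: "smooth f \<Longrightarrow> dirac (dirac f) x = - lapl f x"
  using dirac_dirac[of UNIV x f] by (simp add: smooth_on_UNIV)

text \<open>The Laplacian is minus the square of the Dirac operator, so \<open>dirac_T\<close>
  handles the first factor and \<open>dirac_S\<close> the second. The Euler derivatives of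
  \<open>dirac f\<close> cancel, and the remaining terms are those of \<open>K_op\<close> at the
  image point.\<close>

lemma lapl_T:
  assumes x: "x \<noteq> 0" and f: "smooth f"
  shows "lapl (T (- (2 * l + 1)) f) x = T (- (2 * l + 1) - 2) (K_op l f) x"
proof -
  define w where "w = - (2 * l + 1)"
  define c where "c = - (of_nat CARD('n) + w)"
  define h where "h = (\<lambda>y. c *s f y - G y (dirac f y))"
  define y where "y = vinv x"
  have df: "f differentiable (at z)" "dirac f differentiable (at z)"
    "(\<lambda>z. G z (dirac f z)) differentiable (at z)" for z
    using f smooth_dirac[OF f] by (auto intro: smooth_differentiable dirac_G(1))
  have dh: "h differentiable (at z)" for z
    unfolding h_def by (intro differentiable_diff differentiable_smult df)
  have "lapl (T w f) x = - dirac (dirac (T w f)) x"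
    using dirac_dirac[OF open_nonzero _ smooth_on_T[OF f], of x w] x by simp
  also have "dirac (dirac (T w f)) x = dirac (S w h) x"
    using x by (intro dirac_cong_open[OF open_nonzero]) (auto simp: dirac_T[OF _ df(1)] h_def c_def)
  also have "\<dots> = cpow w x *s (G y (w *s h y - 2 *\<^sub>R euler h y) + (1 / (x \<bullet> x)) *\<^sub>R dirac h y)"
    unfolding y_def by (rule dirac_S[OF x dh])
  also have "dirac h y = c *s dirac f y
      - (- of_nat CARD('n) *s dirac f y - G y (- lapl f y) - 2 *\<^sub>R euler (dirac f) y)"
    unfolding h_def dirac_lincomb(1)[OF df(1,3)] dirac_G(3)[OF df(2)] dirac_dirac_UNIV[OF f] ..
  also have "euler h y = c *s euler f y - (G y (dirac f y) + G y (euler (dirac f) y))"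
    unfolding h_def dirac_lincomb(2)[OF df(1,3)] dirac_G(4)[OF df(2)] ..
  also have "h y = c *s f y - G y (dirac f y)" by (simp add: h_def)
  finally have L: "lapl (T w f) x = - (cpow w x *s (G y (w *s (c *s f y - G y (dirac f y)) - 2 *\<^sub>R
      (c *s euler f y - (G y (dirac f y) + G y (euler (dirac f) y)))) + (1 / (x \<bullet> x)) *\<^sub>R (c *s dirac f y
      - (- of_nat CARD('n) *s dirac f y - G y (- lapl f y) - 2 *\<^sub>R euler (dirac f) y))))" .
  have R: "T (w - 2) (K_op l f) x = cpow w x *s G y (K_op l f y)"
    unfolding y_def by (rule T_minus2[OF x])
  have yy: "y \<bullet> y = 1 / (x \<bullet> x)" using x by (simp add: y_def vinv_inner)
  have l: "2 * l = - w - 1" by (simp add: w_def)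
  show ?thesis
    unfolding w_def[symmetric] L R
    unfolding K_op_def l c_def yy
    by (simp add: G_simps G_square yy vcomp algebra_simps)
qed

lemma P_op_T:
  assumes x: "x \<noteq> 0" and f: "smooth f"
  shows "P_op l j (T (- (2 * l + 1)) f) x = T (- (2 * l + 1) - 2) (P_op l j f) x"
proof -
  define w where "w = - (2 * l + 1)"
  define y where "y = vinv x"
  have df: "f differentiable (at z)" for z
    using f by (auto intro: smooth_differentiable)
  have R: "T (w - 2) h x = cpow w x *s G y (h y)" for h
    unfolding y_def by (rule T_minus2[OF x])
  obtain r where r: "x \<bullet> x = r" "r \<noteq> 0" using x by simp
  have yy: "y \<bullet> y = 1 / (x \<bullet> x)" using x by (simp add: y_def vinv_inner)
  have l: "2 * l = - w - 1" by (simp add: w_def)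
  have xj: "x $ j = (x \<bullet> x) * y $ j" using x by (simp add: y_def vinv_def)
  have pT: "pd j (T w f) x = g j (S w f x) + G x (pd j (S w f) x)"
    unfolding T_def[abs_def] by (rule pd_G[OF pd_S(1)[OF x df]])
  show ?thesis
    unfolding w_def[symmetric] P_op_def[of l j "T w f"] dirac_T[OF x df] pT pd_S(2)[OF x df]
      lapl_T[OF x f, of l, folded w_def] R
    unfolding P_op_def K_op_def l y_def[symmetric] S_def xj G_vinv[OF x] yy
    using r by (simp add: G_simps g_simps G_square g_G yy vcomp algebra_simps)
qed

text \<open>Writing K through the P operators and the Laplacian reduces its behaviour under
  inversion to that of the latter.\<close>

lemma K_op_P_op: "K_op l f x = 2 *\<^sub>R (\<Sum>j\<in>UNIV. x $ j *\<^sub>R P_op l j f x) - (x \<bullet> x) *\<^sub>R lapl f x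
    + ((2 * l - of_nat CARD('n) + 1) * (2 * l + 1)) *s f x"
proof -
  have "(\<Sum>j\<in>UNIV. x $ j *\<^sub>R P_op l j f x) = (\<Sum>j\<in>UNIV. (x $ j * x $ j) *\<^sub>R lapl f x)
      + (2 * l - of_nat CARD('n) + 1) *s euler f x - G x (dirac f x)"
    by (simp add: P_op_def euler_def G_def vcomp sum.distrib sum_subtractf sum_distrib_left algebra_simps)
  also have "(\<Sum>j\<in>UNIV. (x $ j * x $ j) *\<^sub>R lapl f x) = (x \<bullet> x) *\<^sub>R lapl f x"
    by (simp add: inner_sum_components scaleR_sum_left)
  finally have *: "(\<Sum>j\<in>UNIV. x $ j *\<^sub>R P_op l j f x) = (x \<bullet> x) *\<^sub>R lapl f x
      + (2 * l - of_nat CARD('n) + 1) *s euler f x - G x (dirac f x)" .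
  show ?thesis unfolding * K_op_def by (simp add: vcomp algebra_simps)
qed

text \<open>By \<open>K_op_P_op\<close> at x, the left side is a combination of transforms already
  known from \<open>P_op_T\<close> and \<open>lapl_T\<close>. The same identity at the image point
  eliminates the sum of the P operators there.\<close>

lemma K_op_T:
  assumes x: "x \<noteq> 0" and f: "smooth f"
  shows "K_op l (T (- (2 * l + 1)) f) x = T (- (2 * l + 1) - 2) (lapl f) x"
proof -
  define w where "w = - (2 * l + 1)"
  define y where "y = vinv x"
  define a where "a = (2 * l - of_nat CARD('n) + 1) * (2 * l + 1)"
  have R: "T (w - 2) h x = cpow w x *s G y (h y)" for h
    unfolding y_def by (rule T_minus2[OF x])
  obtain r where r: "x \<bullet> x = r" "r \<noteq> 0" using x by simp
  have T: "T w f x = cpow w x *s ((x \<bullet> x) *\<^sub>R G y (f y))"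
    by (simp add: T_def S_def G_simps G_vinv[OF x] y_def vcomp)
  have yy: "y \<bullet> y = 1 / (x \<bullet> x)" using x by (simp add: y_def vinv_inner)
  have xj: "x $ j = (x \<bullet> x) * y $ j" for j using x by (simp add: y_def vinv_def)
  have "(\<Sum>j\<in>UNIV. x $ j *\<^sub>R T (w - 2) (P_op l j f) x)
      = cpow w x *s ((x \<bullet> x) *\<^sub>R G y (\<Sum>j\<in>UNIV. y $ j *\<^sub>R P_op l j f y))"
    by (simp add: R xj G_simps vcomp sum_distrib_left algebra_simps)
  moreover have "2 *\<^sub>R (\<Sum>j\<in>UNIV. y $ j *\<^sub>R P_op l j f y) = K_op l f y + (y \<bullet> y) *\<^sub>R lapl f y - a *s f y"
    by (simp add: K_op_P_op a_def)
  \<comment> \<open>Since x is |x|^2 times y, the sum at x is governed by the sum at y, which is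
    solved for here.\<close>
  then have "(\<Sum>j\<in>UNIV. y $ j *\<^sub>R P_op l j f y) = (1/2) *\<^sub>R (K_op l f y + (y \<bullet> y) *\<^sub>R lapl f y - a *s f y)"
    by (metis (no_types) scaleR_scaleR scaleR_one mult.commute nonzero_eq_divide_eq zero_neq_numeral)
  ultimately have *: "(\<Sum>j\<in>UNIV. x $ j *\<^sub>R T (w - 2) (P_op l j f) x)
      = cpow w x *s ((x \<bullet> x) *\<^sub>R G y ((1/2) *\<^sub>R (K_op l f y + (y \<bullet> y) *\<^sub>R lapl f y - a *s f y)))" by simp
  show ?thesis
    unfolding w_def[symmetric] K_op_P_op[of l "T w f"] P_op_T[OF x f, of l, folded w_def]
      lapl_T[OF x f, of l, folded w_def] a_def[symmetric] * unfolding yy T R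
    using r by (simp add: G_simps vcomp algebra_simps)
qed

end

section \<open>Additivity of the operators and their commutation with linear maps\<close>

lemma smooth_on_scaleR: "open W \<Longrightarrow> smooth_on W f \<Longrightarrow> smooth_on W (\<lambda>x. r *\<^sub>R (f x :: 'b::real_normed_vector))"
  by (rule smooth_on_bounded_linear[OF bounded_linear_scaleR_right])

lemma smooth_on_smult: "open W \<Longrightarrow> smooth_on W f \<Longrightarrow> smooth_on W (\<lambda>x. z *s (f x :: complex^'t::finite))"
  by (rule smooth_on_clin[OF clin_smult_const])

lemma clin_neg: "clin (\<lambda>u. - u)"
  by (simp add: clin_def vec_eq_iff)

lemma clin_scale: "clin (\<lambda>u. r *\<^sub>R u)"
  by (simp add: clin_def scaleR_add_right vcomp mult_ac)

lemma clin_const0: "clin (\<lambda>u. 0)"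
  by (simp add: clin_def vec_eq_iff)

lemma smooth_on_diff:
  "open W \<Longrightarrow> smooth_on W f \<Longrightarrow> smooth_on W h \<Longrightarrow> smooth_on W (\<lambda>x. f x - (h x :: complex^'t::finite))"
  using smooth_on_add[of W f "\<lambda>x. - h x"] smooth_on_clin[OF clin_neg, of W h] by simp

lemma pd_add_smooth:
  "x \<in> W \<Longrightarrow> smooth_on W f \<Longrightarrow> smooth_on W h \<Longrightarrow> pd j (\<lambda>x. f x + h x) x = pd j f x + pd j h x"
  by (intro pd_add) (auto intro: smooth_on_differentiable)

lemma pd_clin_smooth:
  "x \<in> W \<Longrightarrow> smooth_on W f \<Longrightarrow> clin M \<Longrightarrow> pd j (\<lambda>x. M (f x)) x = M (pd j f x)"
  by (intro pd_clin) (auto intro: smooth_on_differentiable)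

lemma lapl_add:
  assumes "open W" "x \<in> W" "smooth_on W f" "smooth_on W h"
  shows "lapl (\<lambda>x. f x + h x) x = lapl f x + lapl h x"
proof -
  have "pd j (pd j (\<lambda>x. f x + h x)) x = pd j (\<lambda>x. pd j f x + pd j h x) x" for j
    by (rule pd_cong_open[OF assms(1,2)]) (rule pd_add_smooth[OF _ assms(3,4)])
  also have "\<dots> j = pd j (pd j f) x + pd j (pd j h) x" for j
    by (rule pd_add_smooth[OF assms(2) smooth_on_pd smooth_on_pd]) (rule assms)+
  finally show ?thesis by (simp add: lapl_def sum.distrib)
qed

lemma lapl_clin:
  assumes "open W" "x \<in> W" "smooth_on W f" "clin M"
  shows "lapl (\<lambda>x. M (f x)) x = M (lapl f x)"
proof -
  have "pd j (pd j (\<lambda>x. M (f x))) x = pd j (\<lambda>x. M (pd j f x)) x" for j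
    by (rule pd_cong_open[OF assms(1,2)]) (rule pd_clin_smooth[OF _ assms(3,4)])
  also have "\<dots> j = M (pd j (pd j f) x)" for j
    by (rule pd_clin_smooth[OF assms(2) smooth_on_pd]) (rule assms)+
  finally show ?thesis by (simp add: lapl_def clin_sum[OF assms(4)])
qed

lemma euler_clin:
  assumes "x \<in> W" "smooth_on W f" "clin M"
  shows "euler (\<lambda>x. M (f x)) x = M (euler f x)"
  by (simp add: euler_def pd_clin_smooth[OF assms] clin_simps[OF assms(3)])

context clifford_ops
begin

lemma dirac_add_smooth:
  assumes "x \<in> W" "smooth_on W f" "smooth_on W h"
  shows "dirac (\<lambda>x. f x + h x) x = dirac f x + dirac h x"
  by (simp add: dirac_def pd_add_smooth[OF assms] g_simps sum.distrib)

lemma dirac_clin: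
  assumes "x \<in> W" "smooth_on W f" "clin M" "\<And>j u. M (g j u) = g j (M u)"
  shows "dirac (\<lambda>x. M (f x)) x = M (dirac f x)"
  by (simp add: dirac_def pd_clin_smooth[OF assms(1-3)] clin_sum[OF assms(3)] assms(4))

lemma G_commute:
  assumes "clin M" "\<And>j u. M (g j u) = g j (M u)"
  shows "M (G v u) = G v (M u)"
  by (simp add: G_def clin_simps[OF assms(1)] assms(2))

lemma P_op_add:
  assumes "open W" "x \<in> W" "smooth_on W f" "smooth_on W h"
  shows "P_op l j (\<lambda>x. f x + h x) x = P_op l j f x + P_op l j h x"
  unfolding P_op_def lapl_add[OF assms] pd_add_smooth[OF assms(2-4)] dirac_add_smooth[OF assms(2-4)]
  by (simp add: g_simps vcomp algebra_simps)

text \<open>Meant for maps that are constant in x and belong to the other variable, such as Clifford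
  multiplication by y on the second factor: they commute with every \<open>g j\<close>.\<close>

lemma P_op_clin:
  assumes "open W" "x \<in> W" "smooth_on W f" "clin M" "\<And>j u. M (g j u) = g j (M u)"
  shows "P_op l j (\<lambda>x. M (f x)) x = M (P_op l j f x)"
  unfolding P_op_def lapl_clin[OF assms(1-4)] pd_clin_smooth[OF assms(2-4)] dirac_clin[OF assms(2-5)]
  by (simp add: clin_simps[OF assms(4)] assms(5))

lemma K_op_clin:
  assumes "open W" "x \<in> W" "smooth_on W f" "clin M" "\<And>j u. M (g j u) = g j (M u)"
  shows "K_op l (\<lambda>x. M (f x)) x = M (K_op l f x)"
  unfolding K_op_def lapl_clin[OF assms(1-4)] euler_clin[OF assms(2-4)] dirac_clin[OF assms(2-5)]
  by (simp add: clin_simps[OF assms(4)] G_commute[OF assms(4,5)])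

lemma P_op_sum:
  assumes "open W" "x \<in> W" "\<And>i. i \<in> I \<Longrightarrow> smooth_on W (f i)"
  shows "P_op l j (\<lambda>x. \<Sum>i\<in>I. f i x) x = (\<Sum>i\<in>I. P_op l j (f i) x)"
proof -
  have 0: "P_op l j (\<lambda>x. 0) x = 0"
    using P_op_clin[OF assms(1,2) smooth_on_const[of W 0] clin_const0] by (simp add: g_simps)
  show ?thesis using assms(3)
  proof (induction I rule: infinite_finite_induct)
    case (insert i I)
    then show ?case
      using P_op_add[OF assms(1,2), of "f i" "\<lambda>x. \<Sum>i\<in>I. f i x"] smooth_on_sum[OF assms(1), of I f]
      by simp
  qed (simp_all add: 0)
qed

end

section \<open>Linear similarities\<close>

locale similarity =
  fixes B :: "real^'n::finite \<Rightarrow> real^'n" and \<theta> :: real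
  assumes linear_B: "linear B" and \<theta>: "\<theta> \<noteq> 0"
    and inner_B: "\<theta>\<^sup>2 * (B v \<bullet> B w) = v \<bullet> w"
begin

definition b :: "'n \<Rightarrow> 'n \<Rightarrow> real" where "b j i = B (axis j 1) $ i"

text \<open>\<open>inner_B\<close> makes the rows \<open>b j\<close> orthogonal, whereas summing
  over the index j of a derivative needs the columns. For a square matrix both are the same
  condition, which is used through orthogonal transformations.\<close>

lemma b_orthogonal: "(\<Sum>j\<in>UNIV. b j i * b j k) = (if i = k then 1 / \<theta>\<^sup>2 else 0)"
proof -
  define Q where "Q = (\<lambda>v. \<theta> *\<^sub>R B v)"
  have lin: "linear Q"
    unfolding Q_def using linear_B by (rule linear_compose_scale_right)
  have "orthogonal_transformation Q"
    using lin inner_B by (simp add: orthogonal_transformation_def Q_def power2_eq_square mult.assoc)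
  then have "matrix Q ** transpose (matrix Q) = mat 1"
    using orthogonal_transformation_matrix[of Q] lin by (simp add: orthogonal_matrix)
      (metis orthogonal_matrix orthogonal_matrix_def)
  then have "(matrix Q ** transpose (matrix Q)) $ i $ k = mat 1 $ i $ k" by simp
  then have "\<theta>\<^sup>2 * (\<Sum>j\<in>UNIV. b j i * b j k) = (if i = k then 1 else 0)"
    by (simp add: matrix_matrix_mult_def transpose_def matrix_def mat_def Q_def b_def
        power2_eq_square sum_distrib_left mult_ac)
  then show ?thesis using \<theta> by (auto simp: field_simps split: if_splits)
qed

lemma x_component: "x $ j = \<theta>\<^sup>2 * (\<Sum>i\<in>UNIV. b j i * B x $ i)"
  using inner_B[of "axis j 1" x] by (simp add: inner_axis' inner_sum_components[of "B _"] b_def)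

lemma B_has_derivative: "(f has_derivative f') (at (B x)) \<Longrightarrow> ((\<lambda>x. f (B x)) has_derivative (\<lambda>v. f' (B v))) (at x)"
  by (rule has_derivative_compose[where f=B])
    (simp_all add: linear_B linear_imp_has_derivative)

lemma smooth_on_B: "smooth f \<Longrightarrow> smooth (\<lambda>x. f (B x))"
  using smooth_on_compose[OF open_UNIV open_UNIV, of B f] smooth_on_linear[of B UNIV]
    linear_conv_bounded_linear linear_B by (auto simp: smooth_on_UNIV)

lemma pd_B:
  assumes "clin M" "f differentiable (at (B x))"
  shows "pd j (\<lambda>x. M (f (B x))) x = M (\<Sum>i\<in>UNIV. b j i *\<^sub>R pd i f (B x))"
proof -
  obtain f' where f': "(f has_derivative f') (at (B x))" using assms(2) by (auto simp: differentiable_def)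
  have "pd j (\<lambda>x. M (f (B x))) x = M (f' (B (axis j 1)))"
    using pd_eq[OF bounded_linear.has_derivative[OF clin_bounded_linear[OF assms(1)] B_has_derivative[OF f']]] .
  then show ?thesis using derivative_expansion[OF f', of "B (axis j 1)"] by (simp add: b_def)
qed

lemma euler_B:
  assumes "clin M" "f differentiable (at (B x))"
  shows "euler (\<lambda>x. M (f (B x))) x = M (euler f (B x))"
proof -
  obtain f' where f': "(f has_derivative f') (at (B x))" using assms(2) by (auto simp: differentiable_def)
  show ?thesis
    using euler_eq[OF bounded_linear.has_derivative[OF clin_bounded_linear[OF assms(1)] B_has_derivative[OF f']]]
      euler_eq[OF f'] by simp
qed

text \<open>This contraction makes the Laplacian, the Dirac operator and the sum of the products of
  P operators all transform by a scalar.\<close>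

lemma double_sum_b:
  fixes c :: "'n \<Rightarrow> 'n \<Rightarrow> 'v::real_vector"
  shows "(\<Sum>j\<in>UNIV. \<Sum>i\<in>UNIV. \<Sum>k\<in>UNIV. (b j i * b j k) *\<^sub>R c i k) = (1 / \<theta>\<^sup>2) *\<^sub>R (\<Sum>i\<in>UNIV. c i i)"
proof -
  have "(\<Sum>j\<in>UNIV. \<Sum>i\<in>UNIV. \<Sum>k\<in>UNIV. (b j i * b j k) *\<^sub>R c i k)
      = (\<Sum>i\<in>UNIV. \<Sum>k\<in>UNIV. \<Sum>j\<in>UNIV. (b j i * b j k) *\<^sub>R c i k)"
    by (rule trans[OF sum.swap], rule sum.cong[OF refl], rule sum.swap)
  also have "\<dots> = (\<Sum>i\<in>UNIV. \<Sum>k\<in>UNIV. (if i = k then 1 / \<theta>\<^sup>2 else 0) *\<^sub>R c i k)"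
    by (simp only: scaleR_sum_left[symmetric] b_orthogonal)
  also have "\<dots> = (\<Sum>i\<in>UNIV. (1 / \<theta>\<^sup>2) *\<^sub>R c i i)"
    by (simp add: if_distrib[where f="\<lambda>r. r *\<^sub>R _"] cong: if_cong)
  finally show ?thesis by (simp add: scaleR_sum_right)
qed

lemma lapl_B:
  assumes M: "clin M" and f: "smooth f"
  shows "lapl (\<lambda>x. M (f (B x))) x = (1 / \<theta>\<^sup>2) *\<^sub>R M (lapl f (B x))"
proof -
  have f': "smooth_on UNIV f" using f by (simp add: smooth_on_UNIV)
  have df: "pd i f differentiable (at z)" "f differentiable (at z)" for i z
    using smooth_on_differentiable[OF smooth_on_pd[OF f']] smooth_on_differentiable[OF f'] by auto
  have d: "(\<lambda>z. b j i *\<^sub>R pd i f z) differentiable (at z)" for i j z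
    using df by simp
  have ps: "pd j (\<lambda>x. b k i *\<^sub>R pd i f x) z = b k i *\<^sub>R pd j (pd i f) z" for i j k z
    by (rule pd_clin[OF clin_scale df(1)])
  have "pd j (\<lambda>x. M (f (B x))) = (\<lambda>x. M ((\<lambda>z. \<Sum>i\<in>UNIV. b j i *\<^sub>R pd i f z) (B x)))" for j
    using pd_B[OF M df(2)] by auto
  then have "pd j (pd j (\<lambda>x. M (f (B x)))) x
      = M (\<Sum>k\<in>UNIV. b j k *\<^sub>R pd k (\<lambda>z. \<Sum>i\<in>UNIV. b j i *\<^sub>R pd i f z) (B x))" for j
    using pd_B[OF M, of "\<lambda>z. \<Sum>i\<in>UNIV. b j i *\<^sub>R pd i f z" x j] d by simp
  also have "\<dots> j = M (\<Sum>k\<in>UNIV. \<Sum>i\<in>UNIV. (b j k * b j i) *\<^sub>R pd k (pd i f) (B x))" for j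
    by (simp add: pd_sum d ps scaleR_sum_right)
  finally show ?thesis
    by (simp add: lapl_def clin_sum[OF M, symmetric] double_sum_b clin_scaleR[OF M])
qed

end

text \<open>The underlying similarity sees only the square of \<theta>. Its sign enters in
  \<open>G_M\<close>, where an odd product of vectors gives a negative \<theta>.\<close>

locale clifford_similarity = clifford_ops g + similarity B \<theta>
  for g :: "'n::finite \<Rightarrow> complex^'t::finite \<Rightarrow> complex^'t" and B :: "real^'n \<Rightarrow> real^'n" and \<theta> +
  fixes M :: "complex^'t \<Rightarrow> complex^'t"
  assumes clin_M: "clin M" and G_M: "G v (M u) = \<theta> *\<^sub>R M (G (B v) u)"
begin

lemmas M_simps = clin_simps[OF clin_M]

lemma g_M: "g j (M u) = \<theta> *\<^sub>R M (\<Sum>i\<in>UNIV. b j i *\<^sub>R g i u)"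
  using G_M[of "axis j 1" u] by (simp add: G_axis G_def[of "B _"] b_def)

lemma dirac_B:
  assumes "smooth f"
  shows "dirac (\<lambda>x. M (f (B x))) x = (1 / \<theta>) *\<^sub>R M (dirac f (B x))"
proof -
  have "dirac (\<lambda>x. M (f (B x))) x =
      (\<Sum>j\<in>UNIV. \<Sum>i\<in>UNIV. \<Sum>k\<in>UNIV. (b j i * b j k) *\<^sub>R \<theta> *\<^sub>R M (g k (pd i f (B x))))"
    unfolding dirac_def pd_B[OF clin_M smooth_differentiable[OF assms]]
    by (simp add: g_simps M_simps g_M scaleR_sum_right mult_ac)
  also have "\<dots> = (1 / \<theta>) *\<^sub>R M (dirac f (B x))"
    by (subst double_sum_b) (simp add: dirac_def M_simps scaleR_sum_right[symmetric] power2_eq_square)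
  finally show ?thesis .
qed

lemma P_op_B:
  assumes f: "smooth f"
  shows "P_op l j (\<lambda>x. M (f (B x))) x = M (\<Sum>i\<in>UNIV. b j i *\<^sub>R P_op l i f (B x))"
proof -
  have 1: "x $ j *\<^sub>R lapl (\<lambda>x. M (f (B x))) x = M (\<Sum>i\<in>UNIV. b j i *\<^sub>R (B x $ i *\<^sub>R lapl f (B x)))"
  proof -
    have "x $ j / \<theta>\<^sup>2 = (\<Sum>i\<in>UNIV. b j i * B x $ i)" using x_component[of x j] \<theta> by simp
    then show ?thesis
      unfolding lapl_B[OF clin_M f] by (simp add: M_simps scaleR_sum_left)
  qed
  have 2: "g j (dirac (\<lambda>x. M (f (B x))) x) = M (\<Sum>i\<in>UNIV. b j i *\<^sub>R g i (dirac f (B x)))"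
    unfolding dirac_B[OF f] using \<theta> by (simp add: g_simps g_M)
  show ?thesis
    unfolding P_op_def 1 2 pd_B[OF clin_M smooth_differentiable[OF f]]
    by (simp add: M_simps sum.distrib sum_subtractf vcomp sum_distrib_left algebra_simps)
qed

text \<open>Each factor from a derivative is compensated by its coefficient: \<theta>^-2 from the
  Laplacian by |x|^2 = \<theta>^2 |B x|^2, and \<theta>^-1 from the Dirac operator by
  \<open>G_M\<close>. So K is unscaled where the Laplacian scales by \<theta>^-2.\<close>

lemma K_op_B:
  assumes f: "smooth f"
  shows "K_op l (\<lambda>x. M (f (B x))) x = M (K_op l f (B x))"
proof -
  have 1: "(x \<bullet> x) *\<^sub>R lapl (\<lambda>x. M (f (B x))) x = (B x \<bullet> B x) *\<^sub>R M (lapl f (B x))"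
    unfolding lapl_B[OF clin_M f] inner_B[of x x, symmetric] using \<theta> by simp
  have 2: "G x (dirac (\<lambda>x. M (f (B x))) x) = M (G (B x) (dirac f (B x)))"
    unfolding dirac_B[OF f] using \<theta> by (simp add: G_simps G_M)
  show ?thesis
    unfolding K_op_def 1 2 euler_B[OF clin_M smooth_differentiable[OF f]] by (simp add: M_simps)
qed

end

section \<open>The source operator as an invariant pairing\<close>

text \<open>Partial application of a one-variable operator, the other variable being a parameter.
  Regarding the result as a function of both variables gives smoothness in the parameter, which is
  needed before an operator in x is applied.\<close>

definition slice_y :: "((real^'n \<Rightarrow> 'v) \<Rightarrow> real^'n \<Rightarrow> 'w) \<Rightarrow> ((real^'n) \<times> (real^'n) \<Rightarrow> 'v) \<Rightarrow> (real^'n) \<times> (real^'n) \<Rightarrow> 'w" where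
  "slice_y Op F = (\<lambda>(x, y). Op (\<lambda>y'. F (x, y')) y)"

definition slice_x :: "((real^'n \<Rightarrow> 'v) \<Rightarrow> real^'n \<Rightarrow> 'w) \<Rightarrow> ((real^'n) \<times> (real^'n) \<Rightarrow> 'v) \<Rightarrow> (real^'n) \<times> (real^'n) \<Rightarrow> 'w" where
  "slice_x Op F = (\<lambda>(x, y). Op (\<lambda>x'. F (x', y)) x)"

lemma open_slice:
  assumes "open W"
  shows "open {x. (x, y) \<in> W}" and "open {y. (x, y) \<in> W}"
proof -
  have "open ((\<lambda>x. (x, y)) -` W)" by (intro open_vimage assms continuous_intros)
  then show "open {x. (x, y) \<in> W}" by (simp add: vimage_def)
  have "open ((\<lambda>y. (x, y)) -` W)" by (intro open_vimage assms continuous_intros)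
  then show "open {y. (x, y) \<in> W}" by (simp add: vimage_def)
qed

lemma smooth_on_const_Pair:
  fixes y :: "real^'n::finite"
  assumes "open W"
  shows "smooth_on W (\<lambda>x :: real^'n. (x, y))" "smooth_on W (\<lambda>x :: real^'n. (y, x))"
proof -
  have l: "bounded_linear (\<lambda>x :: real^'n. (x, 0 :: real^'n))" "bounded_linear (\<lambda>x :: real^'n. (0 :: real^'n, x))"
    by (intro bounded_linear_Pair bounded_linear_ident bounded_linear_zero)+
  show "smooth_on W (\<lambda>x :: real^'n. (x, y))"
    using smooth_on_add[OF assms smooth_on_linear[OF l(1) assms] smooth_on_const[of W "(0, y)"]] by simp
  show "smooth_on W (\<lambda>x :: real^'n. (y, x))"
    using smooth_on_add[OF assms smooth_on_linear[OF l(2) assms] smooth_on_const[of W "(y, 0)"]] by simp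
qed

lemma smooth_on_slice:
  fixes F :: "(real^'n::finite) \<times> (real^'n) \<Rightarrow> 'v::real_normed_vector"
  assumes "open W" "smooth_on W F"
  shows "smooth_on {x. (x, y) \<in> W} (\<lambda>x. F (x, y))" "smooth_on {y. (x, y) \<in> W} (\<lambda>y. F (x, y))"
proof -
  show "smooth_on {x. (x, y) \<in> W} (\<lambda>x. F (x, y))"
    by (rule smooth_on_compose[where H="\<lambda>x. (x, y)", OF open_slice(1)[OF assms(1)] assms(1) _ assms(2)])
      (auto intro: smooth_on_const_Pair open_slice[OF assms(1)])
  show "smooth_on {y. (x, y) \<in> W} (\<lambda>y. F (x, y))"
    by (rule smooth_on_compose[where H="\<lambda>y. (x, y)", OF open_slice(2)[OF assms(1)] assms(1) _ assms(2)])
      (auto intro: smooth_on_const_Pair open_slice[OF assms(1)])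
qed

lemma smooth_slice:
  fixes F :: "(real^'n::finite) \<times> (real^'n) \<Rightarrow> 'v::real_normed_vector"
  assumes "smooth F"
  shows "smooth (\<lambda>x. F (x, y))" "smooth (\<lambda>y. F (x, y))"
  using smooth_on_slice[of UNIV F] assms by (simp_all add: smooth_on_UNIV)

lemma slice_pd:
  assumes "F differentiable (at p)"
  shows "slice_x (pd j) F p = frechet_derivative F (at p) (axis j 1, 0)"
    and "slice_y (pd j) F p = frechet_derivative F (at p) (0, axis j 1)"
proof -
  obtain x y where p: "p = (x, y)" by (cases p)
  obtain F' where F': "(F has_derivative F') (at (x, y))" using assms p by (auto simp: differentiable_def)
  have "((\<lambda>x. (x, y)) has_derivative (\<lambda>v. (v, 0))) (at x)" "((\<lambda>y. (x, y)) has_derivative (\<lambda>v. (0, v))) (at y)"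
    by (auto intro!: derivative_eq_intros)
  note this[THEN has_derivative_compose, OF F']
  from this[THEN pd_eq] show "slice_x (pd j) F p = frechet_derivative F (at p) (axis j 1, 0)"
    "slice_y (pd j) F p = frechet_derivative F (at p) (0, axis j 1)"
    using frechet_derivative_at[OF F'] by (simp_all add: slice_x_def slice_y_def p)
qed

lemma smooth_on_slice_pd:
  assumes "open W" "smooth_on W F"
  shows "smooth_on W (slice_x (pd j) F)" "smooth_on W (slice_y (pd j) F)"
  using smooth_on_deriv[OF assms(2)] slice_pd[OF smooth_on_differentiable[OF assms(2)]]
    smooth_on_cong[OF assms(1)] by (metis (no_types, lifting))+

lemma slice_lapl: "slice_y lapl F = (\<lambda>p. \<Sum>j\<in>UNIV. slice_y (pd j) (slice_y (pd j) F) p)"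
  "slice_x lapl F = (\<lambda>p. \<Sum>j\<in>UNIV. slice_x (pd j) (slice_x (pd j) F) p)"
  by (auto simp: slice_y_def slice_x_def lapl_def fun_eq_iff)

lemma smooth_on_slice_lapl: "open W \<Longrightarrow> smooth_on W F \<Longrightarrow> smooth_on W (slice_y lapl F)"
  unfolding slice_lapl by (intro smooth_on_sum smooth_on_slice_pd)

lemma smooth_on_slice_euler: "open W \<Longrightarrow> smooth_on W F \<Longrightarrow> smooth_on W (slice_y euler F)"
proof -
  have e: "slice_y euler F = (\<lambda>p. \<Sum>j\<in>UNIV. snd p $ j *\<^sub>R slice_y (pd j) F p)"
    by (auto simp: slice_y_def euler_def fun_eq_iff)
  show "open W \<Longrightarrow> smooth_on W F \<Longrightarrow> smooth_on W (slice_y euler F)" unfolding e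
    by (intro smooth_on_sum smooth_on_bilinear[OF bounded_bilinear_scaleR] smooth_on_slice_pd
      smooth_on_linear[OF bounded_linear_compose[OF bounded_linear_vec_nth bounded_linear_snd]])
qed

context clifford_ops
begin

lemma smooth_on_slice_dirac: "open W \<Longrightarrow> smooth_on W F \<Longrightarrow> smooth_on W (slice_y dirac F)"
proof -
  have e: "slice_y dirac F = (\<lambda>p. \<Sum>j\<in>UNIV. g j (slice_y (pd j) F p))"
    by (auto simp: slice_y_def dirac_def fun_eq_iff)
  show "open W \<Longrightarrow> smooth_on W F \<Longrightarrow> smooth_on W (slice_y dirac F)" unfolding e
    by (intro smooth_on_sum smooth_on_clin[OF clin_g] smooth_on_slice_pd)
qed

lemma smooth_on_slice_P_op:
  assumes "open W" "smooth_on W F"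
  shows "smooth_on W (slice_y (P_op l j) F)"
proof -
  have e: "slice_y (P_op l j) F = (\<lambda>p. snd p $ j *\<^sub>R slice_y lapl F p
      + (2 * l - of_nat CARD('n) + 1) *s slice_y (pd j) F p - g j (slice_y dirac F p))"
    by (auto simp: slice_y_def P_op_def fun_eq_iff)
  show ?thesis unfolding e
    by (intro smooth_on_add smooth_on_diff smooth_on_bilinear[OF bounded_bilinear_scaleR] smooth_on_slice_lapl
      smooth_on_linear[OF bounded_linear_compose[OF bounded_linear_vec_nth bounded_linear_snd]]
      smooth_on_smult smooth_on_slice_pd smooth_on_clin[OF clin_g] smooth_on_slice_dirac assms)
qed

lemma smooth_on_slice_K_op:
  assumes "open W" "smooth_on W F"
  shows "smooth_on W (slice_y (K_op l) F)"
proof -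
  have e: "slice_y (K_op l) F = (\<lambda>p. (snd p \<bullet> snd p) *\<^sub>R slice_y lapl F p
      + (2 * (2 * l - of_nat CARD('n) + 1)) *s slice_y euler F p - 2 *s G (snd p) (slice_y dirac F p)
      + ((2 * l - of_nat CARD('n) + 1) * (2 * l + 1)) *s F p)"
    by (auto simp: slice_y_def K_op_def fun_eq_iff)
  show ?thesis unfolding e
    by (intro smooth_on_add smooth_on_diff smooth_on_bilinear[OF bounded_bilinear_scaleR] smooth_on_slice_lapl
      smooth_on_linear[OF bounded_linear_snd] smooth_on_bilinear[OF bounded_bilinear_inner]
      smooth_on_smult smooth_on_slice_euler smooth_on_bilinear[OF bounded_bilinear_G] smooth_on_slice_dirac assms)
qed

lemma smooth_slice_ops:
  fixes F :: "(real^'n) \<times> (real^'n) \<Rightarrow> complex^'t"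
  assumes "smooth F"
  shows "smooth (\<lambda>x. lapl (\<lambda>y. F (x, y)) y)" "smooth (\<lambda>x. P_op l j (\<lambda>y. F (x, y)) y)"
    "smooth (\<lambda>x. K_op l (\<lambda>y. F (x, y)) y)"
  using assms smooth_slice(1)[of "slice_y lapl F" y] smooth_slice(1)[of "slice_y (P_op l j) F" y]
    smooth_slice(1)[of "slice_y (K_op l) F" y] smooth_on_slice_lapl[of UNIV F]
    smooth_on_slice_P_op[of UNIV F] smooth_on_slice_K_op[of UNIV F]
  by (simp_all add: smooth_on_UNIV slice_y_def)

end

locale clifford_pair = X: clifford_ops gx + Y: clifford_ops gy
  for gx gy :: "'n::finite \<Rightarrow> complex^'t::finite \<Rightarrow> complex^'t" +
  assumes gx_gy: "gx i (gy j u) = gy j (gx i u)"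
begin

text \<open>In every summand the operator in y comes first, as it does in \<open>source_op\<close>,
  so the comparison requires no exchange of x and y derivatives.\<close>

definition E :: "complex \<Rightarrow> complex \<Rightarrow> ((real^'n) \<times> (real^'n) \<Rightarrow> complex^'t) \<Rightarrow> real^'n \<Rightarrow> real^'n \<Rightarrow> complex^'t" where
  "E l \<mu> F x y = X.K_op l (\<lambda>x. lapl (\<lambda>y. F (x, y)) y) x + lapl (\<lambda>x. Y.K_op \<mu> (\<lambda>y. F (x, y)) y) x
     - 2 *\<^sub>R (\<Sum>j\<in>UNIV. X.P_op l j (\<lambda>x. Y.P_op \<mu> j (\<lambda>y. F (x, y)) y) x)"

lemma gx_Gy: "gx i (Y.G v u) = Y.G v (gx i u)"
  by (rule Y.G_commute[OF X.clin_g]) (rule gx_gy)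

lemma Gx_gy: "X.G v (gy j u) = gy j (X.G v u)"
  by (rule X.G_commute[OF Y.clin_g, symmetric]) (rule gx_gy[symmetric])

text \<open>Under a similarity K is unscaled, the Laplacian is multiplied by \<theta>^-2, and the P
  operators mix by a matrix whose contraction with itself is \<theta>^-2. Hence all three parts of
  the pairing carry the same factor.\<close>

lemma E_similarity:
  assumes "clifford_similarity gx B \<theta> M" "clifford_similarity gy B \<theta> M" and F: "smooth F"
  shows "E l \<mu> (\<lambda>(x, y). M (F (B x, B y))) x y = (1 / \<theta>\<^sup>2) *\<^sub>R M (E l \<mu> F (B x) (B y))"
proof -
  interpret BX: clifford_similarity gx B \<theta> M by fact
  interpret BY: clifford_similarity gy B \<theta> M by fact
  note M = BX.clin_M
  note sl = smooth_slice(2)[OF F]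
  note sm = Y.smooth_slice_ops[OF F, where y="B y"]
  have on: "smooth h \<Longrightarrow> smooth_on UNIV (\<lambda>x. M (h (B x)))" for h
    by (rule smooth_on_clin[OF M open_UNIV]) (simp add: smooth_on_UNIV BX.smooth_on_B)
  have 1: "X.K_op l (\<lambda>x. lapl (\<lambda>y. M (F (B x, B y))) y) x
      = (1 / \<theta>\<^sup>2) *\<^sub>R M (X.K_op l (\<lambda>x. lapl (\<lambda>y. F (x, y)) (B y)) (B x))"
  proof -
    have "X.K_op l (\<lambda>x. lapl (\<lambda>y. M (F (B x, B y))) y) x
        = X.K_op l (\<lambda>x. (1 / \<theta>\<^sup>2) *\<^sub>R M (lapl (\<lambda>y. F (B x, y)) (B y))) x"
      by (simp add: BX.lapl_B[OF M sl])
    also have "\<dots> = (1 / \<theta>\<^sup>2) *\<^sub>R X.K_op l (\<lambda>x. M (lapl (\<lambda>y. F (B x, y)) (B y))) x"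
      by (rule X.K_op_clin[OF open_UNIV UNIV_I on[OF sm(1)] clin_scale, of "1 / \<theta>\<^sup>2"])
        (simp only: X.g_simps)
    finally show ?thesis by (simp add: BX.K_op_B[OF sm(1)])
  qed
  have 2: "lapl (\<lambda>x. Y.K_op \<mu> (\<lambda>y. M (F (B x, B y))) y) x
      = (1 / \<theta>\<^sup>2) *\<^sub>R M (lapl (\<lambda>x. Y.K_op \<mu> (\<lambda>y. F (x, y)) (B y)) (B x))"
    by (simp add: BY.K_op_B[OF sl] BX.lapl_B[OF M sm(3)])
  define c where "c k i = X.P_op l k (\<lambda>x. Y.P_op \<mu> i (\<lambda>y. F (x, y)) (B y)) (B x)" for k i
  have "X.P_op l j (\<lambda>x. Y.P_op \<mu> j (\<lambda>y. M (F (B x, B y))) y) x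
      = (\<Sum>k\<in>UNIV. \<Sum>i\<in>UNIV. (BX.b j k * BX.b j i) *\<^sub>R M (c k i))" for j
  proof -
    have h: "smooth (\<lambda>x. \<Sum>i\<in>UNIV. BX.b j i *\<^sub>R Y.P_op \<mu> i (\<lambda>y. F (x, y)) (B y))"
      "smooth (\<lambda>x. BX.b j i *\<^sub>R Y.P_op \<mu> i (\<lambda>y. F (x, y)) (B y))" for i
      using sm(2) by (auto intro!: smooth_on_sum smooth_on_scaleR simp: smooth_on_UNIV[symmetric])
    have main: "X.P_op l j (\<lambda>x. Y.P_op \<mu> j (\<lambda>y. M (F (B x, B y))) y) x
        = M (\<Sum>k\<in>UNIV. BX.b j k *\<^sub>R X.P_op l k (\<lambda>x. \<Sum>i\<in>UNIV. BX.b j i *\<^sub>R Y.P_op \<mu> i (\<lambda>y. F (x, y)) (B y)) (B x))"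
      by (simp only: BY.P_op_B[OF sl] BX.P_op_B[OF h(1)])
    have inner: "X.P_op l k (\<lambda>x. \<Sum>i\<in>UNIV. BX.b j i *\<^sub>R Y.P_op \<mu> i (\<lambda>y. F (x, y)) (B y)) (B x)
        = (\<Sum>i\<in>UNIV. BX.b j i *\<^sub>R c k i)" for k
      unfolding c_def
      using h(2) sm(2) by (subst X.P_op_sum[OF open_UNIV UNIV_I])
        (auto simp: smooth_on_UNIV X.g_simps intro!: sum.cong X.P_op_clin[OF open_UNIV UNIV_I _ clin_scale])
    show ?thesis unfolding main inner by (simp add: BX.M_simps scaleR_sum_right)
  qed
  then have 3: "(\<Sum>j\<in>UNIV. X.P_op l j (\<lambda>x. Y.P_op \<mu> j (\<lambda>y. M (F (B x, B y))) y) x)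
      = (1 / \<theta>\<^sup>2) *\<^sub>R M (\<Sum>j\<in>UNIV. c j j)"
    by (simp add: BX.double_sum_b BX.M_simps)
  show ?thesis
    unfolding E_def prod.case 1 2 3 c_def by (simp add: BX.M_simps scaleR_add_right scaleR_diff_right)
qed

text \<open>The pointwise linear part of the twisted inversion in both variables, separated from the
  substitution of points.\<close>

definition J :: "complex \<Rightarrow> complex \<Rightarrow> real^'n \<Rightarrow> real^'n \<Rightarrow> complex^'t \<Rightarrow> complex^'t" where
  "J w w' x y u = X.G x (cpow w x *s Y.G y (cpow w' y *s u))"

lemma clin_J: "clin (J w w' x y)"
  unfolding J_def[abs_def]
  by (rule clin_comp[OF X.clin_G clin_comp[OF clin_smult_const clin_comp[OF Y.clin_G clin_smult_const]]])

text \<open>In each variable the inversion exchanges K with the Laplacian, so the first two summands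
  of \<open>E\<close> change places, and the third is a sum of products of operators that the
  inversion fixes.\<close>

lemma E_inversion:
  fixes l \<mu> :: complex
  assumes x: "x \<noteq> 0" and y: "y \<noteq> 0" and F: "smooth F"
  defines "w \<equiv> - (2 * l + 1)" and "w' \<equiv> - (2 * \<mu> + 1)"
  shows "E l \<mu> (\<lambda>(x, y). J w w' x y (F (vinv x, vinv y))) x y
    = J (w - 2) (w' - 2) x y (E l \<mu> F (vinv x) (vinv y))"
proof -
  \<comment> \<open>For fixed x the map is \<open>Q x\<close> applied to a transform in y alone, and
    \<open>Q x\<close> commutes with the operators in y. After those have acted, the y-part of the
    transform is the map \<open>R\<close>, constant in x, and the rest is a transform in x
    alone.\<close>
  define Q where "Q = (\<lambda>x u. X.G x (cpow w x *s u))"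
  define R where "R = (\<lambda>u. Y.G y (cpow (w' - 2) y *s u))"
  have Q: "clin (Q x)" "Q x (gy j u) = gy j (Q x u)" for x j u
    unfolding Q_def by (rule clin_comp[OF X.clin_G clin_smult_const])
      (simp only: Gx_gy[symmetric] Y.g_simps)
  have R: "clin R" "R (gx j u) = gx j (R u)" for j u
    unfolding R_def by (rule clin_comp[OF Y.clin_G clin_smult_const])
      (simp only: gx_Gy X.g_simps)
  have JT: "J w w' x y (F (vinv x, vinv y)) = Q x (Y.T w' (\<lambda>y. F (vinv x, y)) y)" for x y
    by (simp add: J_def Q_def Y.T_def Y.S_def)
  have TQ: "Q x (Y.T (w' - 2) (H (vinv x)) y) = X.T w (\<lambda>x. R (H x (vinv y))) x" for H x
    by (simp add: Q_def Y.T_def Y.S_def X.T_def X.S_def R_def)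
  have JR: "X.T (w - 2) (\<lambda>x. R (H x)) x = J (w - 2) (w' - 2) x y (H (vinv x))" for H
    by (simp add: X.T_def X.S_def R_def J_def)
  have y': "y \<in> - {0}" using y by simp
  note sl = smooth_slice(2)[OF F]
  note sm = Y.smooth_slice_ops[OF F, where y="vinv y"]
  note smR = smooth_on_clin[OF R(1) open_UNIV, unfolded smooth_on_UNIV]
  note smU = smooth_on_UNIV[THEN iffD2]
  have l1: "lapl (\<lambda>y. J w w' x y (F (vinv x, vinv y))) y
      = X.T w (\<lambda>x. R (Y.K_op \<mu> (\<lambda>y. F (x, y)) (vinv y))) x" for x
    unfolding JT lapl_clin[OF open_nonzero y' Y.smooth_on_T[OF sl] Q(1)] Y.lapl_T[OF y sl, of \<mu>, folded w'_def]
    by (rule TQ[where H="\<lambda>x. Y.K_op \<mu> (\<lambda>y. F (x, y))"])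
  have l2: "Y.K_op \<mu> (\<lambda>y. J w w' x y (F (vinv x, vinv y))) y
      = X.T w (\<lambda>x. R (lapl (\<lambda>y. F (x, y)) (vinv y))) x" for x
    unfolding JT Y.K_op_clin[OF open_nonzero y' Y.smooth_on_T[OF sl] Q] Y.K_op_T[OF y sl, of \<mu>, folded w'_def]
    by (rule TQ[where H="\<lambda>x. lapl (\<lambda>y. F (x, y))"])
  have l3: "Y.P_op \<mu> j (\<lambda>y. J w w' x y (F (vinv x, vinv y))) y
      = X.T w (\<lambda>x. R (Y.P_op \<mu> j (\<lambda>y. F (x, y)) (vinv y))) x" for x j
    unfolding JT Y.P_op_clin[OF open_nonzero y' Y.smooth_on_T[OF sl] Q] Y.P_op_T[OF y sl, of \<mu>, folded w'_def]
    by (rule TQ[where H="\<lambda>x. Y.P_op \<mu> j (\<lambda>y. F (x, y))"])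
  show ?thesis
    unfolding E_def prod.case l1 l2 l3
    unfolding X.K_op_T[OF x smR[OF sm(3)], of l, folded w_def] X.lapl_T[OF x smR[OF sm(1)], of l, folded w_def]
      X.P_op_T[OF x smR[OF sm(2)], of l, folded w_def]
    unfolding lapl_clin[OF open_UNIV UNIV_I smU[OF sm(3)] R(1)]
      X.K_op_clin[OF open_UNIV UNIV_I smU[OF sm(1)] R]
      X.P_op_clin[OF open_UNIV UNIV_I smU[OF sm(2)] R] JR
    \<comment> \<open>The interchange of K and the Laplacian shows up here as commutativity of the
      first two summands.\<close>
    by (simp add: clin_simps[OF clin_J] add.commute)
qed

lemma smooth_on_J:
  assumes "smooth F"
  shows "smooth_on ((- {0}) \<times> (- {0})) (\<lambda>(x, y). J w w' x y (F (vinv x, vinv y)))"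
proof -
  let ?W = "(- {0 :: real^'n}) \<times> (- {0 :: real^'n})"
  have W: "open ?W" by (intro open_Times open_nonzero)
  have comp: "smooth_on ?W (\<lambda>p. f (fst p))" "smooth_on ?W (\<lambda>p. f (snd p))"
    if "smooth_on (- {0}) f" for f :: "real^'n \<Rightarrow> 'z::real_normed_vector"
    by (rule smooth_on_compose[OF W open_nonzero _ that smooth_on_linear[OF bounded_linear_fst W]], auto)
      (rule smooth_on_compose[OF W open_nonzero _ that smooth_on_linear[OF bounded_linear_snd W]], auto)
  have pair: "smooth_on ?W (\<lambda>p. (vinv (fst p), vinv (snd p)))"
  proof -
    have "smooth_on ?W (\<lambda>p. (\<lambda>x. (x, 0)) (vinv (fst p)) + (\<lambda>x. (0, x)) (vinv (snd p)))"
      by (intro smooth_on_add[OF W] smooth_on_bounded_linear[OF bounded_linear_Pair W] comp smooth_on_vinv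
          bounded_linear_ident bounded_linear_zero)
    then show ?thesis by simp
  qed
  have FF: "smooth_on ?W (\<lambda>p. F (vinv (fst p), vinv (snd p)))"
    by (rule smooth_on_compose[OF W open_UNIV _ _ pair]) (auto simp: smooth_on_UNIV assms)
  have "smooth_on ?W (\<lambda>p. J w w' (fst p) (snd p) (F (vinv (fst p), vinv (snd p))))"
    unfolding J_def
    by (intro smooth_on_bilinear[OF X.bounded_bilinear_G W] smooth_on_bilinear[OF Y.bounded_bilinear_G W]
        smooth_on_bilinear[OF bounded_bilinear_smult W] comp(1)[OF smooth_on_cpow] comp(2)[OF smooth_on_cpow]
        smooth_on_linear[OF bounded_linear_fst W] smooth_on_linear[OF bounded_linear_snd W] FF)
  then show ?thesis by (simp only: case_prod_unfold)
qed

end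

section \<open>Comparison of the pairing with the source operator\<close>

lemma lapl_diff:
  assumes "open W" "x \<in> W" "smooth_on W f" "smooth_on W h"
  shows "lapl (\<lambda>x. f x - h x) x = lapl f x - lapl h x"
  using lapl_add[OF assms(1-3) smooth_on_clin[OF clin_neg assms(1,4)]] lapl_clin[OF assms(1,2,4) clin_neg]
  by simp

lemma lapl_sum:
  assumes "open W" "x \<in> W" "\<And>i. i \<in> I \<Longrightarrow> smooth_on W (f i)"
  shows "lapl (\<lambda>x. \<Sum>i\<in>I. f i x) x = (\<Sum>i\<in>I. lapl (f i) x)"
proof -
  have 0: "lapl (\<lambda>x. 0 :: complex^'t::finite) x = 0"
    using lapl_clin[OF assms(1,2) smooth_on_const[of W 0] clin_const0] by simp
  show ?thesis using assms(3)
  proof (induction I rule: infinite_finite_induct)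
    case (insert i I)
    then show ?case
      using lapl_add[OF assms(1,2), of "f i" "\<lambda>x. \<Sum>i\<in>I. f i x"] smooth_on_sum[OF assms(1), of I f]
      by simp
  qed (simp_all add: 0)
qed

lemma (in clifford_ops) P_op_diff:
  assumes "open W" "x \<in> W" "smooth_on W f" "smooth_on W h"
  shows "P_op l j (\<lambda>x. f x - h x) x = P_op l j f x - P_op l j h x"
  using P_op_add[OF assms(1-3) smooth_on_clin[OF clin_neg assms(1,4)]] P_op_clin[OF assms(1,2,4) clin_neg]
  by (simp add: g_simps)

context clifford_pair
begin

text \<open>The squares |x|^2 and |y|^2 from the two K operators combine with -2 (x . y) from the P
  operators to |x - y|^2, and the coefficients linear in x or y combine in the same way. So the
  coefficients depend on x - y only, which is the translation invariance.\<close>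

lemma E_expand:
  fixes F :: "(real^'n) \<times> (real^'n) \<Rightarrow> complex^'t" and l \<mu> :: complex
  assumes W: "open W" "(x, y) \<in> W" and F: "smooth_on W F"
  defines "Ly \<equiv> slice_y lapl F" and "Dy \<equiv> slice_y Y.dirac F" and "py \<equiv> \<lambda>j. slice_y (pd j) F"
    and "a \<equiv> 2 * l - of_nat CARD('n) + 1" and "b \<equiv> 2 * \<mu> - of_nat CARD('n) + 1"
  shows "E l \<mu> F x y = (norm (x - y))\<^sup>2 *\<^sub>R slice_x lapl Ly (x, y)
      + (2 * a) *s (\<Sum>j\<in>UNIV. (x $ j - y $ j) *\<^sub>R slice_x (pd j) Ly (x, y))
      + (2 * b) *s (\<Sum>j\<in>UNIV. (y $ j - x $ j) *\<^sub>R slice_x lapl (py j) (x, y))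
      - 2 *s X.G (x - y) (slice_x X.dirac Ly (x, y))
      - 2 *s Y.G (y - x) (slice_x lapl Dy (x, y))
      + (b * (2 * \<mu> + 1)) *s slice_x lapl F (x, y)
      + (a * (2 * l + 1)) *s Ly (x, y)
      - (2 * a * b) *s (\<Sum>j\<in>UNIV. slice_x (pd j) (py j) (x, y))
      + (2 * a) *s (\<Sum>j\<in>UNIV. gy j (slice_x (pd j) Dy (x, y)))
      + (2 * b) *s (\<Sum>j\<in>UNIV. gx j (slice_x X.dirac (py j) (x, y)))
      - 2 *s (\<Sum>j\<in>UNIV. gx j (gy j (slice_x X.dirac Dy (x, y))))"
proof -
  define V where "V = {x. (x, y) \<in> W}"
  have V: "open V" "x \<in> V" using W open_slice(1) by (auto simp: V_def)
  have sm: "smooth_on V (\<lambda>x. Ly (x, y))" "smooth_on V (\<lambda>x. Dy (x, y))" "smooth_on V (\<lambda>x. py j (x, y))"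
    "smooth_on V (\<lambda>x. F (x, y))" for j
    unfolding V_def Ly_def Dy_def py_def
    by (intro smooth_on_slice(1)[OF W(1)] smooth_on_slice_lapl Y.smooth_on_slice_dirac
        smooth_on_slice_pd F W(1))+
  have smc: "smooth_on V (\<lambda>x. M (f x))" if "clin M" "smooth_on V f"
    for M :: "complex^'t \<Rightarrow> complex^'t" and f :: "real^'n \<Rightarrow> complex^'t"
    by (rule smooth_on_clin[OF that(1) V(1) that(2)])
  have T1: "X.K_op l (\<lambda>x. lapl (\<lambda>y. F (x, y)) y) x = (x \<bullet> x) *\<^sub>R slice_x lapl Ly (x, y)
      + (2 * a) *s (\<Sum>j\<in>UNIV. x $ j *\<^sub>R slice_x (pd j) Ly (x, y)) - 2 *s X.G x (slice_x X.dirac Ly (x, y))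
      + (a * (2 * l + 1)) *s Ly (x, y)"
    by (simp add: X.K_op_def euler_def slice_x_def slice_y_def Ly_def a_def)
  have spy: "smooth_on V (\<lambda>x. \<Sum>j\<in>UNIV. y $ j *\<^sub>R py j (x, y))"
    by (rule smooth_on_sum[OF V(1)]) (rule smc[OF clin_scale sm(3)])
  note s1 = smc[OF clin_scale sm(1), of "y \<bullet> y"] and s2 = smc[OF clin_smult_const spy, of "2 * b"]
    and s3 = smc[OF clin_smult_const smc[OF Y.clin_G sm(2)], of 2 y]
    and s4 = smc[OF clin_smult_const sm(4), of "b * (2 * \<mu> + 1)"]
  have fe: "(\<lambda>x. Y.K_op \<mu> (\<lambda>y. F (x, y)) y) = (\<lambda>x. (y \<bullet> y) *\<^sub>R Ly (x, y)
      + (2 * b) *s (\<Sum>j\<in>UNIV. y $ j *\<^sub>R py j (x, y)) - 2 *s Y.G y (Dy (x, y))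
      + (b * (2 * \<mu> + 1)) *s F (x, y))"
    by (simp add: Y.K_op_def euler_def slice_x_def slice_y_def Ly_def Dy_def py_def b_def)
  have "lapl (\<lambda>x. Y.K_op \<mu> (\<lambda>y. F (x, y)) y) x = lapl (\<lambda>x. (y \<bullet> y) *\<^sub>R Ly (x, y)) x
      + lapl (\<lambda>x. (2 * b) *s (\<Sum>j\<in>UNIV. y $ j *\<^sub>R py j (x, y))) x - lapl (\<lambda>x. 2 *s Y.G y (Dy (x, y))) x
      + lapl (\<lambda>x. (b * (2 * \<mu> + 1)) *s F (x, y)) x"
    by (simp only: fe lapl_add[OF V smooth_on_diff[OF V(1) smooth_on_add[OF V(1) s1 s2] s3] s4]
        lapl_diff[OF V smooth_on_add[OF V(1) s1 s2] s3] lapl_add[OF V s1 s2])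
  also have "\<dots> = (y \<bullet> y) *\<^sub>R lapl (\<lambda>x. Ly (x, y)) x
      + (2 * b) *s (\<Sum>j\<in>UNIV. y $ j *\<^sub>R lapl (\<lambda>x. py j (x, y)) x) - 2 *s Y.G y (lapl (\<lambda>x. Dy (x, y)) x)
      + (b * (2 * \<mu> + 1)) *s lapl (\<lambda>x. F (x, y)) x"
  proof -
    have "lapl (\<lambda>x. \<Sum>j\<in>UNIV. y $ j *\<^sub>R py j (x, y)) x = (\<Sum>j\<in>UNIV. lapl (\<lambda>x. y $ j *\<^sub>R py j (x, y)) x)"
      by (rule lapl_sum[OF V]) (rule smc[OF clin_scale sm(3)])
    also have "\<dots> = (\<Sum>j\<in>UNIV. y $ j *\<^sub>R lapl (\<lambda>x. py j (x, y)) x)"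
      by (rule sum.cong[OF refl]) (rule lapl_clin[OF V sm(3) clin_scale])
    finally have "lapl (\<lambda>x. (2 * b) *s (\<Sum>j\<in>UNIV. y $ j *\<^sub>R py j (x, y))) x
        = (2 * b) *s (\<Sum>j\<in>UNIV. y $ j *\<^sub>R lapl (\<lambda>x. py j (x, y)) x)"
      using lapl_clin[OF V spy clin_smult_const[of "2 * b"]] by simp
    moreover have "lapl (\<lambda>x. 2 *s Y.G y (Dy (x, y))) x = 2 *s Y.G y (lapl (\<lambda>x. Dy (x, y)) x)"
      using lapl_clin[OF V smc[OF Y.clin_G sm(2), of y] clin_smult_const[of 2]]
        lapl_clin[OF V sm(2) Y.clin_G[of y]] by simp
    ultimately show ?thesis
      using lapl_clin[OF V sm(1) clin_scale[of "y \<bullet> y"]]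
        lapl_clin[OF V sm(4) clin_smult_const[of "b * (2 * \<mu> + 1)"]] by presburger
  qed
  finally have T2: "lapl (\<lambda>x. Y.K_op \<mu> (\<lambda>y. F (x, y)) y) x = (y \<bullet> y) *\<^sub>R slice_x lapl Ly (x, y)
      + (2 * b) *s (\<Sum>j\<in>UNIV. y $ j *\<^sub>R slice_x lapl (py j) (x, y)) - 2 *s Y.G y (slice_x lapl Dy (x, y))
      + (b * (2 * \<mu> + 1)) *s slice_x lapl F (x, y)"
    by (simp add: slice_x_def)
  have T3: "X.P_op l j (\<lambda>x. Y.P_op \<mu> j (\<lambda>y. F (x, y)) y) x =
      y $ j *\<^sub>R (x $ j *\<^sub>R slice_x lapl Ly (x, y) + a *s slice_x (pd j) Ly (x, y) - gx j (slice_x X.dirac Ly (x, y)))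
      + b *s (x $ j *\<^sub>R slice_x lapl (py j) (x, y) + a *s slice_x (pd j) (py j) (x, y) - gx j (slice_x X.dirac (py j) (x, y)))
      - gy j (x $ j *\<^sub>R slice_x lapl Dy (x, y) + a *s slice_x (pd j) Dy (x, y) - gx j (slice_x X.dirac Dy (x, y)))"
    for j
  proof -
    have gyx: "gy k (gx i u) = gx i (gy k u)" for i k u by (rule gx_gy[symmetric])
    note t1 = smc[OF clin_scale sm(1), of "y $ j"] and t2 = smc[OF clin_smult_const sm(3), of b j]
      and t3 = smc[OF Y.clin_g sm(2), of j]
    have fe: "(\<lambda>x. Y.P_op \<mu> j (\<lambda>y. F (x, y)) y) =
        (\<lambda>x. y $ j *\<^sub>R Ly (x, y) + b *s py j (x, y) - gy j (Dy (x, y)))"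
      by (simp add: Y.P_op_def slice_x_def slice_y_def Ly_def Dy_def py_def b_def)
    have "X.P_op l j (\<lambda>x. Y.P_op \<mu> j (\<lambda>y. F (x, y)) y) x = X.P_op l j (\<lambda>x. y $ j *\<^sub>R Ly (x, y)) x + X.P_op l j (\<lambda>x. b *s py j (x, y)) x
        - X.P_op l j (\<lambda>x. gy j (Dy (x, y))) x"
      by (simp only: fe X.P_op_diff[OF V smooth_on_add[OF V(1) t1 t2] t3] X.P_op_add[OF V t1 t2])
    also have "\<dots> = y $ j *\<^sub>R X.P_op l j (\<lambda>x. Ly (x, y)) x + b *s X.P_op l j (\<lambda>x. py j (x, y)) x
        - gy j (X.P_op l j (\<lambda>x. Dy (x, y)) x)"
      using X.P_op_clin[OF V sm(1) clin_scale, of "y $ j" l j] X.P_op_clin[OF V sm(3) clin_smult_const, of b l j]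
        X.P_op_clin[OF V sm(2) Y.clin_g, of j l j] gyx by (simp add: X.g_simps)
    finally show ?thesis by (simp add: X.P_op_def slice_x_def a_def)
  qed
  have nrm: "(norm (x - y))\<^sup>2 = x \<bullet> x + y \<bullet> y - 2 * (\<Sum>j\<in>UNIV. x $ j * y $ j)"
    unfolding power2_norm_eq_inner inner_sum_components[of x y, symmetric]
    by (simp add: inner_diff inner_commute)
  have Gd: "X.G (x - y) u = X.G x u - X.G y u" "Y.G (y - x) u = Y.G y u - Y.G x u" for u
    using X.G_add[of "x - y" y u] Y.G_add[of "y - x" x u] by simp_all
  have Gy: "X.G y u = (\<Sum>j\<in>UNIV. y $ j *\<^sub>R gx j u)" "Y.G x u = (\<Sum>j\<in>UNIV. x $ j *\<^sub>R gy j u)" for u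
    by (simp_all add: X.G_def Y.G_def)
  show ?thesis
    unfolding E_def T1 T2 T3 nrm Gd Gy
    by (simp add: vcomp X.g_simps Y.g_simps gx_gy sum.distrib sum_subtractf sum_distrib_left
        sum_distrib_right algebra_simps)
qed

end

lemma kron_mult_vec:
  fixes A B C D :: "complex^'s::finite^'s"
  shows "kron A B *v (kron C D *v u) = kron (A ** C) (B ** D) *v u"
proof -
  have "kron A B ** kron C D = kron (A ** C) (B ** D)"
  proof -
    have "(kron A B ** kron C D) $ p $ r = kron (A ** C) (B ** D) $ p $ r" for p r
    proof -
      have "(kron A B ** kron C D) $ p $ r = (\<Sum>q\<in>UNIV \<times> UNIV.
          (A $ fst p $ fst q * C $ fst q $ fst r) * (B $ snd p $ snd q * D $ snd q $ snd r))"
        by (simp add: kron_def matrix_matrix_mult_def mult_ac)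
      also have "\<dots> = (\<Sum>a\<in>UNIV. \<Sum>b\<in>UNIV.
          (A $ fst p $ a * C $ a $ fst r) * (B $ snd p $ b * D $ b $ snd r))"
        by (simp add: sum.cartesian_product split_beta)
      also have "\<dots> = kron (A ** C) (B ** D) $ p $ r"
        by (simp only: kron_def matrix_matrix_mult_def sum_product vec_lambda_beta)
      finally show ?thesis .
    qed
    then show ?thesis by (simp add: vec_eq_iff)
  qed
  then show ?thesis by (simp add: matrix_vector_mul_assoc)
qed

lemma kron_mat_1: "kron (mat 1) (mat 1) = (mat 1 :: complex^('s::finite \<times> 's)^('s \<times> 's))"
  by (auto simp: kron_def mat_def vec_eq_iff prod_eq_iff)

lemma kron_add_left: "kron (A + B) C *v u = kron A C *v u + kron B C *v u"
  and kron_add_right: "kron A (B + C) *v u = kron A B *v u + kron A C *v u"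
  by (simp_all add: kron_def vec_eq_iff matrix_vector_mult_def sum.distrib[symmetric] algebra_simps)

lemma kron_scaleR_left: "kron (r *\<^sub>R A) C *v u = r *\<^sub>R (kron A C *v u)"
  and kron_scaleR_right: "kron A (r *\<^sub>R C) *v u = r *\<^sub>R (kron A C *v u)"
  by (simp_all add: kron_def vec_eq_iff matrix_vector_mult_def scaleR_sum_right)

lemma clifford_module_simps:
  assumes "clifford_module \<rho>"
  shows "\<rho> (cl_cpx (a + b)) = \<rho> (cl_cpx a) + \<rho> (cl_cpx b)"
    and "\<rho> (cl_cpx (a * b)) = \<rho> (cl_cpx a) ** \<rho> (cl_cpx b)"
    and "\<rho> (cl_cpx (r *\<^sub>R a)) = r *\<^sub>R \<rho> (cl_cpx a)"
    and "\<rho> (cl_cpx 1) = mat 1"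
proof -
  have 1: "cl_cpx (a + b) = cl_cpx a + cl_cpx b" by (simp add: plus_complexification_def)
  have 2: "cl_cpx (a * b) = cl_cpx a * cl_cpx b" by (simp add: times_complexification_def)
  have 3: "cl_cpx (r *\<^sub>R a) = cpx_scale (of_real r) (cl_cpx a)" by (simp add: cpx_scale_def)
  show "\<rho> (cl_cpx (a + b)) = \<rho> (cl_cpx a) + \<rho> (cl_cpx b)"
    "\<rho> (cl_cpx (a * b)) = \<rho> (cl_cpx a) ** \<rho> (cl_cpx b)"
    using assms unfolding 1 2 clifford_module_def by blast+
  have "\<rho> (cpx_scale (of_real r) (cl_cpx a)) = (\<chi> i j. of_real r * \<rho> (cl_cpx a) $ i $ j)"
    using assms unfolding clifford_module_def by blast
  then show "\<rho> (cl_cpx (r *\<^sub>R a)) = r *\<^sub>R \<rho> (cl_cpx a)"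
    unfolding 3 by (simp add: vec_eq_iff vector_scaleR_component scaleR_conv_of_real[where 'a=complex])
  show "\<rho> (cl_cpx 1) = mat 1"
    using assms by (simp add: clifford_module_def one_complexification_def)
qed

lemma clifford_module_e:
  assumes "clifford_module \<rho>"
  shows "\<rho> (cl_e i) ** \<rho> (cl_e j) + \<rho> (cl_e j) ** \<rho> (cl_e i) = (if i = j then - 2 else 0) *\<^sub>R mat 1"
proof -
  have "\<rho> (cl_e i) ** \<rho> (cl_e j) + \<rho> (cl_e j) ** \<rho> (cl_e i) = \<rho> (cl_cpx ((2 * qprod (stdb i :: real^'a) (stdb j)) *\<^sub>R 1))"
    by (simp add: clifford_module_simps[OF assms] cvec_clifford[symmetric])
  then show ?thesis
    unfolding clifford_module_simps(3,4)[OF assms] by (simp add: qprod_vec_def inner_axis_axis)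
qed

abbreviation opx :: "('n::finite, 's::finite) cl_hom \<Rightarrow> 'n \<Rightarrow> complex^('s \<times> 's) \<Rightarrow> complex^('s \<times> 's)" where
  "opx \<rho> j \<equiv> (*v) (kron (\<rho> (cl_e j)) (mat 1))"

abbreviation opy :: "('n::finite, 's::finite) cl_hom \<Rightarrow> 'n \<Rightarrow> complex^('s \<times> 's) \<Rightarrow> complex^('s \<times> 's)" where
  "opy \<rho>' j \<equiv> (*v) (kron (mat 1) (\<rho>' (cl_e j)))"

lemma clifford_pair_kron:
  fixes \<rho> \<rho>' :: "('n::finite, 's::finite) cl_hom"
  assumes "clifford_module \<rho>" "clifford_module \<rho>'"
  shows "clifford_pair (opx \<rho>) (opy \<rho>')"
proof
  fix i j :: 'n and u :: "complex^('s \<times> 's)"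
  show "clin (opx \<rho> j)" "clin (opy \<rho>' j)" by (rule clin_matrix)+
  show "opx \<rho> i (opx \<rho> j u) + opx \<rho> j (opx \<rho> i u) = (if i = j then - 2 else 0) *s u"
    by (simp add: kron_mult_vec kron_add_left[symmetric] clifford_module_e[OF assms(1)]
        kron_scaleR_left kron_mat_1 scaleR_eq_smult del: scaleR_minus_left)
  show "opy \<rho>' i (opy \<rho>' j u) + opy \<rho>' j (opy \<rho>' i u) = (if i = j then - 2 else 0) *s u"
    by (simp add: kron_mult_vec kron_add_right[symmetric] clifford_module_e[OF assms(2)]
        kron_scaleR_right kron_mat_1 scaleR_eq_smult del: scaleR_minus_left)
  show "opx \<rho> i (opy \<rho>' j u) = opy \<rho>' j (opx \<rho> i u)"
    by (simp add: kron_mult_vec)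
qed

lemma dx_cong_open:
  assumes "open W" "p \<in> W" "\<And>q. q \<in> W \<Longrightarrow> F q = H q"
  shows "dx j F p = dx j H p" "dy j F p = dy j H p"
  unfolding dx_def dy_def by (simp_all add: frechet_derivative_cong_open[OF assms])

lemma lap_cong_open:
  assumes "open W" "p \<in> W" "\<And>q. q \<in> W \<Longrightarrow> F q = H q"
  shows "lap_x F p = lap_x H p" "lap_y F p = lap_y H p"
    "dirac_x \<rho> F p = dirac_x \<rho> H p" "dirac_y \<rho> F p = dirac_y \<rho> H p"
proof -
  have 1: "dx j (dx j F) p = dx j (dx j H) p" "dy j (dy j F) p = dy j (dy j H) p" for j
    by (rule dx_cong_open(1)[OF assms(1,2)], rule dx_cong_open(1)[OF assms(1) _ assms(3)], assumption+)
      (rule dx_cong_open(2)[OF assms(1,2)], rule dx_cong_open(2)[OF assms(1) _ assms(3)], assumption+)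
  then show "lap_x F p = lap_x H p" "lap_y F p = lap_y H p" by (simp_all add: lap_x_def lap_y_def)
  show "dirac_x \<rho> F p = dirac_x \<rho> H p" "dirac_y \<rho> F p = dirac_y \<rho> H p"
    by (simp_all add: dirac_x_def dirac_y_def dx_cong_open[OF assms])
qed

text \<open>Locality is what allows \<open>pi_tensor\<close> to be replaced by an explicit smooth
  formula, or by 0, on a neighbourhood of the point considered.\<close>

lemma source_op_cong_open:
  fixes F :: "('n::finite, 's::finite) field2"
  assumes "open W" "p \<in> W" "\<And>q. q \<in> W \<Longrightarrow> F q = H q"
  shows "source_op \<rho> \<rho>' l \<mu> F p = source_op \<rho> \<rho>' l \<mu> H p"
proof -
  note c = dx_cong_open[OF assms(1)] lap_cong_open[OF assms(1)]
  have d1: "lap_y F q = lap_y H q" "dy j F q = dy j H q" "dirac_y \<rho>' F q = dirac_y \<rho>' H q" if "q \<in> W" for q j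
    by (rule c[OF that assms(3)], assumption)+
  note d2 = c[OF assms(2) d1(1)] c[OF assms(2) d1(2)] c[OF assms(2) d1(3)] c[OF assms(2,3)]
  obtain x y where p: "p = (x, y)" by (cases p)
  show ?thesis
    unfolding source_op_def p prod.case using d2[unfolded p] by (simp only: simp_thms)
qed

lemma slice_dx:
  assumes "open W" "p \<in> W" "smooth_on W H" "\<And>q. q \<in> W \<Longrightarrow> F q = H q"
  shows "dx j F p = slice_x (pd j) H p" "dy j F p = slice_y (pd j) H p"
  unfolding slice_pd[OF smooth_on_differentiable[OF assms(3,2)]] dx_def dy_def
  by (simp_all add: frechet_derivative_cong_open[OF assms(1,2,4)])

lemma slice_lap:
  assumes "open W" "p \<in> W" "smooth_on W H" "\<And>q. q \<in> W \<Longrightarrow> F q = H q"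
  shows "lap_x F p = slice_x lapl H p" "lap_y F p = slice_y lapl H p"
proof -
  have 1: "dx j (dx j F) p = slice_x (pd j) (slice_x (pd j) H) p" "dy j (dy j F) p = slice_y (pd j) (slice_y (pd j) H) p" for j
    by (rule slice_dx(1)[OF assms(1,2) smooth_on_slice_pd(1)[OF assms(1,3)]],
        rule slice_dx(1)[OF assms(1) _ assms(3,4)], assumption+)
      (rule slice_dx(2)[OF assms(1,2) smooth_on_slice_pd(2)[OF assms(1,3)]],
        rule slice_dx(2)[OF assms(1) _ assms(3,4)], assumption+)
  then show "lap_x F p = slice_x lapl H p" "lap_y F p = slice_y lapl H p"
    by (simp_all add: lap_x_def lap_y_def slice_lapl)
qed

lemma source_op_eq_E:
  fixes \<rho> \<rho>' :: "('n::finite, 's::finite) cl_hom" and F :: "('n, 's) field2"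
  assumes \<rho>: "clifford_module \<rho>" "clifford_module \<rho>'" and W: "open W" "(x, y) \<in> W" and F: "smooth_on W F"
  shows "source_op \<rho> \<rho>' l \<mu> F (x, y) = clifford_pair.E (opx \<rho>) (opy \<rho>') l \<mu> F x y"
proof -
  interpret clifford_pair "opx \<rho>" "opy \<rho>'" by (rule clifford_pair_kron[OF \<rho>])
  have dirac: "dirac_x \<rho> F' p = slice_x X.dirac H p" "dirac_y \<rho>' F' p = slice_y Y.dirac H p"
    if "p \<in> W" "smooth_on W H" "\<And>q. q \<in> W \<Longrightarrow> F' q = H q" for F' H p
  proof -
    have "dirac_x \<rho> F' p = (\<Sum>j\<in>UNIV. opx \<rho> j (slice_x (pd j) H p))"
      "dirac_y \<rho>' F' p = (\<Sum>j\<in>UNIV. opy \<rho>' j (slice_y (pd j) H p))"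
      by (simp_all only: dirac_x_def dirac_y_def slice_dx[OF W(1) that])
    moreover have "slice_x X.dirac H p = (\<Sum>j\<in>UNIV. opx \<rho> j (slice_x (pd j) H p))"
      "slice_y Y.dirac H p = (\<Sum>j\<in>UNIV. opy \<rho>' j (slice_y (pd j) H p))"
      by (simp_all only: slice_x_def slice_y_def X.dirac_def Y.dirac_def case_prod_beta)
    ultimately show "dirac_x \<rho> F' p = slice_x X.dirac H p" "dirac_y \<rho>' F' p = slice_y Y.dirac H p"
      by simp_all
  qed
  note sl = slice_dx[OF W(1)] slice_lap[OF W(1)] dirac
  note y = sl(2,4,6)[OF _ F refl]
  have sm: "smooth_on W (slice_y lapl F)" "smooth_on W (slice_y Y.dirac F)" "smooth_on W (slice_y (pd j) F)" for j
    by (intro smooth_on_slice_lapl Y.smooth_on_slice_dirac smooth_on_slice_pd F W(1))+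
  have sx: "dx j F' (x, y) = slice_x (pd j) H (x, y)" "lap_x F' (x, y) = slice_x lapl H (x, y)"
    "dirac_x \<rho> F' (x, y) = slice_x X.dirac H (x, y)"
    if "smooth_on W H" "\<forall>q\<in>W. F' q = H q" for F' H j
    using that sl(1,3,5)[OF W(2) that(1), of F'] by blast+
  have yF: "\<forall>q\<in>W. lap_y F q = slice_y lapl F q" "\<forall>q\<in>W. dirac_y \<rho>' F q = slice_y Y.dirac F q"
    "\<forall>q\<in>W. dy j F q = slice_y (pd j) F q" "\<forall>q\<in>W. F q = F q" for j
    using y by blast+
  note x = sx[OF sm(1) yF(1)] sx[OF sm(2) yF(2)] sx[OF sm(3) yF(3)] sx[OF F yF(4)] y[OF W(2)]
  have G: "kron (\<rho> (cl_vec v)) (mat 1) *v u = X.G v u" "kron (mat 1) (\<rho>' (cl_vec v)) *v u = Y.G v u" for u v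
  proof -
    have lin: "linear (\<lambda>v. kron (\<rho> (cl_vec v)) (mat 1) *v u)" "linear (\<lambda>v. kron (mat 1) (\<rho>' (cl_vec v)) *v u)"
      by (intro linearI; simp add: cvec_add cvec_scaleR clifford_module_simps[OF \<rho>(1)] clifford_module_simps[OF \<rho>(2)]
          kron_add_left kron_add_right kron_scaleR_left kron_scaleR_right)+
    show "kron (\<rho> (cl_vec v)) (mat 1) *v u = X.G v u"
      unfolding X.G_def by (rule linear_expansion[OF lin(1)])
    show "kron (mat 1) (\<rho>' (cl_vec v)) *v u = Y.G v u"
      unfolding Y.G_def by (rule linear_expansion[OF lin(2)])
  qed
  have k: "kron (\<rho> (cl_e j)) (\<rho>' (cl_e j)) *v u = opx \<rho> j (opy \<rho>' j u)" for j u
    by (simp add: kron_mult_vec)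
  show ?thesis
    unfolding E_expand[OF W F] source_op_def prod.case Let_def x G[of "x - y"] G[of "y - x"] k ..
qed

section \<open>Products of vectors in Clifford algebras\<close>

lemma clifford_induct [case_names vec scal add mult]:
  fixes a :: "'v::quadratic_space clifford"
  assumes "\<And>x. P (cvec x)" "\<And>r. P (r *\<^sub>R 1)"
    and "\<And>a b. P a \<Longrightarrow> P b \<Longrightarrow> P (a + b)" "\<And>a b. P a \<Longrightarrow> P b \<Longrightarrow> P (a * b)"
  shows "P a"
proof (induction a rule: clifford.abs_induct)
  case (1 t)
  show ?case
  proof (induction t)
    case (Vec x)
    show ?case using assms(1)[of x] by (simp add: cvec.abs_eq)
  next
    case (Scal r)
    have "abs_clifford (Scal r) = r *\<^sub>R (1 :: 'v clifford)"
      by (simp add: one_clifford.abs_eq scaleR_clifford.abs_eq) (simp add: clifford.abs_eq_iff cl_scal_eq)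
    then show ?case using assms(2)[of r] by simp
  next
    case (Add a b)
    then show ?case using assms(3) by (metis plus_clifford.abs_eq)
  next
    case (Mul a b)
    then show ?case using assms(4) by (metis times_clifford.abs_eq)
  qed
qed

section \<open>Reversal and products of nonzero vectors\<close>

primrec rev_term :: "'v cl_term \<Rightarrow> 'v cl_term" where
  "rev_term (Vec x) = Vec x"
| "rev_term (Scal r) = Scal r"
| "rev_term (Add a b) = Add (rev_term a) (rev_term b)"
| "rev_term (Mul a b) = Mul (rev_term b) (rev_term a)"

lemma rev_term_cong: "cl_rel a b \<Longrightarrow> cl_rel (rev_term a) (rev_term b)"
proof (induction rule: cl_rel.induct)
  case (cl_sym a b)
  show ?case by (rule cl_rel.cl_sym[OF cl_sym.IH])
next
  case (cl_trans a b c)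
  show ?case by (rule cl_rel.cl_trans[OF cl_trans.IH])
next
  case (cl_add_minus a)
  show ?case
    unfolding rev_term.simps
    by (rule cl_rel.cl_trans[OF cl_rel.cl_add_cong[OF cl_rel.cl_sym[OF cl_scal_central] cl_refl] cl_rel.cl_add_minus])
next
  case (cl_mul_1 a)
  show ?case
    unfolding rev_term.simps by (rule cl_rel.cl_trans[OF cl_rel.cl_sym[OF cl_scal_central] cl_rel.cl_mul_1])
next
  case (cl_scal_mul r s)
  show ?case
    unfolding rev_term.simps mult.commute[of r s] by (rule cl_rel.cl_scal_mul)
next
  case (cl_vec_scaleR r x)
  show ?case
    unfolding rev_term.simps by (rule cl_rel.cl_trans[OF cl_rel.cl_vec_scaleR cl_scal_central])
next
  case (cl_clifford x y)
  show ?case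
    unfolding rev_term.simps qprod_commute[of x y] by (rule cl_rel.cl_clifford)
next
  case (cl_mul_assoc a b c)
  show ?case unfolding rev_term.simps by (rule cl_rel.cl_sym[OF cl_rel.cl_mul_assoc])
next
  case (cl_scal_central r a)
  show ?case unfolding rev_term.simps by (rule cl_rel.cl_sym[OF cl_rel.cl_scal_central])
next
  case (cl_mul_cong a a' b b')
  show ?case unfolding rev_term.simps by (rule cl_rel.cl_mul_cong[OF cl_mul_cong.IH(2,1)])
next
  case (cl_add_cong a a' b b')
  show ?case unfolding rev_term.simps by (rule cl_rel.cl_add_cong[OF cl_add_cong.IH])
qed (simp_all add: cl_refl cl_rel.cl_add_assoc cl_rel.cl_add_commute cl_rel.cl_add_0 cl_rel.cl_distrib_left
    cl_rel.cl_distrib_right cl_rel.cl_scal_add cl_rel.cl_vec_add)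

lift_definition crev :: "'v::quadratic_space clifford \<Rightarrow> 'v clifford" is rev_term
  by (rule rev_term_cong)

lemma crev_simps [simp]:
  "crev (cvec x) = cvec x" "crev (a + b) = crev a + crev b" "crev (a * b) = crev b * crev a"
  by (transfer, simp add: cl_refl)+

lemma crev_scaleR [simp]: "crev (r *\<^sub>R a) = r *\<^sub>R crev a"
  by transfer (simp add: cl_scal_central cl_sym)

lemma crev_1 [simp]: "crev 1 = 1"
  by transfer (simp add: cl_refl)

lemma crev_0 [simp]: "crev 0 = 0"
  using crev_scaleR[of 0 0] by simp

lemma crev_minus [simp]: "crev (- a) = - crev a"
  using crev_scaleR[of "- 1" a] by simp

lemma crev_diff [simp]: "crev (a - b) = crev a - crev b"
  using crev_simps(2)[of a "- b"] by simp

lemma crev_crev [simp]: "crev (crev a) = a"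
  by (induction a rule: clifford_induct) auto

lemma cvec_0 [simp]: "cvec 0 = (0 :: (real^'n::finite) clifford)"
  using cvec_scaleR[of 0 0] by simp

lemma cvec_minus: "cvec (- x) = - cvec (x :: real^'n::finite)"
  using cvec_scaleR[of "- 1" x] by simp

lemma cvec_diff: "cvec (x - y) = cvec x - cvec (y :: real^'n::finite)"
  using cvec_add[of x "- y"] by (simp add: cvec_minus)

lemma cvec_mult_self: "cvec x * cvec x = (- (x \<bullet> x)) *\<^sub>R (1 :: (real^'n::finite) clifford)"
proof -
  have "2 *\<^sub>R (cvec x * cvec x) = 2 *\<^sub>R ((- (x \<bullet> x)) *\<^sub>R (1 :: (real^'n) clifford))"
    using cvec_clifford[of x x] by (simp add: scaleR_2[symmetric] qprod_vec_def)
  then show ?thesis by (simp only: scaleR_cancel_left) simp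
qed

lemma cvec_mult_self_left: "cvec x * (cvec x * a) = (- (x \<bullet> x)) *\<^sub>R (a :: (real^'n::finite) clifford)"
  by (simp add: mult.assoc[symmetric] cvec_mult_self)

lemma cvec_swap: "cvec x * cvec y = - (cvec y * cvec x) - (2 * (x \<bullet> y)) *\<^sub>R (1 :: (real^'n::finite) clifford)"
proof -
  have "cvec x * cvec y = (cvec x * cvec y + cvec y * cvec x) - cvec y * cvec x" by simp
  then show ?thesis unfolding cvec_clifford by (simp add: qprod_vec_def)
qed

lemma cvec_sandwich: "cvec x * cvec y * cvec x = cvec ((x \<bullet> x) *\<^sub>R y - (2 * (x \<bullet> y)) *\<^sub>R (x :: real^'n::finite))"
proof -
  have "cvec x * cvec y * cvec x = - (cvec y * (cvec x * cvec x)) - (2 * (x \<bullet> y)) *\<^sub>R cvec x"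
    unfolding cvec_swap[of x y] by (simp add: algebra_simps)
  then show ?thesis by (simp add: cvec_mult_self cvec_diff cvec_scaleR)
qed

text \<open>The Lipschitz group of products of nonzero vectors, not normalised. The flag is True for
  an even number of factors.\<close>

inductive lipschitz :: "bool \<Rightarrow> (real^'n::finite) clifford \<Rightarrow> bool" where
  lipschitz_1: "lipschitz True 1"
| lipschitz_vec: "x \<noteq> 0 \<Longrightarrow> lipschitz b z \<Longrightarrow> lipschitz (\<not> b) (cvec x * z)"

lemma lipschitz_cvec: "x \<noteq> 0 \<Longrightarrow> lipschitz False (cvec x)"
  using lipschitz_vec[OF _ lipschitz_1, of x] by simp

lemma lipschitz_scaleR:
  assumes "lipschitz b z" "c \<noteq> 0"
  shows "lipschitz b (c *\<^sub>R z :: (real^'n::finite) clifford)"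
  using assms(1)
proof cases
  case lipschitz_1
  \<comment> \<open>The empty product has no factor that could absorb c, so c is written as (c
    e)(-e) with a unit vector e. An index type is inhabited, hence \<open>undefined\<close> can
    serve as the index.\<close>
  define e :: "real^'n" where "e = axis undefined 1"
  have e: "e \<bullet> e = 1" by (simp add: e_def inner_axis_axis)
  have "e \<noteq> 0" using e by auto
  then have "lipschitz (\<not> \<not> True) (cvec (c *\<^sub>R e) * (cvec (- e) * 1 :: (real^'n) clifford))"
    using assms(2) by (intro lipschitz_vec lipschitz.lipschitz_1) auto
  moreover have "cvec (c *\<^sub>R e) * (cvec (- e) * 1) = c *\<^sub>R (1 :: (real^'n) clifford)"
    by (simp add: cvec_minus cvec_scaleR cvec_mult_self e)
  ultimately show ?thesis using lipschitz_1 by simp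
next
  case (lipschitz_vec x b' z')
  then show ?thesis using lipschitz.lipschitz_vec[of "c *\<^sub>R x" b' z'] assms(2) by (simp add: cvec_scaleR)
qed

lemma lipschitz_mult: "lipschitz b z \<Longrightarrow> lipschitz b' w \<Longrightarrow> lipschitz (b = b') (z * w)"
proof (induction rule: lipschitz.induct)
  case (lipschitz_vec x b z)
  have "((\<not> b) = b') = (\<not> (b = b'))" by auto
  then show ?case using lipschitz.lipschitz_vec[OF lipschitz_vec.hyps(1) lipschitz_vec.IH[OF lipschitz_vec.prems]] by (simp add: mult.assoc)
qed auto

definition bsign :: "bool \<Rightarrow> real" where "bsign b = (if b then 1 else - 1)"

text \<open>For one vector x the square is -|x|^2 and v -> x v x is |x|^2 times a reflection;
  \<kappa> is the product of the squared lengths. The power \<kappa>^2 in the last equation leaves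
  \<open>B\<close> with ratio 1/\<kappa>, which is the linear part of the action on points found in
  \<open>spin_normal_form\<close>.\<close>

lemma lipschitz_norm:
  fixes z :: "(real^'n::finite) clifford"
  assumes "lipschitz b z"
  obtains \<kappa> B where "\<kappa> > 0" "z * crev z = (bsign b * \<kappa>) *\<^sub>R 1" "crev z * z = (bsign b * \<kappa>) *\<^sub>R 1"
    and "\<And>v. z * cvec v * crev z = (\<kappa>\<^sup>2) *\<^sub>R cvec (B v)"
proof -
  have "\<exists>\<kappa> B. \<kappa> > 0 \<and> z * crev z = (bsign b * \<kappa>) *\<^sub>R 1 \<and> crev z * z = (bsign b * \<kappa>) *\<^sub>R 1
    \<and> (\<forall>v. z * cvec v * crev z = (\<kappa>\<^sup>2) *\<^sub>R cvec (B v))"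
    using assms
  proof (induction rule: lipschitz.induct)
    case lipschitz_1
    then show ?case by (intro exI[of _ 1] exI[of _ id]) (simp add: bsign_def)
  next
    case (lipschitz_vec x b z)
    then obtain \<kappa> B where IH: "\<kappa> > 0" "z * crev z = (bsign b * \<kappa>) *\<^sub>R 1" "crev z * z = (bsign b * \<kappa>) *\<^sub>R 1"
      "\<And>v. z * cvec v * crev z = (\<kappa>\<^sup>2) *\<^sub>R cvec (B v)" by blast
    define B' where "B' v = (1 / (x \<bullet> x)\<^sup>2) *\<^sub>R ((x \<bullet> x) *\<^sub>R B v - (2 * (x \<bullet> B v)) *\<^sub>R x)" for v
    have x: "x \<bullet> x > 0" using lipschitz_vec.hyps(1) by simp
    have s: "bsign (\<not> b) = - bsign b" by (simp add: bsign_def)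
    have 1: "cvec x * z * crev (cvec x * z) = cvec x * (z * crev z) * cvec x"
      "crev (cvec x * z) * (cvec x * z) = crev z * (cvec x * cvec x) * z"
      "cvec x * z * cvec v * crev (cvec x * z) = cvec x * (z * cvec v * crev z) * cvec x" for v
      by (simp_all add: mult.assoc)
    have "(\<kappa> * (x \<bullet> x))\<^sup>2 *\<^sub>R cvec (B' v) = \<kappa>\<^sup>2 *\<^sub>R cvec ((x \<bullet> x) *\<^sub>R B v - (2 * (x \<bullet> B v)) *\<^sub>R x)" for v
      using x by (simp add: B'_def cvec_scaleR power_mult_distrib)
    then have "cvec x * z * cvec v * crev (cvec x * z) = (\<kappa> * (x \<bullet> x))\<^sup>2 *\<^sub>R cvec (B' v)" for v
      unfolding 1 IH(4) by (simp add: cvec_sandwich)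
    moreover have "cvec x * z * crev (cvec x * z) = (bsign (\<not> b) * (\<kappa> * (x \<bullet> x))) *\<^sub>R 1"
      "crev (cvec x * z) * (cvec x * z) = (bsign (\<not> b) * (\<kappa> * (x \<bullet> x))) *\<^sub>R 1"
      unfolding 1 IH(2) cvec_mult_self by (simp_all add: cvec_mult_self IH(3) s mult_ac)
    ultimately show ?case using IH(1) x by (intro exI[of _ "\<kappa> * (x \<bullet> x)"] exI[of _ B']) simp
  qed
  then show ?thesis using that by blast
qed

text \<open>Each vector is scaled to unit length and the lengths are collected in e^t, the factor by
  which \<open>a_elt t\<close> acts on the first coordinate of the ideal.\<close>

lemma lipschitz_polar:
  fixes z :: "(real^'n::finite) clifford"
  assumes "lipschitz b z"
  obtains us t where "\<forall>u\<in>set us. norm u = 1" "even (length us) = b" "z = exp t *\<^sub>R prod_list (map cvec us)"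
proof -
  have "\<exists>us t. (\<forall>u\<in>set us. norm u = 1) \<and> even (length us) = b \<and> z = exp t *\<^sub>R prod_list (map cvec us)"
    using assms
  proof (induction rule: lipschitz.induct)
    case lipschitz_1
    then show ?case by (intro exI[of _ "[]"] exI[of _ 0]) simp
  next
    case (lipschitz_vec x b z)
    then obtain us t where IH: "\<forall>u\<in>set us. norm u = 1" "even (length us) = b"
      "z = exp t *\<^sub>R prod_list (map cvec us)" by blast
    have "cvec x = norm x *\<^sub>R cvec ((1 / norm x) *\<^sub>R x)" using lipschitz_vec.hyps(1) by (simp add: cvec_scaleR)
    moreover have "exp (t + ln (norm x)) = exp t * norm x" using lipschitz_vec.hyps(1) by (simp add: exp_add)
    ultimately have "cvec x * z = exp (t + ln (norm x)) *\<^sub>R prod_list (map cvec ((1 / norm x) *\<^sub>R x # us))"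
      by (simp add: IH(3) mult.commute)
    then show ?case using IH lipschitz_vec.hyps(1)
      by (intro exI[of _ "(1 / norm x) *\<^sub>R x # us"] exI[of _ "t + ln (norm x)"]) simp
  qed
  then show ?thesis using that by blast
qed

lemma unit_prod:
  "\<forall>u\<in>set us. norm u = 1 \<Longrightarrow> crev (prod_list (map cvec us)) * prod_list (map cvec us)
    = (bsign (even (length us))) *\<^sub>R (1 :: (real^'n::finite) clifford)
   \<and> prod_list (map cvec us) * crev (prod_list (map cvec us))
    = (bsign (even (length us))) *\<^sub>R (1 :: (real^'n::finite) clifford)
   \<and> lipschitz (even (length us)) (prod_list (map cvec us))"
proof (induction us)
  case Nil
  then show ?case by (simp add: bsign_def lipschitz_1)
next
  case (Cons x us)
  let ?z = "prod_list (map cvec us)"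
  have x: "x \<bullet> x = 1" "x \<noteq> 0" using Cons.prems by (auto simp: norm_eq_1)
  have 1: "cvec x * ?z * crev (cvec x * ?z) = cvec x * (?z * crev ?z) * cvec x"
    "crev (cvec x * ?z) * (cvec x * ?z) = crev ?z * (cvec x * cvec x) * ?z"
    by (simp_all add: mult.assoc)
  have IH: "crev ?z * ?z = bsign (even (length us)) *\<^sub>R 1" "?z * crev ?z = bsign (even (length us)) *\<^sub>R 1"
    "lipschitz (even (length us)) ?z"
    using Cons by auto
  have "lipschitz (even (length (x # us))) (cvec x * ?z)"
    using lipschitz_vec[OF x(2) IH(3)] by simp
  then show ?case
    by (simp only: list.map prod_list.Cons 1 IH cvec_mult_self x)
      (simp add: cvec_mult_self x IH bsign_def)
qed

lemma spin_compactD: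
  assumes "m \<in> spin_compact"
  shows "crev m * m = 1" "m * crev m = 1" "lipschitz True m"
proof -
  obtain vs where vs: "m = prod_list (map cvec vs)" "even (length vs)" "\<forall>v\<in>set vs. norm v = 1"
    using assms unfolding spin_compact_def by blast
  show "crev m * m = 1" "m * crev m = 1" "lipschitz True m"
    using unit_prod[OF vs(3)] vs(2) by (simp_all add: vs(1) bsign_def)
qed

lemma lipschitz_True_polar:
  fixes z :: "(real^'n::finite) clifford"
  assumes "lipschitz True z"
  obtains m t where "m \<in> spin_compact" "z = exp t *\<^sub>R m"
proof -
  obtain us t where us: "\<forall>u\<in>set us. norm u = 1" "even (length us) = True"
    "z = exp t *\<^sub>R prod_list (map cvec us)" by (rule lipschitz_polar[OF assms])
  have "prod_list (map cvec us) \<in> spin_compact" unfolding spin_compact_def using us by auto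
  then show ?thesis using us(3) that by blast
qed

text \<open>Left multiplication on the left ideal generated by \<open>\<epsilon> = q p / 4\<close>, where \<open>p = e\<^sub>0 + e\<^sub>n\<^sub>+\<^sub>1\<close> and
  \<open>q = e\<^sub>0 - e\<^sub>n\<^sub>+\<^sub>1\<close>, in the coordinates \<open>(u, n)\<close> of \<open>\<epsilon> u + p n / 2\<close>. The element
  \<open>nbar_elt x\<close> sends \<open>\<epsilon>\<close> to \<open>(1, - x)\<close>, so that \<open>(u, - y u)\<close> represents the point \<open>y\<close> of
  \<open>\<real>\<^sup>n\<close> and \<open>(0, n)\<close> the point at infinity.\<close>

type_synonym 'n spinor2 = "(real^'n) clifford \<times> (real^'n) clifford"

primrec ideal_act_term :: "'n::finite lorentz cl_term \<Rightarrow> 'n spinor2 \<Rightarrow> 'n spinor2" where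
  "ideal_act_term (Vec v) s = (cvec (lor_mid v) * fst s + (lor_first v - lor_last v) *\<^sub>R snd s,
     (lor_first v + lor_last v) *\<^sub>R fst s - cvec (lor_mid v) * snd s)"
| "ideal_act_term (Scal r) s = r *\<^sub>R s"
| "ideal_act_term (Add a b) s = ideal_act_term a s + ideal_act_term b s"
| "ideal_act_term (Mul a b) s = ideal_act_term a (ideal_act_term b s)"

lemma ideal_act_term_add: "ideal_act_term a (s + s') = ideal_act_term a s + ideal_act_term a s'"
  by (induction a arbitrary: s s') (simp_all add: algebra_simps)

lemma ideal_act_term_scaleR: "ideal_act_term a (r *\<^sub>R s) = r *\<^sub>R ideal_act_term a s"
  by (induction a arbitrary: s) (simp_all add: algebra_simps)

text \<open>The vector with components a, w, b acts by the Vahlen matrix with rows (w, a - b) and (a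
  + b, -w), whose square is a^2 - b^2 - |w|^2; this is the polarised form of that
  computation.\<close>

lemma ideal_act_term_clifford: "ideal_act_term (Vec x) (ideal_act_term (Vec y) s) + ideal_act_term (Vec y) (ideal_act_term (Vec x) s) = (2 * qprod x y) *\<^sub>R s"
proof -
  obtain a u b where x: "x = Lor a u b" by (cases x)
  obtain c v d where y: "y = Lor c v d" by (cases y)
  obtain f h where s: "s = (f, h)" by (cases s)
  have uv: "cvec u * (cvec v * k) = - (cvec v * (cvec u * k)) - (2 * (u \<bullet> v)) *\<^sub>R k" for k
    using arg_cong[where f="\<lambda>z. z * k", OF cvec_swap[of u v]] by (simp add: algebra_simps)
  have dbl: "(r * (t * 2)) *\<^sub>R k = (r * t) *\<^sub>R k + (r * t) *\<^sub>R k" for r t and k :: "(real^'a) clifford"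
    by (simp add: scaleR_add_left[symmetric])
  show ?thesis
    unfolding x y s by (simp add: qprod_lorentz_def uv dbl algebra_simps)
qed

lemma ideal_act_term_cong: "cl_rel a b \<Longrightarrow> ideal_act_term a s = ideal_act_term b s"
proof (induction arbitrary: s rule: cl_rel.induct)
  case (cl_clifford x y)
  show ?case using ideal_act_term_clifford[of x y s] by simp
next
  case (cl_vec_add x y)
  show ?case by (simp add: plus_lorentz_def cvec_add algebra_simps)
next
  case (cl_vec_scaleR r x)
  show ?case by (simp add: scaleR_lorentz_def cvec_scaleR algebra_simps)
qed (simp_all add: ideal_act_term_add ideal_act_term_scaleR algebra_simps)

lift_definition ideal_act :: "'n::finite lorentz clifford \<Rightarrow> 'n spinor2 \<Rightarrow> 'n spinor2" is ideal_act_term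
  by (rule ext) (rule ideal_act_term_cong)

lemma ideal_act_simps [simp]:
  "ideal_act (a * b) s = ideal_act a (ideal_act b s)" "ideal_act (a + b) s = ideal_act a s + ideal_act b s" "ideal_act 1 s = s"
  "ideal_act (r *\<^sub>R a) s = r *\<^sub>R ideal_act a s"
  by (transfer, simp)+

lemma ideal_act_cvec: "ideal_act (cvec (Lor a w b)) (u, n) = (cvec w * u + (a - b) *\<^sub>R n, (a + b) *\<^sub>R u - cvec w * n)"
  by (simp add: cvec.abs_eq[of "Lor a w b"] ideal_act.abs_eq)

lemma ideal_act_add: "ideal_act a (s + s') = ideal_act a s + ideal_act a s'"
  and ideal_act_scaleR: "ideal_act a (r *\<^sub>R s) = r *\<^sub>R ideal_act a s"
  by (induction a rule: clifford.abs_induct) (simp_all add: ideal_act.abs_eq ideal_act_term_add ideal_act_term_scaleR)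

definition rmul :: "'n::finite spinor2 \<Rightarrow> (real^'n) clifford \<Rightarrow> 'n spinor2" where
  "rmul s c = (fst s * c, snd s * c)"

text \<open>Entries of the group act from the left, so right multiplication commutes with them.
  Hence the image of (0, 1) determines the image of every (0, v).\<close>

lemma ideal_act_rmul: "ideal_act a (rmul s c) = rmul (ideal_act a s) c"
proof (induction a arbitrary: s rule: clifford_induct)
  case (vec v)
  then show ?case by (cases v; cases s) (simp add: rmul_def ideal_act_cvec algebra_simps)
qed (simp_all add: rmul_def algebra_simps)

lemma ideal_act_incl: "ideal_act (cl_incl a) (u, 0) = (a * u, 0)"
proof (induction a arbitrary: u rule: clifford_induct)
  case (vec v)
  then show ?case by (simp add: cl_incl_simps ideal_act_cvec)
qed (simp_all add: cl_incl_simps algebra_simps)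

definition pvec :: "'n::finite lorentz clifford" where "pvec = cvec (Lor 1 0 1)"
definition qvec :: "'n::finite lorentz clifford" where "qvec = cvec (Lor 1 0 (- 1))"

lemma pvec_eq: "lor_e0 + lor_en1 = pvec" and qvec_eq: "lor_e0 - lor_en1 = qvec"
proof -
  show "lor_e0 + lor_en1 = pvec" by (simp add: pvec_def cvec_add[symmetric] plus_lorentz_def)
  have "lor_e0 - lor_en1 = lor_e0 + (- 1) *\<^sub>R lor_en1" by simp
  then show "lor_e0 - lor_en1 = qvec"
    by (simp only: qvec_def cvec_add[symmetric] cvec_scaleR[symmetric]) (simp add: plus_lorentz_def scaleR_lorentz_def)
qed

lemma ideal_act_pvec: "ideal_act pvec (u, n) = (0, 2 *\<^sub>R u)" and ideal_act_qvec: "ideal_act qvec (u, n) = (2 *\<^sub>R n, 0)"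
  by (simp_all add: pvec_def qvec_def ideal_act_cvec)

lemma ideal_act_nbar: "ideal_act (nbar_elt x) (u, 0) = (u, - (cvec x * u))"
  by (simp add: nbar_elt_def pvec_eq ideal_act_pvec cl_incl_simps ideal_act_cvec)

lemma ideal_act_n: "ideal_act (n_elt z) (u, 0) = (u, 0)"
  by (simp add: n_elt_def qvec_eq ideal_act_qvec cl_incl_simps ideal_act_cvec)

lemma ideal_act_a: "ideal_act (a_elt t) (u, 0) = (exp t *\<^sub>R u, 0)"
  by (simp add: a_elt_def ideal_act_cvec scaleR_add_left[symmetric] cosh_def sinh_def field_simps)

text \<open>The factor in \<open>N\<close> fixes the generator of the ideal and drops out, and the
  other three factors act by explicit formulas. The state on the right therefore carries all data of
  the decomposition.\<close>

lemma is_decomp_ideal_act: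
  assumes "is_decomp h x y m t"
  shows "m \<in> spin_compact" and "ideal_act h (1, - cvec x) = (exp t *\<^sub>R m, - (cvec y * (exp t *\<^sub>R m)))"
proof -
  obtain z where z: "m \<in> spin_compact" "h * nbar_elt x = nbar_elt y * cl_incl m * a_elt t * n_elt z"
    using assms unfolding is_decomp_def by blast
  show "m \<in> spin_compact" by fact
  have "ideal_act h (1, - cvec x) = ideal_act (h * nbar_elt x) (1, 0)" by (simp add: ideal_act_nbar)
  also have "\<dots> = (exp t *\<^sub>R m, - (cvec y * (exp t *\<^sub>R m)))"
    unfolding z(2) by (simp add: ideal_act_nbar ideal_act_n ideal_act_a ideal_act_incl)
  finally show "ideal_act h (1, - cvec x) = (exp t *\<^sub>R m, - (cvec y * (exp t *\<^sub>R m)))" .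
qed

text \<open>The square of a difference of vectors is minus its squared length times 1, so a nonzero
  vector can only become 0 if 1 does.\<close>

lemma cvec_inj:
  assumes ne: "(1 :: (real^'n::finite) clifford) \<noteq> 0" and "cvec x = (cvec y :: (real^'n) clifford)"
  shows "x = y"
proof -
  have "cvec (x - y) = (0 :: (real^'n) clifford)" using assms(2) by (simp add: cvec_diff)
  then have "((x - y) \<bullet> (x - y)) *\<^sub>R (1 :: (real^'n) clifford) = 0"
    using cvec_mult_self[of "x - y"] by simp
  then show ?thesis using ne by simp
qed

definition conj_similarity :: "bool \<Rightarrow> (real^'n::finite) clifford \<Rightarrow> real \<Rightarrow> (real^'n \<Rightarrow> real^'n) \<Rightarrow> bool" where
  "conj_similarity b z \<kappa> B \<longleftrightarrow> \<kappa> > 0 \<and> z * crev z = (bsign b * \<kappa>) *\<^sub>R 1 \<and> crev z * z = (bsign b * \<kappa>) *\<^sub>R 1 \<and>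
     (\<forall>v. z * cvec v * crev z = \<kappa>\<^sup>2 *\<^sub>R cvec (B v)) \<and> similarity B (bsign b * \<kappa>)"

text \<open>\<open>B\<close> is given by an existence statement, but z v crev(z) is linear in v and
  \<open>cvec\<close> is injective, so \<open>B\<close> is linear. Comparing squares gives the
  lengths, and polarisation gives the inner products.\<close>

lemma lipschitz_conj_similarity:
  assumes ne: "(1 :: (real^'n::finite) clifford) \<noteq> 0" and "lipschitz b (z :: (real^'n) clifford)"
  obtains \<kappa> B where "conj_similarity b z \<kappa> B"
proof -
  obtain \<kappa> B where B: "\<kappa> > 0" "z * crev z = (bsign b * \<kappa>) *\<^sub>R 1" "crev z * z = (bsign b * \<kappa>) *\<^sub>R 1"
    "\<And>v. z * cvec v * crev z = (\<kappa>\<^sup>2) *\<^sub>R cvec (B v)" by (rule lipschitz_norm[OF assms(2)]) blast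
  have Bv: "cvec (B v) = (1 / \<kappa>\<^sup>2) *\<^sub>R (z * cvec v * crev z)" for v using B(1) by (simp add: B(4))
  have lin: "linear B"
  proof (rule linearI)
    fix v w and r :: real
    show "B (v + w) = B v + B w"
      by (rule cvec_inj[OF ne]) (simp add: Bv cvec_add algebra_simps)
    show "B (r *\<^sub>R v) = r *\<^sub>R B v"
      by (rule cvec_inj[OF ne]) (simp add: Bv cvec_scaleR algebra_simps)
  qed
  have s: "bsign b * bsign b = 1" by (simp add: bsign_def)
  have sq: "\<kappa>\<^sup>2 * (B v \<bullet> B v) = v \<bullet> v" for v
  proof -
    \<comment> \<open>The inner product crev(z) z and then v v and z crev(z) are scalars, so the
      square collapses; the two signs from z cancel.\<close>
    have "z * cvec v * crev z * (z * cvec v * crev z) = z * cvec v * (crev z * z) * cvec v * crev z"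
      by (simp add: mult.assoc)
    also have "\<dots> = (\<kappa>\<^sup>2 * - (v \<bullet> v)) *\<^sub>R 1"
      unfolding B(3) using s by (simp add: mult.assoc cvec_mult_self_left B(2) power2_eq_square mult_ac)
    finally have "(\<kappa>\<^sup>2 * \<kappa>\<^sup>2 * - (B v \<bullet> B v)) *\<^sub>R (1 :: (real^'n) clifford) = (\<kappa>\<^sup>2 * - (v \<bullet> v)) *\<^sub>R 1"
      unfolding B(4) by (simp add: cvec_mult_self)
    then have "\<kappa>\<^sup>2 * \<kappa>\<^sup>2 * - (B v \<bullet> B v) = \<kappa>\<^sup>2 * - (v \<bullet> v)"
      using ne by (simp only: scaleR_cancel_right) simp
    then have "\<kappa>\<^sup>2 * (\<kappa>\<^sup>2 * (B v \<bullet> B v)) = \<kappa>\<^sup>2 * (v \<bullet> v)"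
      by (simp only: mult.assoc mult_minus_right neg_equal_iff_equal)
    moreover have "\<kappa>\<^sup>2 \<noteq> 0" using B(1) by simp
    ultimately show ?thesis by (simp only: mult_cancel_left) blast
  qed
  have "(bsign b * \<kappa>)\<^sup>2 * (B v \<bullet> B w) = v \<bullet> w" for v w
  proof -
    have "\<kappa>\<^sup>2 * (B v \<bullet> B w) = v \<bullet> w"
      using sq[of "v + w"] sq[of v] sq[of w]
      by (simp add: linear_add[OF lin] inner_add inner_commute[of w v] inner_commute[of "B w" "B v"] algebra_simps)
    then show ?thesis using s by (simp add: power2_eq_square mult_ac)
  qed
  then have "similarity B (bsign b * \<kappa>)"
    unfolding similarity_def using lin B(1) by (simp add: bsign_def)
  then have "conj_similarity b z \<kappa> B" unfolding conj_similarity_def using B by blast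
  then show ?thesis by (rule that)
qed

section \<open>The ideal inside the Clifford algebra and elements of the spin group\<close>

definition eps :: "'n::finite lorentz clifford" where "eps = (1/4) *\<^sub>R (qvec * pvec)"

definition embed :: "'n::finite spinor2 \<Rightarrow> 'n lorentz clifford" where
  "embed s = eps * cl_incl (fst s) + (1/2) *\<^sub>R (pvec * cl_incl (snd s))"

lemma cvec_sq: "cvec v * cvec v = qprod v v *\<^sub>R (1 :: 'v::quadratic_space clifford)"
proof -
  have "2 *\<^sub>R (cvec v * cvec v) = 2 *\<^sub>R (qprod v v *\<^sub>R (1 :: 'v clifford))"
    using cvec_clifford[of v v] by (simp add: scaleR_2[symmetric])
  then show ?thesis by (simp only: scaleR_cancel_left) simp
qed

lemma cvec_anticommute: "qprod v w = 0 \<Longrightarrow> cvec v * cvec w = - (cvec w * cvec v :: 'v::quadratic_space clifford)"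
  using cvec_clifford[of v w] by (simp add: eq_neg_iff_add_eq_0)

lemma pq_rules:
  "pvec * pvec = 0" "qvec * qvec = 0" "pvec * qvec = 4 *\<^sub>R 1 - qvec * pvec"
  "cl_incl (cvec x) * pvec = - (pvec * cl_incl (cvec x))" "cl_incl (cvec x) * qvec = - (qvec * cl_incl (cvec x))"
  "lor_en1 * pvec = - (qvec * lor_en1)" "lor_en1 * qvec = - (pvec * lor_en1)"
  "lor_en1 * lor_en1 = - 1" "cl_incl (cvec x) * lor_en1 = - (lor_en1 * cl_incl (cvec x))"
proof -
  show "pvec * pvec = 0" "qvec * qvec = 0"
    by (simp_all add: pvec_def qvec_def cvec_sq qprod_lorentz_def)
  have "pvec * qvec + qvec * pvec = (4 :: real) *\<^sub>R 1"
    unfolding pvec_def qvec_def cvec_clifford by (simp add: qprod_lorentz_def)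
  then show "pvec * qvec = 4 *\<^sub>R 1 - qvec * pvec" by (simp add: eq_diff_eq)
  show "cl_incl (cvec x) * pvec = - (pvec * cl_incl (cvec x))" "cl_incl (cvec x) * qvec = - (qvec * cl_incl (cvec x))"
    "cl_incl (cvec x) * lor_en1 = - (lor_en1 * cl_incl (cvec x))"
    unfolding cl_incl_simps pvec_def qvec_def by (rule cvec_anticommute, simp add: qprod_lorentz_def)+
  show e: "lor_en1 * lor_en1 = - 1" by (simp add: cvec_sq qprod_lorentz_def)
  have 0: "lor_en1 * lor_e0 = - (lor_e0 * lor_en1)"
    by (rule cvec_anticommute) (simp add: qprod_lorentz_def)
  show "lor_en1 * pvec = - (qvec * lor_en1)" "lor_en1 * qvec = - (pvec * lor_en1)"
    unfolding pvec_eq[symmetric] qvec_eq[symmetric] by (simp_all add: algebra_simps 0 e)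
qed

lemma pq_rules_left: "pvec * (pvec * k) = 0" "qvec * (qvec * k) = 0"
  "pvec * (qvec * k) = 4 *\<^sub>R k - qvec * (pvec * k)"
  "lor_en1 * (pvec * k) = - (qvec * (lor_en1 * k))" "lor_en1 * (qvec * k) = - (pvec * (lor_en1 * k))"
  "lor_en1 * (lor_en1 * k) = - k"
  "cl_incl (cvec x) * (pvec * k) = - (pvec * (cl_incl (cvec x) * k))"
  "cl_incl (cvec x) * (qvec * k) = - (qvec * (cl_incl (cvec x) * k))"
  "cl_incl (cvec x) * (lor_en1 * k) = - (lor_en1 * (cl_incl (cvec x) * k))"
  by (simp_all only: mult.assoc[symmetric] pq_rules)
    (simp_all add: left_diff_distrib mult.assoc)

lemma eps_rules: "pvec * eps = pvec" "qvec * eps = 0" "eps * qvec = qvec"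
  "cl_incl (cvec x) * eps = eps * cl_incl (cvec x)"
  by (simp_all add: eps_def pq_rules pq_rules_left mult.assoc right_diff_distrib)

lemma cl_incl_minus: "cl_incl (- a) = - cl_incl a"
  using cl_incl_simps(5)[of "- 1" a] by simp

lemma cl_incl_diff: "cl_incl (a - b) = cl_incl a - cl_incl b"
  using cl_incl_simps(3)[of a "- b"] by (simp add: cl_incl_minus)

lemma cl_incl_0: "cl_incl 0 = 0"
  using cl_incl_simps(5)[of 0 0] by simp

text \<open>Shows that the coordinate action is left multiplication on the ideal. It is what turns
  equal coordinates back into equations between elements of the Clifford algebra.\<close>

lemma embed_vec: "cvec v * embed s = embed (ideal_act (cvec v) s)"
proof -
  \<comment> \<open>Coordinates of v in the null directions \<open>pvec\<close> and
    \<open>qvec\<close>, in which the multiplication rules are short.\<close>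
  define \<alpha> \<beta> where "\<alpha> = (lor_first v + lor_last v) / 2" and "\<beta> = (lor_first v - lor_last v) / 2"
  define w where "w = lor_mid v"
  have v: "v = Lor (\<alpha> + \<beta>) w (\<alpha> - \<beta>)"
    by (simp add: \<alpha>_def \<beta>_def w_def field_simps)
  obtain u n where s: "s = (u, n)" by (cases s)
  define U N W where "U = cl_incl u" and "N = cl_incl n" and "W = cl_incl (cvec w)"
  have cv: "cvec v = \<alpha> *\<^sub>R pvec + \<beta> *\<^sub>R qvec + W"
    unfolding v pvec_def qvec_def W_def cl_incl_simps cvec_scaleR[symmetric] cvec_add[symmetric]
    by (simp add: plus_lorentz_def scaleR_lorentz_def)
  have r: "pvec * (eps * k) = pvec * k" "qvec * (eps * k) = 0" "W * (eps * k) = eps * (W * k)"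
    "pvec * (pvec * k) = 0" "qvec * (pvec * k) = 4 *\<^sub>R (eps * k)" "W * (pvec * k) = - (pvec * (W * k))" for k
    unfolding W_def by (simp_all add: mult.assoc[symmetric] eps_rules pq_rules) (simp add: eps_def)
  have "embed (ideal_act (cvec v) s) = eps * (W * U + (2 * \<beta>) *\<^sub>R N) + (1/2) *\<^sub>R (pvec * ((2 * \<alpha>) *\<^sub>R U - W * N))"
    unfolding v s ideal_act_cvec embed_def by (simp add: cl_incl_simps(3-5) cl_incl_diff U_def N_def W_def)
  also have "\<dots> = eps * (W * U) + (2 * \<beta>) *\<^sub>R (eps * N) + \<alpha> *\<^sub>R (pvec * U) - (1/2) *\<^sub>R (pvec * (W * N))"
    by (simp add: distrib_left right_diff_distrib scaleR_diff_right)
  also have "\<dots> = (\<alpha> *\<^sub>R pvec + \<beta> *\<^sub>R qvec + W) * (eps * U + (1/2) *\<^sub>R (pvec * N))"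
    by (simp add: distrib_left distrib_right r scaleR_add_right scaleR_diff_right)
  finally show ?thesis unfolding cv s embed_def U_def N_def by simp
qed

lemma embed_ideal_act: "g * embed s = embed (ideal_act g s)"
proof (induction g arbitrary: s rule: clifford_induct)
  case (vec x)
  then show ?case by (rule embed_vec)
next
  case (add a b)
  have "embed (s + s') = embed s + embed s'" for s s' :: "'a spinor2"
    by (simp add: embed_def cl_incl_simps algebra_simps)
  then show ?case using add by (simp add: distrib_right)
next
  case (mult a b)
  then show ?case by (simp add: mult.assoc)
qed (simp add: embed_def cl_incl_simps algebra_simps)

lemma spin_lorentz_mult: "g \<in> spin_lorentz \<Longrightarrow> h \<in> spin_lorentz \<Longrightarrow> g * h \<in> spin_lorentz"
proof -
  assume "g \<in> spin_lorentz" "h \<in> spin_lorentz"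
  then obtain vs ws where vs: "g = prod_list (map cvec vs)" "even (length vs)"
      "\<forall>v\<in>set vs. qprod v v = 1 \<or> qprod v v = -1" "even (length (filter (\<lambda>v. qprod v v = -1) vs))"
    and ws: "h = prod_list (map cvec ws)" "even (length ws)"
      "\<forall>v\<in>set ws. qprod v v = 1 \<or> qprod v v = -1" "even (length (filter (\<lambda>v. qprod v v = -1) ws))"
    unfolding spin_lorentz_def by blast
  then show "g * h \<in> spin_lorentz"
    unfolding spin_lorentz_def by (intro CollectI exI[of _ "vs @ ws"]) auto
qed

lemma spin_lorentz_pair:
  assumes "qprod v v = qprod w w" "qprod v v = 1 \<or> qprod v v = -1"
  shows "cvec v * cvec w \<in> spin_lorentz"
  unfolding spin_lorentz_def using assms by (intro CollectI exI[of _ "[v, w]"]) auto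

text \<open>For x = r u with a unit vector u, the element is the product of u and (r/2) p - u with p
  = \<open>pvec\<close>. Both square to -1 since p is null and orthogonal to u.\<close>

lemma nbar_in_spin: "nbar_elt x \<in> spin_lorentz"
proof (cases "x = 0")
  case True
  have "cvec (0 :: real^'a) = 0" by simp
  then have "nbar_elt x = (1 :: 'a lorentz clifford)" by (simp add: nbar_elt_def True cl_incl_0)
  then show ?thesis unfolding spin_lorentz_def by (intro CollectI exI[of _ "[]"]) simp
next
  case False
  define r where "r = norm x"
  define u where "u = (1 / r) *\<^sub>R x"
  have r: "r \<noteq> 0" and u: "u \<bullet> u = 1" and x: "x = r *\<^sub>R u"
    using False by (simp_all add: r_def u_def dot_square_norm power2_eq_square)
  have "cvec (Lor (r / 2) (- u) (r / 2)) = (r / 2) *\<^sub>R pvec - cvec (Lor 0 u 0)"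
  proof -
    have "(r / 2) *\<^sub>R pvec - cvec (Lor 0 u 0) = (r / 2) *\<^sub>R pvec + (- 1) *\<^sub>R cvec (Lor 0 u 0)" by simp
    also have "\<dots> = cvec (Lor (r / 2) (- u) (r / 2))"
      unfolding pvec_def cvec_scaleR[symmetric] cvec_add[symmetric] by (simp add: plus_lorentz_def scaleR_lorentz_def)
    finally show ?thesis ..
  qed
  moreover have "cvec (Lor 0 u 0) * cvec (Lor 0 u 0) = (- 1) *\<^sub>R 1"
    by (simp add: cvec_sq qprod_lorentz_def u)
  ultimately have "cvec (Lor 0 u 0) * cvec (Lor (r / 2) (- u) (r / 2)) = nbar_elt x"
    by (simp add: nbar_elt_def pvec_eq x cvec_scaleR cl_incl_simps right_diff_distrib)
  moreover have "cvec (Lor 0 u 0) * cvec (Lor (r / 2) (- u) (r / 2)) \<in> spin_lorentz"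
    by (rule spin_lorentz_pair) (simp_all add: qprod_lorentz_def u)
  ultimately show ?thesis by simp
qed

text \<open>The element is the product of the unit timelike vectors e_0 and cosh(t) e_0 + sinh(t)
  e_(n+1).\<close>

lemma a_in_spin: "a_elt t \<in> (spin_lorentz :: 'n::finite lorentz clifford set)"
proof -
  have "cvec (Lor (cosh t) 0 (sinh t)) = cosh t *\<^sub>R lor_e0 + sinh t *\<^sub>R (lor_en1 :: 'n lorentz clifford)"
    unfolding cvec_scaleR[symmetric] cvec_add[symmetric] by (simp add: plus_lorentz_def scaleR_lorentz_def)
  moreover have "lor_e0 * lor_e0 = (1 :: 'n lorentz clifford)" by (simp add: cvec_sq qprod_lorentz_def)
  ultimately have "a_elt t = (lor_e0 :: 'n lorentz clifford) * cvec (Lor (cosh t) 0 (sinh t))"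
    by (simp add: a_elt_def distrib_left)
  moreover have "lor_e0 * cvec (Lor (cosh t) 0 (sinh t)) \<in> (spin_lorentz :: 'n lorentz clifford set)"
    using cosh_square_eq[of t] by (intro spin_lorentz_pair) (simp_all add: qprod_lorentz_def power2_eq_square)
  ultimately show ?thesis by simp
qed

lemma cl_incl_in_spin:
  assumes "m \<in> spin_compact"
  shows "cl_incl m \<in> spin_lorentz"
proof -
  obtain us where us: "m = prod_list (map cvec us)" "even (length us)" "\<forall>v\<in>set us. norm v = 1"
    using assms unfolding spin_compact_def by blast
  have "cl_incl (prod_list (map cvec us)) = prod_list (map cvec (map (\<lambda>u. Lor 0 u 0) us))" for us :: "(real^'a) list"
    by (induction us) (simp_all add: cl_incl_simps)
  moreover have "filter (\<lambda>v. qprod v v = -1) (map (\<lambda>u. Lor 0 u 0) us) = map (\<lambda>u. Lor 0 u 0) us"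
    using us(3) by (auto simp: filter_id_conv qprod_lorentz_def norm_eq_1)
  ultimately show ?thesis
    unfolding spin_lorentz_def using us
    by (intro CollectI exI[of _ "map (\<lambda>u. Lor 0 u 0) us"]) (auto simp: qprod_lorentz_def norm_eq_1)
qed

lemma prod_list_rev:
  "prod_list (map cvec vs) * prod_list (map cvec (rev vs)) = prod_list (map (\<lambda>v. qprod v v) vs) *\<^sub>R 1"
proof (induction vs)
  case (Cons v vs)
  have "prod_list (map cvec (v # vs)) * prod_list (map cvec (rev (v # vs)))
      = cvec v * (prod_list (map cvec vs) * prod_list (map cvec (rev vs))) * cvec v"
    by (simp add: mult.assoc)
  then show ?case unfolding Cons by (simp add: cvec_sq)
qed simp

lemma prod_list_signs:
  assumes "\<forall>v\<in>set vs. qprod v v = 1 \<or> qprod v v = -1"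
  shows "prod_list (map (\<lambda>v. qprod v v) vs) = bsign (even (length (filter (\<lambda>v. qprod v v = -1) vs)))"
  using assms by (induction vs) (auto simp: bsign_def)

text \<open>The product with the reversed list is the product of all squares, which is 1 because the
  number of squares equal to -1 is even.\<close>

lemma spin_inverse:
  assumes "g \<in> spin_lorentz"
  shows "clinv g \<in> spin_lorentz" "g * clinv g = 1" "clinv g * g = 1"
proof -
  obtain vs where vs: "g = prod_list (map cvec vs)" "even (length vs)"
      "\<forall>v\<in>set vs. qprod v v = 1 \<or> qprod v v = -1" "even (length (filter (\<lambda>v. qprod v v = -1) vs))"
    using assms unfolding spin_lorentz_def by blast
  let ?h = "prod_list (map cvec (rev vs))"
  have h: "?h \<in> spin_lorentz"
    unfolding spin_lorentz_def using vs by (intro CollectI exI[of _ "rev vs"]) (auto simp flip: rev_filter)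
  have 1: "g * ?h = 1" "?h * g = 1"
    using prod_list_rev[of vs] prod_list_rev[of "rev vs"] prod_list_signs[of vs] prod_list_signs[of "rev vs"] vs
    by (simp_all add: bsign_def flip: rev_filter)
  have uniq: "b = ?h" if "g * b = 1 \<and> b * g = 1" for b
  proof -
    have "b = ?h * g * b" using 1 by simp
    then show ?thesis using that by (simp add: mult.assoc)
  qed
  have "clinv g = ?h" unfolding clinv_def by (rule the_equality, rule conjI[OF 1]) (rule uniq)
  then show "clinv g \<in> spin_lorentz" "g * clinv g = 1" "clinv g * g = 1" using h 1 by simp_all
qed

section \<open>An invariant form and the action on points\<close>

definition ideal_form :: "'n::finite spinor2 \<Rightarrow> 'n spinor2 \<Rightarrow> (real^'n) clifford" where
  "ideal_form s s' = crev (fst s) * snd s' - crev (snd s) * fst s'"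

lemma ideal_form_vec: "ideal_form (ideal_act (cvec v) s) (ideal_act (cvec v) s') = (- qprod v v) *\<^sub>R ideal_form s s'"
proof -
  obtain a w b where v: "v = Lor a w b" by (cases v)
  obtain f h where s: "s = (f, h)" by (cases s)
  obtain f' h' where s': "s' = (f', h')" by (cases s')
  show ?thesis
    unfolding v s s' ideal_act_cvec ideal_form_def
    by (simp add: cvec_mult_self_left mult.assoc qprod_lorentz_def algebra_simps)
qed

lemma ideal_form_prod:
  "ideal_form (ideal_act (prod_list (map cvec vs)) s) (ideal_act (prod_list (map cvec vs)) s')
    = prod_list (map (\<lambda>v. - qprod v v) vs) *\<^sub>R ideal_form s s'"
  by (induction vs) (simp_all add: ideal_form_vec)

text \<open>A vector multiplies the form by minus its square. The number of vectors is even and so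
  is the number of squares equal to -1, so the total factor is 1. On a pair of states the form is
  the pseudo-determinant of a Vahlen matrix.\<close>

lemma ideal_form_spin:
  assumes "g \<in> spin_lorentz"
  shows "ideal_form (ideal_act g s) (ideal_act g s') = ideal_form s s'"
proof -
  obtain vs where vs: "g = prod_list (map cvec vs)" "even (length vs)"
      "\<forall>v\<in>set vs. qprod v v = 1 \<or> qprod v v = -1" "even (length (filter (\<lambda>v. qprod v v = -1) vs))"
    using assms unfolding spin_lorentz_def by blast
  have "prod_list (map (\<lambda>v. - qprod v v) vs) = (- 1) ^ length vs * prod_list (map (\<lambda>v. qprod v v) vs)"
    for vs :: "'a lorentz list" by (induction vs) simp_all
  then show ?thesis
    using ideal_form_prod[of vs s s'] prod_list_signs[OF vs(3)] vs by (simp add: bsign_def)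
qed

text \<open>States of a finite point or of infinity whose nonzero coordinates are products of
  nonzero vectors. The flag is the parity of the first coordinate; the second has the opposite
  parity.\<close>

definition point_state :: "bool \<Rightarrow> 'n::finite spinor2 \<Rightarrow> bool" where
  "point_state b s \<longleftrightarrow> (\<exists>y u. lipschitz b u \<and> s = (u, - (cvec y * u))) \<or> (\<exists>n. lipschitz (\<not> b) n \<and> s = (0, n))"

text \<open>A vector with nonzero square acts on the points including infinity as a reflection or
  inversion. The cases are whether source and image are finite, decided by whether the new first
  coordinate vanishes.\<close>

lemma point_state_vec:
  assumes Q: "qprod v v \<noteq> 0" and "point_state b s"
  shows "point_state (\<not> b) (ideal_act (cvec v) s)"
proof -
  obtain a w c where v: "v = Lor a w c" by (cases v)
  have Q': "(a + c) * (a - c) - w \<bullet> w \<noteq> 0" using Q by (simp add: v qprod_lorentz_def algebra_simps)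
  from assms(2) consider y u where "lipschitz b u" "s = (u, - (cvec y * u))" | n where "lipschitz (\<not> b) n" "s = (0, n)"
    unfolding point_state_def by blast
  then show ?thesis
  proof cases
    case 1
    \<comment> \<open>The vector by which the first coordinate gets multiplied; the image is
      infinite exactly if it is 0.\<close>
    define x where "x = w - (a - c) *\<^sub>R y"
    have cx: "cvec x = cvec w - (a - c) *\<^sub>R cvec y" by (simp add: x_def cvec_diff cvec_scaleR)
    then have m: "ideal_act (cvec v) s = (cvec x * u, (a + c) *\<^sub>R u + cvec w * (cvec y * u))"
      unfolding v 1(2) ideal_act_cvec by (simp add: left_diff_distrib)
    show ?thesis
    proof (cases "x = 0")
      case True
      then have w: "w = (a - c) *\<^sub>R y" by (simp add: x_def)
      have "(a - c) * ((a + c) - (a - c) * (y \<bullet> y)) \<noteq> 0"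
        using Q' by (simp add: w algebra_simps)
      then have "(a + c) - (a - c) * (y \<bullet> y) \<noteq> 0" by auto
      then have "lipschitz b (((a + c) - (a - c) * (y \<bullet> y)) *\<^sub>R u)" by (rule lipschitz_scaleR[OF 1(1)])
      moreover have "ideal_act (cvec v) s = (0, ((a + c) - (a - c) * (y \<bullet> y)) *\<^sub>R u)"
      proof -
        have "cvec w * (cvec y * u) = - (((a - c) * (y \<bullet> y)) *\<^sub>R u)"
          unfolding w cvec_scaleR by (simp add: cvec_mult_self_left)
        then show ?thesis unfolding m True by (simp add: scaleR_diff_left)
      qed
      ultimately show ?thesis unfolding point_state_def by auto
    next
      case False
      \<comment> \<open>The image point is -((a + c) + w y) times the inverse of x, that is ((a + c)
        + w y) x / |x|^2. Its numerator is a vector because w y w is one, and z is that vector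
        computed by \<open>cvec_sandwich\<close>.\<close>
      define z where "z = ((a + c) - 2 * (w \<bullet> y) + (a - c) * (y \<bullet> y)) *\<^sub>R w + ((w \<bullet> w) - (a + c) * (a - c)) *\<^sub>R y"
      have "((a + c) *\<^sub>R 1 + cvec w * cvec y) * cvec x
          = (a + c) *\<^sub>R cvec x + (cvec w * cvec y * cvec w - (a - c) *\<^sub>R (cvec w * (cvec y * cvec y)))"
        unfolding cx by (simp add: algebra_simps)
      also have "\<dots> = cvec z"
        unfolding cvec_sandwich cvec_mult_self z_def cx
        by (simp only: cvec_diff cvec_add cvec_scaleR) (simp add: algebra_simps)
      finally have z: "((a + c) *\<^sub>R 1 + cvec w * cvec y) * cvec x = cvec z" .
      have "cvec ((1 / (x \<bullet> x)) *\<^sub>R z) * (cvec x * u)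
          = (1 / (x \<bullet> x)) *\<^sub>R (((a + c) *\<^sub>R 1 + cvec w * cvec y) * (cvec x * (cvec x * u)))"
        by (simp add: cvec_scaleR z[symmetric] mult.assoc)
      also have "\<dots> = - ((a + c) *\<^sub>R u + cvec w * (cvec y * u))"
        using False by (simp add: cvec_mult_self_left distrib_right mult.assoc)
      finally have "ideal_act (cvec v) s = (cvec x * u, - (cvec ((1 / (x \<bullet> x)) *\<^sub>R z) * (cvec x * u)))"
        by (simp add: m)
      then show ?thesis unfolding point_state_def using lipschitz_vec[OF False 1(1)] by blast
    qed
  next
    case 2
    have m: "ideal_act (cvec v) s = ((a - c) *\<^sub>R n, - (cvec w * n))" unfolding v 2(2) ideal_act_cvec by simp
    show ?thesis
    proof (cases "a = c")
      case True
      then have "w \<noteq> 0" using Q' by auto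
      then have "lipschitz b (cvec (- w) * n)" using lipschitz_vec[OF _ 2(1), of "- w"] by simp
      then show ?thesis unfolding point_state_def m using True by (auto simp: cvec_minus)
    next
      case False
      have "- (cvec w * n) = - (cvec ((1 / (a - c)) *\<^sub>R w) * ((a - c) *\<^sub>R n))"
        using False by (simp add: cvec_scaleR)
      then show ?thesis unfolding point_state_def m using lipschitz_scaleR[OF 2(1), of "a - c"] False by auto
    qed
  qed
qed

lemma point_state_spin:
  assumes "g \<in> spin_lorentz" and "point_state b s"
  shows "point_state b (ideal_act g s)"
proof -
  obtain vs where vs: "g = prod_list (map cvec vs)" "even (length vs)"
      "\<forall>v\<in>set vs. qprod v v = 1 \<or> qprod v v = -1"
    using assms unfolding spin_lorentz_def by blast
  have "point_state (b = even (length vs)) (ideal_act (prod_list (map cvec vs)) s)"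
    if "\<forall>v\<in>set vs. qprod v v = 1 \<or> qprod v v = -1" for vs
    using that
  proof (induction vs)
    case (Cons v vs)
    have Q: "qprod v v \<noteq> 0" using Cons.prems by auto
    have b: "(b = even (length (v # vs))) = (\<not> (b = even (length vs)))" by auto
    have IH: "point_state (b = even (length vs)) (ideal_act (prod_list (map cvec vs)) s)"
      using Cons by simp
    show ?case unfolding b using point_state_vec[OF Q IH] by simp
  qed (simp add: assms(2))
  from this[OF vs(3)] show ?thesis by (simp add: vs(1,2))
qed

section \<open>Uniqueness and existence of the decomposition; the shape of the action\<close>

context
  fixes n_type :: "'n::finite itself"
  assumes ne: "(1 :: (real^'n) clifford) \<noteq> 0"
begin

lemma scaleR_one_inj: "r *\<^sub>R (1 :: (real^'n) clifford) = s *\<^sub>R 1 \<Longrightarrow> r = s"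
  using ne by simp

text \<open>Both decompositions give the same state. The first coordinate times its reversal is
  e^(2t), which fixes t and then m; cancelling m in the second coordinate fixes the point.\<close>

lemma decomp_unique:
  fixes h :: "'n lorentz clifford"
  assumes m: "m \<in> spin_compact" and h: "ideal_act h (1, - cvec x) = (exp t *\<^sub>R m, - (cvec y * (exp t *\<^sub>R m)))"
    and d: "is_decomp h x y' m' t'"
  shows "y' = y" "m' = m" "t' = t"
proof -
  note d' = is_decomp_ideal_act[OF d]
  have eq: "exp t' *\<^sub>R m' = exp t *\<^sub>R m" "cvec y' * (exp t' *\<^sub>R m') = cvec y * (exp t *\<^sub>R m)"
    using trans[OF d'(2)[symmetric] h] unfolding prod.inject neg_equal_iff_equal by blast+
  have "(exp t' *\<^sub>R m') * crev (exp t' *\<^sub>R m') = (exp t *\<^sub>R m) * crev (exp t *\<^sub>R m)" by (simp only: eq)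
  then have "(exp t' * exp t') *\<^sub>R (1 :: (real^'n) clifford) = (exp t * exp t) *\<^sub>R 1"
    using spin_compactD(2)[OF m] spin_compactD(2)[OF d'(1)] by simp
  then have "exp t' * exp t' = exp t * exp t" by (rule scaleR_one_inj)
  then show t: "t' = t" by (simp flip: exp_add)
  show m': "m' = m" using eq(1) by (simp add: t)
  have "exp t *\<^sub>R (cvec y' * m) = exp t *\<^sub>R (cvec y * m)" using eq(2) unfolding eq(1) by simp
  then have "cvec y' * m = cvec y * m" by (simp only: scaleR_cancel_left) simp
  then have "cvec y' * (m * crev m) = cvec y * (m * crev m)" by (simp only: mult.assoc[symmetric])
  then show "y' = y" using spin_compactD(2)[OF m] cvec_inj[OF ne] by simp
qed

text \<open>The form is 1 on the states of x and of infinity. This is the determinant condition on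
  the matrix of h, from which its missing entries are solved below.\<close>

lemma ideal_form_inf:
  fixes h :: "'n lorentz clifford"
  assumes "h \<in> spin_lorentz" and "ideal_act h (1, - cvec x) = (d, b)" and "ideal_act h (0, 1) = (c, a)"
  shows "crev d * a - crev b * c = 1"
  using ideal_form_spin[OF assms(1), of "(1, - cvec x)" "(0, 1)"] unfolding assms(2,3) by (simp add: ideal_form_def)

lemma point_state_cvec: "point_state True (1, - cvec (x :: real^'n))"
  unfolding point_state_def using lipschitz_1 by (intro disjI1 exI[of _ x] exI[of _ 1]) simp

lemma point_state_inf: "point_state False (0, 1 :: (real^'n) clifford)"
  unfolding point_state_def using lipschitz_1 by (intro disjI2 exI[of _ 1]) simp

text \<open>The determinant condition makes the first coordinate of the image of the origin equal to
  1, so this image is a point y, and k agrees with \<open>nbar_elt y\<close> on \<open>eps\<close>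
  and on \<open>pvec\<close>. These determine k because 1 = eps + p q / 4.\<close>

lemma fixes_inf_eq_nbar:
  fixes k :: "'n lorentz clifford"
  assumes k: "k \<in> spin_lorentz" and kp: "k * pvec = pvec"
  obtains z where "k = nbar_elt z"
proof -
  have "ideal_act k (0, 2 *\<^sub>R 1) = (0, 2 *\<^sub>R 1)"
  proof -
    have "ideal_act (k * pvec) (1, 0) = ideal_act pvec (1, 0)" by (simp only: kp)
    then show ?thesis by (simp add: ideal_act_pvec)
  qed
  then have "2 *\<^sub>R ideal_act k (0, 1) = 2 *\<^sub>R (0, 1)"
    using ideal_act_scaleR[of k 2 "(0, 1)"] by simp
  then have inf: "ideal_act k (0, 1) = (0, 1)" by (simp only: scaleR_cancel_left) simp
  obtain d b where db: "ideal_act k (1, - cvec 0) = (d, b)" by (cases "ideal_act k (1, - cvec 0)")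
  have "crev d = 1" using ideal_form_inf[OF k db inf] by simp
  then have d: "d = 1" using crev_crev[of d] by simp
  have "point_state True (ideal_act k (1, - cvec 0))"
    by (rule point_state_spin[OF k point_state_cvec])
  then obtain y where y: "b = - cvec y" unfolding db point_state_def using d ne by auto
  have ke: "k * eps = nbar_elt y * eps"
  proof -
    have "k * embed (1, 0) = embed (ideal_act k (1, 0))" by (rule embed_ideal_act)
    also have "ideal_act k (1, 0) = ideal_act (nbar_elt y) (1, 0)" using db by (simp add: d y ideal_act_nbar)
    also have "embed \<dots> = nbar_elt y * embed (1, 0)" by (rule embed_ideal_act[symmetric])
    finally show ?thesis by (simp add: embed_def cl_incl_simps cl_incl_0)
  qed
  have np: "nbar_elt y * pvec = pvec"
    by (simp add: nbar_elt_def pvec_eq left_diff_distrib mult.assoc pq_rules pq_rules_left)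
  have one: "1 = eps + (1/4) *\<^sub>R (pvec * qvec)"
    by (simp add: eps_def pq_rules scaleR_diff_right)
  have "k = k * (eps + (1/4) *\<^sub>R (pvec * qvec))" by (simp flip: one)
  also have "\<dots> = nbar_elt y * (eps + (1/4) *\<^sub>R (pvec * qvec))"
    using kp np by (simp add: distrib_left ke mult.assoc[symmetric])
  finally have "k = nbar_elt y" by (simp flip: one)
  then show ?thesis by (rule that)
qed

text \<open>An element fixing \<open>\<epsilon>\<close> is conjugated by \<open>e\<^sub>n\<^sub>+\<^sub>1\<close> into one fixing \<open>p\<close>, that is, into \<open>\<overline>N\<close>.\<close>

lemma fixes_eps_eq_n:
  fixes k :: "'n lorentz clifford"
  assumes k: "k \<in> spin_lorentz" and ke: "k * eps = eps"
  obtains z where "k = n_elt z"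
proof -
  define e where "e = (lor_en1 :: 'n lorentz clifford)"
  have ee: "e * e = - 1" "e * (e * a) = - a" for a by (simp_all add: e_def pq_rules pq_rules_left)
  define k' where "k' = - (e * k * e)"
  have "k' = e * k * cvec (Lor 0 0 (- 1))"
    using cvec_scaleR[of "- 1" "Lor 0 0 1 :: 'n lorentz"] by (simp add: k'_def e_def scaleR_lorentz_def)
  moreover have "e * k * cvec (Lor 0 0 (- 1)) \<in> spin_lorentz"
  proof -
    obtain vs where vs: "k = prod_list (map cvec vs)" "even (length vs)"
        "\<forall>v\<in>set vs. qprod v v = 1 \<or> qprod v v = -1" "even (length (filter (\<lambda>v. qprod v v = -1) vs))"
      using k unfolding spin_lorentz_def by blast
    then show ?thesis unfolding spin_lorentz_def e_def
      by (intro CollectI exI[of _ "Lor 0 0 1 # vs @ [Lor 0 0 (- 1)]"]) (auto simp: qprod_lorentz_def mult.assoc)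
  qed
  ultimately have k': "k' \<in> spin_lorentz" by simp
  have "k * qvec = k * eps * qvec" by (simp add: mult.assoc eps_rules)
  then have kq: "k * qvec = qvec" by (simp add: ke eps_rules)
  have "k' * pvec = e * (k * qvec) * e"
    by (simp add: k'_def e_def mult.assoc pq_rules)
  also have "\<dots> = pvec" unfolding kq by (simp add: e_def pq_rules mult.assoc)
  finally obtain z where z: "k' = nbar_elt z" using fixes_inf_eq_nbar[OF k'] by blast
  have "k = - (e * k' * e)" by (simp add: k'_def mult.assoc ee)
  also have "\<dots> = n_elt z"
    by (simp add: z n_elt_def nbar_elt_def pvec_eq qvec_eq distrib_left distrib_right left_diff_distrib
        right_diff_distrib ee mult.assoc e_def pq_rules pq_rules_left)
  finally show ?thesis by (rule that)
qed

text \<open>The product w of the first three factors and h times \<open>nbar_elt x\<close> have the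
  same effect on the generator of the ideal. So w^-1 h \<open>nbar_elt x\<close> fixes the generator
  and is the missing factor in \<open>N\<close>.\<close>

lemma decomp_exists:
  fixes h :: "'n lorentz clifford"
  assumes h: "h \<in> spin_lorentz" and m: "m \<in> spin_compact"
    and D: "ideal_act h (1, - cvec x) = (exp t *\<^sub>R m, - (cvec y * (exp t *\<^sub>R m)))"
  shows "is_decomp h x y m t"
proof -
  define w where "w = nbar_elt y * cl_incl m * a_elt t"
  have w: "w \<in> spin_lorentz"
    unfolding w_def by (intro spin_lorentz_mult nbar_in_spin cl_incl_in_spin a_in_spin m)
  note wi = spin_inverse[OF w]
  define k where "k = clinv w * (h * nbar_elt x)"
  have k: "k \<in> spin_lorentz"
    unfolding k_def by (intro spin_lorentz_mult nbar_in_spin wi h)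
  have "ideal_act (h * nbar_elt x) (1, 0) = ideal_act w (1, 0)"
    using D by (simp add: w_def ideal_act_nbar ideal_act_incl ideal_act_a)
  then have "ideal_act k (1, 0) = ideal_act (clinv w * w) (1, 0)" by (simp add: k_def)
  then have "ideal_act k (1, 0) = (1, 0)" by (simp only: wi ideal_act_simps)
  then have "k * embed (1, 0) = embed (1, 0)" by (simp only: embed_ideal_act)
  then have "k * eps = eps" by (simp add: embed_def cl_incl_simps cl_incl_0)
  then obtain z where z: "k = n_elt z" using fixes_eps_eq_n[OF k] by blast
  have "w * k = h * nbar_elt x" by (simp add: k_def mult.assoc[symmetric] wi)
  then show ?thesis unfolding is_decomp_def using m by (intro conjI exI[of _ z]) (simp_all add: w_def z)
qed

lemma decomp_parts:
  fixes h :: "'n lorentz clifford"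
  assumes h: "h \<in> spin_lorentz" and m: "m \<in> spin_compact"
    and D: "ideal_act h (1, - cvec x) = (exp t *\<^sub>R m, - (cvec y * (exp t *\<^sub>R m)))"
  shows "act_defined h x" "act h x = y" "m_part h x = m" "a_part h x = t"
proof -
  note ex = decomp_exists[OF assms] and un = decomp_unique[OF m D]
  show "act_defined h x" unfolding act_defined_def using ex by blast
  show "act h x = y" unfolding act_def using ex un by (intro the_equality) blast+
  show "m_part h x = m" unfolding m_part_def using ex un by (intro the_equality) blast+
  show "a_part h x = t" unfolding a_part_def using ex un by (intro the_equality) blast+
qed

lemma not_act_defined:
  fixes h :: "'n lorentz clifford"
  assumes "fst (ideal_act h (1, - cvec x)) = 0"
  shows "\<not> act_defined h x"
proof
  assume "act_defined h x"
  then obtain y m t where d: "is_decomp h x y m t" unfolding act_defined_def by blast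
  have "exp t *\<^sub>R m = 0" using is_decomp_ideal_act(2)[OF d] assms by simp
  then have "m = 0" by simp
  then show False using spin_compactD(2)[OF is_decomp_ideal_act(1)[OF d]] ne by simp
qed

lemma conj_similarity_vec:
  fixes z :: "(real^'n) clifford"
  assumes s: "conj_similarity b z \<kappa> B"
  shows "cvec (B v) * z = (bsign b / \<kappa>) *\<^sub>R (z * cvec v)"
proof -
  have "\<kappa>\<^sup>2 *\<^sub>R (cvec (B v) * z) = z * cvec v * (crev z * z)"
  proof -
    have "\<kappa>\<^sup>2 *\<^sub>R (cvec (B v) * z) = (\<kappa>\<^sup>2 *\<^sub>R cvec (B v)) * z" by simp
    also have "\<kappa>\<^sup>2 *\<^sub>R cvec (B v) = z * cvec v * crev z" using s unfolding conj_similarity_def by simp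
    finally show ?thesis by (simp add: mult.assoc)
  qed
  also have "\<dots> = (bsign b * \<kappa>) *\<^sub>R (z * cvec v)" using s unfolding conj_similarity_def by simp
  finally have "(1 / \<kappa>\<^sup>2) *\<^sub>R (\<kappa>\<^sup>2 *\<^sub>R (cvec (B v) * z)) = (1 / \<kappa>\<^sup>2) *\<^sub>R ((bsign b * \<kappa>) *\<^sub>R (z * cvec v))" by simp
  then show ?thesis using s unfolding conj_similarity_def by (simp add: power2_eq_square)
qed

text \<open>The first coordinate c of the image of infinity decides. If it is 0, infinity is fixed
  and the action is affine. Otherwise some finite x0 goes to infinity, infinity goes to some y0, and
  what remains between them is the inversion followed by a similarity.\<close>

lemma spin_normal_form:
  fixes h :: "'n lorentz clifford"
  assumes h: "h \<in> spin_lorentz"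
  obtains (affine) d y0 \<kappa> B where "lipschitz True d" "conj_similarity True d \<kappa> B"
      "\<And>x. ideal_act h (1, - cvec x) = (d, - (cvec (y0 + B x) * d))"
    | (inversion) c x0 y0 \<kappa> B where "lipschitz False c" "conj_similarity False c \<kappa> B" "fst (ideal_act h (1, - cvec x0)) = 0"
      "\<And>x. x \<noteq> x0 \<Longrightarrow> ideal_act h (1, - cvec x) = (- (c * cvec (x - x0)), cvec (y0 + B (vinv (x - x0))) * (c * cvec (x - x0)))"
proof -
  obtain c a where ca: "ideal_act h (0, 1) = (c, a)" by (cases "ideal_act h (0, 1)")
  \<comment> \<open>The state of x is that of y minus (0, x - y), and the image of (0, v) is that of
    infinity times v; so the state depends on x in an affine way.\<close>
  have lin: "ideal_act h (1, - cvec x) = (fst (ideal_act h (1, - cvec y)) - c * cvec (x - y), snd (ideal_act h (1, - cvec y)) - a * cvec (x - y))"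
    for x y
  proof -
    have r: "ideal_act h (0, cvec v) = (c * cvec v, a * cvec v)" for v
      using ideal_act_rmul[of h "(0, 1)" "cvec v"] by (simp add: rmul_def ca)
    have e: "(1, - cvec x) = (1, - cvec y) + (- 1) *\<^sub>R (0, cvec (x - y))"
      by (simp add: cvec_diff)
    show ?thesis
      by (subst e) (simp only: ideal_act_add ideal_act_scaleR r, simp add: prod_eq_iff)
  qed
  have ps: "point_state True (ideal_act h (1, - cvec x))" for x
    by (rule point_state_spin[OF h point_state_cvec])
  have "point_state False (ideal_act h (0, 1))"
    by (rule point_state_spin[OF h point_state_inf])
  then consider "c = 0" | y0 where "lipschitz False c" "a = - (cvec y0 * c)"
    unfolding ca point_state_def by auto
  then show ?thesis
  proof cases
    case 1
    obtain d b where db: "ideal_act h (1, - cvec 0) = (d, b)" by (cases "ideal_act h (1, - cvec 0)")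
    \<comment> \<open>With c = 0 the determinant condition reads crev(d) a = 1, hence a = d /
      \<kappa>. Then a x = (B x) d, which is the linear part claimed.\<close>
    have da: "crev d * a = 1" using ideal_form_inf[OF h db ca] 1 by simp
    then have "d \<noteq> 0" using ne by auto
    then obtain y0 where y0: "lipschitz True d" "b = - (cvec y0 * d)" using ps[of 0] unfolding db point_state_def by auto
    obtain \<kappa> B where s: "conj_similarity True d \<kappa> B" by (rule lipschitz_conj_similarity[OF ne y0(1)])
    have \<kappa>: "\<kappa> > 0" and dd: "d * crev d = \<kappa> *\<^sub>R 1" using s by (simp_all add: conj_similarity_def bsign_def)
    have "\<kappa> *\<^sub>R a = d * (crev d * a)" by (simp add: mult.assoc[symmetric] dd)
    then have "(1 / \<kappa>) *\<^sub>R (\<kappa> *\<^sub>R a) = (1 / \<kappa>) *\<^sub>R d" by (simp only: da mult_1_right)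
    then have a: "a = (1 / \<kappa>) *\<^sub>R d" using \<kappa> by simp
    have "ideal_act h (1, - cvec x) = (d, - (cvec (y0 + B x) * d))" for x
      unfolding lin[of x 0] db using conj_similarity_vec[OF s, of x]
      by (simp add: 1 y0(2) a cvec_add distrib_right bsign_def)
    then show ?thesis using affine y0(1) s by blast
  next
    case 2
    note hi = spin_inverse[OF h]
    \<comment> \<open>The candidate for x0 is the preimage of infinity. Were it infinite as well, c
      a2 = 0 would follow, hence a2 = 0 as c is invertible, against a a2 = 1.\<close>
    obtain c2 a2 where inf2: "ideal_act (clinv h) (0, 1) = (c2, a2)" by (cases "ideal_act (clinv h) (0, 1)")
    have inv_inf: "ideal_act h (c2, a2) = (0, 1)"
      unfolding inf2[symmetric] ideal_act_simps(1)[symmetric] hi by simp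
    obtain \<kappa> B where s: "conj_similarity False c \<kappa> B" by (rule lipschitz_conj_similarity[OF ne 2(1)])
    have \<kappa>: "\<kappa> > 0" and cc: "c * crev c = - \<kappa> *\<^sub>R 1" "crev c * c = - \<kappa> *\<^sub>R 1"
      using s by (simp_all add: conj_similarity_def bsign_def)
    have "point_state False (ideal_act (clinv h) (0, 1))"
      by (rule point_state_spin[OF hi(1) point_state_inf])
    then consider "c2 = 0" | x0 where "lipschitz False c2" "a2 = - (cvec x0 * c2)"
      unfolding inf2 point_state_def by auto
    then obtain x0 where x0: "lipschitz False c2" "a2 = - (cvec x0 * c2)"
    proof cases
      case 1
      have r: "ideal_act h (0, a2) = (c * a2, a * a2)"
        using ideal_act_rmul[of h "(0, 1)" a2] by (simp add: rmul_def ca)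
      then have "c * a2 = 0" "a * a2 = 1" using inv_inf 1 by auto
      then have "\<kappa> *\<^sub>R a2 = 0"
        using arg_cong[where f="\<lambda>z. z * a2", OF cc(2)] by (simp add: mult.assoc)
      then have "a2 = 0" using \<kappa> by simp
      then show ?thesis using \<open>a * a2 = 1\<close> ne by simp
    qed
    obtain D N where DN: "ideal_act h (1, - cvec x0) = (D, N)" by (cases "ideal_act h (1, - cvec x0)")
    have "ideal_act h (rmul (1, - cvec x0) c2) = (0, 1)" using inv_inf by (simp add: rmul_def x0(2))
    then have Dc: "D * c2 = 0" unfolding ideal_act_rmul DN by (simp add: rmul_def)
    obtain \<kappa>' B' where "conj_similarity False c2 \<kappa>' B'" by (rule lipschitz_conj_similarity[OF ne x0(1)])
    then have "\<kappa>' > 0" and cc': "c2 * crev c2 = - \<kappa>' *\<^sub>R 1" by (simp_all add: conj_similarity_def bsign_def)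
    have "\<kappa>' *\<^sub>R D = - (D * (c2 * crev c2))" unfolding cc' by simp
    also have "D * (c2 * crev c2) = 0" using Dc by (simp add: mult.assoc[symmetric])
    finally have "\<kappa>' *\<^sub>R D = 0" by simp
    then have D: "D = 0" using \<open>\<kappa>' > 0\<close> by simp
    \<comment> \<open>At x0 the first coordinate D is 0, so the determinant condition determines the
      second one, N = c / \<kappa>.\<close>
    have "crev N * c = - 1" using ideal_form_inf[OF h DN ca] by (simp add: D)
        (metis add.inverse_inverse)
    then have "crev (crev N * c) = - 1" by simp
    then have "crev c * N = - 1" by simp
    then have "\<kappa> *\<^sub>R N = c"
      using arg_cong[where f="\<lambda>z. z * N", OF cc(1)] by (simp add: mult.assoc)
    then have N: "N = (1 / \<kappa>) *\<^sub>R c" using \<kappa> by auto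
    have "ideal_act h (1, - cvec x) = (- (c * cvec (x - x0)), cvec (y0 + B (vinv (x - x0))) * (c * cvec (x - x0)))"
      if "x \<noteq> x0" for x
    proof -
      have z: "x - x0 \<noteq> 0" using that by simp
      have "cvec (B (vinv (x - x0))) * (c * cvec (x - x0)) = (- 1 / \<kappa>) *\<^sub>R (c * cvec (vinv (x - x0)) * cvec (x - x0))"
        using conj_similarity_vec[OF s, of "vinv (x - x0)"] by (simp add: mult.assoc[symmetric] bsign_def)
      also have "c * cvec (vinv (x - x0)) * cvec (x - x0) = - c"
        using z by (simp add: vinv_def cvec_scaleR mult.assoc cvec_mult_self)
      finally show ?thesis
        unfolding lin[of x x0] DN by (simp add: D N 2(2) cvec_add distrib_right mult.assoc)
    qed
    then show ?thesis using inversion[OF 2(1) s, of x0 y0] D DN by simp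
  qed
qed

end

section \<open>Covariance of the source operator\<close>

text \<open>A module is a unital homomorphism into complex matrices of positive size, where the
  identity is not 0. This certifies that the relations do not collapse the Clifford algebra.\<close>

lemma clifford_module_nontrivial:
  fixes \<rho> :: "('n::finite, 's::finite) cl_hom"
  assumes "clifford_module \<rho>"
  shows "(1 :: (real^'n) clifford) \<noteq> 0"
proof
  assume "(1 :: (real^'n) clifford) = 0"
  then have "(1 :: (real^'n) clifford) = 0 *\<^sub>R 1" by simp
  then have "\<rho> (cl_cpx 1) = \<rho> (cl_cpx (0 *\<^sub>R 1))" by simp
  then have "mat 1 = (0 :: complex^'s^'s)"
    unfolding clifford_module_simps(3)[OF assms] clifford_module_simps(4)[OF assms] by simp
  then have "(mat 1 :: complex^'s^'s) $ undefined $ undefined = 0" by simp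
  then show False by (simp add: mat_def)
qed

lemma matrix_inv_spin:
  fixes \<rho> :: "('n::finite, 's::finite) cl_hom"
  assumes "clifford_module \<rho>" "m \<in> spin_compact"
  shows "matrix_inv (\<rho> (cl_cpx m)) = \<rho> (cl_cpx (crev m))"
proof -
  let ?A = "\<rho> (cl_cpx m)" and ?B = "\<rho> (cl_cpx (crev m))"
  have 1: "?A ** ?B = mat 1" "?B ** ?A = mat 1"
    using spin_compactD[OF assms(2)]
    by (simp_all add: clifford_module_simps(2)[OF assms(1), symmetric] clifford_module_simps(4)[OF assms(1)])
  have "A' = ?B" if "?A ** A' = mat 1 \<and> A' ** ?A = mat 1" for A'
  proof -
    have "A' = A' ** (?A ** ?B)" by (simp add: 1)
    then show ?thesis using that by (simp add: matrix_mul_assoc)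
  qed
  then show ?thesis
    unfolding matrix_inv_def using 1 by (intro some_equality) blast+
qed

section \<open>Translations, and similarities from products of vectors\<close>

lemma has_derivative_shift:
  "((\<lambda>p. f (p + c)) has_derivative D) (at p) \<longleftrightarrow> (f has_derivative D) (at (p + c))"
proof
  assume f: "(f has_derivative D) (at (p + c))"
  show "((\<lambda>p. f (p + c)) has_derivative D) (at p)"
    by (rule has_derivative_compose[where f="\<lambda>p. p + c", OF _ f]) (auto intro!: derivative_eq_intros)
next
  assume f: "((\<lambda>p. f (p + c)) has_derivative D) (at p)"
  have "((\<lambda>p. (\<lambda>p. f (p + c)) (p - c)) has_derivative D) (at (p + c))"
    by (rule has_derivative_compose[where f="\<lambda>p. p - c"]) (auto intro!: derivative_eq_intros f)
  then show "(f has_derivative D) (at (p + c))" by simp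
qed

lemma dx_shift: "dx j (\<lambda>p. F (p + c)) = (\<lambda>p. dx j F (p + c))" "dy j (\<lambda>p. F (p + c)) = (\<lambda>p. dy j F (p + c))"
  by (simp_all add: dx_def dy_def frechet_derivative_def has_derivative_shift)

lemma lap_shift: "lap_x (\<lambda>p. F (p + c)) = (\<lambda>p. lap_x F (p + c))" "lap_y (\<lambda>p. F (p + c)) = (\<lambda>p. lap_y F (p + c))"
  "dirac_x \<rho> (\<lambda>p. F (p + c)) = (\<lambda>p. dirac_x \<rho> F (p + c))" "dirac_y \<rho> (\<lambda>p. F (p + c)) = (\<lambda>p. dirac_y \<rho> F (p + c))"
  by (simp_all add: lap_x_def lap_y_def dirac_x_def dirac_y_def dx_shift)

lemma source_op_shift:
  fixes F :: "('n::finite, 's::finite) field2"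
  shows "source_op \<rho> \<rho>' l \<mu> (\<lambda>p. F (p + (c, c))) (x, y) = source_op \<rho> \<rho>' l \<mu> F (x + c, y + c)"
proof -
  have "source_op \<rho> \<rho>' l \<mu> F (x + c, y + c) = source_op \<rho> \<rho>' l \<mu> F ((x, y) + (c, c))" by simp
  then show ?thesis
    unfolding source_op_def lap_shift dx_shift by (simp only: prod.case add_Pair add_diff_cancel_right vector_add_component)
qed

lemma source_op_zero: "source_op \<rho> \<rho>' l \<mu> (\<lambda>_. 0) p = (0 :: complex^('s::finite \<times> 's))"
proof -
  have z: "dx j (\<lambda>_. 0 :: complex^('s \<times> 's)) = (\<lambda>_. 0)" "dy j (\<lambda>_. 0 :: complex^('s \<times> 's)) = (\<lambda>_. 0)" for j :: 'a
    by (simp_all add: dx_def dy_def)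
  have z2: "lap_x (\<lambda>_. 0 :: complex^('s \<times> 's)) = (\<lambda>_ :: (real^'a) \<times> (real^'a). 0)"
    "lap_y (\<lambda>_. 0 :: complex^('s \<times> 's)) = (\<lambda>_ :: (real^'a) \<times> (real^'a). 0)"
    "dirac_x \<rho> (\<lambda>_. 0) = (\<lambda>_. 0)" "dirac_y \<rho>' (\<lambda>_. 0) = (\<lambda>_. 0)"
    by (simp_all add: lap_x_def lap_y_def dirac_x_def dirac_y_def z)
  have s: "z *s (0 :: complex^('s \<times> 's)) = 0" for z by (simp add: vec_eq_iff)
  show ?thesis by (cases p) (simp add: source_op_def z z2 s Let_def)
qed

lemma smooth_kron_affine:
  fixes F :: "('n::finite, 's::finite) field2" and B :: "real^'n \<Rightarrow> real^'n"
  assumes F: "smooth F" and B: "linear B" and M: "clin M"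
  shows "smooth (\<lambda>(x, y). M (F (B x, B y)) :: complex^('s \<times> 's))"
proof -
  have b: "bounded_linear B" using B by (simp add: linear_conv_bounded_linear)
  have "smooth_on UNIV (\<lambda>p. (B (fst p), B (snd p)))"
    by (intro smooth_on_linear bounded_linear_Pair bounded_linear_compose[OF b] bounded_linear_fst
        bounded_linear_snd open_UNIV)
  then have "smooth_on UNIV (\<lambda>p. F (B (fst p), B (snd p)))"
    by (rule smooth_on_compose[OF open_UNIV open_UNIV subset_UNIV F[folded smooth_on_UNIV]])
  then have "smooth_on UNIV (\<lambda>p. M (F (B (fst p), B (snd p))))"
    by (rule smooth_on_clin[OF M open_UNIV])
  then show ?thesis by (simp only: smooth_on_UNIV case_prod_unfold)
qed

lemma smooth_shift:
  fixes F :: "'a::euclidean_space \<Rightarrow> 'b::real_normed_vector"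
  assumes "smooth F"
  shows "smooth (\<lambda>p. F (p + c))"
proof -
  have "smooth_on UNIV (\<lambda>p::'a. p + c)"
    by (rule smooth_on_add[OF open_UNIV smooth_on_linear[OF bounded_linear_ident open_UNIV] smooth_on_const])
  then have "smooth_on UNIV (\<lambda>p. F (p + c))"
    by (rule smooth_on_compose[OF open_UNIV open_UNIV subset_UNIV assms[folded smooth_on_UNIV]])
  then show ?thesis by (simp only: smooth_on_UNIV)
qed

lemma G_opx:
  fixes \<rho> \<rho>' :: "('n::finite, 's::finite) cl_hom"
  assumes \<rho>: "clifford_module \<rho>" "clifford_module \<rho>'"
  shows "clifford_ops.G (opx \<rho>) v u = kron (\<rho> (cl_vec v)) (mat 1) *v u"
    and "clifford_ops.G (opy \<rho>') v u = kron (mat 1) (\<rho>' (cl_vec v)) *v u"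
proof -
  interpret clifford_pair "opx \<rho>" "opy \<rho>'" by (rule clifford_pair_kron[OF \<rho>])
  have lin: "linear (\<lambda>v. kron (\<rho> (cl_vec v)) (mat 1) *v u)" "linear (\<lambda>v. kron (mat 1) (\<rho>' (cl_vec v)) *v u)"
    by (intro linearI; simp add: cvec_add cvec_scaleR clifford_module_simps[OF \<rho>(1)] clifford_module_simps[OF \<rho>(2)]
        kron_add_left kron_add_right kron_scaleR_left kron_scaleR_right)+
  show "X.G v u = kron (\<rho> (cl_vec v)) (mat 1) *v u"
    unfolding X.G_def by (rule linear_expansion[OF lin(1), symmetric])
  show "Y.G v u = kron (mat 1) (\<rho>' (cl_vec v)) *v u"
    unfolding Y.G_def by (rule linear_expansion[OF lin(2), symmetric])
qed

text \<open>Reversing \<open>conj_similarity_vec\<close> moves a vector past crev(z) at the cost of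
  the factor \<theta> and of applying \<open>B\<close>. The free scalar C takes up the
  multipliers.\<close>

lemma conj_similarity_clifford_similarity:
  fixes \<rho> \<rho>' :: "('n::finite, 's::finite) cl_hom" and C :: complex
  assumes \<rho>: "clifford_module \<rho>" "clifford_module \<rho>'" and s: "conj_similarity b z \<kappa> B"
  defines "M \<equiv> \<lambda>u. C *s (kron (\<rho> (cl_cpx (crev z))) (\<rho>' (cl_cpx (crev z))) *v u)"
  shows "clifford_similarity (opx \<rho>) B (bsign b * \<kappa>) M" "clifford_similarity (opy \<rho>') B (bsign b * \<kappa>) M"
proof -
  interpret clifford_pair "opx \<rho>" "opy \<rho>'" by (rule clifford_pair_kron[OF \<rho>])
  note ne = clifford_module_nontrivial[OF \<rho>(1)]
  have M: "clin M" unfolding M_def by (rule clin_comp[OF clin_smult_const clin_matrix])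
  have \<kappa>: "\<kappa> > 0" and sim: "similarity B (bsign b * \<kappa>)" using s by (simp_all add: conj_similarity_def)
  have b: "bsign b * bsign b = 1" by (simp add: bsign_def)
  have "cvec v * crev z = (bsign b * \<kappa>) *\<^sub>R (crev z * cvec (B v))" for v
  proof -
    have "crev z * cvec (B v) = (bsign b / \<kappa>) *\<^sub>R (cvec v * crev z)"
      using arg_cong[where f=crev, OF conj_similarity_vec[OF ne s, of v]] by simp
    then show ?thesis using \<kappa> b by simp
  qed
  note zv = arg_cong[where f="\<lambda>a. \<rho> (cl_cpx a)", OF this] arg_cong[where f="\<lambda>a. \<rho>' (cl_cpx a)", OF this]
  have GM: "X.G v (M u) = (bsign b * \<kappa>) *\<^sub>R M (X.G (B v) u)" "Y.G v (M u) = (bsign b * \<kappa>) *\<^sub>R M (Y.G (B v) u)" for v u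
    unfolding M_def G_opx[OF \<rho>] X.G_simps(2) clin_smult[OF clin_matrix] kron_mult_vec
      clifford_module_simps(2)[OF \<rho>(1), symmetric] clifford_module_simps(2)[OF \<rho>(2), symmetric] zv
    by (simp_all add: clifford_module_simps(2,3)[OF \<rho>(1)] clifford_module_simps(2,3)[OF \<rho>(2)]
        kron_scaleR_left kron_scaleR_right vcomp mult_ac)
  show "clifford_similarity (opx \<rho>) B (bsign b * \<kappa>) M"
    by (intro clifford_similarity.intro clifford_similarity_axioms.intro X.clifford_ops_axioms sim M GM)
  show "clifford_similarity (opy \<rho>') B (bsign b * \<kappa>) M"
    by (intro clifford_similarity.intro clifford_similarity_axioms.intro Y.clifford_ops_axioms sim M GM)
qed

text \<open>The factor e^-t arises because the reversal of the unnormalised element e^t m is e^t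
  times the inverse of m. With it the character becomes the exponent of the twisted
  inversion.\<close>

lemma chi_factor: "inverse (chi l t) * of_real (exp (- t)) = exp (of_real t * - (2 * l + 1))"
  by (simp add: chi_def exp_minus[symmetric] exp_of_real[symmetric] exp_add[symmetric] algebra_simps)

lemma kron_smult: "kron ((r :: real) *\<^sub>R A) (s *\<^sub>R B) *v u = (of_real r * of_real s) *s (kron A B *v u)"
  by (simp add: kron_scaleR_left kron_scaleR_right vcomp mult_ac)

text \<open>By the normal form of the inverse of g, \<open>pi_tensor\<close> is a composition of
  translations, a similarity and possibly the twisted inversion, each of which intertwines. Bounded
  support takes care of the point where the inverse of g is undefined.\<close>

lemma source_op_covariant:
  fixes \<rho> \<rho>' :: "('n::finite, 's::finite) cl_hom" and F :: "('n, 's) field2"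
  assumes \<rho>: "clifford_module \<rho>" "clifford_module \<rho>'" and g: "g \<in> spin_lorentz"
    and F: "smooth F" and bd: "\<And>p. norm p > R \<Longrightarrow> F p = 0"
  shows "source_op \<rho> \<rho>' l \<mu> (pi_tensor \<rho> \<rho>' l \<mu> g F) = pi_tensor \<rho> \<rho>' (l + 1) (\<mu> + 1) g (source_op \<rho> \<rho>' l \<mu> F)"
proof -
  interpret clifford_pair "opx \<rho>" "opy \<rho>'" by (rule clifford_pair_kron[OF \<rho>])
  note ne = clifford_module_nontrivial[OF \<rho>(1)]
  define h where "h = clinv g"
  have h: "h \<in> spin_lorentz" unfolding h_def by (rule spin_inverse(1)[OF g])
  note parts = decomp_parts[OF ne h]
  define E' where "E' = source_op \<rho> \<rho>' l \<mu> F"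
  have EE: "E l \<mu> H x y = source_op \<rho> \<rho>' l \<mu> H (x, y)" if "smooth H" for H x y
    by (rule source_op_eq_E[OF \<rho> open_UNIV, symmetric]) (simp_all add: smooth_on_UNIV that)
  show ?thesis
  proof (rule spin_normal_form[OF ne h], goal_cases affine inversion)
    case (affine d y0 \<kappa> B)
    obtain m t where mt: "m \<in> spin_compact" "d = exp t *\<^sub>R m" by (rule lipschitz_True_polar[OF affine(1)])
    have \<kappa>: "\<kappa> > 0" and dd: "d * crev d = \<kappa> *\<^sub>R 1" using affine(2) by (simp_all add: conj_similarity_def bsign_def)
    have "(exp t * exp t) *\<^sub>R (1 :: (real^'n) clifford) = \<kappa> *\<^sub>R 1"
      using dd spin_compactD(2)[OF mt(1)] by (simp add: mt(2))
    then have et: "exp t * exp t = \<kappa>" by (rule scaleR_one_inj[OF ne])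
    note p = parts[OF mt(1) affine(3)[unfolded mt(2)]]
    have "crev m = exp (- t) *\<^sub>R crev d" by (simp add: mt(2) exp_minus)
    then have inv: "matrix_inv (\<rho> (cl_cpx m)) = exp (- t) *\<^sub>R \<rho> (cl_cpx (crev d))"
      "matrix_inv (\<rho>' (cl_cpx m)) = exp (- t) *\<^sub>R \<rho>' (cl_cpx (crev d))"
      unfolding matrix_inv_spin[OF \<rho>(1) mt(1)] matrix_inv_spin[OF \<rho>(2) mt(1)]
      by (simp_all add: clifford_module_simps(3)[OF \<rho>(1)] clifford_module_simps(3)[OF \<rho>(2)])
    define C where "C l \<mu> = inverse (chi l t) * inverse (chi \<mu> t) * (of_real (exp (- t)) * of_real (exp (- t)))" for l \<mu>
    define M where "M C u = C *s (kron (\<rho> (cl_cpx (crev d))) (\<rho>' (cl_cpx (crev d))) *v u)" for C u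
    have pi: "pi_tensor \<rho> \<rho>' l \<mu> g H (x, y) = M (C l \<mu>) (H (y0 + B x, y0 + B y))" for l \<mu> H x y
      unfolding pi_tensor_def h_def[symmetric] Let_def prod.case
      by (simp add: p inv kron_smult C_def M_def vec_eq_iff)
    \<comment> \<open>Raising each weight by one contributes e^(-2t) = 1/\<kappa>, together the
      factor \<theta>^-2 that \<open>E_similarity\<close> produces.\<close>
    have C1: "C (l + 1) (\<mu> + 1) = of_real (1 / \<kappa>\<^sup>2) * C l \<mu>"
    proof -
      have "chi (l + 1) t = chi l t * of_real \<kappa>" for l
        unfolding et[symmetric] by (simp add: chi_def exp_add[symmetric] exp_of_real[symmetric] algebra_simps)
      then show ?thesis by (simp add: C_def power2_eq_square divide_inverse mult_ac)
    qed
    define F0 where "F0 = (\<lambda>p. F (p + (y0, y0)))"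
    have F0: "smooth F0" unfolding F0_def by (rule smooth_shift[OF F])
    note sim = conj_similarity_clifford_similarity[OF \<rho> affine(2), of "C l \<mu>", folded M_def]
    have clM: "clin (M (C l \<mu>))" by (rule clifford_similarity.clin_M[OF sim(1)])
    have lin: "linear B" using affine(2) by (simp add: conj_similarity_def similarity_def)
    have piF: "pi_tensor \<rho> \<rho>' l \<mu> g F = (\<lambda>(x, y). M (C l \<mu>) (F0 (B x, B y)))"
      by (simp add: fun_eq_iff pi F0_def add.commute)
    show ?thesis
    proof (rule ext, clarify)
      fix x y
      have "source_op \<rho> \<rho>' l \<mu> (pi_tensor \<rho> \<rho>' l \<mu> g F) (x, y) = E l \<mu> (\<lambda>(x, y). M (C l \<mu>) (F0 (B x, B y))) x y"
        unfolding piF by (rule EE[symmetric]) (rule smooth_kron_affine[OF F0 lin clM])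
      also have "\<dots> = (1 / \<kappa>\<^sup>2) *\<^sub>R M (C l \<mu>) (E l \<mu> F0 (B x) (B y))"
        using E_similarity[OF sim F0] by (simp add: bsign_def)
      also have "E l \<mu> F0 (B x) (B y) = E' (y0 + B x, y0 + B y)"
        unfolding EE[OF F0] unfolding F0_def source_op_shift E'_def by (simp add: add.commute)
      also have "(1 / \<kappa>\<^sup>2) *\<^sub>R M (C l \<mu>) (E' (y0 + B x, y0 + B y)) = M (C (l + 1) (\<mu> + 1)) (E' (y0 + B x, y0 + B y))"
        by (simp add: C1 M_def vcomp)
      finally show "source_op \<rho> \<rho>' l \<mu> (pi_tensor \<rho> \<rho>' l \<mu> g F) (x, y) =
          pi_tensor \<rho> \<rho>' (l + 1) (\<mu> + 1) g (source_op \<rho> \<rho>' l \<mu> F) (x, y)"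
        by (simp only: pi E'_def)
    qed
  next
    case (inversion c x0 y0 \<kappa> B)
    have \<kappa>: "\<kappa> > 0" and cc: "c * crev c = (- \<kappa>) *\<^sub>R 1" using inversion(2) by (simp_all add: conj_similarity_def bsign_def)
    have undef: "\<not> act_defined h x0" by (rule not_act_defined[OF ne inversion(3)])
    \<comment> \<open>The solution t of e^(2t) = \<kappa> |x - x0|^2, the right side being the norm
      of c (x - x0). The explicit formula splits the multiplier into a constant and a power of |x -
      x0|.\<close>
    define \<tau> where "\<tau> x = ln \<kappa> / 2 + ln ((x - x0) \<bullet> (x - x0)) / 2" for x
    define m where "m x = exp (- \<tau> x) *\<^sub>R (- (c * cvec (x - x0)))" for x
    have m: "m x \<in> spin_compact" "- (c * cvec (x - x0)) = exp (\<tau> x) *\<^sub>R m x" if x: "x \<noteq> x0" for x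
    proof -
      have z: "x - x0 \<noteq> 0" using x by simp
      have "lipschitz (False = False) (c * cvec (- (x - x0)))" using z by (intro lipschitz_mult[OF inversion(1) lipschitz_cvec]) simp
      then have "lipschitz True (- (c * cvec (x - x0)))" by (simp only: cvec_minus) simp
      then obtain m' t where mt: "m' \<in> spin_compact" "- (c * cvec (x - x0)) = exp t *\<^sub>R m'"
        by (rule lipschitz_True_polar)
      have "(- (c * cvec (x - x0))) * crev (- (c * cvec (x - x0))) = c * (cvec (x - x0) * cvec (x - x0)) * crev c"
        by (simp add: mult.assoc)
      also have "\<dots> = (\<kappa> * ((x - x0) \<bullet> (x - x0))) *\<^sub>R 1"
        unfolding cvec_mult_self by (simp add: cc mult.commute)
      finally have "(exp t * exp t) *\<^sub>R (1 :: (real^'n) clifford) = (\<kappa> * ((x - x0) \<bullet> (x - x0))) *\<^sub>R 1"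
        unfolding mt(2) using spin_compactD(2)[OF mt(1)] by simp
      then have "exp (2 * t) = \<kappa> * ((x - x0) \<bullet> (x - x0))"
        using scaleR_one_inj[OF ne] by (simp flip: exp_add)
      then have "2 * t = ln (\<kappa> * ((x - x0) \<bullet> (x - x0)))" by (metis ln_exp)
      then have t: "t = \<tau> x" using \<kappa> z by (simp add: \<tau>_def ln_mult)
      have "m x = m'" unfolding m_def mt(2) t by (simp flip: exp_add)
      then show "m x \<in> spin_compact" "- (c * cvec (x - x0)) = exp (\<tau> x) *\<^sub>R m x" using mt t by simp_all
    qed
    have p: "act_defined h x" "act h x = y0 + B (vinv (x - x0))" "m_part h x = m x" "a_part h x = \<tau> x"
      if x: "x \<noteq> x0" for x
    proof -
      have "ideal_act h (1, - cvec x) = (exp (\<tau> x) *\<^sub>R m x, - (cvec (y0 + B (vinv (x - x0))) * (exp (\<tau> x) *\<^sub>R m x)))"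
        unfolding inversion(4)[OF x] m(2)[OF x, symmetric] by simp
      from parts[OF m(1)[OF x] this] show "act_defined h x" "act h x = y0 + B (vinv (x - x0))"
        "m_part h x = m x" "a_part h x = \<tau> x" by auto
    qed
    have inv: "matrix_inv (\<rho> (cl_cpx (m x))) = (- exp (- \<tau> x)) *\<^sub>R (\<rho> (cl_vec (x - x0)) ** \<rho> (cl_cpx (crev c)))"
      "matrix_inv (\<rho>' (cl_cpx (m x))) = (- exp (- \<tau> x)) *\<^sub>R (\<rho>' (cl_vec (x - x0)) ** \<rho>' (cl_cpx (crev c)))"
      if x: "x \<noteq> x0" for x
    proof -
      have "crev (m x) = (- exp (- \<tau> x)) *\<^sub>R (cvec (x - x0) * crev c)" by (simp add: m_def)
      then show "matrix_inv (\<rho> (cl_cpx (m x))) = (- exp (- \<tau> x)) *\<^sub>R (\<rho> (cl_vec (x - x0)) ** \<rho> (cl_cpx (crev c)))"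
        "matrix_inv (\<rho>' (cl_cpx (m x))) = (- exp (- \<tau> x)) *\<^sub>R (\<rho>' (cl_vec (x - x0)) ** \<rho>' (cl_cpx (crev c)))"
        unfolding matrix_inv_spin[OF \<rho>(1) m(1)[OF x]] matrix_inv_spin[OF \<rho>(2) m(1)[OF x]]
        by (simp_all only: clifford_module_simps(2,3)[OF \<rho>(1)] clifford_module_simps(2,3)[OF \<rho>(2)])
    qed
    \<comment> \<open>The part of both multipliers that comes from \<kappa>; the powers of |x - x0|
      and |y - x0| go into \<open>J\<close>.\<close>
    define C where "C l \<mu> = exp (of_real (ln \<kappa> / 2) * (- (2 * l + 1) + - (2 * \<mu> + 1)))" for l \<mu> :: complex
    define M where "M C u = C *s (kron (\<rho> (cl_cpx (crev c))) (\<rho>' (cl_cpx (crev c))) *v u)" for C u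
    have fac: "inverse (chi l (\<tau> x)) * of_real (exp (- \<tau> x))
        = exp (of_real (ln \<kappa> / 2) * - (2 * l + 1)) * cpow (- (2 * l + 1)) (x - x0)" for l x
    proof -
      have "complex_of_real (\<tau> x) * - (2 * l + 1) = of_real (ln \<kappa> / 2) * - (2 * l + 1)
          + - (2 * l + 1) * of_real (ln ((x - x0) \<bullet> (x - x0)) / 2)"
        by (simp add: \<tau>_def algebra_simps)
      then show ?thesis unfolding chi_factor cpow_def by (simp only: exp_add)
    qed
    have pi: "pi_tensor \<rho> \<rho>' l \<mu> g H (x, y) = J (- (2 * l + 1)) (- (2 * \<mu> + 1)) (x - x0) (y - x0)
        (M (C l \<mu>) (H (y0 + B (vinv (x - x0)), y0 + B (vinv (y - x0)))))"
      if x: "x \<noteq> x0" and y: "y \<noteq> x0" for l \<mu> H x y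
    proof -
      let ?u = "H (y0 + B (vinv (x - x0)), y0 + B (vinv (y - x0)))"
      let ?K = "kron (\<rho> (cl_vec (x - x0)) ** \<rho> (cl_cpx (crev c))) (\<rho>' (cl_vec (y - x0)) ** \<rho>' (cl_cpx (crev c))) *v ?u"
      have "pi_tensor \<rho> \<rho>' l \<mu> g H (x, y) = ((inverse (chi l (\<tau> x)) * of_real (exp (- \<tau> x))) *
          (inverse (chi \<mu> (\<tau> y)) * of_real (exp (- \<tau> y)))) *s ?K"
        unfolding pi_tensor_def h_def[symmetric] Let_def prod.case p[OF x] p[OF y] inv[OF x] inv[OF y] kron_smult
        using p(1)[OF x] p(1)[OF y] by (simp add: vec_eq_iff)
      also have "\<dots> = (C l \<mu> * (cpow (- (2 * l + 1)) (x - x0) * cpow (- (2 * \<mu> + 1)) (y - x0))) *s ?K"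
        unfolding fac C_def by (simp only: exp_add distrib_left) (simp add: mult_ac)
      also have "\<dots> = J (- (2 * l + 1)) (- (2 * \<mu> + 1)) (x - x0) (y - x0) (M (C l \<mu>) ?u)"
        unfolding J_def M_def G_opx[OF \<rho>] clin_smult[OF clin_matrix] kron_mult_vec
        by (simp add: kron_mult_vec vec_eq_iff mult_ac)
      finally show ?thesis .
    qed
    have C1: "C (l + 1) (\<mu> + 1) = of_real (1 / \<kappa>\<^sup>2) * C l \<mu>"
    proof -
      have "of_real (ln \<kappa> / 2) * (- (2 * (l + 1) + 1) + - (2 * (\<mu> + 1) + 1)) =
          complex_of_real (- (2 * ln \<kappa>)) + of_real (ln \<kappa> / 2) * (- (2 * l + 1) + - (2 * \<mu> + 1))"
        by (simp add: field_simps)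
      moreover have "exp (- (2 * ln \<kappa>)) = 1 / \<kappa>\<^sup>2"
        using \<kappa> by (simp add: exp_minus exp_double inverse_eq_divide)
      ultimately show ?thesis unfolding C_def by (simp only: exp_add exp_of_real)
    qed
    define F0 where "F0 = (\<lambda>p. F (p + (y0, y0)))"
    have F0: "smooth F0" unfolding F0_def by (rule smooth_shift[OF F])
    note sim = conj_similarity_clifford_similarity[OF \<rho> inversion(2), of "C l \<mu>", folded M_def]
    have clM: "clin (M (C l \<mu>))" by (rule clifford_similarity.clin_M[OF sim(1)])
    have lin: "linear B" and inner_B: "\<kappa>\<^sup>2 * (B v \<bullet> B v) = v \<bullet> v" for v
      using inversion(2) by (simp_all add: conj_similarity_def similarity_def bsign_def)
    define F1 where "F1 = (\<lambda>(x, y). M (C l \<mu>) (F0 (B x, B y)))"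
    have F1: "smooth F1" unfolding F1_def by (rule smooth_kron_affine[OF F0 lin clM])
    define w w' where "w = - (2 * l + 1)" and "w' = - (2 * \<mu> + 1)"
    define H where "H = (\<lambda>(x, y). J w w' x y (F1 (vinv x, vinv y)))"
    show ?thesis
    proof (rule ext, clarify)
      fix x y
      show "source_op \<rho> \<rho>' l \<mu> (pi_tensor \<rho> \<rho>' l \<mu> g F) (x, y) =
          pi_tensor \<rho> \<rho>' (l + 1) (\<mu> + 1) g (source_op \<rho> \<rho>' l \<mu> F) (x, y)"
      proof (cases "x \<noteq> x0 \<and> y \<noteq> x0")
        case True
        then have x: "x \<noteq> x0" "x - x0 \<noteq> 0" and y: "y \<noteq> x0" "y - x0 \<noteq> 0" by simp_all
        have W: "open ((- {x0}) \<times> (- {x0}))" "(x, y) \<in> (- {x0}) \<times> (- {x0})"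
          using x y by (auto intro: open_Times)
        \<comment> \<open>The explicit formula holds on the open set where neither variable is x0,
          and this is enough by locality.\<close>
        have "source_op \<rho> \<rho>' l \<mu> (pi_tensor \<rho> \<rho>' l \<mu> g F) (x, y)
            = source_op \<rho> \<rho>' l \<mu> (\<lambda>p. H (p + (- x0, - x0))) (x, y)"
        proof (rule source_op_cong_open[OF W])
          fix q assume "q \<in> (- {x0}) \<times> (- {x0})"
          then obtain a b where q: "q = (a, b)" "a \<noteq> x0" "b \<noteq> x0" by (cases q) auto
          show "pi_tensor \<rho> \<rho>' l \<mu> g F q = H (q + (- x0, - x0))"
            unfolding q(1) pi[OF q(2,3)] H_def F1_def F0_def w_def w'_def by (simp add: add.commute)
        qed
        also have "\<dots> = source_op \<rho> \<rho>' l \<mu> H (x - x0, y - x0)" by (simp add: source_op_shift)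
        also have "\<dots> = E l \<mu> H (x - x0) (y - x0)"
          unfolding H_def using x y
          by (intro source_op_eq_E[OF \<rho> _ _ smooth_on_J[OF F1]]) (auto intro: open_Times)
        also have "\<dots> = J (w - 2) (w' - 2) (x - x0) (y - x0) (E l \<mu> F1 (vinv (x - x0)) (vinv (y - x0)))"
          unfolding H_def w_def w'_def by (rule E_inversion[OF x(2) y(2) F1])
        also have "E l \<mu> F1 (vinv (x - x0)) (vinv (y - x0))
            = (1 / \<kappa>\<^sup>2) *\<^sub>R M (C l \<mu>) (E l \<mu> F0 (B (vinv (x - x0))) (B (vinv (y - x0))))"
          unfolding F1_def using E_similarity[OF sim F0] by (simp add: bsign_def)
        also have "E l \<mu> F0 (B (vinv (x - x0))) (B (vinv (y - x0)))
            = E' (y0 + B (vinv (x - x0)), y0 + B (vinv (y - x0)))"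
          unfolding EE[OF F0] unfolding F0_def source_op_shift E'_def by (simp add: add.commute)
        also have "(1 / \<kappa>\<^sup>2) *\<^sub>R M (C l \<mu>) (E' (y0 + B (vinv (x - x0)), y0 + B (vinv (y - x0))))
            = M (C (l + 1) (\<mu> + 1)) (E' (y0 + B (vinv (x - x0)), y0 + B (vinv (y - x0))))"
          by (simp add: C1 M_def vcomp)
        finally show ?thesis
          unfolding pi[OF x(1) y(1)] E'_def w_def w'_def by (simp add: algebra_simps)
      next
        case False
        \<comment> \<open>Within this distance of x0 the inverted point has norm 1 / (\<kappa> |z -
          x0|), larger than |R| + |y0| + 1, so the image stays beyond R after the translation by y0.
          Hence \<open>pi_tensor\<close> vanishes on a neighbourhood of every pair having x0 as a
          component.\<close>
        define K where "K = 1 / (\<kappa> * (\<bar>R\<bar> + norm y0 + 1))"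
        have pos: "0 < \<kappa> * (\<bar>R\<bar> + norm y0 + 1)"
          using \<kappa> norm_ge_zero[of y0] abs_ge_zero[of R] by (intro mult_pos_pos) linarith+
        then have K: "K > 0" unfolding K_def by simp
        have far: "norm (y0 + B (vinv (z - x0))) > R" if "z \<noteq> x0" "norm (z - x0) < K" for z
        proof -
          let ?v = "z - x0"
          have v: "norm ?v > 0" using that by simp
          have "(\<kappa> * norm (B (vinv ?v)))\<^sup>2 = (norm (vinv ?v))\<^sup>2"
            using inner_B[of "vinv ?v"] by (simp add: power_mult_distrib power2_norm_eq_inner)
          then have "\<kappa> * norm (B (vinv ?v)) = norm (vinv ?v)" using \<kappa> by (simp add: power2_eq_iff_nonneg)
          also have "\<dots> = 1 / norm ?v" using v by (simp add: vinv_def dot_square_norm power2_eq_square)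
          also have "1 / norm ?v > \<kappa> * (\<bar>R\<bar> + norm y0 + 1)"
            using pos that(2) v unfolding K_def by (simp add: pos_less_divide_eq mult.commute)
          finally have "norm (B (vinv ?v)) > \<bar>R\<bar> + norm y0 + 1" using \<kappa> by simp
          then show ?thesis using norm_diff_ineq[of "B (vinv ?v)" y0] by (simp add: add.commute)
        qed
        define V where "V = {p :: (real^'n) \<times> (real^'n). norm (fst p - x0) < K} \<union> {p. norm (snd p - x0) < K}"
        have V: "open V" "(x, y) \<in> V"
          unfolding V_def using False K by (auto intro!: open_Un open_Collect_less continuous_intros)
        have zero: "pi_tensor \<rho> \<rho>' l \<mu> g F q = 0" if "q \<in> V" for q
        proof -
          obtain a b where q: "q = (a, b)" by (cases q)
          show ?thesis
          proof (cases "a \<noteq> x0 \<and> b \<noteq> x0")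
            case True
            have "norm (y0 + B (vinv (a - x0))) > R \<or> norm (y0 + B (vinv (b - x0))) > R"
              using that far[of a] far[of b] True by (auto simp: V_def q)
            then have "norm (y0 + B (vinv (a - x0)), y0 + B (vinv (b - x0))) > R"
              using norm_fst_le[of "y0 + B (vinv (a - x0))" "y0 + B (vinv (b - x0))"]
                norm_snd_le[of "y0 + B (vinv (b - x0))" "y0 + B (vinv (a - x0))"] by auto
            then have "F (y0 + B (vinv (a - x0)), y0 + B (vinv (b - x0))) = 0" by (rule bd)
            moreover have ab: "a \<noteq> x0" "b \<noteq> x0" using True by simp_all
            ultimately show ?thesis unfolding q pi[OF ab] by (simp only: clin_zero[OF clM] clin_zero[OF clin_J])
          next
            case False
            then show ?thesis using undef by (auto simp: q pi_tensor_def h_def Let_def)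
          qed
        qed
        have "source_op \<rho> \<rho>' l \<mu> (pi_tensor \<rho> \<rho>' l \<mu> g F) (x, y) = source_op \<rho> \<rho>' l \<mu> (\<lambda>_. 0) (x, y)"
          by (rule source_op_cong_open[OF V zero])
        also have "\<dots> = 0" by (rule source_op_zero)
        also have "0 = pi_tensor \<rho> \<rho>' (l + 1) (\<mu> + 1) g (source_op \<rho> \<rho>' l \<mu> F) (x, y)"
          using undef False by (auto simp: pi_tensor_def h_def Let_def)
        finally show ?thesis .
      qed
    qed
  qed
qed

section \<open>Clifford modules and alternating forms\<close>

lemma permute_list_transpose:
  assumes "a < length vs" "b < length vs"
  shows "permute_list (Transposition.transpose a b) vs = vs[a := vs ! b, b := vs ! a]"
proof (rule nth_equalityI)
  fix i assume "i < length (permute_list (Transposition.transpose a b) vs)"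
  then have i: "i < length vs" by simp
  have p: "Transposition.transpose a b permutes {..<length vs}" using assms by (intro permutes_swap_id) auto
  show "permute_list (Transposition.transpose a b) vs ! i = vs[a := vs ! b, b := vs ! a] ! i"
    using permute_list_nth[OF p i] assms i
    by (auto simp: nth_list_update Transposition.transpose_def)
qed simp

lemma permute_list_update:
  assumes p: "p permutes {..<length vs}" and i: "i < length vs"
  shows "permute_list p (vs[i := w]) = (permute_list p vs)[inv p i := w]"
proof (rule nth_equalityI)
  fix j assume "j < length (permute_list p (vs[i := w]))"
  then have j: "j < length vs" by simp
  have e: "(p j = i) = (inv p i = j)" using p by (metis permutes_inverses(1) permutes_inverses(2))
  have pj: "p j < length vs" using permutes_in_image[OF p, of j] j by simp
  have p': "p permutes {..<length (vs[i := w])}" and j': "j < length (vs[i := w])" using p j by simp_all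
  show "permute_list p (vs[i := w]) ! j = (permute_list p vs)[inv p i := w] ! j"
    unfolding permute_list_nth[OF p' j'] using j pj e permute_list_nth[OF p j]
    by (auto simp: nth_list_update)
qed simp

text \<open>Permutations are composed of transpositions. The predicate \<open>Q\<close> restricts to
  a class of lists closed under exchange of entries: orthogonal lists for Clifford words, lists of
  the right length for alternating forms.\<close>

lemma sign_swap_list:
  fixes L :: "'v list \<Rightarrow> 'c::comm_ring_1"
  assumes sw: "\<And>vs a b. Q vs \<Longrightarrow> a < b \<Longrightarrow> b < length vs \<Longrightarrow> L (vs[a := vs ! b, b := vs ! a]) = - L vs"
    and Q: "\<And>vs a b. Q vs \<Longrightarrow> a < b \<Longrightarrow> b < length vs \<Longrightarrow> Q (vs[a := vs ! b, b := vs ! a])"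
    and Qv: "Q vs" and p: "p permutes {..<k}" and k: "length vs = k"
  shows "L (permute_list p vs) = of_int (sign p) * L vs"
proof -
  have "\<forall>vs. Q vs \<and> length vs = k \<longrightarrow> L (permute_list p vs) = of_int (sign p) * L vs"
    using p finite_lessThan
  proof (induction rule: permutes_induct)
    case id
    then show ?case by simp
  next
    case (swap a b p)
    show ?case
    proof (intro allI impI)
      fix vs assume vs: "Q vs \<and> length vs = k"
      \<comment> \<open>The assumption covers transpositions of ordered positions only.\<close>
      define a' b' where "a' = min a b" and "b' = max a b"
      have ab: "a' < b'" "b' < length vs" using swap.hyps vs by (auto simp: a'_def b'_def)
      have t: "Transposition.transpose a b = Transposition.transpose a' b'"
        by (auto simp: a'_def b'_def min_def max_def Transposition.transpose_commute)
      let ?ws = "vs[a' := vs ! b', b' := vs ! a']"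
      have pl: "permute_list (Transposition.transpose a' b') vs = ?ws"
        using ab by (intro permute_list_transpose) auto
      have "permute_list (Transposition.transpose a b \<circ> p) vs = permute_list p ?ws"
        unfolding t using swap.hyps vs by (subst permute_list_compose) (simp_all add: pl)
      also have "L \<dots> = of_int (sign p) * L ?ws"
        using swap.IH Q[of vs, OF _ ab] vs by simp
      also have "L ?ws = - L vs" using sw[of vs, OF _ ab] vs by simp
      finally have "L (permute_list (Transposition.transpose a b \<circ> p) vs) = of_int (sign p) * - L vs" .
      moreover have "sign (Transposition.transpose a b \<circ> p) = - sign p"
        using swap.hyps permutation_permutes[of p] finite_lessThan
        by (subst sign_compose) (auto simp: permutation_swap_id sign_swap_id)
      ultimately show "L (permute_list (Transposition.transpose a b \<circ> p) vs) = of_int (sign (Transposition.transpose a b \<circ> p)) * L vs"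
        by (simp only: of_int_minus mult_minus_left mult_minus_right)
    qed
  qed
  then show ?thesis using Qv k by blast
qed

section \<open>Clifford words and their antisymmetrisation\<close>

definition clifford_word :: "('n::finite, 's::finite) cl_hom \<Rightarrow> (real^'n) list \<Rightarrow> complex^'s^'s" where
  "clifford_word \<rho> vs = foldr (\<lambda>v A. \<rho> (cl_vec v) ** A) vs (mat 1)"

lemma clifford_word_simps [simp]: "clifford_word \<rho> [] = mat 1" "clifford_word \<rho> (v # vs) = \<rho> (cl_vec v) ** clifford_word \<rho> vs"
  by (simp_all add: clifford_word_def)

lemma clifford_word_append: "clifford_word \<rho> (vs @ ws) = clifford_word \<rho> vs ** clifford_word \<rho> ws"
  by (induction vs) (simp_all add: matrix_mul_assoc)

lemma matrix_scaleR_mult: "(r *\<^sub>R A) ** B = r *\<^sub>R (A ** B)" "A ** (r *\<^sub>R B) = r *\<^sub>R (A ** B)"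
  for A B :: "complex^'s::finite^'s"
  by (simp_all add: vec_eq_iff matrix_matrix_mult_def scaleR_sum_right)

lemma matrix_minus_mult: "(- A) ** B = - (A ** B)" "A ** (- B) = - (A ** B)" for A B :: "complex^'s::finite^'s"
  by (simp_all add: vec_eq_iff matrix_matrix_mult_def sum_negf)

lemma matrix_add_mult: "(A + B) ** C = A ** C + B ** C" "C ** (A + B) = C ** A + C ** B"
  for A B C :: "complex^'s::finite^'s"
  by (simp_all add: vec_eq_iff matrix_matrix_mult_def distrib_left distrib_right sum.distrib)

text \<open>The linear extension of the pairing (W s, t') from pure tensors to all T, with W the
  word.\<close>

definition trace_word :: "('n::finite, 's::finite) cl_hom \<Rightarrow> complex^('s \<times> 's) \<Rightarrow> (real^'n) list \<Rightarrow> complex" where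
  "trace_word \<rho> T vs = (\<Sum>a\<in>UNIV. \<Sum>b\<in>UNIV. T $ (a, b) * clifford_word \<rho> vs $ b $ a)"

lemma psi_basis_trace_word: "psi_basis \<rho> is T = trace_word \<rho> T (map stdb is)"
proof -
  have "foldr (\<lambda>i A. \<rho> (cl_e i) ** A) is (mat 1) = clifford_word \<rho> (map stdb is)"
    by (induction "is") simp_all
  moreover have "pairing (M *v axis a 1) (axis b 1) = M $ b $ a" for M :: "complex^'b^'b" and a b
    by (simp add: pairing_def matrix_vector_mult_def axis_def if_distrib cong: if_cong)
  ultimately show ?thesis by (simp add: psi_basis_def trace_word_def)
qed

lemma trace_word_linear:
  "trace_word \<rho> (T + U) vs = trace_word \<rho> T vs + trace_word \<rho> U vs"
  "trace_word \<rho> (z *s T) vs = z * trace_word \<rho> T vs"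
  by (simp_all add: trace_word_def algebra_simps sum.distrib sum_distrib_left)

lemma trace_word_cong: "clifford_word \<rho> vs = c *\<^sub>R clifford_word \<rho> ws \<Longrightarrow> trace_word \<rho> T vs = of_real c * trace_word \<rho> T ws"
  by (simp add: trace_word_def vector_scaleR_component scaleR_conv_of_real[where 'a=complex] sum_distrib_left mult_ac)

lemma trace_word_add: "clifford_word \<rho> vs = clifford_word \<rho> us + clifford_word \<rho> ws \<Longrightarrow>
    trace_word \<rho> T vs = trace_word \<rho> T us + trace_word \<rho> T ws"
  by (simp add: trace_word_def distrib_left sum.distrib)

context
  fixes \<rho> :: "('n::finite, 's::finite) cl_hom"
  assumes \<rho>: "clifford_module \<rho>"
begin

lemma clifford_word_update: "i < length vs \<Longrightarrow> clifford_word \<rho> (vs[i := w]) = clifford_word \<rho> (take i vs) ** (\<rho> (cl_vec w) ** clifford_word \<rho> (drop (Suc i) vs))"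
  by (simp add: upd_conv_take_nth_drop clifford_word_append)

lemma trace_word_multilinear:
  assumes "i < length vs"
  shows "trace_word \<rho> T (vs[i := u + v]) = trace_word \<rho> T (vs[i := u]) + trace_word \<rho> T (vs[i := v])"
    "trace_word \<rho> T (vs[i := r *\<^sub>R v]) = of_real r * trace_word \<rho> T (vs[i := v])"
proof -
  show "trace_word \<rho> T (vs[i := u + v]) = trace_word \<rho> T (vs[i := u]) + trace_word \<rho> T (vs[i := v])"
    by (rule trace_word_add)
      (simp add: clifford_word_update[OF assms] cvec_add clifford_module_simps[OF \<rho>] matrix_add_mult)
  show "trace_word \<rho> T (vs[i := r *\<^sub>R v]) = of_real r * trace_word \<rho> T (vs[i := v])"
    by (rule trace_word_cong)
      (simp add: clifford_word_update[OF assms] cvec_scaleR clifford_module_simps[OF \<rho>] matrix_scaleR_mult)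
qed

lemma cl_vec_anticommute:
  assumes "v \<bullet> w = 0"
  shows "\<rho> (cl_vec v) ** \<rho> (cl_vec w) = - (\<rho> (cl_vec w) ** \<rho> (cl_vec v))"
proof -
  have "\<rho> (cl_vec v) ** \<rho> (cl_vec w) + \<rho> (cl_vec w) ** \<rho> (cl_vec v) = \<rho> (cl_cpx (0 *\<^sub>R 1))"
    using assms by (simp add: clifford_module_simps(1,2)[OF \<rho>, symmetric] cvec_clifford qprod_vec_def)
  then show ?thesis unfolding clifford_module_simps(3)[OF \<rho>] by (simp add: eq_neg_iff_add_eq_0)
qed

lemma clifford_word_move:
  assumes "\<forall>z\<in>set zs. x \<bullet> z = 0"
  shows "\<rho> (cl_vec x) ** clifford_word \<rho> zs = (- 1) ^ length zs *\<^sub>R (clifford_word \<rho> zs ** \<rho> (cl_vec x))"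
  using assms
proof (induction zs)
  case (Cons z zs)
  have "\<rho> (cl_vec x) ** clifford_word \<rho> (z # zs) = (\<rho> (cl_vec x) ** \<rho> (cl_vec z)) ** clifford_word \<rho> zs"
    by (simp add: matrix_mul_assoc)
  also have "\<dots> = - (\<rho> (cl_vec z) ** (\<rho> (cl_vec x) ** clifford_word \<rho> zs))"
    using Cons.prems by (simp add: cl_vec_anticommute[of x z] matrix_minus_mult matrix_mul_assoc)
  finally show ?case using Cons by (simp add: matrix_scaleR_mult matrix_mul_assoc)
qed simp

text \<open>Moving x or y through the entries between them gives the same power of -1, so these
  signs agree on both sides and only y x = - x y remains.\<close>

lemma clifford_word_swap:
  assumes "\<forall>z\<in>set zs. x \<bullet> z = 0" "\<forall>z\<in>set zs. y \<bullet> z = 0" "x \<bullet> y = 0"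
  shows "clifford_word \<rho> (xs @ y # zs @ x # ws) = - clifford_word \<rho> (xs @ x # zs @ y # ws)"
proof -
  define e where "e = (- 1 :: real) ^ length zs"
  have e: "e * e = 1" by (simp add: e_def flip: power_add)
  let ?x = "\<rho> (cl_vec x)" and ?y = "\<rho> (cl_vec y)" and ?z = "clifford_word \<rho> zs"
  have x: "?x ** ?z = e *\<^sub>R (?z ** ?x)" and y: "?y ** ?z = e *\<^sub>R (?z ** ?y)"
    using clifford_word_move assms by (simp_all add: e_def)
  have s1: "?y ** (?z ** ?x) = e *\<^sub>R (?z ** (?y ** ?x))" and s2: "?x ** (?z ** ?y) = e *\<^sub>R (?z ** (?x ** ?y))"
    by (simp_all only: matrix_mul_assoc x y matrix_scaleR_mult)
  have s3: "?y ** ?x = - (?x ** ?y)"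
    by (rule cl_vec_anticommute) (use assms(3) in \<open>simp add: inner_commute\<close>)
  have "?y ** (?z ** ?x) = - (?x ** (?z ** ?y))"
    unfolding s1 s2 s3 by (simp only: matrix_minus_mult scaleR_minus_right)
  moreover have "clifford_word \<rho> (xs @ v # zs @ w # ws)
      = clifford_word \<rho> xs ** (\<rho> (cl_vec v) ** (?z ** \<rho> (cl_vec w)) ** clifford_word \<rho> ws)" for v w
    by (simp add: clifford_word_append matrix_mul_assoc)
  ultimately show ?thesis by (simp only: matrix_minus_mult)
qed

lemma list_swap_split:
  assumes "a < b" "b < length vs"
  obtains xs zs ws where "vs = xs @ vs ! a # zs @ vs ! b # ws"
    "vs[a := vs ! b, b := vs ! a] = xs @ vs ! b # zs @ vs ! a # ws" "length xs = a" "length zs = b - Suc a"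
proof -
  define xs zs ws where "xs = take a vs" and "zs = take (b - Suc a) (drop (Suc a) vs)" and "ws = drop (Suc b) vs"
  have 1: "vs = xs @ vs ! a # drop (Suc a) vs" unfolding xs_def using assms by (simp add: id_take_nth_drop)
  have "drop (Suc a) vs = zs @ drop (Suc a) vs ! (b - Suc a) # drop (Suc (b - Suc a)) (drop (Suc a) vs)"
    unfolding zs_def using assms by (intro id_take_nth_drop) simp
  then have 2: "drop (Suc a) vs = zs @ vs ! b # ws" using assms by (simp add: ws_def)
  have l: "length xs = a" "length zs = b - Suc a" using assms by (simp_all add: xs_def zs_def)
  have vs: "vs = xs @ vs ! a # zs @ vs ! b # ws" using 1 2 by simp
  have "(xs @ x # zs @ y # ws)[a := u, b := v] = xs @ u # zs @ v # ws" for x y u v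
    using l assms by (simp add: list_update_append nth_append)
      (metis Suc_diff_Suc diff_self_eq_0 length_Cons list_update_code(2) list_update_length nat.case(2) not_less_eq)
  then have "vs[a := vs ! b, b := vs ! a] = xs @ vs ! b # zs @ vs ! a # ws" using vs by metis
  then show ?thesis using that vs l by blast
qed

definition orth_list :: "(real^'n) list \<Rightarrow> bool" where
  "orth_list vs \<longleftrightarrow> (\<forall>i<length vs. \<forall>j<length vs. i \<noteq> j \<longrightarrow> vs ! i \<bullet> vs ! j = 0)"

lemma orth_list_swap:
  assumes "orth_list vs" "a < b" "b < length vs"
  shows "orth_list (vs[a := vs ! b, b := vs ! a])"
  using assms unfolding orth_list_def by (auto simp: nth_list_update)

lemma clifford_word_orth_swap:
  assumes o: "orth_list vs" and ab: "a < b" "b < length vs"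
  shows "clifford_word \<rho> (vs[a := vs ! b, b := vs ! a]) = - clifford_word \<rho> vs"
proof -
  obtain xs zs ws where s: "vs = xs @ vs ! a # zs @ vs ! b # ws"
    "vs[a := vs ! b, b := vs ! a] = xs @ vs ! b # zs @ vs ! a # ws" "length xs = a" "length zs = b - Suc a"
    by (rule list_swap_split[OF ab])
  have e: "xs @ vs ! a # zs @ vs ! b # ws = vs" by (rule s(1)[symmetric])
  have z: "vs ! c \<bullet> z = 0" if zs: "z \<in> set zs" and c: "c = a \<or> c = b" for z c
  proof -
    obtain i where i: "i < length zs" "zs ! i = z" using zs unfolding in_set_conv_nth by blast
    have "(xs @ u # zs @ v # ws) ! (Suc a + i) = zs ! i" for u v
      using i s(3) by (simp add: nth_append)
    from this[of "vs ! a" "vs ! b"] have "vs ! (Suc a + i) = z" unfolding e i(2) .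
    moreover have "Suc a + i < b" using i s(4) ab by simp
    moreover have "c < length vs" "Suc a + i < length vs" "c \<noteq> Suc a + i"
      using \<open>Suc a + i < b\<close> ab c by auto
    ultimately show ?thesis using o unfolding orth_list_def by blast
  qed
  have "vs ! a \<bullet> vs ! b = 0" using o ab unfolding orth_list_def by auto
  then have "clifford_word \<rho> (xs @ vs ! b # zs @ vs ! a # ws) = - clifford_word \<rho> (xs @ vs ! a # zs @ vs ! b # ws)"
    using z by (intro clifford_word_swap) blast+
  then show ?thesis by (simp only: s(2) e)
qed

text \<open>Dividing by k! makes the antisymmetrisation agree with the word itself on lists of
  distinct basis vectors.\<close>

definition alt_word :: "nat \<Rightarrow> complex^('s \<times> 's) \<Rightarrow> 'n form" where
  "alt_word k T vs = (if length vs = k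
     then (\<Sum>p | p permutes {..<k}. of_int (sign p) * trace_word \<rho> T (permute_list p vs)) / fact k else 0)"

lemma alt_word_linear:
  "alt_word k (T + U) vs = alt_word k T vs + alt_word k U vs"
  "alt_word k (z *s T) vs = z * alt_word k T vs"
  by (simp_all add: alt_word_def trace_word_linear algebra_simps sum.distrib add_divide_distrib sum_distrib_left)

lemma alt_form_alt_word: "alt_form k (alt_word k T)"
  unfolding alt_form_def
proof (intro conjI allI impI)
  fix vs :: "(real^'n) list" assume "length vs \<noteq> k"
  then show "alt_word k T vs = 0" by (simp add: alt_word_def)
next
  fix vs :: "(real^'n) list" and i u v assume i: "length vs = k \<and> i < k"
  have "trace_word \<rho> T (permute_list p (vs[i := u + v]))
      = trace_word \<rho> T (permute_list p (vs[i := u])) + trace_word \<rho> T (permute_list p (vs[i := v]))"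
    if p: "p permutes {..<k}" for p
  proof -
    have p': "p permutes {..<length vs}" and il: "i < length vs" using p i by simp_all
    have "inv p i < length (permute_list p vs)"
      using permutes_in_image[OF permutes_inv[OF p], of i] i by simp
    then show ?thesis unfolding permute_list_update[OF p' il] by (rule trace_word_multilinear)
  qed
  then show "alt_word k T (vs[i := u + v]) = alt_word k T (vs[i := u]) + alt_word k T (vs[i := v])"
    using i by (simp add: alt_word_def distrib_left sum.distrib add_divide_distrib)
next
  fix vs :: "(real^'n) list" and i r v assume i: "length vs = k \<and> i < k"
  have "trace_word \<rho> T (permute_list p (vs[i := r *\<^sub>R v])) = of_real r * trace_word \<rho> T (permute_list p (vs[i := v]))"
    if p: "p permutes {..<k}" for p
  proof -
    have p': "p permutes {..<length vs}" and il: "i < length vs" using p i by simp_all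
    have "inv p i < length (permute_list p vs)"
      using permutes_in_image[OF permutes_inv[OF p], of i] i by simp
    then show ?thesis unfolding permute_list_update[OF p' il] by (rule trace_word_multilinear)
  qed
  then show "alt_word k T (vs[i := r *\<^sub>R v]) = of_real r * alt_word k T (vs[i := v])"
    using i by (simp add: alt_word_def sum_distrib_left mult_ac)
next
  fix vs :: "(real^'n) list" and i j assume h: "length vs = k \<and> i < j \<and> j < k \<and> vs ! i = vs ! j"
  \<comment> \<open>Composition with the transposition of the two equal entries pairs the
    permutations; paired terms have the same word and opposite signs.\<close>
  define t where "t = Transposition.transpose i j"
  define f where "f p = of_int (sign p) * trace_word \<rho> T (permute_list p vs)" for p
  have t: "t permutes {..<k}" unfolding t_def using h by (intro permutes_swap_id) auto
  have tvs: "permute_list t vs = vs"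
  proof -
    have "vs[i := vs ! j, j := vs ! i] = vs" using h by (metis list_update_id)
    then show ?thesis unfolding t_def using h by (subst permute_list_transpose) auto
  qed
  have "f (t \<circ> p) = - f p" if p: "p permutes {..<k}" for p
  proof -
    have "sign (t \<circ> p) = - sign p"
      using p h permutation_permutes[of p] finite_lessThan unfolding t_def
      by (subst sign_compose) (auto simp: permutation_swap_id sign_swap_id)
    moreover have "permute_list (t \<circ> p) vs = permute_list p vs"
      using p h by (subst permute_list_compose) (simp_all add: tvs)
    ultimately show ?thesis by (simp add: f_def)
  qed
  moreover have "sum f {p. p permutes {..<k}} = (\<Sum>p | p permutes {..<k}. f (t \<circ> p))"
  proof (rule sum.reindex_bij_betw[symmetric], rule bij_betwI[where g="\<lambda>p. t \<circ> p"])
    have "t \<circ> (t \<circ> p) = p" for p by (simp add: t_def o_assoc)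
    then show "t \<circ> (t \<circ> p) = p" "t \<circ> (t \<circ> p) = p" for p by blast+
  qed (auto intro: permutes_compose[OF _ t])
  ultimately have "sum f {p. p permutes {..<k}} = - sum f {p. p permutes {..<k}}"
    by (simp add: sum_negf)
  then have "sum f {p. p permutes {..<k}} = 0" by (simp only: eq_neg_iff_add_eq_0) simp
  then show "alt_word k T vs = 0" by (simp add: alt_word_def f_def)
qed

text \<open>Orthogonal vectors anticommute, so on such lists the word already changes by the sign of
  the permutation and all k! summands are equal.\<close>

lemma alt_word_basis:
  assumes "distinct is" "length is = k"
  shows "alt_word k T (map stdb is) = trace_word \<rho> T (map stdb is)"
proof -
  let ?vs = "map stdb is :: (real^'n) list"
  have o: "orth_list ?vs" using assms by (auto simp: orth_list_def inner_axis_axis nth_eq_iff_index_eq)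
  have "trace_word \<rho> T (permute_list p ?vs) = of_int (sign p) * trace_word \<rho> T ?vs" if "p permutes {..<k}" for p
  proof (rule sign_swap_list[where Q=orth_list and k=k])
    fix vs :: "(real^'n) list" and a b assume *: "orth_list vs" "a < b" "b < length vs"
    show "trace_word \<rho> T (vs[a := vs ! b, b := vs ! a]) = - trace_word \<rho> T vs"
      using trace_word_cong[of \<rho> _ "- 1" vs] clifford_word_orth_swap[OF *] by simp
    show "orth_list (vs[a := vs ! b, b := vs ! a])" by (rule orth_list_swap[OF *])
  qed (use o that assms in auto)
  then have "of_int (sign p) * trace_word \<rho> T (permute_list p ?vs) = trace_word \<rho> T ?vs" if "p permutes {..<k}" for p
    using that by (simp add: mult.assoc[symmetric] flip: of_int_mult)
  then have "(\<Sum>p | p permutes {..<k}. of_int (sign p) * trace_word \<rho> T (permute_list p ?vs))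
      = of_nat (card {p. p permutes {..<k}}) * trace_word \<rho> T ?vs" by simp
  also have "card {p. p permutes {..<k}} = fact k" by (rule card_permutations) auto
  finally show ?thesis using assms by (simp add: alt_word_def)
qed

end

section \<open>An alternating form is determined by its values on increasing basis lists\<close>

lemma alt_form_swap:
  assumes \<omega>: "alt_form k \<omega>" and vs: "length vs = k" and ab: "a < b" "b < k"
  shows "\<omega> (vs[a := vs ! b, b := vs ! a]) = - \<omega> vs"
proof -
  define f where "f u v = \<omega> (vs[a := u, b := v])" for u v
  have add: "\<omega> (ws[i := u + v]) = \<omega> (ws[i := u]) + \<omega> (ws[i := v])" if "length ws = k" "i < k" for ws i u v
    using \<omega> that unfolding alt_form_def by blast
  have 1: "f u (v + w) = f u v + f u w" for u v w
    unfolding f_def using add[of "vs[a := u]" b] vs ab by simp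
  have 2: "f (u + v) w = f u w + f v w" for u v w
    unfolding f_def list_update_swap[of a b] using add[of "vs[b := w]" a] vs ab
    by (simp add: list_update_swap)
  have 3: "f u u = 0" for u
  proof -
    have "vs[a := u, b := u] ! a = vs[a := u, b := u] ! b" using vs ab by (simp add: nth_list_update)
    then show ?thesis unfolding f_def using \<omega> vs ab unfolding alt_form_def by (metis length_list_update)
  qed
  have "f (vs ! b) (vs ! a) + f (vs ! a) (vs ! b) = 0"
  proof -
    have "f (x + y) (x + y) = f x x + f y y + (f x y + f y x)" for x y
      by (simp only: 1 2 add_ac)
    from this[of "vs ! b" "vs ! a"] show ?thesis by (simp only: 3) simp
  qed
  moreover have "f (vs ! a) (vs ! b) = \<omega> vs" by (simp add: f_def)
  ultimately show ?thesis by (simp add: f_def eq_neg_iff_add_eq_0)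
qed

lemma alt_form_permute:
  assumes "alt_form k \<omega>" "length vs = k" "p permutes {..<k}"
  shows "\<omega> (permute_list p vs) = of_int (sign p) * \<omega> vs"
  by (rule sign_swap_list[where Q="\<lambda>vs. length vs = k" and k=k])
    (use assms alt_form_swap[OF assms(1)] in auto)

text \<open>Sorting reaches all lists of distinct basis vectors, repeated entries give 0 by
  alternation, and multilinearity passes from basis vectors to arbitrary ones.\<close>

lemma alt_form_zero:
  fixes \<omega> :: "'n::{finite,linorder} form"
  assumes \<omega>: "alt_form k \<omega>"
    and z: "\<And>is. length is = k \<Longrightarrow> sorted_wrt (<) is \<Longrightarrow> \<omega> (map stdb is) = 0"
  shows "\<omega> vs = 0"
proof -
  have basis: "\<omega> (map stdb is) = 0" if len: "length is = k" for "is" :: "'n list"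
  proof (cases "distinct is")
    case True
    have "mset is = mset (sort is)" by simp
    then obtain p where p: "p permutes {..<length (sort is)}" "permute_list p (sort is) = is"
      by (rule mset_eq_permutation)
    have "map stdb is = permute_list p (map stdb (sort is))"
      using permute_list_map[OF p(1), of stdb] p(2) by simp
    moreover have "sorted_wrt (<) (sort is)" using True by (simp add: strict_sorted_iff)
    ultimately show ?thesis
      using alt_form_permute[OF \<omega>, of "map stdb (sort is)" p] z[of "sort is"] p(1) len by simp
  next
    case False
    then obtain i j where ij: "i < length is" "j < length is" "i \<noteq> j" "is ! i = is ! j"
      by (auto simp: distinct_conv_nth)
    define a b where "a = min i j" and "b = max i j"
    have "a < b" "b < k" "is ! a = is ! b" using ij len by (auto simp: a_def b_def min_def max_def)
    then have "map stdb is ! a = map stdb is ! b" "a < b" "b < k" using len by simp_all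
    then show ?thesis using \<omega> len unfolding alt_form_def by (metis length_map)
  qed
  \<comment> \<open>Induction on the number j of leading positions that may hold arbitrary vectors;
    each step expands the last such position in the basis.\<close>
  have main: "\<omega> vs = 0" if "length vs = k" "j \<le> k" "\<forall>i. j \<le> i \<and> i < k \<longrightarrow> (\<exists>m. vs ! i = stdb m)" for j vs
    using that
  proof (induction j arbitrary: vs)
    case 0
    then have "\<forall>i. \<exists>m. i < k \<longrightarrow> vs ! i = stdb m" by auto
    from choice[OF this] obtain m where m: "\<forall>i. i < k \<longrightarrow> vs ! i = stdb (m i)" by blast
    have "vs = map stdb (map m [0..<k])" using 0 m by (intro nth_equalityI) auto
    then show ?case using basis[of "map m [0..<k]"] by simp
  next
    case (Suc j)
    then have j: "j < k" by simp
    have add: "\<omega> (vs[j := u + v]) = \<omega> (vs[j := u]) + \<omega> (vs[j := v])"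
      and scale: "\<omega> (vs[j := r *\<^sub>R v]) = of_real r * \<omega> (vs[j := v])" for u v r
      using \<omega> Suc.prems(1) j unfolding alt_form_def by blast+
    have e: "\<omega> (vs[j := stdb m]) = 0" for m
    proof (rule Suc.IH)
      show "\<forall>i. j \<le> i \<and> i < k \<longrightarrow> (\<exists>m'. vs[j := stdb m] ! i = stdb m')"
      proof (intro allI impI)
        fix i assume i: "j \<le> i \<and> i < k"
        show "\<exists>m'. vs[j := stdb m] ! i = stdb m'"
        proof (cases "i = j")
          case True
          then show ?thesis using Suc.prems(1) j by auto
        next
          case False
          then have "Suc j \<le> i \<and> i < k" using i by simp
          then show ?thesis using Suc.prems(3) False by simp
        qed
      qed
    qed (use Suc.prems in simp_all)
    have zero: "\<omega> (vs[j := 0]) = 0" using scale[of 0 0] by simp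
    have "\<omega> (vs[j := \<Sum>m\<in>M. c m *\<^sub>R stdb m]) = 0" if "finite M" for M and c :: "'n \<Rightarrow> real"
      using that by (induction M rule: finite_induct) (simp_all add: zero add scale e)
    from this[of UNIV "\<lambda>m. vs ! j $ m"] have "\<omega> (vs[j := vs ! j]) = 0"
      by (simp only: axis_expansion[of "vs ! j", symmetric] finite)
    then show ?case by simp
  qed
  show ?thesis
  proof (cases "length vs = k")
    case True
    then show ?thesis by (intro main[of vs k]) auto
  next
    case False
    then show ?thesis using \<omega> unfolding alt_form_def by blast
  qed
qed

lemma alt_form_diff: "alt_form k \<omega> \<Longrightarrow> alt_form k \<omega>' \<Longrightarrow> alt_form k (\<lambda>vs. \<omega> vs - \<omega>' vs)"
  unfolding alt_form_def by (auto simp: algebra_simps)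

text \<open>\<open>psi\<close> is prescribed on increasing basis lists only, where equivariance
  cannot be seen since rotations destroy the basis. The antisymmetrised word makes sense for all
  vectors and takes the prescribed values.\<close>

lemma psi_eq_alt_word:
  fixes \<rho> :: "('n::{finite,linorder}, 's::finite) cl_hom"
  assumes \<rho>: "clifford_module \<rho>"
  shows "psi \<rho> k T = alt_word \<rho> k T"
  unfolding psi_def
proof (rule the_equality)
  have ex: "alt_word \<rho> k T (map stdb is) = psi_basis \<rho> is T" if "length is = k \<and> sorted_wrt (<) is" for "is"
    using that alt_word_basis[OF \<rho>, of "is"] by (simp add: psi_basis_trace_word strict_sorted_iff)
  then show "alt_form k (alt_word \<rho> k T) \<and>
      (\<forall>is. length is = k \<and> sorted_wrt (<) is \<longrightarrow> alt_word \<rho> k T (map stdb is) = psi_basis \<rho> is T)"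
    using alt_form_alt_word[OF \<rho>] by blast
  fix \<omega> assume \<omega>: "alt_form k \<omega> \<and> (\<forall>is. length is = k \<and> sorted_wrt (<) is \<longrightarrow> \<omega> (map stdb is) = psi_basis \<rho> is T)"
  have "\<omega> vs - alt_word \<rho> k T vs = 0" for vs
    by (rule alt_form_zero[OF alt_form_diff[of k \<omega> "alt_word \<rho> k T"]])
      (use \<omega> ex alt_form_alt_word[OF \<rho>] in auto)
  then show "\<omega> = alt_word \<rho> k T" by (auto simp: fun_eq_iff)
qed

section \<open>Equivariance under the compact spin group\<close>

lemma clinv_eqI: "a * b = 1 \<Longrightarrow> b * a = 1 \<Longrightarrow> clinv a = b"
proof -
  assume ab: "a * b = 1" "b * a = 1"
  have "c = b" if "a * c = 1 \<and> c * a = 1" for c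
  proof -
    have "c = b * a * c" using ab by simp
    then show ?thesis using that by (simp add: mult.assoc)
  qed
  then show ?thesis unfolding clinv_def using ab by (intro the_equality) blast+
qed

lemma crev_in_spin_compact:
  assumes "m \<in> spin_compact"
  shows "crev m \<in> spin_compact"
proof -
  obtain us where us: "m = prod_list (map cvec us)" "even (length us)" "\<forall>v\<in>set us. norm v = 1"
    using assms unfolding spin_compact_def by blast
  have "crev (prod_list (map cvec us)) = prod_list (map cvec (rev us))" for us :: "(real^'a) list"
    by (induction us) simp_all
  then show ?thesis unfolding spin_compact_def using us by (intro CollectI exI[of _ "rev us"]) simp
qed

text \<open>Sandwiching a vector by a product of vectors gives a vector, so the definite description
  has a value, and injectivity of \<open>cvec\<close> makes it unique.\<close>

lemma cvec_spin_conj: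
  fixes m :: "(real^'n::finite) clifford"
  assumes ne: "(1 :: (real^'n) clifford) \<noteq> 0" and m: "m \<in> spin_compact"
  shows "cvec (spin_conj m v) = crev m * cvec v * m"
proof -
  have "clinv m = crev m" using spin_compactD[OF m] by (intro clinv_eqI)
  then have d: "spin_conj m v = (THE w. cvec w = crev m * cvec v * m)" by (simp add: spin_conj_def)
  obtain \<kappa> B where "crev m * cvec v * crev (crev m) = \<kappa>\<^sup>2 *\<^sub>R cvec (B v)"
    using lipschitz_norm[OF spin_compactD(3)[OF crev_in_spin_compact[OF m]]] by metis
  then have w: "cvec (\<kappa>\<^sup>2 *\<^sub>R B v) = crev m * cvec v * m" by (simp add: cvec_scaleR)
  show ?thesis unfolding d
  proof (rule theI[of "\<lambda>w. cvec w = crev m * cvec v * m"])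
    show "cvec (\<kappa>\<^sup>2 *\<^sub>R B v) = crev m * cvec v * m" by (rule w)
    fix w' assume "cvec w' = crev m * cvec v * m"
    then show "w' = \<kappa>\<^sup>2 *\<^sub>R B v" using w by (intro cvec_inj[OF ne]) simp
  qed
qed

lemma spin_conj_inverse:
  fixes m :: "(real^'n::finite) clifford"
  assumes ne: "(1 :: (real^'n) clifford) \<noteq> 0" and m: "m \<in> spin_compact"
  shows "spin_conj m (spin_conj (crev m) v) = v" "spin_conj (crev m) (spin_conj m v) = v"
proof -
  have a: "crev m * (m * x) = x" "m * (crev m * x) = x" for x
    using spin_compactD[OF m] by (simp_all add: mult.assoc[symmetric])
  show "spin_conj m (spin_conj (crev m) v) = v" "spin_conj (crev m) (spin_conj m v) = v"
    by (rule cvec_inj[OF ne], simp add: cvec_spin_conj[OF ne] m crev_in_spin_compact[OF m] mult.assoc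
        spin_compactD[OF m] a)+
qed

lemma inv_tau:
  fixes m :: "(real^'n::finite) clifford"
  assumes ne: "(1 :: (real^'n) clifford) \<noteq> 0" and m: "m \<in> spin_compact"
  shows "inv (tau m) \<phi> = (\<lambda>vs. \<phi> (map (spin_conj (crev m)) vs))"
proof (rule inv_f_eq)
  have i: "map (spin_conj (crev m)) (map (spin_conj m) vs) = vs" "map (spin_conj m) (map (spin_conj (crev m)) vs) = vs" for vs
    by (simp_all add: o_def spin_conj_inverse[OF ne m])
  show "inj (tau m)"
  proof (rule injI, rule ext)
    fix \<omega> \<omega>' vs assume "tau m \<omega> = tau m \<omega>'"
    then have "tau m \<omega> (map (spin_conj (crev m)) vs) = tau m \<omega>' (map (spin_conj (crev m)) vs)" by simp
    then show "\<omega> vs = \<omega>' vs" unfolding tau_def i .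
  qed
  show "tau m (\<lambda>vs. \<phi> (map (spin_conj (crev m)) vs)) = \<phi>" unfolding tau_def i ..
qed

lemma transpose_dual:
  fixes \<rho> \<rho>' :: "('n::finite, 's::finite) cl_hom"
  assumes "dual_module \<rho> \<rho>'"
  shows "transpose (\<rho>' (cl_vec x)) = - \<rho> (cl_vec x)"
proof -
  have p: "pairing (axis a 1) (A *v axis b 1) = A $ a $ b" "pairing (A *v axis a 1) (axis b 1) = A $ b $ a"
    for A :: "complex^'s^'s" and a b
    by (simp_all add: pairing_def matrix_vector_mult_def axis_def if_distrib if_distribR cong: if_cong)
  have "\<rho>' (cl_vec x) $ a $ b = - \<rho> (cl_vec x) $ b $ a" for a b
  proof -
    have "pairing (axis a 1) (\<rho>' (cl_vec x) *v axis b 1) = - pairing (\<rho> (cl_vec x) *v axis a 1) (axis b 1)"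
      using assms unfolding dual_module_def by blast
    then show ?thesis unfolding p .
  qed
  then show ?thesis by (simp add: vec_eq_iff transpose_def)
qed

text \<open>Transposition reverses the order of the factors, as \<open>crev\<close> does, and each
  vector contributes -1 through the definition of the dual. For even products the sign is 1.\<close>

lemma transpose_lipschitz:
  fixes \<rho> \<rho>' :: "('n::finite, 's::finite) cl_hom"
  assumes \<rho>: "clifford_module \<rho>" and d: "dual_module \<rho> \<rho>'" and "lipschitz b z"
  shows "transpose (\<rho>' (cl_cpx z)) = bsign b *\<^sub>R \<rho> (cl_cpx (crev z))"
proof -
  have \<rho>': "clifford_module \<rho>'" using d by (simp add: dual_module_def)
  show ?thesis using assms(3)
  proof (induction rule: lipschitz.induct)
    case lipschitz_1
    then show ?case by (simp add: clifford_module_simps(4)[OF \<rho>] clifford_module_simps(4)[OF \<rho>'] bsign_def)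
  next
    case (lipschitz_vec x b z)
    have "transpose (\<rho>' (cl_cpx (cvec x * z))) = transpose (\<rho>' (cl_cpx z)) ** transpose (\<rho>' (cl_vec x))"
      by (simp add: clifford_module_simps(2)[OF \<rho>'] matrix_transpose_mul)
    also have "\<dots> = bsign (\<not> b) *\<^sub>R (\<rho> (cl_cpx (crev z)) ** \<rho> (cl_vec x))"
      unfolding lipschitz_vec.IH transpose_dual[OF d] by (simp add: matrix_scaleR_mult matrix_minus_mult bsign_def)
    finally show ?case by (simp add: clifford_module_simps(2)[OF \<rho>])
  qed
qed

lemma trace_word_pairs: "trace_word \<rho> T vs = (\<Sum>p\<in>UNIV. T $ p * clifford_word \<rho> vs $ snd p $ fst p)"
  unfolding trace_word_def sum.cartesian_product by (simp add: split_beta)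

text \<open>In the pairing, A acts on the vector before the word, and B on the dual vector can be
  moved to the other side as its transpose.\<close>

lemma trace_word_kron:
  fixes \<rho> :: "('n::finite, 's::finite) cl_hom"
  shows "trace_word \<rho> (kron A B *v T) vs = (\<Sum>q\<in>UNIV. T $ q * (transpose B ** clifford_word \<rho> vs ** A) $ snd q $ fst q)"
proof -
  let ?W = "clifford_word \<rho> vs"
  have "trace_word \<rho> (kron A B *v T) vs
      = (\<Sum>p\<in>UNIV. \<Sum>q\<in>UNIV. T $ q * (B $ snd p $ snd q * ?W $ snd p $ fst p * A $ fst p $ fst q))"
    by (simp add: trace_word_pairs kron_def matrix_vector_mult_def sum_distrib_left sum_distrib_right mult_ac)
  also have "\<dots> = (\<Sum>q\<in>UNIV. T $ q * (\<Sum>p\<in>UNIV. B $ snd p $ snd q * ?W $ snd p $ fst p * A $ fst p $ fst q))"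
    by (subst sum.swap) (simp add: sum_distrib_left)
  finally have outer: "trace_word \<rho> (kron A B *v T) vs
      = (\<Sum>q\<in>UNIV. T $ q * (\<Sum>p\<in>UNIV. B $ snd p $ snd q * ?W $ snd p $ fst p * A $ fst p $ fst q))" .
  have inner: "(\<Sum>p\<in>UNIV. B $ snd p $ snd q * ?W $ snd p $ fst p * A $ fst p $ fst q)
      = (transpose B ** ?W ** A) $ snd q $ fst q" for q
  proof -
    have "(\<Sum>p\<in>UNIV. B $ snd p $ snd q * ?W $ snd p $ fst p * A $ fst p $ fst q)
        = (\<Sum>a\<in>UNIV. \<Sum>b\<in>UNIV. B $ b $ snd q * ?W $ b $ a * A $ a $ fst q)"
      unfolding sum.cartesian_product by (simp add: split_beta)
    then show ?thesis by (simp add: matrix_matrix_mult_def transpose_def sum_distrib_right)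
  qed
  show ?thesis unfolding outer inner ..
qed

text \<open>Inserting crev(m) m = 1 between consecutive factors conjugates every vector of the word
  separately.\<close>

lemma clifford_word_conj:
  fixes \<rho> :: "('n::finite, 's::finite) cl_hom"
  assumes \<rho>: "clifford_module \<rho>" and m: "m \<in> spin_compact"
  shows "\<rho> (cl_cpx m) ** clifford_word \<rho> vs ** \<rho> (cl_cpx (crev m)) = clifford_word \<rho> (map (spin_conj (crev m)) vs)"
proof (induction vs)
  case Nil
  then show ?case
    by (simp add: clifford_module_simps(2)[OF \<rho>, symmetric] spin_compactD[OF m] clifford_module_simps(4)[OF \<rho>])
next
  case (Cons v vs)
  let ?m = "\<rho> (cl_cpx m)" and ?m' = "\<rho> (cl_cpx (crev m))"
  have mm: "?m' ** ?m = mat 1"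
    by (simp add: clifford_module_simps(2)[OF \<rho>, symmetric] spin_compactD[OF m] clifford_module_simps(4)[OF \<rho>])
  have "?m ** clifford_word \<rho> (v # vs) ** ?m' = (?m ** \<rho> (cl_vec v) ** ?m') ** (?m ** clifford_word \<rho> vs ** ?m')"
  proof -
    have "?m' ** (?m ** Z) = Z" for Z :: "complex^'s^'s" by (simp add: matrix_mul_assoc mm)
    note this[of "clifford_word \<rho> vs ** ?m'"]
    then show ?thesis by (simp only: clifford_word_simps matrix_mul_assoc[symmetric])
  qed
  also have "?m ** \<rho> (cl_vec v) ** ?m' = \<rho> (cl_vec (spin_conj (crev m) v))"
    by (simp add: clifford_module_simps(2)[OF \<rho>, symmetric] mult.assoc
        cvec_spin_conj[OF clifford_module_nontrivial[OF \<rho>] crev_in_spin_compact[OF m]])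
  finally show ?case using Cons by simp
qed

text \<open>The transpose of the dual action turns the word into its conjugate by m, hence into the
  word of the rotated vectors. Rotating all entries commutes with permuting them, so this passes to
  the antisymmetrisation.\<close>

lemma psi_spin:
  fixes \<rho> \<rho>' :: "('n::{finite,linorder}, 's::finite) cl_hom"
  assumes \<rho>: "clifford_module \<rho>" and d: "dual_module \<rho> \<rho>'" and m: "m \<in> spin_compact"
  shows "psi \<rho> k (kron (\<rho> (cl_cpx (crev m))) (\<rho>' (cl_cpx (crev m))) *v T) vs
    = psi \<rho> k T (map (spin_conj (crev m)) vs)"
proof -
  have t: "transpose (\<rho>' (cl_cpx (crev m))) = \<rho> (cl_cpx m)"
    using transpose_lipschitz[OF \<rho> d spin_compactD(3)[OF crev_in_spin_compact[OF m]]] by (simp add: bsign_def)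
  have "trace_word \<rho> (kron (\<rho> (cl_cpx (crev m))) (\<rho>' (cl_cpx (crev m))) *v T) ws
      = trace_word \<rho> T (map (spin_conj (crev m)) ws)" for ws
    unfolding trace_word_kron t clifford_word_conj[OF \<rho> m] by (rule trace_word_pairs[symmetric])
  then show ?thesis
    unfolding psi_eq_alt_word[OF \<rho>] alt_word_def[OF \<rho>]
    by (auto simp: permute_list_map intro!: sum.cong)
qed

lemma psi_linear:
  fixes \<rho> :: "('n::{finite,linorder}, 's::finite) cl_hom"
  assumes \<rho>: "clifford_module \<rho>"
  shows "psi \<rho> k (T + U) vs = psi \<rho> k T vs + psi \<rho> k U vs" "psi \<rho> k (z *s T) vs = z * psi \<rho> k T vs"
    "psi \<rho> k 0 vs = 0" "alt_form k (psi \<rho> k T)"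
proof -
  show "psi \<rho> k (T + U) vs = psi \<rho> k T vs + psi \<rho> k U vs"
    "alt_form k (psi \<rho> k T)"
    and s: "psi \<rho> k (z *s T) vs = z * psi \<rho> k T vs" for z T
    unfolding psi_eq_alt_word[OF \<rho>] by (rule alt_word_linear[OF \<rho>] alt_form_alt_word[OF \<rho>])+
  show "psi \<rho> k 0 vs = 0" using s[of 0 0] by (simp add: vec_eq_iff)
qed

text \<open>On the diagonal the m and a components for x and y coincide: the characters multiply to
  weight l + \<mu>, and \<open>psi_spin\<close> treats the simultaneous action of m. Where the
  action is undefined both sides are 0.\<close>

lemma psi_diag_covariant:
  fixes \<rho> \<rho>' :: "('n::{finite,linorder}, 's::finite) cl_hom"
  assumes \<rho>: "clifford_module \<rho>" and d: "dual_module \<rho> \<rho>'" and g: "g \<in> spin_lorentz"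
  shows "psi_diag \<rho> k (pi_tensor \<rho> \<rho>' l \<mu> g F) = pi_form (l + \<mu>) g (psi_diag \<rho> k F)"
proof (intro ext)
  fix x vs
  have \<rho>': "clifford_module \<rho>'" using d by (simp add: dual_module_def)
  note ne = clifford_module_nontrivial[OF \<rho>]
  define h where "h = clinv g"
  have h: "h \<in> spin_lorentz" unfolding h_def by (rule spin_inverse(1)[OF g])
  show "psi_diag \<rho> k (pi_tensor \<rho> \<rho>' l \<mu> g F) x vs = pi_form (l + \<mu>) g (psi_diag \<rho> k F) x vs"
  proof (cases "act_defined h x")
    case False
    then show ?thesis
      by (simp add: psi_diag_def pi_tensor_def pi_form_def h_def[symmetric] Let_def psi_linear[OF \<rho>])
  next
    case True
    then obtain y m t where "is_decomp h x y m t" unfolding act_defined_def by blast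
    note dc = is_decomp_ideal_act[OF this]
    note p = decomp_parts[OF ne h dc]
    have "chi l t * chi \<mu> t = chi (l + \<mu>) t" by (simp add: chi_def exp_add[symmetric] algebra_simps)
    then have c: "inverse (chi l t) * inverse (chi \<mu> t) = inverse (chi (l + \<mu>) t)" by (metis inverse_mult_distrib)
    show ?thesis
      unfolding psi_diag_def pi_tensor_def pi_form_def h_def[symmetric] Let_def prod.case p
      by (simp add: p(1) c psi_linear[OF \<rho>] matrix_inv_spin[OF \<rho> dc(1)] matrix_inv_spin[OF \<rho>' dc(1)]
          psi_spin[OF \<rho> d dc(1)] inv_tau[OF ne dc(1)])
  qed
qed

section \<open>Iteration of the source operator\<close>

lemma smooth_source_op:
  fixes \<rho> \<rho>' :: "('n::finite, 's::finite) cl_hom" and F :: "('n, 's) field2"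
  assumes \<rho>: "clifford_module \<rho>" "clifford_module \<rho>'" and F: "smooth F"
  shows "smooth (source_op \<rho> \<rho>' l \<mu> F)"
proof -
  interpret clifford_pair "opx \<rho>" "opy \<rho>'" by (rule clifford_pair_kron[OF \<rho>])
  note U = open_UNIV
  have dxs: "smooth_on UNIV (dx j H)" "smooth_on UNIV (dy j H)" if "smooth_on UNIV H" for j and H :: "('n, 's) field2"
    unfolding dx_def dy_def by (rule smooth_on_deriv[OF that])+
  have ops: "smooth_on UNIV (lap_x H)" "smooth_on UNIV (lap_y H)" "smooth_on UNIV (dirac_x \<rho> H)" "smooth_on UNIV (dirac_y \<rho>' H)"
    if "smooth_on UNIV H" for H :: "('n, 's) field2"
    unfolding lap_x_def lap_y_def dirac_x_def dirac_y_def
    by (intro smooth_on_sum[OF U] dxs that smooth_on_clin[OF clin_matrix U])+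
  have F': "smooth_on UNIV F" using F by (simp add: smooth_on_UNIV)
  have lin: "bounded_linear (\<lambda>p :: (real^'n) \<times> (real^'n). fst p - snd p)" "bounded_linear (\<lambda>p :: (real^'n) \<times> (real^'n). snd p - fst p)"
    by (intro bounded_linear_sub bounded_linear_fst bounded_linear_snd)+
  have comp: "smooth_on UNIV (\<lambda>p :: (real^'n) \<times> (real^'n). fst p $ j - snd p $ j)" "smooth_on UNIV (\<lambda>p :: (real^'n) \<times> (real^'n). snd p $ j - fst p $ j)" for j
    by (rule smooth_on_linear[OF _ U], intro bounded_linear_sub bounded_linear_compose[OF bounded_linear_vec_nth] bounded_linear_fst bounded_linear_snd)+
  have nrm: "smooth_on UNIV (\<lambda>p :: (real^'n) \<times> (real^'n). (norm (fst p - snd p))\<^sup>2)"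
    unfolding power2_norm_eq_inner
    by (intro smooth_on_bilinear[OF bounded_bilinear_inner U] smooth_on_linear[OF lin(1) U])
  have sX: "smooth_on UNIV (\<lambda>p. kron (\<rho> (cl_vec (fst p - snd p))) (mat 1) *v H p)"
    and sY: "smooth_on UNIV (\<lambda>p. kron (mat 1) (\<rho>' (cl_vec (snd p - fst p))) *v H p)"
    if "smooth_on UNIV H" for H :: "('n, 's) field2"
    using smooth_on_bilinear[OF X.bounded_bilinear_G U smooth_on_linear[OF lin(1) U] that]
      smooth_on_bilinear[OF Y.bounded_bilinear_G U smooth_on_linear[OF lin(2) U] that]
    by (simp_all only: G_opx[OF \<rho>])
  note mat = smooth_on_clin[OF clin_matrix U]
  have "smooth_on UNIV (\<lambda>p. source_op \<rho> \<rho>' l \<mu> F (fst p, snd p))"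
    unfolding source_op_def prod.case Let_def unfolding prod.collapse
    by (intro smooth_on_add[OF U] smooth_on_diff[OF U] smooth_on_bilinear[OF bounded_bilinear_scaleR U] nrm comp
        smooth_on_smult[OF U] smooth_on_sum[OF U] sX sY ops dxs F' mat)
  then show ?thesis by (simp add: smooth_on_UNIV)
qed

text \<open>Together with smoothness this keeps the hypotheses of \<open>source_op_covariant\<close>
  valid along the iteration. A radius is easier to carry along than compactness of a
  support.\<close>

lemma source_op_bounded_support:
  fixes F :: "('n::finite, 's::finite) field2"
  assumes bd: "\<And>p. norm p > R \<Longrightarrow> F p = 0" and p: "norm p > R"
  shows "source_op \<rho> \<rho>' l \<mu> F p = 0"
proof -
  have W: "open {p :: (real^'n) \<times> (real^'n). norm p > R}" by (intro open_Collect_less continuous_intros)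
  have "source_op \<rho> \<rho>' l \<mu> F p = source_op \<rho> \<rho>' l \<mu> (\<lambda>_. 0) p"
    by (rule source_op_cong_open[OF W]) (use bd p in auto)
  then show ?thesis by (simp add: source_op_zero)
qed

lemma source_op_iter_smooth:
  fixes \<rho> \<rho>' :: "('n::finite, 's::finite) cl_hom" and F :: "('n, 's) field2"
  assumes \<rho>: "clifford_module \<rho>" "clifford_module \<rho>'" and F: "smooth F"
  shows "smooth (source_op_iter \<rho> \<rho>' l \<mu> m F)"
  using F by (induction m) (simp_all add: smooth_source_op[OF \<rho>])

text \<open>Each application of the source operator raises both weights by one, and the next one has
  exactly the shifted parameters.\<close>

lemma source_op_iter_covariant:
  fixes \<rho> \<rho>' :: "('n::finite, 's::finite) cl_hom" and F :: "('n, 's) field2"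
  assumes \<rho>: "clifford_module \<rho>" "clifford_module \<rho>'" and g: "g \<in> spin_lorentz"
    and F: "smooth F" and bd: "\<And>p. norm p > R \<Longrightarrow> F p = 0"
  shows "source_op_iter \<rho> \<rho>' l \<mu> m (pi_tensor \<rho> \<rho>' l \<mu> g F)
    = pi_tensor \<rho> \<rho>' (l + of_nat m) (\<mu> + of_nat m) g (source_op_iter \<rho> \<rho>' l \<mu> m F)"
proof (induction m)
  case (Suc m)
  have "source_op_iter \<rho> \<rho>' l \<mu> m F p = 0" if "norm p > R" for p
    using that
  proof (induction m arbitrary: p)
    case (Suc m)
    show ?case using source_op_bounded_support[OF Suc.IH Suc.prems] by simp
  qed (simp add: bd)
  note c = source_op_covariant[OF \<rho> g source_op_iter_smooth[OF \<rho> F] this]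
  show ?case by (simp add: Suc c algebra_simps)
qed simp

lemma sym_break_op_covariant:
  fixes \<rho> \<rho>' :: "('n::{finite,linorder}, 's::finite) cl_hom"
  assumes \<rho>: "clifford_module \<rho>" and d: "dual_module \<rho> \<rho>'" and g: "g \<in> spin_lorentz"
    and F: "smooth F" and c: "compact (supp F)"
  shows "sym_break_op \<rho> \<rho>' k l \<mu> m (pi_tensor \<rho> \<rho>' l \<mu> g F) =
    pi_form (l + \<mu> + 2 * of_nat m) g (sym_break_op \<rho> \<rho>' k l \<mu> m F)"
proof -
  have \<rho>': "clifford_module \<rho>'" using d by (simp add: dual_module_def)
  obtain R where R: "\<forall>p\<in>supp F. norm p \<le> R" using compact_imp_bounded[OF c] unfolding bounded_iff by blast
  have bd: "F p = 0" if "norm p > R" for p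
  proof (rule ccontr)
    assume "F p \<noteq> 0"
    then have "p \<in> supp F" unfolding supp_def using closure_subset[of "{p. F p \<noteq> 0}"] by auto
    then have "norm p \<le> R" using R by blast
    then show False using that by simp
  qed
  have e: "l + of_nat m + (\<mu> + of_nat m) = l + \<mu> + 2 * of_nat m" by simp
  have "source_op_iter \<rho> \<rho>' l \<mu> m (pi_tensor \<rho> \<rho>' l \<mu> g F)
      = pi_tensor \<rho> \<rho>' (l + of_nat m) (\<mu> + of_nat m) g (source_op_iter \<rho> \<rho>' l \<mu> m F)"
    by (rule source_op_iter_covariant[OF \<rho> \<rho>' g F]) (rule bd)
  then show ?thesis
    unfolding sym_break_op_def o_def psi_diag_covariant[OF \<rho> d g] e by (simp only: psi_diag_covariant[OF \<rho> d g] e)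
qed

section \<open>Homogeneity\<close>

type_synonym ('n, 's) field_op = "('n, 's) field2 \<Rightarrow> ('n, 's) field2"

primrec dword :: "('n + 'n) list \<Rightarrow> ('n::finite, 's::finite) field_op" where
  "dword [] F = F"
| "dword (i # w) F = (case i of Inl j \<Rightarrow> dx j (dword w F) | Inr j \<Rightarrow> dy j (dword w F))"

abbreviation cdiff :: "'n \<Rightarrow> (real^'n) \<times> (real^'n) \<Rightarrow> real" where
  "cdiff j p \<equiv> fst p $ j - snd p $ j"

definition monomial_op :: "'n list \<Rightarrow> complex^('s \<times> 's)^('s \<times> 's) \<Rightarrow> ('n + 'n) list \<Rightarrow> ('n::finite, 's::finite) field_op" where
  "monomial_op xs M w F = (\<lambda>p. prod_list (map (\<lambda>j. cdiff j p) xs) *\<^sub>R (M *v dword w F p))"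

text \<open>Derivatives have degree \<open>1\<close>, the coefficients \<open>x\<^sub>j - y\<^sub>j\<close> degree \<open>-1\<close>. The degree is preserved
  by moving derivatives to the right of coefficients, and on the diagonal only monomials without
  coefficients survive.\<close>

inductive homog :: "nat \<Rightarrow> ('n::finite, 's::finite) field_op \<Rightarrow> bool" where
  homog_monomial: "length w = length xs + d \<Longrightarrow> homog d (monomial_op xs M w)"
| homog_add: "homog d P \<Longrightarrow> homog d Q \<Longrightarrow> homog d (\<lambda>F p. P F p + Q F p)"
| homog_cong: "homog d P \<Longrightarrow> (\<And>F. smooth F \<Longrightarrow> Q F = P F) \<Longrightarrow> homog d Q"

lemma smooth_dx:
  assumes "smooth F"
  shows "smooth (dx j F)" "smooth (dy j F)"
  using smooth_on_deriv[of UNIV F] assms unfolding dx_def dy_def by (simp_all add: smooth_on_UNIV)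

lemma smooth_dword: "smooth F \<Longrightarrow> smooth (dword w F)"
  by (induction w) (auto simp: smooth_dx split: sum.split)

lemma smooth_cdiff: "smooth_on UNIV (cdiff j)"
  by (rule smooth_on_linear[OF _ open_UNIV], intro bounded_linear_sub
      bounded_linear_compose[OF bounded_linear_vec_nth] bounded_linear_fst bounded_linear_snd)

lemma smooth_coord:
  fixes H :: "('n::finite, 's::finite) field2"
  shows "smooth H \<Longrightarrow> smooth (\<lambda>p. cdiff j p *\<^sub>R H p)"
  using smooth_on_bilinear[OF bounded_bilinear_scaleR open_UNIV smooth_cdiff, of H j] by (simp only: smooth_on_UNIV)

lemma monomial_op_Cons: "monomial_op (i # xs) M w F = (\<lambda>p. cdiff i p *\<^sub>R monomial_op xs M w F p)"
  by (simp add: monomial_op_def fun_eq_iff)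

lemma homog_smooth:
  fixes P :: "('n::finite, 's::finite) field_op"
  shows "homog d P \<Longrightarrow> smooth F \<Longrightarrow> smooth (P F)"
proof (induction rule: homog.induct)
  case (homog_monomial w xs d M)
  show ?case
  proof (induction xs)
    case Nil
    have "smooth_on UNIV (\<lambda>p. M *v dword w F p)"
      by (rule smooth_on_clin[OF clin_matrix open_UNIV]) (simp add: smooth_on_UNIV smooth_dword homog_monomial)
    then show ?case by (simp add: monomial_op_def smooth_on_UNIV)
  next
    case (Cons i xs)
    show ?case unfolding monomial_op_Cons by (rule smooth_coord[OF Cons])
  qed
next
  case (homog_add d P Q)
  then show ?case using smooth_on_add[OF open_UNIV, of "P F" "Q F"] by (simp add: smooth_on_UNIV)
next
  case (homog_cong d P Q)
  then show ?case by simp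
qed

lemma homog_mat:
  fixes P :: "('n::finite, 's::finite) field_op"
  shows "homog d P \<Longrightarrow> homog d (\<lambda>F p. A *v P F p)"
proof (induction rule: homog.induct)
  case (homog_monomial w xs d M)
  have "(\<lambda>F p. A *v monomial_op xs M w F p) = monomial_op xs (A ** M) w"
    by (simp add: monomial_op_def fun_eq_iff clin_scaleR[OF clin_matrix] matrix_vector_mul_assoc)
  then show ?case using homog.homog_monomial[OF homog_monomial] by simp
next
  case (homog_add d P Q)
  show ?case using homog.homog_add[OF homog_add.IH] by (simp add: matrix_vector_right_distrib)
next
  case (homog_cong d P Q)
  show ?case by (rule homog.homog_cong[OF homog_cong.IH]) (simp add: homog_cong.hyps)
qed

lemma homog_smult:
  fixes P :: "('n::finite, 's::finite) field_op"
  assumes "homog d P"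
  shows "homog d (\<lambda>F p. z *s P F p)"
proof -
  have "mat z *v u = z *s u" for u :: "complex^('s \<times> 's)"
    by (simp add: vec_eq_iff matrix_vector_mult_def mat_def if_distrib if_distribR cong: if_cong)
  then show ?thesis using homog_mat[OF assms, of "mat z"] by simp
qed

lemma homog_zero: "homog d (\<lambda>F p. 0 :: complex^('s::finite \<times> 's))"
\<comment> \<open>Even the zero operator must be presented by a word of d derivatives; any word
  serves, with coefficient matrix 0.\<close>
proof (rule homog_cong[OF homog_monomial[of "replicate d (Inl undefined)" "[]" d 0]])
  fix F :: "('n::finite, 's) field2"
  show "(\<lambda>p. 0) = monomial_op [] 0 (replicate d (Inl undefined)) F"
    by (simp add: monomial_op_def fun_eq_iff vec_eq_iff matrix_vector_mult_def)
qed simp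

lemma homog_diff:
  fixes P :: "('n::finite, 's::finite) field_op"
  assumes "homog d P" "homog d Q"
  shows "homog d (\<lambda>F p. P F p - Q F p)"
proof -
  have "(- 1) *s u = - u" for u :: "complex^('s \<times> 's)" by (simp add: vec_eq_iff)
  then show ?thesis using homog_add[OF assms(1) homog_smult[OF assms(2), of "- 1"]] by simp
qed

lemma homog_sum:
  fixes P :: "'i::finite \<Rightarrow> ('n::finite, 's::finite) field_op"
  assumes "\<And>j. homog d (P j)"
  shows "homog d (\<lambda>F p. \<Sum>j\<in>UNIV. P j F p)"
proof -
  have "homog d (\<lambda>F p. \<Sum>j\<in>J. P j F p)" if "finite J" for J
    using that by (induction J rule: finite_induct) (simp_all add: homog_zero homog_add assms)
  then show ?thesis by simp
qed

lemma homog_coord: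
  fixes P :: "('n::finite, 's::finite) field_op"
  shows "homog d' P \<Longrightarrow> d' = Suc d \<Longrightarrow> homog d (\<lambda>F p. cdiff i p *\<^sub>R P F p)"
proof (induction rule: homog.induct)
  case (homog_monomial w xs d' M)
  have "homog d (monomial_op (i # xs) M w)" using homog_monomial by (intro homog.homog_monomial) simp
  moreover have "monomial_op (i # xs) M w = (\<lambda>F p. cdiff i p *\<^sub>R monomial_op xs M w F p)"
    by (simp add: monomial_op_Cons fun_eq_iff)
  ultimately show ?case by simp
next
  case (homog_add d' P Q)
  show ?case using homog.homog_add[OF homog_add.IH] homog_add.prems by (simp add: scaleR_add_right)
next
  case (homog_cong d' P Q)
  show ?case by (rule homog.homog_cong[OF homog_cong.IH]) (simp_all add: homog_cong)
qed

lemma dx_coord: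
  fixes H :: "('n::finite, 's::finite) field2"
  assumes "smooth H"
  shows "dx j (\<lambda>p. cdiff i p *\<^sub>R H p) = (\<lambda>p. cdiff i p *\<^sub>R dx j H p + (if i = j then 1 else 0) *s H p)"
    "dy j (\<lambda>p. cdiff i p *\<^sub>R H p) = (\<lambda>p. cdiff i p *\<^sub>R dy j H p + (if i = j then - 1 else 0) *s H p)"
proof -
  have c: "bounded_linear (cdiff i :: (real^'n) \<times> (real^'n) \<Rightarrow> real)"
    by (intro bounded_linear_sub bounded_linear_compose[OF bounded_linear_vec_nth] bounded_linear_fst bounded_linear_snd)
  have "((\<lambda>p. cdiff i p *\<^sub>R H p) has_derivative (\<lambda>v. cdiff i p *\<^sub>R frechet_derivative H (at p) v + cdiff i v *\<^sub>R H p)) (at p)" for p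
    by (intro bounded_bilinear.FDERIV[OF bounded_bilinear_scaleR] bounded_linear_imp_has_derivative c
        smooth_on_has_derivative[of UNIV]) (simp_all add: smooth_on_UNIV assms)
  note d = frechet_derivative_at[OF this, symmetric]
  show "dx j (\<lambda>p. cdiff i p *\<^sub>R H p) = (\<lambda>p. cdiff i p *\<^sub>R dx j H p + (if i = j then 1 else 0) *s H p)"
    "dy j (\<lambda>p. cdiff i p *\<^sub>R H p) = (\<lambda>p. cdiff i p *\<^sub>R dy j H p + (if i = j then - 1 else 0) *s H p)"
    unfolding dx_def dy_def d by (auto simp: fun_eq_iff axis_def vec_eq_iff)
qed

lemma dx_add:
  assumes "smooth F" "smooth H"
  shows "dx j (\<lambda>p. F p + H p) = (\<lambda>p. dx j F p + dx j H p)" "dy j (\<lambda>p. F p + H p) = (\<lambda>p. dy j F p + dy j H p)"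
proof -
  have "((\<lambda>p. F p + H p) has_derivative (\<lambda>v. frechet_derivative F (at p) v + frechet_derivative H (at p) v)) (at p)" for p
    by (intro has_derivative_add smooth_on_has_derivative[of UNIV]) (simp_all add: smooth_on_UNIV assms)
  note d = frechet_derivative_at[OF this, symmetric]
  show "dx j (\<lambda>p. F p + H p) = (\<lambda>p. dx j F p + dx j H p)" "dy j (\<lambda>p. F p + H p) = (\<lambda>p. dy j F p + dy j H p)"
    unfolding dx_def dy_def d by simp_all
qed

lemma dx_mat:
  assumes "smooth F"
  shows "dx j (\<lambda>p. A *v F p) = (\<lambda>p. A *v dx j F p)" "dy j (\<lambda>p. A *v F p) = (\<lambda>p. A *v dy j F p)"
proof -
  have "F differentiable (at p)" for p
    using smooth_on_differentiable[of UNIV F] assms by (simp add: smooth_on_UNIV)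
  then show "dx j (\<lambda>p. A *v F p) = (\<lambda>p. A *v dx j F p)" "dy j (\<lambda>p. A *v F p) = (\<lambda>p. A *v dy j F p)"
    unfolding dx_def dy_def
    by (simp_all add: frechet_derivative_bounded_linear[OF clin_bounded_linear[OF clin_matrix]])
qed

text \<open>By the product rule a derivative either lengthens the word or removes one factor x_j -
  y_j. Both raise the degree by one.\<close>

lemma homog_dx:
  fixes P :: "('n::finite, 's::finite) field_op"
  assumes "homog d P"
  shows "homog (Suc d) (\<lambda>F. dx j (P F))" "homog (Suc d) (\<lambda>F. dy j (P F))"
proof -
  have "homog (Suc d) (\<lambda>F. dx j (P F)) \<and> homog (Suc d) (\<lambda>F. dy j (P F))"
    using assms
  proof (induction rule: homog.induct)
    case (homog_monomial w xs d M)
    then show ?case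
    proof (induction xs arbitrary: d)
      case Nil
      have m: "homog (Suc d) (monomial_op [] M (Inl j # w))" "homog (Suc d) (monomial_op [] M (Inr j # w))"
        using Nil by (auto intro: homog.homog_monomial)
      show ?case
        by (intro conjI homog_cong[OF m(1)] homog_cong[OF m(2)])
          (simp_all add: monomial_op_def dx_mat smooth_dword)
    next
      case (Cons i xs)
      have h: "homog (Suc d) (monomial_op xs M w)" using Cons.prems by (intro homog.homog_monomial) simp
      have IH: "homog (Suc (Suc d)) (\<lambda>F. dx j (monomial_op xs M w F))" "homog (Suc (Suc d)) (\<lambda>F. dy j (monomial_op xs M w F))"
        using Cons.IH[of "Suc d"] Cons.prems by auto
      have s: "smooth F \<Longrightarrow> smooth (monomial_op xs M w F)" for F by (rule homog_smooth[OF h])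
      show ?case
        by (intro conjI homog_cong[OF homog_add[OF homog_coord[OF IH(1) refl, of i] homog_smult[OF h, of "if i = j then 1 else 0"]]]
            homog_cong[OF homog_add[OF homog_coord[OF IH(2) refl, of i] homog_smult[OF h, of "if i = j then - 1 else 0"]]])
          (simp_all only: monomial_op_Cons dx_coord[OF s])
    qed
  next
    case (homog_add d P Q)
    have s: "smooth F \<Longrightarrow> smooth (P F)" "smooth F \<Longrightarrow> smooth (Q F)" for F
      using homog_smooth homog_add.hyps by blast+
    have h: "homog (Suc d) (\<lambda>F. dx j (P F))" "homog (Suc d) (\<lambda>F. dy j (P F))"
      "homog (Suc d) (\<lambda>F. dx j (Q F))" "homog (Suc d) (\<lambda>F. dy j (Q F))"
      using homog_add.IH by blast+
    show ?case
      by (rule conjI; rule homog.homog_cong, rule homog.homog_add, rule h, rule h, rule dx_add, (erule s)+)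
  next
    case (homog_cong d P Q)
    then have "homog (Suc d) (\<lambda>F. dx j (P F))" "homog (Suc d) (\<lambda>F. dy j (P F))" by blast+
    moreover have "dx j (Q F) = dx j (P F)" "dy j (Q F) = dy j (P F)" if "smooth F" for F
      using homog_cong.hyps that by simp_all
    ultimately show ?case by (blast intro: homog.homog_cong)
  qed
  then show "homog (Suc d) (\<lambda>F. dx j (P F))" "homog (Suc d) (\<lambda>F. dy j (P F))" by blast+
qed

lemma homog_lap:
  fixes P :: "('n::finite, 's::finite) field_op"
  assumes "homog d P"
  shows "homog (Suc (Suc d)) (\<lambda>F. lap_x (P F))" "homog (Suc (Suc d)) (\<lambda>F. lap_y (P F))"
    "homog (Suc d) (\<lambda>F. dirac_x \<rho> (P F))" "homog (Suc d) (\<lambda>F. dirac_y \<rho> (P F))"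
  unfolding lap_x_def lap_y_def dirac_x_def dirac_y_def
  by (intro homog_sum homog_mat homog_dx assms)+

lemma homog_coord':
  fixes P :: "('n::finite, 's::finite) field_op"
  assumes "homog (Suc d) P"
  shows "homog d (\<lambda>F p. (snd p $ i - fst p $ i) *\<^sub>R P F p)"
proof -
  have "(- 1) *s (cdiff i p *\<^sub>R u) = (snd p $ i - fst p $ i) *\<^sub>R u"
    for u :: "complex^('s \<times> 's)" and p :: "(real^'n) \<times> (real^'n)"
    by (simp add: vcomp algebra_simps)
  then show ?thesis using homog_smult[OF homog_coord[OF assms refl, of i], of "- 1"] by simp
qed

lemma homog_norm:
  fixes P :: "('n::finite, 's::finite) field_op"
  assumes "homog (Suc (Suc d)) P"
  shows "homog d (\<lambda>F p. (norm (fst p - snd p))\<^sup>2 *\<^sub>R P F p)"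
proof (rule homog_cong[OF homog_sum[OF homog_coord[OF homog_coord[OF assms refl] refl]]])
  fix F :: "('n, 's) field2"
  show "(\<lambda>p. (norm (fst p - snd p))\<^sup>2 *\<^sub>R P F p) = (\<lambda>p. \<Sum>j\<in>UNIV. cdiff j p *\<^sub>R cdiff j p *\<^sub>R P F p)"
    by (simp add: power2_norm_eq_inner inner_sum_components scaleR_sum_left)
qed

lemma homog_cl:
  fixes P :: "('n::finite, 's::finite) field_op" and \<rho> :: "('n, 's) cl_hom"
  assumes P: "homog (Suc d) P" and \<rho>: "clifford_module \<rho>"
  shows "homog d (\<lambda>F p. kron (\<rho> (cl_vec (fst p - snd p))) (mat 1) *v P F p)"
    "homog d (\<lambda>F p. kron (mat 1) (\<rho> (cl_vec (snd p - fst p))) *v P F p)"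
proof -
  interpret clifford_pair "opx \<rho>" "opy \<rho>" by (rule clifford_pair_kron[OF \<rho> \<rho>])
  have g: "kron (\<rho> (cl_vec v)) (mat 1) *v u = (\<Sum>j\<in>UNIV. v $ j *\<^sub>R (opx \<rho> j u))"
    "kron (mat 1) (\<rho> (cl_vec v)) *v u = (\<Sum>j\<in>UNIV. v $ j *\<^sub>R (opy \<rho> j u))" for u v
    using G_opx(1)[OF \<rho> \<rho>, of v u] G_opx(2)[OF \<rho> \<rho>, of v u] by (simp_all only: X.G_def Y.G_def)
  show "homog d (\<lambda>F p. kron (\<rho> (cl_vec (fst p - snd p))) (mat 1) *v P F p)"
    by (rule homog_cong[OF homog_sum[OF homog_coord[OF homog_mat[OF P, of "kron (\<rho> (cl_e j)) (mat 1)" for j] refl]]])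
      (subst g(1), simp only: vector_minus_component)
  show "homog d (\<lambda>F p. kron (mat 1) (\<rho> (cl_vec (snd p - fst p))) *v P F p)"
    by (rule homog_cong[OF homog_sum[OF homog_coord'[OF homog_mat[OF P, of "kron (mat 1) (\<rho> (cl_e j))" for j]]]])
      (subst g(2), simp only: vector_minus_component)
qed

text \<open>In every summand the number of derivatives exceeds the degree of the coefficient in x -
  y by two.\<close>

lemma homog_source_op:
  fixes P :: "('n::finite, 's::finite) field_op" and \<rho> \<rho>' :: "('n, 's) cl_hom"
  assumes P: "homog d P" and \<rho>: "clifford_module \<rho>" "clifford_module \<rho>'"
  shows "homog (Suc (Suc d)) (\<lambda>F. source_op \<rho> \<rho>' l \<mu> (P F))"
proof (rule homog_cong)
  let ?n = "of_nat CARD('n) :: complex"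
  let ?a = "2 * l - ?n + 1" and ?b = "2 * \<mu> - ?n + 1"
  let ?Q = "\<lambda>F p. (norm (fst p - snd p))\<^sup>2 *\<^sub>R lap_x (lap_y (P F)) p
      + (2 * ?a) *s (\<Sum>j\<in>UNIV. cdiff j p *\<^sub>R dx j (lap_y (P F)) p)
      + (2 * ?b) *s (\<Sum>j\<in>UNIV. (snd p $ j - fst p $ j) *\<^sub>R lap_x (dy j (P F)) p)
      - 2 *s (kron (\<rho> (cl_vec (fst p - snd p))) (mat 1) *v dirac_x \<rho> (lap_y (P F)) p)
      - 2 *s (kron (mat 1) (\<rho>' (cl_vec (snd p - fst p))) *v lap_x (dirac_y \<rho>' (P F)) p)
      + (?b * (2 * \<mu> + 1)) *s lap_x (P F) p
      + (?a * (2 * l + 1)) *s lap_y (P F) p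
      - (2 * ?a * ?b) *s (\<Sum>j\<in>UNIV. dx j (dy j (P F)) p)
      + (2 * ?a) *s (\<Sum>j\<in>UNIV. kron (mat 1) (\<rho>' (cl_e j)) *v dx j (dirac_y \<rho>' (P F)) p)
      + (2 * ?b) *s (\<Sum>j\<in>UNIV. kron (\<rho> (cl_e j)) (mat 1) *v dirac_x \<rho> (dy j (P F)) p)
      - 2 *s (\<Sum>j\<in>UNIV. kron (\<rho> (cl_e j)) (\<rho>' (cl_e j)) *v dirac_x \<rho> (dirac_y \<rho>' (P F)) p)"
  show "homog (Suc (Suc d)) ?Q"
    by (intro homog_add homog_diff homog_smult homog_sum homog_norm homog_coord[OF _ refl] homog_coord'
        homog_cl[OF _ \<rho>(1)] homog_cl[OF _ \<rho>(2)] homog_lap homog_dx P homog_mat)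
  fix F :: "('n, 's) field2"
  show "source_op \<rho> \<rho>' l \<mu> (P F) = ?Q F"
  proof
    fix p
    show "source_op \<rho> \<rho>' l \<mu> (P F) p = ?Q F p"
      by (cases p) (simp only: source_op_def prod.case Let_def fst_conv snd_conv)
  qed
qed

lemma homog_source_op_iter:
  fixes \<rho> \<rho>' :: "('n::finite, 's::finite) cl_hom"
  assumes \<rho>: "clifford_module \<rho>" "clifford_module \<rho>'"
  shows "homog (2 * m) (source_op_iter \<rho> \<rho>' l \<mu> m)"
proof (induction m)
  case 0
  have "homog 0 (monomial_op [] (mat 1) [] :: ('n, 's) field_op)" by (rule homog_monomial) simp
  then have "homog 0 (source_op_iter \<rho> \<rho>' l \<mu> 0)" by (rule homog_cong) (simp add: monomial_op_def id_def)
  then show ?case by (simp add: id_def)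
next
  case (Suc m)
  then show ?case using homog_source_op[OF Suc \<rho>] by (simp add: o_def)
qed

section \<open>Multi-index form and restriction to the diagonal\<close>

lemma dx_commute:
  assumes "smooth F"
  shows "dx i (dx j F) = dx j (dx i F)" "dy i (dx j F) = dx j (dy i F)" "dy i (dy j F) = dy j (dy i F)"
  using schwarz[of UNIV F] assms unfolding dx_def dy_def by (auto simp: smooth_on_UNIV fun_eq_iff)

lemma smooth_dx_pow: "smooth F \<Longrightarrow> smooth ((dx j ^^ k) F)" "smooth F \<Longrightarrow> smooth ((dy j ^^ k) F)"
  by (induction k) (simp_all add: smooth_dx)

lemma fold_commute:
  fixes D :: "('n::finite, 's::finite) field_op" and E :: "'n \<Rightarrow> ('n, 's) field_op"
  assumes c: "\<And>F i. smooth F \<Longrightarrow> D (E i F) = E i (D F)" and E: "\<And>F i. smooth F \<Longrightarrow> smooth (E i F)"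
    and F: "smooth F"
  shows "D (fold (\<lambda>i. E i ^^ \<alpha> i) xs F) = fold (\<lambda>i. E i ^^ \<alpha> i) xs (D F)"
proof -
  have s: "smooth F \<Longrightarrow> smooth ((E i ^^ k) F)" for F i k
    by (induction k) (simp_all add: E)
  have "smooth F \<Longrightarrow> D ((E i ^^ k) F) = (E i ^^ k) (D F)" for F i k
    by (induction k) (simp_all add: c s)
  then show ?thesis using F by (induction xs arbitrary: F) (simp_all add: s)
qed

text \<open>A further derivative in direction j commutes past the others to the place that the fixed
  order of the indices assigns to it.\<close>

lemma fold_increment:
  fixes E :: "'n \<Rightarrow> ('n::finite, 's::finite) field_op"
  assumes c: "\<And>F i j. smooth F \<Longrightarrow> E j (E i F) = E i (E j F)" and E: "\<And>F i. smooth F \<Longrightarrow> smooth (E i F)"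
    and F: "smooth F" and j: "j \<in> set xs" "distinct xs"
  shows "fold (\<lambda>i. E i ^^ (\<alpha>(j := Suc (\<alpha> j))) i) xs F = E j (fold (\<lambda>i. E i ^^ \<alpha> i) xs F)"
proof -
  have s: "smooth F \<Longrightarrow> smooth ((E i ^^ k) F)" for F i k
    by (induction k) (simp_all add: E)
  have p: "smooth F \<Longrightarrow> E j ((E i ^^ k) F) = (E i ^^ k) (E j F)" for F i k
    by (induction k) (simp_all add: c s)
  have "fold (\<lambda>i. E i ^^ (\<alpha>(j := Suc (\<alpha> j))) i) xs F = fold (\<lambda>i. E i ^^ \<alpha> i) xs (E j F)"
    using j F
  proof (induction xs arbitrary: F)
    case (Cons i xs)
    show ?case
    proof (cases "i = j")
      case True
      then have "fold (\<lambda>i. E i ^^ (\<alpha>(j := Suc (\<alpha> j))) i) xs H = fold (\<lambda>i. E i ^^ \<alpha> i) xs H" for H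
        using Cons.prems by (intro fold_cong) auto
      then show ?thesis using True p[OF Cons.prems(3), where i=j and k="\<alpha> j"] by simp
    next
      case False
      then show ?thesis using Cons.IH[of "(E i ^^ \<alpha> i) F"] Cons.prems by (simp add: s p)
    qed
  qed simp
  then show ?thesis using fold_commute[of "E j" E F \<alpha> xs] c E F by simp
qed

lemma smooth_dy_multi:
  fixes F :: "('n::{finite,linorder}, 's::finite) field2"
  assumes "smooth F"
  shows "smooth (dy_multi \<beta> F)"
proof -
  have "smooth (fold (\<lambda>j. dy j ^^ \<beta> j) xs F)" for xs
    using assms by (induction xs arbitrary: F) (simp_all add: smooth_dx_pow)
  then show ?thesis by (simp add: dy_multi_def)
qed

text \<open>The letters of a word are counted: each new derivative raises one entry of a
  multi-index, and y derivatives are moved inside the x derivatives.\<close>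

lemma dword_multi:
  fixes w :: "('n::{finite,linorder} + 'n) list"
  obtains \<alpha> \<beta> where "sum \<alpha> UNIV + sum \<beta> UNIV = length w"
    "\<And>F :: ('n, 's::finite) field2. smooth F \<Longrightarrow> dword w F = dx_multi \<alpha> (dy_multi \<beta> F)"
proof -
  have "\<exists>\<alpha> \<beta>. sum \<alpha> UNIV + sum \<beta> UNIV = length w \<and>
    (\<forall>F :: ('n, 's) field2. smooth F \<longrightarrow> dword w F = dx_multi \<alpha> (dy_multi \<beta> F))"
  proof (induction w)
    case Nil
    have "fold (\<lambda>j. id) xs F = F" for xs :: "'n list" and F :: "('n, 's) field2" by (induction xs) simp_all
    then show ?case
      by (intro exI[of _ "\<lambda>_. 0"]) (simp add: dx_multi_def dy_multi_def)
  next
    case (Cons i w)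
    then obtain \<alpha> \<beta> where IH: "sum \<alpha> UNIV + sum \<beta> UNIV = length w"
      "\<And>F :: ('n, 's) field2. smooth F \<Longrightarrow> dword w F = dx_multi \<alpha> (dy_multi \<beta> F)" by blast
    have inc: "sum (\<gamma>(j := Suc (\<gamma> j))) UNIV = Suc (sum \<gamma> UNIV)" for \<gamma> :: "'n \<Rightarrow> nat" and j
      by (simp add: sum.remove[of UNIV j])
    have xinc: "dx_multi (\<gamma>(j := Suc (\<gamma> j))) F = dx j (dx_multi \<gamma> F)" if "smooth F" for \<gamma> j and F :: "('n, 's) field2"
      unfolding dx_multi_def using that
      by (intro fold_increment dx_commute smooth_dx) auto
    have yinc: "dy_multi (\<gamma>(j := Suc (\<gamma> j))) F = dy j (dy_multi \<gamma> F)" if "smooth F" for \<gamma> j and F :: "('n, 's) field2"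
      unfolding dy_multi_def using that
      by (intro fold_increment dx_commute smooth_dx) auto
    have xy: "dy j (dx_multi \<gamma> F) = dx_multi \<gamma> (dy j F)" if "smooth F" for \<gamma> j and F :: "('n, 's) field2"
      unfolding dx_multi_def using that by (intro fold_commute dx_commute smooth_dx)
    show ?case
    proof (cases i)
      case (Inl j)
      show ?thesis
        by (rule exI[of _ "\<alpha>(j := Suc (\<alpha> j))"], rule exI[of _ \<beta>],
          use IH in \<open>auto simp: Inl inc xinc smooth_dy_multi simp del: fun_upd_apply\<close>)
    next
      case (Inr j)
      show ?thesis
        by (rule exI[of _ \<alpha>], rule exI[of _ "\<beta>(j := Suc (\<beta> j))"],
          use IH in \<open>auto simp: Inr inc yinc xy smooth_dy_multi simp del: fun_upd_apply\<close>)
    qed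
  qed
  then show ?thesis using that by blast
qed

abbreviation multi_indices :: "nat \<Rightarrow> (('n::finite \<Rightarrow> nat) \<times> ('n \<Rightarrow> nat)) set" where
  "multi_indices d \<equiv> {(\<alpha>, \<beta>). sum \<alpha> UNIV + sum \<beta> UNIV = d}"

lemma finite_multi_indices: "finite (multi_indices d :: (('n::finite \<Rightarrow> nat) \<times> ('n \<Rightarrow> nat)) set)"
proof (rule finite_subset)
  have "\<alpha> i \<le> d" if "sum \<alpha> UNIV \<le> d" for \<alpha> :: "'n \<Rightarrow> nat" and i
    using that member_le_sum[of i UNIV \<alpha>] by simp
  then show "multi_indices d \<subseteq> (PiE UNIV (\<lambda>_ :: 'n. {..d})) \<times> (PiE UNIV (\<lambda>_ :: 'n. {..d}))"
    by (fastforce simp: PiE_def Pi_def)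
  show "finite ((PiE UNIV (\<lambda>_ :: 'n. {..d})) \<times> (PiE UNIV (\<lambda>_ :: 'n. {..d})))"
    by (intro finite_cartesian_product finite_PiE finite_atMost finite)
qed

text \<open>At x = y every monomial with a factor x_j - y_j vanishes. The remaining ones of degree d
  have constant coefficients and exactly d derivatives.\<close>

lemma homog_diagonal:
  fixes P :: "('n::{finite,linorder}, 's::finite) field_op"
  assumes "homog d P"
  obtains c where "\<And>\<alpha> \<beta>. clin (c \<alpha> \<beta>)"
    "\<And>F x. smooth F \<Longrightarrow> P F (x, x) = (\<Sum>(\<alpha>, \<beta>)\<in>multi_indices d. c \<alpha> \<beta> (dx_multi \<alpha> (dy_multi \<beta> F) (x, x)))"
proof -
  have "\<exists>c. (\<forall>\<alpha> \<beta>. clin (c \<alpha> \<beta>)) \<and> (\<forall>F x. smooth F \<longrightarrow>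
    P F (x, x) = (\<Sum>(\<alpha>, \<beta>)\<in>multi_indices d. c \<alpha> \<beta> (dx_multi \<alpha> (dy_multi \<beta> F) (x, x))))"
    using assms
  proof (induction rule: homog.induct)
    case (homog_monomial w xs d M)
    show ?case
    proof (cases xs)
      case Nil
      obtain \<alpha>0 \<beta>0 where w: "sum \<alpha>0 UNIV + sum \<beta>0 UNIV = length w"
        "\<And>F :: ('n, 's) field2. smooth F \<Longrightarrow> dword w F = dx_multi \<alpha>0 (dy_multi \<beta>0 F)"
        using dword_multi[where w=w and 's='s] by blast
      \<comment> \<open>A monomial without coefficients contributes to the one pair of multi-indices
        that counts its letters.\<close>
      define c where "c \<alpha> \<beta> = (if (\<alpha>, \<beta>) = (\<alpha>0, \<beta>0) then (*v) M else (\<lambda>u. 0))" for \<alpha> \<beta>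
      have c: "clin (c \<alpha> \<beta>)" for \<alpha> \<beta> unfolding c_def by (simp add: clin_matrix clin_const0)
      have "monomial_op xs M w F (x, x) = (\<Sum>(\<alpha>, \<beta>)\<in>multi_indices d. c \<alpha> \<beta> (dx_multi \<alpha> (dy_multi \<beta> F) (x, x)))"
        if F: "smooth F" for F x
      proof -
        have "(\<Sum>(\<alpha>, \<beta>)\<in>multi_indices d. c \<alpha> \<beta> (dx_multi \<alpha> (dy_multi \<beta> F) (x, x)))
            = (\<Sum>q\<in>multi_indices d. if q = (\<alpha>0, \<beta>0) then M *v dx_multi \<alpha>0 (dy_multi \<beta>0 F) (x, x) else 0)"
          by (intro sum.cong refl) (simp add: c_def split_beta prod_eq_iff)
        also have "\<dots> = M *v dx_multi \<alpha>0 (dy_multi \<beta>0 F) (x, x)"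
          using finite_multi_indices[of d, where 'n='n] w(1) homog_monomial Nil by (simp add: sum.delta)
        finally show ?thesis by (simp add: monomial_op_def Nil w(2)[OF F])
      qed
      then show ?thesis using c by blast
    next
      case (Cons i ys)
      have "monomial_op xs M w F (x, x) = 0" for F x by (simp add: Cons monomial_op_def)
      then show ?thesis by (intro exI[of _ "\<lambda>_ _ _. 0"]) (simp add: clin_const0 split_beta)
    qed
  next
    case (homog_add d P Q)
    then obtain c c' where c: "\<forall>\<alpha> \<beta>. clin (c \<alpha> \<beta>)" "\<forall>\<alpha> \<beta>. clin (c' \<alpha> \<beta>)"
      "\<forall>F x. smooth F \<longrightarrow> P F (x, x) = (\<Sum>(\<alpha>, \<beta>)\<in>multi_indices d. c \<alpha> \<beta> (dx_multi \<alpha> (dy_multi \<beta> F) (x, x)))"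
      "\<forall>F x. smooth F \<longrightarrow> Q F (x, x) = (\<Sum>(\<alpha>, \<beta>)\<in>multi_indices d. c' \<alpha> \<beta> (dx_multi \<alpha> (dy_multi \<beta> F) (x, x)))"
      by blast
    have "clin (\<lambda>u. c \<alpha> \<beta> u + c' \<alpha> \<beta> u)" for \<alpha> \<beta>
      using c(1,2) unfolding clin_def by (simp add: algebra_simps vec_eq_iff)
    then show ?case
      using c(3,4) by (intro exI[of _ "\<lambda>\<alpha> \<beta> u. c \<alpha> \<beta> u + c' \<alpha> \<beta> u"] conjI allI impI)
        (simp_all only: case_prod_unfold sum.distrib)
  next
    case (homog_cong d P Q)
    then show ?case by auto
  qed
  then show ?thesis using that by blast
qed

lemma psi_sum:
  fixes \<rho> :: "('n::{finite,linorder}, 's::finite) cl_hom"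
  assumes "clifford_module \<rho>"
  shows "psi \<rho> k (\<Sum>i\<in>I. T i) vs = (\<Sum>i\<in>I. psi \<rho> k (T i) vs)"
  by (induction I rule: infinite_finite_induct) (simp_all add: psi_linear[OF assms])

lemma const_coeff_sym_break_op:
  fixes \<rho> \<rho>' :: "('n::{finite,linorder}, 's::finite) cl_hom"
  assumes \<rho>: "clifford_module \<rho>" "clifford_module \<rho>'"
  shows "const_coeff_bidiff_op k (2 * m) (sym_break_op \<rho> \<rho>' k l \<mu> m)"
proof -
  obtain c where c: "\<And>\<alpha> \<beta>. clin (c \<alpha> \<beta>)"
    "\<And>F x. smooth F \<Longrightarrow> source_op_iter \<rho> \<rho>' l \<mu> m F (x, x)
      = (\<Sum>(\<alpha>, \<beta>)\<in>multi_indices (2 * m). c \<alpha> \<beta> (dx_multi \<alpha> (dy_multi \<beta> F) (x, x)))"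
    using homog_diagonal[OF homog_source_op_iter[OF \<rho>, of m l \<mu>]] by blast
  define c' where "c' \<alpha> \<beta> T = psi \<rho> k (c \<alpha> \<beta> T)" for \<alpha> \<beta> T
  have "form_valued_linear k (c' \<alpha> \<beta>)" for \<alpha> \<beta>
    unfolding form_valued_linear_def c'_def
    by (simp add: psi_linear[OF \<rho>(1)] clin_add[OF c(1)] clin_smult[OF c(1)])
  moreover have "sym_break_op \<rho> \<rho>' k l \<mu> m F x vs = (\<Sum>(\<alpha>, \<beta>)\<in>multi_indices (2 * m).
      c' \<alpha> \<beta> (dx_multi \<alpha> (dy_multi \<beta> F) (x, x)) vs)" if "smooth F" for F x vs
    using that by (simp add: sym_break_op_def psi_diag_def c(2) c'_def psi_sum[OF \<rho>(1)] split_beta)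
  ultimately show ?thesis unfolding const_coeff_bidiff_op_def by blast
qed

lemma smooth_sym_break_op:
  fixes \<rho> \<rho>' :: "('n::{finite,linorder}, 's::finite) cl_hom"
  assumes \<rho>: "clifford_module \<rho>" "clifford_module \<rho>'" and F: "smooth F"
  shows "smooth_form_field k (sym_break_op \<rho> \<rho>' k l \<mu> m F)"
proof -
  define H where "H = source_op_iter \<rho> \<rho>' l \<mu> m F"
  have H: "smooth_on UNIV H" unfolding H_def using source_op_iter_smooth[OF \<rho> F] by (simp add: smooth_on_UNIV)
  have diag: "smooth_on UNIV (\<lambda>x. (x, x))"
    by (intro smooth_on_linear bounded_linear_Pair bounded_linear_ident open_UNIV)
  have Hd: "smooth_on UNIV (\<lambda>x. H (x, x))"
    by (rule smooth_on_compose[OF open_UNIV open_UNIV subset_UNIV H diag])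
  have "bounded_linear (\<lambda>T. psi \<rho> k T vs)" for vs
  proof -
    have "linear (\<lambda>T. psi \<rho> k T vs)"
      by (intro linearI) (simp_all add: psi_linear[OF \<rho>(1)] scaleR_eq_smult scaleR_conv_of_real)
    then show ?thesis by (simp add: linear_conv_bounded_linear)
  qed
  then have "smooth (\<lambda>x. psi \<rho> k (H (x, x)) vs)" for vs
    using smooth_on_bounded_linear[OF _ open_UNIV Hd, of "\<lambda>T. psi \<rho> k T vs" for vs] by (simp add: smooth_on_UNIV)
  then show ?thesis
    by (simp add: smooth_form_field_def sym_break_op_def psi_diag_def H_def psi_linear[OF \<rho>(1)])
qed

theorem proposition5p2:
  fixes \<rho> \<rho>' :: "('n::{finite,linorder}, 's::finite) cl_hom"
    and l \<mu> :: complex and m k :: nat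
  assumes "clifford_module \<rho>" and "dual_module \<rho> \<rho>'" and "k \<le> CARD('n)"
  shows "(\<forall>F. smooth F \<longrightarrow> smooth_form_field k (sym_break_op \<rho> \<rho>' k l \<mu> m F)) \<and>
    const_coeff_bidiff_op k (2 * m) (sym_break_op \<rho> \<rho>' k l \<mu> m) \<and>
    (\<forall>g\<in>spin_lorentz. \<forall>F. smooth F \<and> compact (supp F) \<and>
        (\<forall>(x, y)\<in>supp F. act_defined g x \<and> act_defined g y) \<longrightarrow>
      sym_break_op \<rho> \<rho>' k l \<mu> m (pi_tensor \<rho> \<rho>' l \<mu> g F) =
        pi_form (l + \<mu> + 2 * of_nat m) g (sym_break_op \<rho> \<rho>' k l \<mu> m F))"
proof -
  have \<rho>': "clifford_module \<rho>'" using assms(2) by (simp add: dual_module_def)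
  show ?thesis
    using smooth_sym_break_op[OF assms(1) \<rho>'] const_coeff_sym_break_op[OF assms(1) \<rho>']
      sym_break_op_covariant[OF assms(1,2)] by blast
qed

end
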